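(* Let $r\ge1$, let $\mathcal{L}$ be a homogeneous Lagrangian on $\mathrm{Imm}\,T^r_nX$, and let $(V,\psi)$, $(\bar V,\bar\psi)$ be two overlapping charts on $X$ with associated non-homogeneous Lagrangians $L$, $\bar L$. Let $s\ge2r$. Then on the overlap $\rho^s_n(W^s\cap\bar W^s)$ of the associated charts $$E_\sigma(L)=\mathcal{J}\,P^\nu_\sigma\,\bar E_\nu(\bar L),$$ where $\mathcal{J}=\det(D_i\bar x^j)$ and $P^\nu_\sigma=\Delta_\sigma\bar y^\nu-\bar y^\nu_i\,(\Delta_\sigma\bar x^i)$.
   Context: $X$ is a smooth manifold of dimension $N=n+m$, $n\ge 1$. $T^r_nX$ is the manifold of $(r,n)$-velocities, i.e. $r$-jets $j^r_0\gamma$ at $0$ of smooth maps $\gamma$ from a neighbourhood of $0\in\mathbb{R}^n$ to $X$; $\mathrm{Imm}\,T^r_nX$ is the open subset of regular velocities (jets of immersions). A chart $(V,(x^A))$ of $X$ induces coordinates $x^A_{j_1,\dots,j_k}(j^r_0\gamma)=\partial^k(x^A\circ\gamma)/\partial t^{j_1}\cdots\partial t^{j_k}|_0$, $0\le k\le r$, symmetric in the lower indices. $L^r_n$ is the group of $r$-jets at $0$ of local diffeomorphisms of $\mathbb{R}^n$ fixing $0$; it acts on the right on $T^r_nX$ by $j^r_0\gamma\cdot j^r_0\alpha=j^r_0(\gamma\circ\alpha)$; for $a=j^r_0\alpha$, $\det(a)$ is the Jacobian determinant of $\alpha$ at $0$. $P^r_nX=\mathrm{Imm}\,T^r_nX/L^r_n$,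 with projection $\rho^r_n$ (a smooth principal bundle). Multi-indices are sequences in $\{1,\dots,n\}$; sums over multi-indices run over all sequences; $IJ$ is juxtaposition. Split the coordinates of a chart of $X$ (in any way) into $x^i$ ($i=1,\dots,n$) and $x^\sigma$ ($\sigma=1,\dots,m$). $W^r$ is the set of regular velocities over $V$ with $\det(\mathbf{x}):=\det(x^i_j)\ne0$; there $(z^i_j)$ is the inverse matrix of $(x^i_j)$ and $y^\sigma=x^\sigma$, $y^\sigma_{i_1,\dots,i_k}=z^j_{i_1}d_jy^\sigma_{i_2,\dots,i_k}$, where $d_j$ is the formal (total) derivative, $d_jx^A_J=x^A_{jJ}$. The $y^\sigma_I$ are symmetric in $I$ and $L^r_n$-invariant, and $(x^i,y^\sigma_I)_{|I|\le r}$ are coordinates on $\rho^r_n(W^r)$. $\Delta^{j_1,\dots,j_k}_\sigma=\frac{r_1!\cdots r_n!}{k!}\frac{\partial}{\partial y^\sigma_{j_1,\dots,j_k}}$ ($r_l$ = number of occurrences of $l$ in $(j_1,\dots,j_k)$), $\Delta_\sigma=\partial/\partial y^\sigma$, and on $P^s_nX$, $D_i=\frac{\partial}{\partial x^i}+\sum_{|J|\le s-1}y^\sigma_{iJ}\Delta^J_\sigma$, $D_J=\prod_{j\in J}D_j$. Objects of the second chart (with its own splitting) are barred. Homogeneous Lagrangian: a smooth real function $\mathcal{L}$ on $\mathrm{Imm}\,T^r_nX$ with $\mathcal{L}(x\cdot a)=\det(a)\mathcal{L}(x)$ for all $a\in L^r_n$; the associated non-homogeneous Lagrangian in a chart is the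 smooth function $L$ on $\rho^r_n(W^r)$ with $\mathcal{L}=\det(\mathbf{x})\,L\circ\rho^r_n$ on $W^r$. Euler–Lagrange expressions: $E_\sigma(L)=\sum_{|J|\le r}(-1)^{|J|}D_J\Delta^J_\sigma L$. *)

theory Defs
  imports "HOL-Analysis.Analysis" "HOL-Library.Multiset"
begin

section \<open>Smooth maps between Euclidean spaces\<close>

text \<open>\<open>pderivs [j\<^sub>1, \<dots>, j\<^sub>k] f\<close> is the iterated partial derivative of \<open>f\<close> in the directions
  \<open>j\<^sub>1, \<dots>, j\<^sub>k\<close>.\<close>

fun pderivs :: "'n::finite list \<Rightarrow> (real^'n \<Rightarrow> 'b::real_normed_vector) \<Rightarrow> real^'n \<Rightarrow> 'b" where
  "pderivs [] f = f"
| "pderivs (j # J) f = (\<lambda>x. frechet_derivative (pderivs J f) (at x) (axis j 1))"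

text \<open>To be used on open sets only. All iterated partial derivatives are required to be
  differentiable, in particular they exist and are continuous.\<close>

definition smooth_map :: "(real^'n::finite) set \<Rightarrow> (real^'n \<Rightarrow> 'b::real_normed_vector) \<Rightarrow> bool" where
  "smooth_map S f \<longleftrightarrow> (\<forall>J. \<forall>x\<in>S. pderivs J f differentiable at x)"


section \<open>Smooth functions on coordinate spaces with a finite set of labels\<close>

text \<open>The space \<open>\<real>\<^sup>K\<close>, for a finite set \<open>K\<close> of labels, is identified with the set of functions
  on the type of labels that vanish off \<open>K\<close>. Jet coordinates of every order thereby live
  in a single type. The topology is the product topology, which on \<open>\<real>\<^sup>K\<close> is the usual one.\<close>

definition cpartial :: "'k \<Rightarrow> (('k \<Rightarrow> real) \<Rightarrow> real) \<Rightarrow> ('k \<Rightarrow> real) \<Rightarrow> real" where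
  "cpartial k F x = deriv (\<lambda>t. F (x(k := t))) (x k)"

text \<open>To be used for \<open>U\<close> relatively open in \<open>\<real>\<^sup>K\<close>: all partial derivatives of all orders exist
  and are continuous on \<open>U\<close>.\<close>

definition csmooth_on :: "'k set \<Rightarrow> ('k \<Rightarrow> real) set \<Rightarrow> (('k \<Rightarrow> real) \<Rightarrow> real) \<Rightarrow> bool" where
  "csmooth_on K U F \<longleftrightarrow> (\<forall>ks. set ks \<subseteq> K \<longrightarrow>
     continuous_on U (foldr cpartial ks F) \<and>
     (\<forall>k\<in>K. \<forall>x\<in>U. (\<lambda>t. foldr cpartial ks F (x(k := t))) field_differentiable at (x k)))"


section \<open>Smooth manifolds\<close>

text \<open>The manifold \<open>X\<close> is the universe of a topological type; a chart is a pair \<open>(V, \<psi>)\<close>, where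
  the values of \<open>\<psi>\<close> off \<open>V\<close> are irrelevant.\<close>

type_synonym ('x, 'N) chart = "'x set \<times> ('x \<Rightarrow> real^'N)"

definition is_chart :: "('x::topological_space, 'N::finite) chart \<Rightarrow> bool" where
  "is_chart = (\<lambda>(V, \<psi>). open V \<and> open (\<psi> ` V) \<and> homeomorphism V (\<psi> ` V) \<psi> (inv_into V \<psi>))"

definition smooth_transition ::
    "('x::topological_space, 'N::finite) chart \<Rightarrow> ('x, 'N) chart \<Rightarrow> bool" where
  "smooth_transition = (\<lambda>(V, \<psi>) (V', \<psi>'). smooth_map (\<psi> ` (V \<inter> V')) (\<psi>' \<circ> inv_into V \<psi>))"

text \<open>A smooth structure is a maximal smooth atlas.\<close>

definition smooth_structure :: "('x::topological_space, 'N::finite) chart set \<Rightarrow> bool" where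
  "smooth_structure \<A> \<longleftrightarrow>
     (\<forall>c\<in>\<A>. is_chart c) \<and> (\<Union>(V, \<psi>)\<in>\<A>. V) = UNIV \<and>
     (\<forall>c\<in>\<A>. \<forall>c'\<in>\<A>. smooth_transition c c') \<and>
     (\<forall>c. is_chart c \<and> (\<forall>c'\<in>\<A>. smooth_transition c c' \<and> smooth_transition c' c) \<longrightarrow> c \<in> \<A>)"


section \<open>Velocities\<close>

text \<open>Maps defined near \<open>0\<close> are represented by total functions; only their germs at \<open>0\<close> matter.\<close>

definition smooth_germ ::
    "('x::topological_space, 'N::finite) chart set \<Rightarrow> (real^'n::finite \<Rightarrow> 'x) \<Rightarrow> bool" where
  "smooth_germ \<A> \<gamma> \<longleftrightarrow> (\<exists>U. open U \<and> 0 \<in> U \<and> continuous_on U \<gamma> \<and>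
     (\<forall>(V, \<psi>)\<in>\<A>. smooth_map {t\<in>U. \<gamma> t \<in> V} (\<psi> \<circ> \<gamma>)))"

definition immersion_germ ::
    "('x::topological_space, 'N::finite) chart set \<Rightarrow> (real^'n::finite \<Rightarrow> 'x) \<Rightarrow> bool" where
  "immersion_germ \<A> \<gamma> \<longleftrightarrow> smooth_germ \<A> \<gamma> \<and>
     (\<forall>(V, \<psi>)\<in>\<A>. \<gamma> 0 \<in> V \<longrightarrow> inj (frechet_derivative (\<psi> \<circ> \<gamma>) (at 0)))"

text \<open>An \<open>r\<close>-jet is an equivalence class of smooth germs, so jets of all orders have the same type.\<close>

type_synonym ('n, 'x) jet = "(real^'n \<Rightarrow> 'x) set"

definition jet :: "('x::topological_space, 'N::finite) chart set \<Rightarrow> nat \<Rightarrow>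
    (real^'n::finite \<Rightarrow> 'x) \<Rightarrow> ('n, 'x) jet" where
  "jet \<A> r \<gamma> = {\<gamma>'. smooth_germ \<A> \<gamma>' \<and> \<gamma>' 0 = \<gamma> 0 \<and>
     (\<forall>(V, \<psi>)\<in>\<A>. \<gamma> 0 \<in> V \<longrightarrow>
        (\<forall>J. length J \<le> r \<longrightarrow> pderivs J (\<psi> \<circ> \<gamma>') 0 = pderivs J (\<psi> \<circ> \<gamma>) 0))}"

definition rep :: "'a set \<Rightarrow> 'a" where
  "rep S = (SOME x. x \<in> S)"

definition ImmT :: "('x::topological_space, 'N::finite) chart set \<Rightarrow> nat \<Rightarrow>
    ('n::finite, 'x) jet set" where
  "ImmT \<A> r = jet \<A> r ` {\<gamma>. immersion_germ \<A> \<gamma>}"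

text \<open>The coordinate \<open>x\<^sup>A\<^sub>J\<close> is a function on velocities of every order \<open>\<ge> |J|\<close>.\<close>

definition xcoord :: "('x \<Rightarrow> real^'N::finite) \<Rightarrow> 'N \<Rightarrow> 'n::finite list \<Rightarrow> ('n, 'x) jet \<Rightarrow> real" where
  "xcoord \<psi> A J u = pderivs J (\<lambda>t. \<psi> (rep u t) $ A) 0"

text \<open>Symmetric families indexed by sequences correspond to families indexed by multisets; the
  latter label the independent coordinates.\<close>

definition arrange :: "'n multiset \<Rightarrow> 'n list" where
  "arrange M = (SOME J. mset J = M)"

definition velocity_labels :: "nat \<Rightarrow> ('N \<times> 'n multiset) set" where
  "velocity_labels r = {(A, M). size M \<le> r}"

definition velocity_coords :: "('x \<Rightarrow> real^'N::finite) \<Rightarrow> nat \<Rightarrow> ('n::finite, 'x) jet \<Rightarrow>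
    ('N \<times> 'n multiset \<Rightarrow> real)" where
  "velocity_coords \<psi> r u =
     (\<lambda>(A, M). if (A, M) \<in> velocity_labels r then xcoord \<psi> A (arrange M) u else 0)"

definition ImmT_over :: "('x::topological_space, 'N::finite) chart set \<Rightarrow> nat \<Rightarrow> 'x set \<Rightarrow>
    ('n::finite, 'x) jet set" where
  "ImmT_over \<A> r V = {u \<in> ImmT \<A> r. rep u 0 \<in> V}"

definition smooth_on_ImmT :: "('x::topological_space, 'N::finite) chart set \<Rightarrow> nat \<Rightarrow>
    (('n::finite, 'x) jet \<Rightarrow> real) \<Rightarrow> bool" where
  "smooth_on_ImmT \<A> r F \<longleftrightarrow> (\<forall>(V, \<psi>)\<in>\<A>.
     csmooth_on (velocity_labels r) (velocity_coords \<psi> r ` ImmT_over \<A> r V)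
       (F \<circ> inv_into (ImmT_over \<A> r V) (velocity_coords \<psi> r)))"


section \<open>The differential group and its action\<close>

definition local_diffeo :: "(real^'n::finite \<Rightarrow> real^'n) \<Rightarrow> bool" where
  "local_diffeo \<alpha> \<longleftrightarrow> \<alpha> 0 = 0 \<and> (\<exists>U. open U \<and> 0 \<in> U \<and> inj_on \<alpha> U \<and> open (\<alpha> ` U) \<and>
     smooth_map U \<alpha> \<and> smooth_map (\<alpha> ` U) (inv_into U \<alpha>))"

definition diffeo_jet :: "nat \<Rightarrow> (real^'n::finite \<Rightarrow> real^'n) \<Rightarrow> ('n, real^'n) jet" where
  "diffeo_jet r \<alpha> = {\<beta>. local_diffeo \<beta> \<and> (\<forall>J. length J \<le> r \<longrightarrow> pderivs J \<beta> 0 = pderivs J \<alpha> 0)}"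

definition diff_group :: "nat \<Rightarrow> ('n::finite, real^'n) jet set" where
  "diff_group r = diffeo_jet r ` {\<alpha>. local_diffeo \<alpha>}"

definition jet_det :: "('n::finite, real^'n) jet \<Rightarrow> real" where
  "jet_det a = det (matrix (frechet_derivative (rep a) (at 0)))"

definition jet_act :: "('x::topological_space, 'N::finite) chart set \<Rightarrow> nat \<Rightarrow>
    ('n::finite, 'x) jet \<Rightarrow> ('n, real^'n) jet \<Rightarrow> ('n, 'x) jet" where
  "jet_act \<A> r u a = jet \<A> r (rep u \<circ> rep a)"

text \<open>\<open>rho \<A> r\<close> is the projection of regular velocities onto \<open>P\<^sup>r\<^sub>nX\<close>; the points of \<open>P\<^sup>r\<^sub>nX\<close> are
  the orbits.\<close>

definition rho :: "('x::topological_space, 'N::finite) chart set \<Rightarrow> nat \<Rightarrow>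
    ('n::finite, 'x) jet \<Rightarrow> ('n, 'x) jet set" where
  "rho \<A> r u = jet_act \<A> r u ` diff_group r"

definition homogeneous_lagrangian :: "('x::topological_space, 'N::finite) chart set \<Rightarrow> nat \<Rightarrow>
    (('n::finite, 'x) jet \<Rightarrow> real) \<Rightarrow> bool" where
  "homogeneous_lagrangian \<A> r \<L> \<longleftrightarrow> smooth_on_ImmT \<A> r \<L> \<and>
     (\<forall>u\<in>ImmT \<A> r. \<forall>a\<in>diff_group r. \<L> (jet_act \<A> r u a) = jet_det a * \<L> u)"

text \<open>The natural projection of \<open>P\<^sup>s\<^sub>nX\<close> onto \<open>P\<^sup>r\<^sub>nX\<close>, for \<open>r \<le> s\<close>.\<close>

definition P_proj :: "('x::topological_space, 'N::finite) chart set \<Rightarrow> nat \<Rightarrow>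
    ('n::finite, 'x) jet set \<Rightarrow> ('n, 'x) jet set" where
  "P_proj \<A> r q = rho \<A> r (jet \<A> r (rep (rep q)))"


section \<open>Charts with a splitting and the coordinates on \<open>P\<^sup>r\<^sub>nX\<close>\<close>

text \<open>A splitting of the coordinates \<open>x\<^sup>A\<close> is an injection of the labels \<open>i\<close> into the labels
  \<open>A\<close>. The remaining labels are the labels \<open>\<sigma>\<close>; there are \<open>m = N - n\<close> of them (possibly none).\<close>

record ('x, 'n, 'N) split_chart =
  cdom :: "'x set"
  cmap :: "'x \<Rightarrow> real^'N"
  ind :: "'n \<Rightarrow> 'N"

definition is_split_chart :: "('x::topological_space, 'N::finite) chart set \<Rightarrow>
    ('x, 'n::finite, 'N) split_chart \<Rightarrow> bool" where
  "is_split_chart \<A> c \<longleftrightarrow> (cdom c, cmap c) \<in> \<A> \<and> inj (ind c)"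

definition dep :: "('x, 'n::finite, 'N::finite) split_chart \<Rightarrow> 'N set" where
  "dep c = - range (ind c)"

definition xmat :: "('x, 'n::finite, 'N::finite) split_chart \<Rightarrow> ('n, 'x) jet \<Rightarrow> real^'n^'n" where
  "xmat c u = (\<chi> i j. xcoord (cmap c) (ind c i) [j] u)"

definition W :: "('x::topological_space, 'N::finite) chart set \<Rightarrow> nat \<Rightarrow>
    ('x, 'n::finite, 'N) split_chart \<Rightarrow> ('n, 'x) jet set" where
  "W \<A> r c = {u \<in> ImmT_over \<A> r (cdom c). det (xmat c u) \<noteq> 0}"

text \<open>The formal derivative maps functions on \<open>k\<close>-velocities to functions on velocities of order
  \<open>\<ge> k + 1\<close>: \<open>(d\<^sub>j F)(j\<^sup>k\<^sup>+\<^sup>1\<^sub>0 \<gamma>)\<close> is the \<open>j\<close>-th partial derivative at \<open>h = 0\<close> of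
  \<open>h \<mapsto> F (j\<^sup>k\<^sub>0 (\<gamma> \<circ> (h + _)))\<close>. In particular \<open>d\<^sub>j x\<^sup>A\<^sub>J = x\<^sup>A\<^sub>j\<^sub>J\<close>.\<close>

definition formal_deriv :: "('x::topological_space, 'N::finite) chart set \<Rightarrow> nat \<Rightarrow> 'n::finite \<Rightarrow>
    (('n, 'x) jet \<Rightarrow> real) \<Rightarrow> ('n, 'x) jet \<Rightarrow> real" where
  "formal_deriv \<A> k j F u = deriv (\<lambda>h. F (jet \<A> k (\<lambda>t. rep u (h *\<^sub>R axis j 1 + t)))) 0"

fun ycoord :: "('x::topological_space, 'N::finite) chart set \<Rightarrow>
    ('x, 'n::finite, 'N) split_chart \<Rightarrow> 'N \<Rightarrow> 'n list \<Rightarrow> ('n, 'x) jet \<Rightarrow> real" where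
  "ycoord \<A> c \<sigma> [] u = xcoord (cmap c) \<sigma> [] u"
| "ycoord \<A> c \<sigma> (i # I) u =
     (\<Sum>j\<in>UNIV. matrix_inv (xmat c u) $ j $ i * formal_deriv \<A> (length I) j (ycoord \<A> c \<sigma> I) u)"

text \<open>The coordinates \<open>x\<^sup>i\<close> and \<open>y\<^sup>\<sigma>\<^sub>I\<close> as functions on \<open>\<rho>\<^sup>s\<^sub>n(W\<^sup>s)\<close>, where \<open>s \<ge> |I|\<close>.\<close>

definition Px :: "('x, 'n::finite, 'N::finite) split_chart \<Rightarrow> 'n \<Rightarrow> ('n, 'x) jet set \<Rightarrow> real" where
  "Px c i q = xcoord (cmap c) (ind c i) [] (rep q)"

definition Py :: "('x::topological_space, 'N::finite) chart set \<Rightarrow>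
    ('x, 'n::finite, 'N) split_chart \<Rightarrow> 'N \<Rightarrow> 'n list \<Rightarrow> ('n, 'x) jet set \<Rightarrow> real" where
  "Py \<A> c \<sigma> I q = ycoord \<A> c \<sigma> I (rep q)"

definition P_labels :: "nat \<Rightarrow> ('x, 'n::finite, 'N::finite) split_chart \<Rightarrow>
    ('n + 'N \<times> 'n multiset) set" where
  "P_labels s c = range Inl \<union> Inr ` {(\<sigma>, M). \<sigma> \<in> dep c \<and> size M \<le> s}"

definition P_coords :: "('x::topological_space, 'N::finite) chart set \<Rightarrow> nat \<Rightarrow>
    ('x, 'n::finite, 'N) split_chart \<Rightarrow> ('n, 'x) jet set \<Rightarrow> ('n + 'N \<times> 'n multiset \<Rightarrow> real)" where
  "P_coords \<A> s c q = (\<lambda>k. if k \<in> P_labels s c then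
     (case k of Inl i \<Rightarrow> Px c i q | Inr (\<sigma>, M) \<Rightarrow> Py \<A> c \<sigma> (arrange M) q) else 0)"

text \<open>The expression of a function on \<open>\<rho>\<^sup>s\<^sub>n(W\<^sup>s)\<close> in these coordinates.\<close>

definition P_local :: "('x::topological_space, 'N::finite) chart set \<Rightarrow> nat \<Rightarrow>
    ('x, 'n::finite, 'N) split_chart \<Rightarrow> (('n, 'x) jet set \<Rightarrow> real) \<Rightarrow>
    ('n + 'N \<times> 'n multiset \<Rightarrow> real) \<Rightarrow> real" where
  "P_local \<A> s c F = F \<circ> inv_into (rho \<A> s ` W \<A> s c) (P_coords \<A> s c)"

definition P_partial :: "('x::topological_space, 'N::finite) chart set \<Rightarrow> nat \<Rightarrow>
    ('x, 'n::finite, 'N) split_chart \<Rightarrow> 'n + 'N \<times> 'n multiset \<Rightarrow>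
    (('n, 'x) jet set \<Rightarrow> real) \<Rightarrow> ('n, 'x) jet set \<Rightarrow> real" where
  "P_partial \<A> s c k F q = cpartial k (P_local \<A> s c F) (P_coords \<A> s c q)"

definition associated_lagrangian :: "('x::topological_space, 'N::finite) chart set \<Rightarrow> nat \<Rightarrow>
    ('x, 'n::finite, 'N) split_chart \<Rightarrow> (('n, 'x) jet \<Rightarrow> real) \<Rightarrow>
    (('n, 'x) jet set \<Rightarrow> real) \<Rightarrow> bool" where
  "associated_lagrangian \<A> r c \<L> L \<longleftrightarrow>
     csmooth_on (P_labels r c) (P_coords \<A> r c ` rho \<A> r ` W \<A> r c) (P_local \<A> r c L) \<and>
     (\<forall>u\<in>W \<A> r c. \<L> u = det (xmat c u) * L (rho \<A> r u))"


section \<open>Euler--Lagrange expressions\<close>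

text \<open>\<open>Delta \<A> s c \<sigma> J\<close> is \<open>\<Delta>\<^sup>J\<^sub>\<sigma>\<close> acting on functions on \<open>\<rho>\<^sup>s\<^sub>n(W\<^sup>s)\<close>; in particular
  \<open>Delta \<A> s c \<sigma> []\<close> is \<open>\<partial>/\<partial>y\<^sup>\<sigma>\<close>.\<close>

definition Delta :: "('x::topological_space, 'N::finite) chart set \<Rightarrow> nat \<Rightarrow>
    ('x, 'n::finite, 'N) split_chart \<Rightarrow> 'N \<Rightarrow> 'n list \<Rightarrow>
    (('n, 'x) jet set \<Rightarrow> real) \<Rightarrow> ('n, 'x) jet set \<Rightarrow> real" where
  "Delta \<A> s c \<sigma> J F q =
     (\<Prod>l\<in>UNIV. fact (count_list J l)) / fact (length J) * P_partial \<A> s c (Inr (\<sigma>, mset J)) F q"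

definition Dtot :: "('x::topological_space, 'N::finite) chart set \<Rightarrow> nat \<Rightarrow>
    ('x, 'n::finite, 'N) split_chart \<Rightarrow> 'n \<Rightarrow>
    (('n, 'x) jet set \<Rightarrow> real) \<Rightarrow> ('n, 'x) jet set \<Rightarrow> real" where
  "Dtot \<A> s c i F q = P_partial \<A> s c (Inl i) F q +
     (\<Sum>\<sigma>\<in>dep c. \<Sum>J | length J \<le> s - 1. Py \<A> c \<sigma> (i # J) q * Delta \<A> s c \<sigma> J F q)"

text \<open>\<open>E\<^sub>\<sigma>(L)\<close> as a function on \<open>\<rho>\<^sup>s\<^sub>n(W\<^sup>s)\<close>, where \<open>s \<ge> 2r\<close> and \<open>L\<close> is a function on \<open>\<rho>\<^sup>r\<^sub>n(W\<^sup>r)\<close>.\<close>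

definition Euler_Lagrange :: "('x::topological_space, 'N::finite) chart set \<Rightarrow> nat \<Rightarrow> nat \<Rightarrow>
    ('x, 'n::finite, 'N) split_chart \<Rightarrow> 'N \<Rightarrow>
    (('n, 'x) jet set \<Rightarrow> real) \<Rightarrow> ('n, 'x) jet set \<Rightarrow> real" where
  "Euler_Lagrange \<A> r s c \<sigma> L q = (\<Sum>J | length J \<le> r.
     (-1) ^ length J * foldr (Dtot \<A> s c) J (Delta \<A> s c \<sigma> J (L \<circ> P_proj \<A> r)) q)"

definition jac :: "('x::topological_space, 'N::finite) chart set \<Rightarrow> nat \<Rightarrow>
    ('x, 'n::finite, 'N) split_chart \<Rightarrow> ('x, 'n, 'N) split_chart \<Rightarrow> ('n, 'x) jet set \<Rightarrow> real" where
  "jac \<A> s c c' q = det (\<chi> i j. Dtot \<A> s c i (Px c' j) q)"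

definition Pcoef :: "('x::topological_space, 'N::finite) chart set \<Rightarrow> nat \<Rightarrow>
    ('x, 'n::finite, 'N) split_chart \<Rightarrow> ('x, 'n, 'N) split_chart \<Rightarrow> 'N \<Rightarrow> 'N \<Rightarrow>
    ('n, 'x) jet set \<Rightarrow> real" where
  "Pcoef \<A> s c c' \<nu> \<sigma> q = Delta \<A> s c \<sigma> [] (Py \<A> c' \<nu> []) q -
     (\<Sum>i\<in>UNIV. Py \<A> c' \<nu> [i] q * Delta \<A> s c \<sigma> [] (Px c' i) q)"

end

theory Submission
  imports Defs "HOL-Combinatorics.Multiset_Permutations"
begin

text \<open>Let a velocity field \<open>\<gamma>\<close> have the coordinate expression \<open>g\<close> in a chart, and let \<open>x\<^sup>i\<close> be its independent
  components. Along \<open>\<gamma>\<close> the total derivative \<open>D\<^sub>i\<close> becomes the vector field \<open>\<Sum>\<^sub>k z\<^sup>k\<^sub>i \<partial>\<^sub>k\<close> on the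
  parameter space, where \<open>z\<close> is the inverse of the Jacobian of \<open>x\<close>, and \<open>y\<^sup>\<sigma>\<^sub>I\<close> becomes \<open>D\<^sub>I g\<^sup>\<sigma>\<close>. The
  function \<open>\<L> = det(\<^bold>x) L\<close> on the jets of a variation \<open>g + \<epsilon> \<phi> e\<^sub>\<sigma>\<close> does not depend on the chart. Its
  \<open>\<epsilon>\<close>-derivative is a linear differential operator in \<open>\<phi>\<close>, and the formal adjoint of this operator
  applied to \<open>1\<close> does not see divergences. In the first chart it is \<open>det(\<^bold>x) E\<^sub>\<sigma>(L)\<close>. In the second
  chart the variation has horizontal components; after a vertical correction by a divergence it is
  \<open>det(\<^bold>x') \<Sum>\<^sub>\<nu> P\<^sup>\<nu>\<^sub>\<sigma> E'\<^sub>\<nu>(L')\<close>. Both the integration by parts and the vertical correction are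
  instances of the Piola identity \<open>\<Sum>\<^sub>k \<partial>\<^sub>k (det(\<^bold>x) z\<^sup>k\<^sub>i) = 0\<close>, the latter in the space of \<open>(\<epsilon>, t)\<close>.\<close>

section \<open>Calculus of smooth functions\<close>

text \<open>The adjoint at \<open>1\<close> replaces integration. It is an algebraic expression in
  the coefficients of an operator, and it depends on the operator alone, because Taylor monomials
  centred at each point read off the coefficients. Compact supports and boundary terms never occur.

  The main obstacle is that velocities, their orbits and the functions on orbits are given through
  chosen representatives and inverse maps, whereas the variational argument is about actual curves.
  Hence every point of the orbit space is represented by a curve, and all coordinates and operators
  are rewritten as derivatives along it. This requires that the coordinates separate orbits and fill
  the whole coordinate domain.

  In coordinates of order \<open>s\<close> the total derivative is a truncated sum, correct only on
  functions of order below \<open>s\<close>. Applying up to \<open>r\<close> of them to a function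
  of order \<open>r\<close> respects this bound because \<open>s\<close> is at least
  \<open>2 * r\<close>.\<close>

definition pd :: "'p::finite \<Rightarrow> (real^'p \<Rightarrow> real) \<Rightarrow> real^'p \<Rightarrow> real" where
  "pd j f = (\<lambda>x. frechet_derivative f (at x) (axis j 1))"

lemma pderivs_Cons: "pderivs (j # J) f = pd j (pderivs J f)" for f :: "real^'p::finite \<Rightarrow> real"
  by (simp add: pd_def)

declare pderivs.simps(2) [simp del]
declare pderivs_Cons [simp]

lemma pderivs_append: "pderivs (J @ K) f = pderivs J (pderivs K f)"
  by (induction J) (simp_all add: pderivs.simps)

text \<open>A graded version of \<open>smooth_map\<close> that permits induction on the order:
  derivatives of products and composites contain the original functions again, needed at one order
  less. The recursion strips the innermost derivative while \<open>pderivs\<close> adds an outermost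
  one; \<open>Ck_iff\<close> reconciles the two.\<close>

fun Ck :: "nat \<Rightarrow> (real^'p::finite) set \<Rightarrow> (real^'p \<Rightarrow> real) \<Rightarrow> bool" where
  "Ck 0 S f \<longleftrightarrow> True"
| "Ck (Suc n) S f \<longleftrightarrow> (\<forall>x\<in>S. f differentiable at x) \<and> (\<forall>j. Ck n S (pd j f))"

lemma Ck_iff: "Ck n S f \<longleftrightarrow> (\<forall>J. length J < n \<longrightarrow> (\<forall>x\<in>S. pderivs J f differentiable at x))"
proof (induction n arbitrary: f)
  case (Suc n)
  have "(\<forall>J. length J < Suc n \<longrightarrow> (\<forall>x\<in>S. pderivs J f differentiable at x)) \<longleftrightarrow>
    (\<forall>x\<in>S. f differentiable at x) \<and>
    (\<forall>j J. length J < n \<longrightarrow> (\<forall>x\<in>S. pderivs (J @ [j]) f differentiable at x))" (is "?L \<longleftrightarrow> ?R")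
  proof
    assume L: ?L
    have "f differentiable at x" if "x \<in> S" for x
      using L[rule_format, of "[]" x] that by simp
    moreover have "pderivs (J @ [j]) f differentiable at x" if "length J < n" "x \<in> S" for J j x
      using L[rule_format, of "J @ [j]" x] that by simp
    ultimately show ?R by blast
  next
    assume R: ?R
    show ?L
    proof (intro allI impI ballI)
      fix J :: "'a list" and x assume "length J < Suc n" "x \<in> S"
      then show "pderivs J f differentiable at x"
        using R by (cases J rule: rev_cases) auto
    qed
  qed
  then show ?case using Suc by (simp add: pderivs_append)
qed simp

lemma smooth_iff_Ck: "smooth_map S f \<longleftrightarrow> (\<forall>n. Ck n S f)" for f :: "real^'p::finite \<Rightarrow> real"
  unfolding smooth_map_def Ck_iff by blast

lemma Ck_Suc: "Ck (Suc n) S f \<Longrightarrow> Ck n S f"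
  unfolding Ck_iff by auto

lemma pd_has_derivative: "(f has_derivative D) (at x) \<Longrightarrow> pd j f x = D (axis j 1)"
  unfolding pd_def using frechet_derivative_at by force

text \<open>\<open>frechet_derivative\<close> is a choice among all derivatives, so having the same
  derivatives at \<open>x\<close> already gives equal values, even if there are none.\<close>

lemma pd_cong:
  assumes "open S" "x \<in> S" "\<And>y. y \<in> S \<Longrightarrow> f y = g y"
  shows "pd j f x = pd j g x"
proof -
  have "(f has_derivative D) (at x) \<longleftrightarrow> (g has_derivative D) (at x)" for D
    using has_derivative_transform_within_open[of f D x UNIV S g]
      has_derivative_transform_within_open[of g D x UNIV S f] assms by auto
  then show ?thesis by (simp add: pd_def frechet_derivative_def)
qed

lemma differentiable_cong_open:
  assumes "open S" "x \<in> S" "\<And>y. y \<in> S \<Longrightarrow> f y = g y" "f differentiable at x"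
  shows "g differentiable at x"
  using assms(4) has_derivative_transform_within_open[OF _ assms(1,2,3)]
  unfolding differentiable_def by (metis assms(1,2,3) has_derivative_transform_within_open)

lemma pderivs_cong:
  fixes f :: "real^'p::finite \<Rightarrow> real"
  assumes "open S" "\<And>y. y \<in> S \<Longrightarrow> f y = g y"
  shows "x \<in> S \<Longrightarrow> pderivs J f x = pderivs J g x"
proof (induction J arbitrary: x)
  case (Cons j J)
  have "pd j (pderivs J f) x = pd j (pderivs J g) x"
    by (rule pd_cong[OF assms(1) Cons.prems Cons.IH])
  then show ?case by simp
qed (simp add: assms(2))

lemma Ck_cong:
  assumes "open S" "\<And>y. y \<in> S \<Longrightarrow> f y = g y" "Ck n S f"
  shows "Ck n S g"
  unfolding Ck_iff
proof (intro allI impI ballI)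
  fix J :: "'a list" and x assume "length J < n" "x \<in> S"
  then show "pderivs J g differentiable at x"
    using assms(3) unfolding Ck_iff
    by (intro differentiable_cong_open[OF assms(1) \<open>x \<in> S\<close> pderivs_cong[OF assms(1,2)]]) auto
qed

lemma smooth_cong:
  fixes f :: "real^'p::finite \<Rightarrow> real"
  assumes "smooth_map S f" "open S" "\<And>y. y \<in> S \<Longrightarrow> f y = g y"
  shows "smooth_map S g"
  using assms Ck_cong unfolding smooth_iff_Ck by blast

lemma smooth_subset: "smooth_map S f \<Longrightarrow> T \<subseteq> S \<Longrightarrow> smooth_map T f"
  unfolding smooth_map_def by blast

lemma smooth_diffable: "smooth_map S f \<Longrightarrow> x \<in> S \<Longrightarrow> f differentiable at x"
  unfolding smooth_map_def by (metis pderivs.simps(1))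

lemma smooth_continuous_on: "smooth_map S f \<Longrightarrow> continuous_on S f"
  by (meson continuous_at_imp_continuous_on differentiable_imp_continuous_within smooth_diffable)

lemma smooth_pderivs: "smooth_map S f \<Longrightarrow> smooth_map S (pderivs J f)"
  unfolding smooth_map_def by (metis pderivs_append)

lemma smooth_pd: "smooth_map S f \<Longrightarrow> smooth_map S (pd j f)"
  using smooth_pderivs[of S f "[j]"] by simp

lemma pd_const [simp]: "pd j (\<lambda>x. c) = (\<lambda>x. 0)"
  by (auto simp: pd_def)

lemma Ck_const: "Ck n S (\<lambda>x. c)"
  by (induction n arbitrary: c) auto

lemma smooth_const: "smooth_map S (\<lambda>x. c::real)" for S :: "(real^'p::finite) set"
  by (simp add: smooth_iff_Ck Ck_const)

lemma has_derivative_nth: "((\<lambda>x. x $ k) has_derivative (\<lambda>x. x $ k)) F"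
  by (simp add: bounded_linear_imp_has_derivative bounded_linear_vec_nth)

lemma pd_coord: "pd j (\<lambda>x. x $ k) = (\<lambda>x. if j = k then 1 else 0)"
  by (auto simp: pd_has_derivative[OF has_derivative_nth] axis_def)

lemma Ck_coord: "Ck n S (\<lambda>x. x $ k)"
  by (cases n) (auto simp: pd_coord Ck_const differentiable_def intro: has_derivative_nth)

lemma smooth_coord: "smooth_map S (\<lambda>x. x $ k)"
  by (simp add: smooth_iff_Ck Ck_coord)

lemma pd_add:
  assumes "f differentiable at x" "g differentiable at x"
  shows "pd j (\<lambda>x. f x + g x) x = pd j f x + pd j g x"
  using pd_has_derivative[OF has_derivative_add] assms unfolding frechet_derivative_works pd_def[of _ f] pd_def[of _ g] by blast

lemma pd_mult:
  assumes "f differentiable at x" "g differentiable at x"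
  shows "pd j (\<lambda>x. f x * g x) x = pd j f x * g x + f x * pd j g x"
  using pd_has_derivative[OF has_derivative_mult[OF assms[unfolded frechet_derivative_works]], of j]
  by (simp add: pd_def[of _ f] pd_def[of _ g])

lemma pd_cmult:
  assumes "f differentiable at x"
  shows "pd j (\<lambda>x. c * f x) x = c * pd j f x"
  using pd_mult[of "\<lambda>x. c" x f j] assms by simp

lemma pd_sum:
  assumes "\<And>i. i \<in> I \<Longrightarrow> f i differentiable at x"
  shows "pd j (\<lambda>x. \<Sum>i\<in>I. f i x) x = (\<Sum>i\<in>I. pd j (f i) x)"
  using assms
proof (induction I rule: infinite_finite_induct)
  case (insert i I)
  then have "(\<lambda>x. \<Sum>i\<in>I. f i x) differentiable at x"
    by (intro differentiable_sum) auto
  with insert show ?case by (simp add: pd_add)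
qed auto

lemma Ck_add:
  assumes "open S"
  shows "Ck n S f \<Longrightarrow> Ck n S g \<Longrightarrow> Ck n S (\<lambda>x. f x + g x)"
proof (induction n arbitrary: f g)
  case (Suc n)
  have "Ck n S (\<lambda>x. pd j f x + pd j g x)" for j
    using Suc by simp
  then have "Ck n S (pd j (\<lambda>x. f x + g x))" for j
    by (rule Ck_cong[OF assms, rotated]) (use Suc.prems in \<open>auto simp: pd_add\<close>)
  with Suc.prems show ?case by auto
qed simp

lemma Ck_mult:
  assumes "open S"
  shows "Ck n S f \<Longrightarrow> Ck n S g \<Longrightarrow> Ck n S (\<lambda>x. f x * g x)"
proof (induction n arbitrary: f g)
  case (Suc n)
  have "Ck n S (\<lambda>x. pd j f x * g x + f x * pd j g x)" for j
    using Suc.prems by (intro Ck_add assms Suc.IH) (auto intro: Ck_Suc)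
  then have "Ck n S (pd j (\<lambda>x. f x * g x))" for j
    by (rule Ck_cong[OF assms, rotated]) (use Suc.prems in \<open>auto simp: pd_mult\<close>)
  with Suc.prems show ?case by auto
qed simp

context
  fixes S :: "(real^'p::finite) set"
  assumes S: "open S"
begin

lemma smooth_add: "smooth_map S f \<Longrightarrow> smooth_map S g \<Longrightarrow> smooth_map S (\<lambda>x. f x + g x :: real)"
  unfolding smooth_iff_Ck using Ck_add S by blast

lemma smooth_mult: "smooth_map S f \<Longrightarrow> smooth_map S g \<Longrightarrow> smooth_map S (\<lambda>x. f x * g x :: real)"
  unfolding smooth_iff_Ck using Ck_mult S by blast

lemma smooth_uminus: "smooth_map S f \<Longrightarrow> smooth_map S (\<lambda>x. - f x :: real)"
  using smooth_mult[OF smooth_const[of S "-1"]] by simp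

lemma smooth_diff: "smooth_map S f \<Longrightarrow> smooth_map S g \<Longrightarrow> smooth_map S (\<lambda>x. f x - g x :: real)"
  using smooth_add[OF _ smooth_uminus] by simp

lemma smooth_sum: "(\<And>i. i \<in> I \<Longrightarrow> smooth_map S (f i)) \<Longrightarrow> smooth_map S (\<lambda>x. \<Sum>i\<in>I. f i x :: real)"
  by (induction I rule: infinite_finite_induct) (auto intro: smooth_const smooth_add)

lemma smooth_prod: "(\<And>i. i \<in> I \<Longrightarrow> smooth_map S (f i)) \<Longrightarrow> smooth_map S (\<lambda>x. \<Prod>i\<in>I. f i x :: real)"
  by (induction I rule: infinite_finite_induct) (auto intro: smooth_const smooth_mult)

text \<open>The derivative is \<open>- pd j f\<close> times the square of the reciprocal itself, so
  differentiability of order \<open>n\<close> of the reciprocal yields order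
  \<open>Suc n\<close>.\<close>

lemma smooth_inverse:
  assumes "smooth_map S f" and nz: "\<And>x. x \<in> S \<Longrightarrow> f x \<noteq> 0"
  shows "smooth_map S (\<lambda>x. inverse (f x) :: real)"
proof -
  have df: "f differentiable at x" if "x \<in> S" for x using assms(1) smooth_diffable that by blast
  have d: "(\<lambda>x. inverse (f x)) differentiable at x" if "x \<in> S" for x
    using df[OF that] nz[OF that] by (rule differentiable_inverse)
  have eq: "pd j (\<lambda>x. inverse (f x)) x = - pd j f x * (inverse (f x) * inverse (f x))" if "x \<in> S" for j x
  proof -
    have "pd j (\<lambda>x. inverse (f x)) x =
      - (inverse (f x) * frechet_derivative f (at x) (axis j 1) * inverse (f x))"
      using df[OF that] nz[OF that] unfolding frechet_derivative_works
      by (intro pd_has_derivative[OF Deriv.has_derivative_inverse]) auto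
    then show ?thesis by (simp add: pd_def)
  qed
  have "Ck n S (\<lambda>x. inverse (f x))" for n
  proof (induction n)
    case (Suc n)
    have "Ck n S (\<lambda>x. - pd j f x * (inverse (f x) * inverse (f x)))" for j
      using smooth_uminus[OF smooth_pd[OF assms(1)]] Suc
      by (intro Ck_mult S) (auto simp: smooth_iff_Ck)
    then have "Ck n S (pd j (\<lambda>x. inverse (f x)))" for j
      by (rule Ck_cong[OF S, rotated]) (use eq in auto)
    with d show ?case by auto
  qed simp
  then show ?thesis by (simp add: smooth_iff_Ck)
qed

end

lemma smooth_divide:
  fixes S :: "(real^'p::finite) set"
  assumes "open S" "smooth_map S f" "smooth_map S g" "\<And>x. x \<in> S \<Longrightarrow> g x \<noteq> 0"
  shows "smooth_map S (\<lambda>x. f x / g x :: real)"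
  unfolding divide_inverse using assms by (intro smooth_mult smooth_inverse) auto

section \<open>Vector-valued maps and the chain rule\<close>

lemma vec_eq_sum_axis: "v = (\<Sum>k\<in>UNIV. (v $ k) *\<^sub>R axis k 1)" for v :: "real^'p::finite"
  by (simp add: vec_eq_iff axis_def if_distrib cong: if_cong)

lemma has_derivative_vec_iff:
  fixes g :: "real^'p::finite \<Rightarrow> real^'q::finite"
  shows "(g has_derivative D) (at x) \<longleftrightarrow>
    (\<forall>k. ((\<lambda>x. g x $ k) has_derivative (\<lambda>v. D v $ k)) (at x))"
  by (subst has_derivative_componentwise_within) (auto simp: Basis_vec_def inner_axis)

lemma differentiable_vec_iff:
  fixes g :: "real^'p::finite \<Rightarrow> real^'q::finite"
  shows "g differentiable at x \<longleftrightarrow> (\<forall>k. (\<lambda>x. g x $ k) differentiable at x)"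
  by (subst differentiable_componentwise_within) (auto simp: Basis_vec_def inner_axis)

lemma frechet_derivative_vec_nth:
  fixes g :: "real^'p::finite \<Rightarrow> real^'q::finite"
  assumes "g differentiable at x"
  shows "frechet_derivative g (at x) (axis j 1) $ k = pd j (\<lambda>x. g x $ k) x"
  using assms unfolding frechet_derivative_works has_derivative_vec_iff
  by (metis pd_has_derivative)

lemma frechet_derivative_pd:
  fixes f :: "real^'p::finite \<Rightarrow> real"
  assumes "f differentiable at x"
  shows "frechet_derivative f (at x) v = (\<Sum>k\<in>UNIV. pd k f x * v $ k)"
proof -
  let ?D = "frechet_derivative f (at x)"
  have "linear ?D" using assms by (rule linear_frechet_derivative)
  have "?D v = ?D (\<Sum>k\<in>UNIV. (v $ k) *\<^sub>R axis k 1)" using vec_eq_sum_axis[of v] by simp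
  also have "\<dots> = (\<Sum>k\<in>UNIV. v $ k * ?D (axis k 1))"
    by (simp add: linear_sum[OF \<open>linear ?D\<close>] linear_scale[OF \<open>linear ?D\<close>])
  finally show ?thesis by (simp add: pd_def mult.commute)
qed

lemma pd_compose:
  fixes g :: "real^'p::finite \<Rightarrow> real^'q::finite"
  assumes "f differentiable at (g x)" "\<And>k. (\<lambda>x. g x $ k) differentiable at x"
  shows "pd j (\<lambda>x. f (g x)) x = (\<Sum>k\<in>UNIV. pd k f (g x) * pd j (\<lambda>x. g x $ k) x)"
proof -
  have g: "g differentiable at x" using assms(2) by (simp add: differentiable_vec_iff)
  have "((\<lambda>x. f (g x)) has_derivative
     (\<lambda>v. frechet_derivative f (at (g x)) (frechet_derivative g (at x) v))) (at x)"
    using has_derivative_compose[of g _ x UNIV f] assms(1) g unfolding frechet_derivative_works by simp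
  then show ?thesis
    by (simp add: pd_has_derivative frechet_derivative_pd[OF assms(1)] frechet_derivative_vec_nth[OF g])
qed

lemma differentiable_compose_vec:
  fixes g :: "real^'p::finite \<Rightarrow> real^'q::finite"
  assumes "f differentiable at (g x)" "\<And>k. (\<lambda>x. g x $ k) differentiable at x"
  shows "(\<lambda>x. f (g x)) differentiable at x"
  using differentiable_chain_at[of g x f] assms by (simp add: differentiable_vec_iff o_def)

text \<open>The inner map is only assumed to be of finite order. The smooth inverse function theorem
  needs this asymmetry: there the inner map is the inverse whose order is being raised.\<close>

lemma Ck_compose:
  fixes g :: "real^'p::finite \<Rightarrow> real^'q::finite" and f :: "real^'q \<Rightarrow> real"
  assumes S: "open S" and sub: "g ` S \<subseteq> T"
  shows "smooth_map T f \<Longrightarrow> (\<And>k. Ck n S (\<lambda>x. g x $ k)) \<Longrightarrow> Ck n S (\<lambda>x. f (g x))"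
proof (induction n arbitrary: f)
  case (Suc n)
  have C: "Ck n S (\<lambda>x. \<Sum>k\<in>A. pd k f (g x) * pd j (\<lambda>x. g x $ k) x)" if "finite A" for j A
    using that
  proof (induction A)
    case (insert k A)
    have "Ck n S (\<lambda>x. pd k f (g x))"
      by (rule Suc.IH[OF smooth_pd[OF Suc.prems(1)] Ck_Suc[OF Suc.prems(2)]])
    moreover have "Ck n S (pd j (\<lambda>x. g x $ k))" using Suc.prems(2)[of k] by simp
    ultimately show ?case using insert by (auto intro!: Ck_add[OF S] Ck_mult[OF S])
  qed (simp add: Ck_const)
  have 1: "f differentiable at (g x)" if "x \<in> S" for x
    by (rule smooth_diffable[OF Suc.prems(1)]) (use that sub in auto)
  have 2: "(\<lambda>x. g x $ k) differentiable at x" if "x \<in> S" for x k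
    using Suc.prems(2)[of k] that by simp
  have eq: "x \<in> S \<Longrightarrow> (\<Sum>k\<in>UNIV. pd k f (g x) * pd j (\<lambda>x. g x $ k) x) = pd j (\<lambda>x. f (g x)) x" for x j
    by (rule pd_compose[OF 1 2, symmetric])
  from Ck_cong[OF S eq C] show ?case by (auto intro: differentiable_compose_vec 1 2)
qed simp

lemma smooth_compose:
  fixes g :: "real^'p::finite \<Rightarrow> real^'q::finite" and f :: "real^'q \<Rightarrow> real"
  assumes "open S" "\<And>k. smooth_map S (\<lambda>x. g x $ k)" "smooth_map T f" "g ` S \<subseteq> T"
  shows "smooth_map S (\<lambda>x. f (g x))"
  using Ck_compose[OF assms(1,4,3)] assms(2) by (simp add: smooth_iff_Ck)

text \<open>The two claims are proved together because each feeds the other: components of a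
  derivative can be read off only where the vector-valued map is differentiable, and the next
  derivative is known to be differentiable only through its components.\<close>

lemma pderivs_vec_nth:
  fixes g :: "real^'p::finite \<Rightarrow> real^'q::finite"
  assumes "open S" "\<And>k. smooth_map S (\<lambda>x. g x $ k)"
  shows "x \<in> S \<Longrightarrow> pderivs J g x $ k = pderivs J (\<lambda>x. g x $ k) x \<and> pderivs J g differentiable at x"
proof (induction J arbitrary: x k)
  case Nil
  then show ?case using assms smooth_diffable by (fastforce simp: differentiable_vec_iff)
next
  case (Cons j J)
  have eq: "pderivs (j # J) g x $ k = pderivs (j # J) (\<lambda>x. g x $ k) x" if "x \<in> S" for x k
  proof -
    have "pderivs (j # J) g x $ k = pd j (\<lambda>x. pderivs J g x $ k) x"
      using Cons.IH[OF that] by (simp add: pderivs.simps frechet_derivative_vec_nth)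
    also have "\<dots> = pd j (pderivs J (\<lambda>x. g x $ k)) x"
      by (rule pd_cong[OF assms(1) that]) (use Cons.IH in blast)
    finally show ?thesis by simp
  qed
  have "(\<lambda>x. pderivs (j # J) g x $ k) differentiable at x" for k
  proof (rule differentiable_cong_open[OF assms(1) Cons.prems])
    show "pderivs (j # J) (\<lambda>x. g x $ k) differentiable at x"
      by (rule smooth_diffable[OF smooth_pderivs[OF assms(2)] Cons.prems])
  qed (rule eq[symmetric])
  then show ?case using eq[OF Cons.prems] by (auto simp only: differentiable_vec_iff)
qed

lemma smooth_vec_iff:
  fixes g :: "real^'p::finite \<Rightarrow> real^'q::finite"
  assumes "open S"
  shows "smooth_map S g \<longleftrightarrow> (\<forall>k. smooth_map S (\<lambda>x. g x $ k))"
proof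
  assume g: "smooth_map S g"
  have *: "x \<in> S \<Longrightarrow> pderivs J g x $ k = pderivs J (\<lambda>x. g x $ k) x" for J x k
  proof (induction J arbitrary: x)
    case (Cons j J)
    have "pderivs (j # J) g x $ k = pd j (\<lambda>x. pderivs J g x $ k) x"
      using g Cons.prems by (auto simp: pderivs.simps smooth_map_def intro!: frechet_derivative_vec_nth)
    also have "\<dots> = pd j (pderivs J (\<lambda>x. g x $ k)) x"
      by (rule pd_cong[OF assms Cons.prems]) (use Cons.IH in blast)
    finally show ?case by simp
  qed simp
  show "\<forall>k. smooth_map S (\<lambda>x. g x $ k)"
    unfolding smooth_map_def
  proof (intro allI ballI)
    fix k J x assume x: "x \<in> S"
    show "pderivs J (\<lambda>x. g x $ k) differentiable at x"
      by (rule differentiable_cong_open[OF assms x, of "\<lambda>x. pderivs J g x $ k"])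
        (use g x * in \<open>auto simp: smooth_map_def differentiable_vec_iff\<close>)
  qed
next
  assume "\<forall>k. smooth_map S (\<lambda>x. g x $ k)"
  then show "smooth_map S g"
    unfolding smooth_map_def[of S g] using pderivs_vec_nth[OF assms] by blast
qed

subsection \<open>Symmetry of mixed partial derivatives\<close>

lemma has_real_derivative_line:
  assumes "f differentiable at (a + s *\<^sub>R axis i 1)"
  shows "((\<lambda>s. f (a + s *\<^sub>R axis i 1)) has_real_derivative pd i f (a + s *\<^sub>R axis i 1)) (at s)"
proof -
  have "((\<lambda>s. a + s *\<^sub>R axis i 1) has_derivative (\<lambda>h. h *\<^sub>R axis i 1)) (at s)"
    by (auto intro!: derivative_eq_intros)
  from has_derivative_compose[OF this] have
    "((\<lambda>s. f (a + s *\<^sub>R axis i 1)) has_derivative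
      (\<lambda>h. frechet_derivative f (at (a + s *\<^sub>R axis i 1)) (h *\<^sub>R axis i 1))) (at s)"
    using assms unfolding frechet_derivative_works by blast
  moreover have "frechet_derivative f (at (a + s *\<^sub>R axis i 1)) (h *\<^sub>R axis i 1) = h * pd i f (a + s *\<^sub>R axis i 1)" for h
    using linear_scale[OF linear_frechet_derivative[OF assms]] by (simp add: pd_def)
  ultimately show ?thesis
    by (simp add: has_field_derivative_def mult.commute[of _ "pd i f (a + s *\<^sub>R axis i 1)"])
qed

text \<open>The mean value theorem is applied in direction \<open>i\<close> to a difference in
  direction \<open>j\<close>, and then in direction \<open>j\<close>. The left side is symmetric in
  \<open>i\<close> and \<open>j\<close>, so the two mixed derivatives coincide at two nearby points,
  and continuity then gives \<open>pd_commute\<close>. The bound \<open>2 * h < d\<close> keeps the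
  parallelogram inside the ball.\<close>

lemma second_difference:
  assumes f: "smooth_map (ball x d) f" and h: "0 < h" "2 * h < d"
  shows "\<exists>y\<in>ball x d. f (x + h *\<^sub>R axis i 1 + h *\<^sub>R axis j 1) - f (x + h *\<^sub>R axis i 1)
    - f (x + h *\<^sub>R axis j 1) + f x = h * h * pd j (pd i f) y"
proof -
  have inb: "x + s *\<^sub>R axis i 1 + s' *\<^sub>R axis j 1 \<in> ball x d" if "0 \<le> s" "s \<le> h" "0 \<le> s'" "s' \<le> h" for s s'
  proof -
    have "norm (s *\<^sub>R axis i 1 + s' *\<^sub>R axis j 1 :: real^'a) \<le> \<bar>s\<bar> + \<bar>s'\<bar>"
      by (rule order_trans[OF norm_triangle_ineq]) simp
    with that h have "norm (s *\<^sub>R axis i 1 + s' *\<^sub>R axis j 1 :: real^'a) < d" by simp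
    moreover have "dist x (x + s *\<^sub>R axis i 1 + s' *\<^sub>R axis j 1) = norm (s *\<^sub>R axis i 1 + s' *\<^sub>R axis j 1 :: real^'a)"
      by (subst dist_commute) (simp add: dist_norm add.assoc)
    ultimately show ?thesis by simp
  qed
  have 1: "((\<lambda>s. f (x + h *\<^sub>R axis j 1 + s *\<^sub>R axis i 1) - f (x + s *\<^sub>R axis i 1)) has_real_derivative
      pd i f (x + h *\<^sub>R axis j 1 + s *\<^sub>R axis i 1) - pd i f (x + s *\<^sub>R axis i 1)) (at s)" if "0 \<le> s" "s \<le> h" for s
    using smooth_diffable[OF f] inb[of s h] inb[of s 0] that h
    by (intro DERIV_diff has_real_derivative_line) (auto simp: algebra_simps)
  obtain s where s: "0 < s" "s < h" and
    "f (x + h *\<^sub>R axis j 1 + h *\<^sub>R axis i 1) - f (x + h *\<^sub>R axis i 1) -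
     (f (x + h *\<^sub>R axis j 1 + 0 *\<^sub>R axis i 1) - f (x + 0 *\<^sub>R axis i 1)) =
     (h - 0) * (pd i f (x + h *\<^sub>R axis j 1 + s *\<^sub>R axis i 1) - pd i f (x + s *\<^sub>R axis i 1))"
    using MVT2[OF h(1) 1] by blast
  then have e1: "f (x + h *\<^sub>R axis i 1 + h *\<^sub>R axis j 1) - f (x + h *\<^sub>R axis i 1)
    - f (x + h *\<^sub>R axis j 1) + f x = h * (pd i f (x + s *\<^sub>R axis i 1 + h *\<^sub>R axis j 1) - pd i f (x + s *\<^sub>R axis i 1))"
    by (simp add: algebra_simps)
  have 2: "((\<lambda>s'. pd i f (x + s *\<^sub>R axis i 1 + s' *\<^sub>R axis j 1)) has_real_derivative
      pd j (pd i f) (x + s *\<^sub>R axis i 1 + s' *\<^sub>R axis j 1)) (at s')" if "0 \<le> s'" "s' \<le> h" for s'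
    using smooth_diffable[OF smooth_pd[OF f]] inb[of s s'] that s
    by (intro has_real_derivative_line) (auto simp: algebra_simps)
  obtain s' where s': "0 < s'" "s' < h" and
    "pd i f (x + s *\<^sub>R axis i 1 + h *\<^sub>R axis j 1) - pd i f (x + s *\<^sub>R axis i 1 + 0 *\<^sub>R axis j 1) =
     (h - 0) * pd j (pd i f) (x + s *\<^sub>R axis i 1 + s' *\<^sub>R axis j 1)"
    using MVT2[OF h(1) 2] by blast
  with e1 show ?thesis using inb[of s s'] s s' by (intro bexI) auto
qed

lemma pd_commute:
  assumes f: "smooth_map S f" and S: "open S" "x \<in> S"
  shows "pd i (pd j f) x = pd j (pd i f) x"
proof (rule ccontr)
  assume ne: "pd i (pd j f) x \<noteq> pd j (pd i f) x"
  define e where "e = \<bar>pd i (pd j f) x - pd j (pd i f) x\<bar> / 2"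
  have e: "e > 0" using ne by (simp add: e_def)
  have "isCont (pd i (pd j f)) x" "isCont (pd j (pd i f)) x"
    by (meson S(2) differentiable_imp_continuous_within f smooth_diffable smooth_pd)+
  then obtain d1 d2 where d: "d1 > 0" "d2 > 0"
    and d1: "\<And>y. dist y x < d1 \<Longrightarrow> dist (pd i (pd j f) y) (pd i (pd j f) x) < e"
    and d2: "\<And>y. dist y x < d2 \<Longrightarrow> dist (pd j (pd i f) y) (pd j (pd i f) x) < e"
    unfolding continuous_at_eps_delta using e by metis
  obtain d3 where d3: "d3 > 0" "ball x d3 \<subseteq> S" using S openE by blast
  define d where "d = min d1 (min d2 d3)"
  have d_pos: "d > 0" using d d3 by (simp add: d_def)
  have fb: "smooth_map (ball x d) f" by (rule smooth_subset[OF f]) (use d3 in \<open>auto simp: d_def\<close>)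
  define h where "h = d / 3"
  have h: "0 < h" "2 * h < d" using d_pos by (auto simp: h_def)
  obtain y where y: "y \<in> ball x d" "f (x + h *\<^sub>R axis i 1 + h *\<^sub>R axis j 1) - f (x + h *\<^sub>R axis i 1)
    - f (x + h *\<^sub>R axis j 1) + f x = h * h * pd j (pd i f) y"
    using second_difference[OF fb h] by blast
  obtain z where z: "z \<in> ball x d" "f (x + h *\<^sub>R axis j 1 + h *\<^sub>R axis i 1) - f (x + h *\<^sub>R axis j 1)
    - f (x + h *\<^sub>R axis i 1) + f x = h * h * pd i (pd j f) z"
    using second_difference[OF fb h] by blast
  have "h * h * pd j (pd i f) y = h * h * pd i (pd j f) z"
    using y(2) z(2) by (simp add: algebra_simps)
  then have "pd j (pd i f) y = pd i (pd j f) z" using h by simp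
  moreover have "dist (pd j (pd i f) y) (pd j (pd i f) x) < e"
    using d2[of y] y(1) by (simp add: d_def dist_commute)
  moreover have "dist (pd i (pd j f) z) (pd i (pd j f) x) < e"
    using d1[of z] z(1) by (simp add: d_def dist_commute)
  ultimately show False unfolding e_def dist_real_def by argo
qed

lemma pderivs_pd_commute:
  assumes f: "smooth_map S f" and S: "open S"
  shows "x \<in> S \<Longrightarrow> pderivs J (pd j f) x = pd j (pderivs J f) x"
proof (induction J arbitrary: x)
  case (Cons i J)
  have "pderivs (i # J) (pd j f) x = pd i (pd j (pderivs J f)) x"
    by (simp only: pderivs_Cons) (rule pd_cong[OF S Cons.prems Cons.IH])
  also have "\<dots> = pd j (pd i (pderivs J f)) x"
    by (rule pd_commute[OF smooth_pderivs[OF f] S Cons.prems])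
  finally show ?case by simp
qed simp

lemma pderivs_mset:
  fixes f :: "real^'p::finite \<Rightarrow> real"
  assumes f: "smooth_map S f" and S: "open S"
  shows "mset I = mset J \<Longrightarrow> x \<in> S \<Longrightarrow> pderivs I f x = pderivs J f x"
proof (induction I arbitrary: J x)
  case (Cons i I)
  then have "i \<in> set J" by (metis list.set_intros(1) mset_eq_setD)
  then obtain J1 J2 where J: "J = J1 @ i # J2" by (meson split_list)
  have "pderivs (i # I) f x = pd i (pderivs (J1 @ J2) f) x"
    using Cons.prems(1) J by (simp only: pderivs_Cons) (rule pd_cong[OF S Cons.prems(2) Cons.IH], auto)
  also have "\<dots> = pderivs J1 (pd i (pderivs J2 f)) x"
    using pderivs_pd_commute[OF smooth_pderivs[OF f] S Cons.prems(2)] by (simp add: pderivs_append)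
  finally show ?case by (simp add: J pderivs_append)
qed simp

subsection \<open>Agreement of partial derivatives up to a given order\<close>

text \<open>Equality of \<open>r\<close>-jets at \<open>p\<close>. The rules below make it a
  congruence for sums, products and composition, which is what independence of chosen
  representatives comes down to.\<close>

definition eqr :: "nat \<Rightarrow> real^'p::finite \<Rightarrow> (real^'p \<Rightarrow> real) \<Rightarrow> (real^'p \<Rightarrow> real) \<Rightarrow> bool" where
  "eqr r p f g \<longleftrightarrow> (\<forall>J. length J \<le> r \<longrightarrow> pderivs J f p = pderivs J g p)"

lemma eqr_0 [simp]: "eqr 0 p f g \<longleftrightarrow> f p = g p"
  by (simp add: eqr_def)

lemma eqr_Suc: "eqr (Suc r) p f g \<longleftrightarrow> f p = g p \<and> (\<forall>j. eqr r p (pd j f) (pd j g))" (is "?L \<longleftrightarrow> ?R")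
proof
  assume L: ?L
  have "f p = g p" using L[unfolded eqr_def, rule_format, of "[]"] by simp
  moreover have "pderivs J (pd j f) p = pderivs J (pd j g) p" if "length J \<le> r" for J j
    using L[unfolded eqr_def, rule_format, of "J @ [j]"] that by (simp add: pderivs_append)
  ultimately show ?R by (simp add: eqr_def)
next
  assume R: ?R
  show ?L unfolding eqr_def
  proof (intro allI impI)
    fix J :: "'a list" assume "length J \<le> Suc r"
    then show "pderivs J f p = pderivs J g p"
      using R by (cases J rule: rev_cases) (auto simp: eqr_def pderivs_append)
  qed
qed

lemma eqr_mono: "eqr r p f g \<Longrightarrow> k \<le> r \<Longrightarrow> eqr k p f g"
  by (auto simp: eqr_def)

lemma eqr_point: "eqr r p f g \<Longrightarrow> f p = g p"
  using eqr_mono[of r p f g 0] by simp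

lemma eqr_refl [simp]: "eqr r p f f"
  by (simp add: eqr_def)

lemma eqr_sym: "eqr r p f g \<Longrightarrow> eqr r p g f"
  by (simp add: eqr_def)

lemma eqr_trans: "eqr r p f g \<Longrightarrow> eqr r p g h \<Longrightarrow> eqr r p f h"
  by (simp add: eqr_def)

lemma eqr_cong:
  assumes "open S" "p \<in> S" "\<And>x. x \<in> S \<Longrightarrow> f x = f' x" "\<And>x. x \<in> S \<Longrightarrow> g x = g' x"
  shows "eqr r p f g \<longleftrightarrow> eqr r p f' g'"
  unfolding eqr_def using pderivs_cong[OF assms(1), of f f'] pderivs_cong[OF assms(1), of g g'] assms by simp

lemma eqr_local:
  assumes "open S" "p \<in> S" "\<And>x. x \<in> S \<Longrightarrow> f x = g x"
  shows "eqr r p f g"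
  unfolding eqr_def using pderivs_cong[OF assms(1), of f g] assms by simp

lemma eqr_pd: "eqr (Suc r) p f g \<Longrightarrow> eqr r p (pd j f) (pd j g)"
  by (simp add: eqr_Suc)

context
  fixes S :: "(real^'p::finite) set" and p
  assumes S: "open S" "p \<in> S"
begin

lemma eqr_add:
  "\<lbrakk>smooth_map S f; smooth_map S f'; smooth_map S g; smooth_map S g'; eqr r p f f'; eqr r p g g'\<rbrakk>
    \<Longrightarrow> eqr r p (\<lambda>x. f x + g x) (\<lambda>x. f' x + g' x)"
proof (induction r arbitrary: f f' g g')
  case (Suc r)
  have "eqr r p (\<lambda>x. pd j f x + pd j g x) (\<lambda>x. pd j f' x + pd j g' x)" for j
    by (rule Suc.IH) (use Suc.prems smooth_pd eqr_pd in blast)+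
  then have "eqr r p (pd j (\<lambda>x. f x + g x)) (pd j (\<lambda>x. f' x + g' x))" for j
    by (rule eqr_cong[OF S, THEN iffD1, rotated 2])
      (use Suc.prems in \<open>simp_all add: pd_add smooth_diffable\<close>)
  then show ?case using Suc.prems by (auto simp: eqr_Suc)
qed simp

lemma eqr_mult:
  "\<lbrakk>smooth_map S f; smooth_map S f'; smooth_map S g; smooth_map S g'; eqr r p f f'; eqr r p g g'\<rbrakk>
    \<Longrightarrow> eqr r p (\<lambda>x. f x * g x) (\<lambda>x. f' x * g' x)"
proof (induction r arbitrary: f f' g g')
  case (Suc r)
  have m: "eqr r p f f'" "eqr r p g g'" using Suc.prems eqr_mono[of "Suc r" p _ _ r] by auto
  have "eqr r p (\<lambda>x. pd j f x * g x + f x * pd j g x) (\<lambda>x. pd j f' x * g' x + f' x * pd j g' x)" for j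
    by (intro eqr_add Suc.IH smooth_mult S) (use Suc.prems m smooth_pd eqr_pd in blast)+
  then have "eqr r p (pd j (\<lambda>x. f x * g x)) (pd j (\<lambda>x. f' x * g' x))" for j
    by (rule eqr_cong[OF S, THEN iffD1, rotated 2])
      (use Suc.prems in \<open>simp_all add: pd_mult smooth_diffable\<close>)
  then show ?case using Suc.prems by (auto simp: eqr_Suc)
qed simp

lemma eqr_sum:
  assumes "\<And>i. i \<in> I \<Longrightarrow> smooth_map S (f i)" "\<And>i. i \<in> I \<Longrightarrow> smooth_map S (f' i)"
    "\<And>i. i \<in> I \<Longrightarrow> eqr r p (f i) (f' i)"
  shows "eqr r p (\<lambda>x. \<Sum>i\<in>I. f i x) (\<lambda>x. \<Sum>i\<in>I. f' i x)"
  using assms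
proof (induction I rule: infinite_finite_induct)
  case (insert i I)
  then show ?case by (auto intro!: eqr_add smooth_sum S)
qed auto

text \<open>Both factors may vary. With equal outer maps this gives independence of the chart, with
  different ones it makes the action of jets of diffeomorphisms well defined.\<close>

lemma eqr_compose:
  fixes g g' :: "real^'p \<Rightarrow> real^'q::finite" and f f' :: "real^'q \<Rightarrow> real"
  assumes g: "\<And>k. smooth_map S (\<lambda>x. g x $ k)" "\<And>k. smooth_map S (\<lambda>x. g' x $ k)"
    and T: "g ` S \<subseteq> T" "g' ` S \<subseteq> T" "open T"
  shows "\<lbrakk>smooth_map T f; smooth_map T f'; eqr r (g p) f f'; \<And>k. eqr r p (\<lambda>x. g x $ k) (\<lambda>x. g' x $ k)\<rbrakk>
    \<Longrightarrow> eqr r p (\<lambda>x. f (g x)) (\<lambda>x. f' (g' x))"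
proof (induction r arbitrary: f f')
  case 0
  then have "g p = g' p" by (simp add: vec_eq_iff)
  with 0 show ?case by simp
next
  case (Suc r)
  have gp: "g p = g' p" using eqr_point[OF Suc.prems(4)] by (simp add: vec_eq_iff)
  have r: "eqr r p (\<lambda>x. g x $ k) (\<lambda>x. g' x $ k)" for k
    using eqr_mono[OF Suc.prems(4), of r] by simp
  have 1: "smooth_map S (\<lambda>x. pd k f (g x))" "smooth_map S (\<lambda>x. pd k f' (g' x))" for k
    using smooth_compose[OF S(1) g(1) smooth_pd[OF Suc.prems(1)] T(1)]
      smooth_compose[OF S(1) g(2) smooth_pd[OF Suc.prems(2)] T(2)] by auto
  have 2: "eqr r p (\<lambda>x. pd k f (g x)) (\<lambda>x. pd k f' (g' x))" for k
    by (rule Suc.IH[OF smooth_pd[OF Suc.prems(1)] smooth_pd[OF Suc.prems(2)] eqr_pd[OF Suc.prems(3)] r])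
  have 3: "eqr r p (\<lambda>x. \<Sum>k\<in>UNIV. pd k f (g x) * pd j (\<lambda>x. g x $ k) x)
     (\<lambda>x. \<Sum>k\<in>UNIV. pd k f' (g' x) * pd j (\<lambda>x. g' x $ k) x)" for j
    using g Suc.prems(4) 1 2
    by (intro eqr_sum eqr_mult smooth_mult[OF S(1)]) (simp_all add: smooth_pd eqr_pd)
  have 4: "pd j (\<lambda>x. h (u x)) x = (\<Sum>k\<in>UNIV. pd k h (u x) * pd j (\<lambda>x. u x $ k) x)"
    if "x \<in> S" "smooth_map T h" "\<And>k. smooth_map S (\<lambda>x. u x $ k)" "u ` S \<subseteq> T"
    for j x h and u :: "real^'p \<Rightarrow> real^'q"
    by (intro pd_compose smooth_diffable[OF that(2)] smooth_diffable[OF that(3) that(1)])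
      (use that in auto)
  have 5: "eqr r p (pd j (\<lambda>x. h (u x))) (\<lambda>x. \<Sum>k\<in>UNIV. pd k h (u x) * pd j (\<lambda>x. u x $ k) x)"
    if "smooth_map T h" "\<And>k. smooth_map S (\<lambda>x. u x $ k)" "u ` S \<subseteq> T"
    for j h and u :: "real^'p \<Rightarrow> real^'q"
    using 4[OF _ that] by (rule eqr_local[OF S])
  have "eqr r p (pd j (\<lambda>x. f (g x))) (pd j (\<lambda>x. f' (g' x)))" for j
    by (rule eqr_trans[OF 5[of f g j, OF Suc.prems(1) g(1) T(1)]
          eqr_trans[OF 3[of j] eqr_sym[OF 5[of f' g' j, OF Suc.prems(2) g(2) T(2)]]]])
  moreover have "f (g p) = f' (g' p)" using eqr_point[OF Suc.prems(3)] gp by simp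
  ultimately show ?case by (simp add: eqr_Suc)
qed

end

section \<open>Moving frames\<close>

lemma smooth_det:
  fixes M :: "real^'p::finite \<Rightarrow> real^'q::finite^'q"
  assumes "open S" "\<And>i j. smooth_map S (\<lambda>t. M t $ i $ j)"
  shows "smooth_map S (\<lambda>t. det (M t))"
  unfolding det_def by (intro smooth_sum smooth_mult smooth_const smooth_prod assms)

lemma matrix_inv_mult:
  fixes A :: "real^'p::finite^'p"
  assumes "det A \<noteq> 0"
  shows "matrix_inv A ** A = mat 1" "A ** matrix_inv A = mat 1"
proof -
  have "\<exists>B. A ** B = mat 1 \<and> B ** A = mat 1"
    using assms by (simp add: invertible_det_nz[symmetric] invertible_def)
  from someI_ex[OF this] show "matrix_inv A ** A = mat 1" "A ** matrix_inv A = mat 1"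
    unfolding matrix_inv_def by auto
qed

lemma matrix_inv_sum:
  fixes A :: "real^'p::finite^'p"
  assumes "det A \<noteq> 0"
  shows "(\<Sum>k\<in>UNIV. matrix_inv A $ i $ k * A $ k $ j) = (if i = j then 1 else 0)"
    "(\<Sum>k\<in>UNIV. A $ i $ k * matrix_inv A $ k $ j) = (if i = j then 1 else 0)"
  using matrix_inv_mult[OF assms] by (simp_all add: matrix_matrix_mult_def mat_def vec_eq_iff)

lemma matrix_mult_eq_1I:
  "(\<And>i j. (\<Sum>k\<in>UNIV. A $ i $ k * B $ k $ j) = (if i = j then 1 else 0)) \<Longrightarrow> A ** B = mat 1"
  by (simp add: matrix_matrix_mult_def mat_def vec_eq_iff)

lemma matrix_inv_unique:
  fixes A B :: "real^'p::finite^'p"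
  assumes "A ** B = mat 1"
  shows "B = matrix_inv A" "det A \<noteq> 0"
proof -
  have "det A * det B = 1" using assms by (metis det_I det_mul)
  then show d: "det A \<noteq> 0" by auto
  have "matrix_inv A ** (A ** B) = B"
    by (simp add: matrix_mul_assoc matrix_inv_mult[OF d])
  then show "B = matrix_inv A" by (simp add: assms)
qed

text \<open>\<open>matrix_inv\<close> is defined by choice, which hides its dependence on the
  matrix. Cramer's rule shows the entries as quotients of determinants, hence smooth.\<close>

lemma matrix_inv_cramer:
  fixes A :: "real^'p::finite^'p"
  assumes "det A \<noteq> 0"
  shows "matrix_inv A $ k $ j = det (\<chi> i l. if l = k then axis j 1 $ i else A $ i $ l) / det A"
proof -
  have "A *v (matrix_inv A *v axis j 1) = axis j 1"
    by (simp add: matrix_vector_mul_assoc matrix_inv_mult[OF assms])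
  then have "matrix_inv A *v axis j 1 =
    (\<chi> k. det (\<chi> i l. if l = k then axis j 1 $ i else A $ i $ l) / det A)"
    by (subst (asm) cramer[OF assms])
  moreover have "(matrix_inv A *v axis j 1) $ k = matrix_inv A $ k $ j"
    by (simp add: matrix_vector_mult_def axis_def if_distrib cong: if_cong)
  ultimately show ?thesis by simp
qed

lemma smooth_matrix_inv:
  fixes M :: "real^'p::finite \<Rightarrow> real^'q::finite^'q"
  assumes "open S" "\<And>i j. smooth_map S (\<lambda>t. M t $ i $ j)" "\<And>t. t \<in> S \<Longrightarrow> det (M t) \<noteq> 0"
  shows "smooth_map S (\<lambda>t. matrix_inv (M t) $ k $ j)"
proof -
  have "smooth_map S (\<lambda>t. det (\<chi> i l. if l = k then axis j 1 $ i else M t $ i $ l) / det (M t))"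
  proof (intro smooth_divide assms smooth_det)
    show "smooth_map S (\<lambda>t. (\<chi> i l. if l = k then axis j 1 $ i else M t $ i $ l) $ a $ b)" for a b
      by (cases "b = k") (use assms in \<open>simp_all add: smooth_const\<close>)
  qed
  then show ?thesis
    by (rule smooth_cong[OF _ assms(1)]) (simp add: matrix_inv_cramer assms)
qed

lemma pd_prod:
  assumes "finite I" "\<And>i. i \<in> I \<Longrightarrow> f i differentiable at t"
  shows "pd k (\<lambda>t. \<Prod>i\<in>I. f i t) t = (\<Sum>i\<in>I. pd k (f i) t * (\<Prod>i'\<in>I - {i}. f i' t))
    \<and> (\<lambda>t. \<Prod>i\<in>I. f i t) differentiable at t"
  using assms
proof (induction I)
  case (insert a I)
  have "(\<Prod>i'\<in>insert a I - {i}. f i' t) = f a t * (\<Prod>i'\<in>I - {i}. f i' t)" if "i \<in> I" for i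
  proof -
    have "insert a I - {i} = insert a (I - {i})" using that insert by auto
    with insert show ?thesis by simp
  qed
  moreover have "insert a I - {a} = I" using insert by auto
  ultimately show ?case using insert
    by (auto simp: pd_mult sum_distrib_left mult_ac intro!: sum.cong)
qed simp

text \<open>Jacobi's formula. The Leibniz expansion yields one determinant per row, with that row
  replaced by its derivative. The inverse matrix writes the differentiated row as a combination of
  the rows of \<open>M\<close>, with coefficients \<open>c i\<close>, and Cramer's lemma extracts
  the coefficient of row \<open>i\<close>.\<close>

lemma pd_det:
  fixes M :: "real^'p::finite \<Rightarrow> real^'q::finite^'q"
  assumes d: "\<And>i j. (\<lambda>t. M t $ i $ j) differentiable at t" and nz: "det (M t) \<noteq> 0"
  shows "pd k (\<lambda>t. det (M t)) t =
    det (M t) * (\<Sum>l\<in>UNIV. \<Sum>m\<in>UNIV. matrix_inv (M t) $ l $ m * pd k (\<lambda>t. M t $ m $ l) t)"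
proof -
  define D where "D = (\<chi> m l. pd k (\<lambda>t. M t $ m $ l) t)"
  define c where "c i = (\<chi> m. \<Sum>l\<in>UNIV. D $ i $ l * matrix_inv (M t) $ l $ m)" for i
  have "pd k (\<lambda>t. det (M t)) t = (\<Sum>p | p permutes (UNIV :: 'q set). of_int (sign p) *
      (\<Sum>i\<in>UNIV. D $ i $ p i * (\<Prod>i'\<in>UNIV - {i}. M t $ i' $ p i')))"
    unfolding det_def using d
    by (subst pd_sum) (auto intro!: differentiable_mult sum.cong simp: pd_cmult pd_prod D_def)
  also have "\<dots> = (\<Sum>i\<in>UNIV. \<Sum>p | p permutes (UNIV :: 'q set). of_int (sign p) *
      (D $ i $ p i * (\<Prod>i'\<in>UNIV - {i}. M t $ i' $ p i')))"
    by (subst sum.swap) (simp add: sum_distrib_left)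
  also have "\<dots> = (\<Sum>i\<in>UNIV. det (\<chi> a. if a = i then D $ i else row a (M t)))"
  proof (intro sum.cong refl)
    fix i :: 'q
    show "(\<Sum>p | p permutes (UNIV :: 'q set). of_int (sign p) *
        (D $ i $ p i * (\<Prod>i'\<in>UNIV - {i}. M t $ i' $ p i'))) =
      det (\<chi> a. if a = i then D $ i else row a (M t))"
      unfolding det_def
    proof (intro sum.cong refl arg_cong2[of _ _ _ _ "(*)"])
      fix p :: "'q \<Rightarrow> 'q"
      show "D $ i $ p i * (\<Prod>i'\<in>UNIV - {i}. M t $ i' $ p i') =
        (\<Prod>a\<in>UNIV. (\<chi> a. if a = i then D $ i else row a (M t)) $ a $ p a)"
        by (subst prod.remove[of UNIV i]) (auto simp: row_def)
    qed
  qed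
  also have "\<dots> = (\<Sum>i\<in>UNIV. c i $ i * det (M t))"
  proof (intro sum.cong refl)
    fix i :: 'q
    have "(\<Sum>m\<in>UNIV. c i $ m *s row m (M t)) = D $ i"
    proof (simp add: vec_eq_iff, intro allI)
      fix j
      have "(\<Sum>m\<in>UNIV. c i $ m * row m (M t) $ j) =
        (\<Sum>l\<in>UNIV. D $ i $ l * (\<Sum>m\<in>UNIV. matrix_inv (M t) $ l $ m * M t $ m $ j))"
        by (simp add: c_def row_def sum_distrib_right sum_distrib_left mult_ac)
          (rule sum.swap)
      then show "(\<Sum>m\<in>UNIV. c i $ m * row m (M t) $ j) = D $ i $ j"
        by (simp add: matrix_inv_sum[OF nz] if_distrib cong: if_cong)
    qed
    with cramer_lemma_transpose[of i "c i" "M t"]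
    show "det (\<chi> a. if a = i then D $ i else row a (M t)) = c i $ i * det (M t)"
      by (simp only:)
  qed
  also have "\<dots> = det (M t) * (\<Sum>i\<in>UNIV. \<Sum>l\<in>UNIV. matrix_inv (M t) $ l $ i * D $ i $ l)"
    by (simp add: c_def sum_distrib_left sum_distrib_right mult_ac)
  finally show ?thesis by (subst sum.swap) (simp add: D_def)
qed

text \<open>\<open>Bop X\<close> is the frame of vector fields with \<open>Bop X i (X j) = \<delta>\<^sub>i\<^sub>j\<close>. If \<open>X\<close> consists of the
  independent components \<open>x\<^sup>i\<close> of a velocity field, then \<open>Bop X i\<close> is the total derivative \<open>D\<^sub>i\<close>.\<close>

definition fmat :: "('p::finite \<Rightarrow> real^'p \<Rightarrow> real) \<Rightarrow> real^'p \<Rightarrow> real^'p^'p" where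
  "fmat X t = (\<chi> i j. pd j (X i) t)"

definition Bop :: "('p::finite \<Rightarrow> real^'p \<Rightarrow> real) \<Rightarrow> 'p \<Rightarrow> (real^'p \<Rightarrow> real) \<Rightarrow> real^'p \<Rightarrow> real" where
  "Bop X i h t = (\<Sum>j\<in>UNIV. matrix_inv (fmat X t) $ j $ i * pd j h t)"

lemma fmat_nth [simp]: "fmat X t $ i $ j = pd j (X i) t"
  by (simp add: fmat_def)

lemma pd_eq_Bop:
  assumes "det (fmat X t) \<noteq> 0"
  shows "pd j h t = (\<Sum>i\<in>UNIV. pd j (X i) t * Bop X i h t)"
proof -
  have "(\<Sum>i\<in>UNIV. pd j (X i) t * Bop X i h t) =
    (\<Sum>k\<in>UNIV. pd k h t * (\<Sum>i\<in>UNIV. matrix_inv (fmat X t) $ k $ i * fmat X t $ i $ j))"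
    by (simp add: Bop_def sum_distrib_left mult_ac) (rule sum.swap)
  also have "\<dots> = pd j h t"
    by (simp add: matrix_inv_sum[OF assms, simplified] if_distrib cong: if_cong)
  finally show ?thesis ..
qed

lemma frame_coeffs_unique:
  assumes "det (fmat X t) \<noteq> 0" "\<And>j. (\<Sum>i\<in>UNIV. pd j (X i) t * v i) = (\<Sum>i\<in>UNIV. pd j (X i) t * w i)"
  shows "v i = w i"
proof -
  have *: "(\<Sum>j\<in>UNIV. matrix_inv (fmat X t) $ j $ i * (\<Sum>a\<in>UNIV. pd j (X a) t * v a)) = v i" for v
  proof -
    have "(\<Sum>j\<in>UNIV. matrix_inv (fmat X t) $ j $ i * (\<Sum>a\<in>UNIV. pd j (X a) t * v a)) =
      (\<Sum>a\<in>UNIV. v a * (\<Sum>j\<in>UNIV. fmat X t $ a $ j * matrix_inv (fmat X t) $ j $ i))"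
      by (simp add: sum_distrib_left mult_ac) (rule sum.swap)
    also have "\<dots> = v i" by (simp add: matrix_inv_sum[OF assms(1), simplified] if_distrib cong: if_cong)
    finally show ?thesis .
  qed
  show ?thesis using *[of v] *[of w] assms(2) by simp
qed

lemma Bop_unique:
  assumes "det (fmat X t) \<noteq> 0" "\<And>j. (\<Sum>i\<in>UNIV. pd j (X i) t * v i) = pd j h t"
  shows "Bop X i h t = v i"
  by (rule frame_coeffs_unique[OF assms(1)]) (simp add: assms(2) pd_eq_Bop[OF assms(1), symmetric])

lemma Bop_cong:
  assumes "open S" "t \<in> S" "\<And>i u. u \<in> S \<Longrightarrow> X i u = X' i u" "\<And>u. u \<in> S \<Longrightarrow> h u = h' u"
  shows "Bop X i h t = Bop X' i h' t"
proof -
  have "pd j (X i) t = pd j (X' i) t" for i j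
    by (rule pd_cong[OF assms(1,2)]) (rule assms(3))
  moreover have "pd j h t = pd j h' t" for j
    by (rule pd_cong[OF assms(1,2)]) (rule assms(4))
  ultimately show ?thesis by (simp add: Bop_def fmat_def)
qed

lemma Bops_cong:
  assumes "open S" "\<And>i u. u \<in> S \<Longrightarrow> X i u = X' i u" "\<And>u. u \<in> S \<Longrightarrow> h u = h' u"
  shows "t \<in> S \<Longrightarrow> foldr (Bop X) I h t = foldr (Bop X') I h' t"
proof (induction I arbitrary: t)
  case (Cons i I)
  have "Bop X i (foldr (Bop X) I h) t = Bop X' i (foldr (Bop X') I h') t"
    by (rule Bop_cong[OF assms(1) Cons.prems assms(2) Cons.IH])
  then show ?case by simp
qed (simp add: assms)

text \<open>By nondegeneracy the functions \<open>X i\<close> are coordinates near every point of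
  \<open>S\<close>, although they need not be injective on \<open>S\<close>. This is why the dual
  vector fields commute.\<close>

locale frame =
  fixes X :: "'p::finite \<Rightarrow> real^'p \<Rightarrow> real" and S :: "(real^'p) set"
  assumes open_S: "open S" and smooth_X: "\<And>i. smooth_map S (X i)"
    and det_nz: "\<And>t. t \<in> S \<Longrightarrow> det (fmat X t) \<noteq> 0"
begin

abbreviation B :: "'p \<Rightarrow> 'p \<Rightarrow> real^'p \<Rightarrow> real" where
  "B k i t \<equiv> matrix_inv (fmat X t) $ k $ i"

lemma smooth_B: "smooth_map S (B k i)"
  by (rule smooth_matrix_inv[OF open_S]) (simp_all add: smooth_pd smooth_X det_nz)

lemma smooth_Bop: "smooth_map S h \<Longrightarrow> smooth_map S (Bop X i h)"
  unfolding Bop_def[abs_def]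
  by (intro smooth_sum smooth_mult open_S smooth_B smooth_pd)

lemma smooth_Bops: "smooth_map S h \<Longrightarrow> smooth_map S (foldr (Bop X) I h)"
  by (induction I) (auto intro: smooth_Bop)

lemma Bop_X: "t \<in> S \<Longrightarrow> Bop X i (X j) t = (if i = j then 1 else 0)"
  by (rule Bop_unique[OF det_nz]) (simp_all add: if_distrib cong: if_cong)

lemma Bop_mult: "smooth_map S f \<Longrightarrow> smooth_map S g \<Longrightarrow> t \<in> S \<Longrightarrow>
    Bop X i (\<lambda>t. f t * g t) t = Bop X i f t * g t + f t * Bop X i g t"
  by (simp add: Bop_def pd_mult smooth_diffable sum.distrib distrib_left sum_distrib_left
      sum_distrib_right mult_ac)

text \<open>Expanding the second derivatives of \<open>h\<close> in the frame, the symmetry for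
  \<open>h\<close> and for each \<open>X l\<close> leaves an identity contracted twice with the
  Jacobian; the Jacobian is cancelled once in each slot.\<close>

lemma Bop_commute:
  assumes h: "smooth_map S h" and t: "t \<in> S"
  shows "Bop X i (Bop X j h) t = Bop X j (Bop X i h) t"
proof -
  have 1: "pd m (pd k h) t = (\<Sum>l\<in>UNIV. pd m (pd k (X l)) t * Bop X l h t) +
      (\<Sum>l\<in>UNIV. pd k (X l) t * (\<Sum>a\<in>UNIV. pd m (X a) t * Bop X a (Bop X l h) t))" for m k
  proof -
    have "pd m (pd k h) t = pd m (\<lambda>t. \<Sum>l\<in>UNIV. pd k (X l) t * Bop X l h t) t"
      by (rule pd_cong[OF open_S t]) (rule pd_eq_Bop[OF det_nz])
    also have "\<dots> = (\<Sum>l\<in>UNIV. pd m (pd k (X l)) t * Bop X l h t + pd k (X l) t * pd m (Bop X l h) t)"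
      by (subst pd_sum)
        (simp_all add: differentiable_mult smooth_diffable[OF smooth_pd[OF smooth_X] t]
          smooth_diffable[OF smooth_Bop[OF h] t] pd_mult)
    finally show ?thesis
      by (simp add: sum.distrib pd_eq_Bop[OF det_nz[OF t], of m "Bop X _ h", symmetric])
  qed
  have 2: "(\<Sum>l\<in>UNIV. pd k (X l) t * (\<Sum>a\<in>UNIV. pd m (X a) t * Bop X a (Bop X l h) t)) =
      (\<Sum>l\<in>UNIV. pd m (X l) t * (\<Sum>a\<in>UNIV. pd k (X a) t * Bop X a (Bop X l h) t))" for m k
    using 1[of m k] 1[of k m] pd_commute[OF h open_S t, of m k]
      pd_commute[OF smooth_X open_S t, of m k] by simp
  have 3: "(\<Sum>l\<in>UNIV. pd m (X l) t * (\<Sum>a\<in>UNIV. pd k (X a) t * Bop X a (Bop X l h) t)) =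
      (\<Sum>l\<in>UNIV. pd k (X l) t * (\<Sum>a\<in>UNIV. pd m (X a) t * Bop X l (Bop X a h) t))" for m k
    by (simp add: sum_distrib_left) (subst sum.swap, simp add: mult_ac)
  have 4: "(\<Sum>a\<in>UNIV. pd m (X a) t * Bop X a (Bop X l h) t) = (\<Sum>a\<in>UNIV. pd m (X a) t * Bop X l (Bop X a h) t)" for l m
    by (rule frame_coeffs_unique[OF det_nz[OF t]]) (use 2 3 in simp)
  show ?thesis by (rule frame_coeffs_unique[OF det_nz[OF t]]) (rule 4)
qed

lemma Bops_Bop_commute:
  assumes h: "smooth_map S h"
  shows "t \<in> S \<Longrightarrow> foldr (Bop X) I (Bop X j h) t = Bop X j (foldr (Bop X) I h) t"
proof (induction I arbitrary: t)
  case (Cons i I)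
  have "Bop X i (foldr (Bop X) I (Bop X j h)) t = Bop X i (Bop X j (foldr (Bop X) I h)) t"
    by (rule Bop_cong[OF open_S Cons.prems refl Cons.IH])
  also have "\<dots> = Bop X j (Bop X i (foldr (Bop X) I h)) t"
    by (rule Bop_commute[OF smooth_Bops[OF h] Cons.prems])
  finally show ?case by simp
qed simp

lemma Bops_mset:
  assumes h: "smooth_map S h"
  shows "mset I = mset J \<Longrightarrow> t \<in> S \<Longrightarrow> foldr (Bop X) I h t = foldr (Bop X) J h t"
proof (induction I arbitrary: J t)
  case (Cons i I)
  then have "i \<in> set J" by (metis list.set_intros(1) mset_eq_setD)
  then obtain J1 J2 where J: "J = J1 @ i # J2" by (meson split_list)
  have "Bop X i (foldr (Bop X) I h) t = Bop X i (foldr (Bop X) (J1 @ J2) h) t"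
    by (rule Bop_cong[OF open_S Cons.prems(2) refl Cons.IH]) (use Cons.prems(1) J in auto)
  also have "\<dots> = foldr (Bop X) J1 (Bop X i (foldr (Bop X) J2 h)) t"
    using Bops_Bop_commute[OF smooth_Bops[OF h] Cons.prems(2), of J1 i J2] by simp
  finally show ?case by (simp add: J)
qed simp

lemma Bop_compose:
  fixes g :: "real^'p \<Rightarrow> real^'q::finite"
  assumes "t \<in> S" "f differentiable at (g t)" "\<And>k. smooth_map S (\<lambda>t. g t $ k)"
  shows "Bop X i (\<lambda>t. f (g t)) t = (\<Sum>k\<in>UNIV. pd k f (g t) * Bop X i (\<lambda>t. g t $ k) t)"
proof -
  have "pd j (\<lambda>t. f (g t)) t = (\<Sum>k\<in>UNIV. pd k f (g t) * pd j (\<lambda>t. g t $ k) t)" for j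
    using assms smooth_diffable[OF assms(3) assms(1)] by (intro pd_compose)
  then show ?thesis
    by (simp add: Bop_def sum_distrib_left mult_ac) (rule sum.swap)
qed

text \<open>Differentiating \<open>B A = 1\<close>, with \<open>A\<close> the Jacobian, and
  multiplying by \<open>B\<close> from the right: the differential of the inverse is
  \<open>- B (dA) B\<close>.\<close>

lemma pd_B:
  assumes t: "t \<in> S"
  shows "pd k (B a i) t = - (\<Sum>l\<in>UNIV. \<Sum>m\<in>UNIV. B a l t * pd k (pd m (X l)) t * B m i t)"
proof -
  have 0: "(\<Sum>l\<in>UNIV. pd k (B a l) t * pd m (X l) t) + (\<Sum>l\<in>UNIV. B a l t * pd k (pd m (X l)) t) = 0" for m
  proof -
    have "pd k (\<lambda>t. \<Sum>l\<in>UNIV. B a l t * pd m (X l) t) t = pd k (\<lambda>t. if a = m then 1 else 0) t"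
      by (rule pd_cong[OF open_S t]) (use matrix_inv_sum(1)[OF det_nz, of _ a m] in simp)
    moreover have "pd k (\<lambda>t. \<Sum>l\<in>UNIV. B a l t * pd m (X l) t) t =
      (\<Sum>l\<in>UNIV. pd k (B a l) t * pd m (X l) t + B a l t * pd k (pd m (X l)) t)"
      by (subst pd_sum)
        (simp_all add: differentiable_mult smooth_diffable[OF smooth_pd[OF smooth_X] t]
          smooth_diffable[OF smooth_B t] pd_mult)
    ultimately show ?thesis by (simp add: sum.distrib)
  qed
  have "(\<Sum>m\<in>UNIV. (\<Sum>l\<in>UNIV. pd k (B a l) t * pd m (X l) t) * B m i t) =
    (\<Sum>l\<in>UNIV. pd k (B a l) t * (\<Sum>m\<in>UNIV. fmat X t $ l $ m * B m i t))"
    by (simp add: sum_distrib_left sum_distrib_right mult_ac) (rule sum.swap)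
  also have "\<dots> = pd k (B a i) t"
    by (simp add: matrix_inv_sum[OF det_nz[OF t], simplified] if_distrib cong: if_cong)
  finally have "pd k (B a i) t = (\<Sum>m\<in>UNIV. (\<Sum>l\<in>UNIV. pd k (B a l) t * pd m (X l) t) * B m i t)" ..
  also have "\<dots> = (\<Sum>m\<in>UNIV. - (\<Sum>l\<in>UNIV. B a l t * pd k (pd m (X l)) t) * B m i t)"
    using 0 by (simp add: add_eq_0_iff2)
  finally show ?thesis
    by (simp add: sum_negf sum_distrib_right) (rule sum.swap)
qed

text \<open>The Piola identity. The density \<open>J\<close> need not be the determinant of the frame itself, which
  allows a frame with an additional parameter.\<close>

lemma piola:
  assumes J: "smooth_map S J"
    and dJ: "\<And>t k. t \<in> S \<Longrightarrow> pd k J t = J t * (\<Sum>l\<in>UNIV. \<Sum>m\<in>UNIV. B l m t * pd k (pd l (X m)) t)"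
    and t: "t \<in> S"
  shows "(\<Sum>k\<in>UNIV. pd k (\<lambda>t. J t * B k i t) t) = 0"
proof -
  have "(\<Sum>k\<in>UNIV. pd k (\<lambda>t. J t * B k i t) t) =
    (\<Sum>k\<in>UNIV. pd k J t * B k i t) + J t * (\<Sum>k\<in>UNIV. pd k (B k i) t)"
    using smooth_diffable[OF J t] smooth_diffable[OF smooth_B t]
    by (simp add: pd_mult sum.distrib sum_distrib_left)
  moreover have "(\<Sum>k\<in>UNIV. pd k J t * B k i t) =
     J t * (\<Sum>k\<in>UNIV. \<Sum>l\<in>UNIV. \<Sum>m\<in>UNIV. B l m t * pd l (pd k (X m)) t * B k i t)"
    by (simp add: dJ[OF t] pd_commute[OF smooth_X open_S t] sum_distrib_left sum_distrib_right mult_ac)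
  moreover have "(\<Sum>k\<in>UNIV. pd k (B k i) t) =
     - (\<Sum>k\<in>UNIV. \<Sum>l\<in>UNIV. \<Sum>m\<in>UNIV. B k l t * pd k (pd m (X l)) t * B m i t)"
    by (simp add: pd_B[OF t] sum_negf)
  moreover have "(\<Sum>k\<in>UNIV. \<Sum>l\<in>UNIV. \<Sum>m\<in>UNIV. B l m t * pd l (pd k (X m)) t * B k i t) =
     (\<Sum>k\<in>UNIV. \<Sum>l\<in>UNIV. \<Sum>m\<in>UNIV. B k l t * pd k (pd m (X l)) t * B m i t)"
    by (subst sum.swap, rule sum.cong[OF refl], rule sum.swap)
  ultimately show ?thesis by simp
qed

text \<open>Since the weighted frame field has no divergence, the product rule leaves only the
  derivative of \<open>w\<close>. In this form a frame derivative times the density is a divergence,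
  which drives both the integration by parts and the vertical correction.\<close>

lemma piola_mult:
  assumes "smooth_map S J"
    and "\<And>t k. t \<in> S \<Longrightarrow> pd k J t = J t * (\<Sum>l\<in>UNIV. \<Sum>m\<in>UNIV. B l m t * pd k (pd l (X m)) t)"
    and t: "t \<in> S" and w: "smooth_map S w"
  shows "(\<Sum>k\<in>UNIV. pd k (\<lambda>t. J t * B k i t * w t) t) = J t * Bop X i w t"
proof -
  have "(\<Sum>k\<in>UNIV. pd k (\<lambda>t. J t * B k i t * w t) t) =
    (\<Sum>k\<in>UNIV. pd k (\<lambda>t. J t * B k i t) t) * w t + (\<Sum>k\<in>UNIV. J t * B k i t * pd k w t)"
    using smooth_diffable[OF assms(1) t] smooth_diffable[OF smooth_B t] smooth_diffable[OF w t]
    by (simp add: pd_mult[of "\<lambda>t. J t * B _ i t"] sum.distrib sum_distrib_right differentiable_mult)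
  then show ?thesis using piola[OF assms(1-3)]
    by (simp add: Bop_def sum_distrib_left mult_ac)
qed

end

subsection \<open>The inverse function theorem\<close>

text \<open>The theorem for continuously differentiable maps provides a differentiable inverse
  \<open>g\<close>. Its partial derivatives are the entries of the inverse Jacobian of
  \<open>f\<close> taken at \<open>g\<close>, so every order of differentiability of
  \<open>g\<close> implies the next.\<close>

lemma smooth_inverse_function:
  fixes f :: "real^'p::finite \<Rightarrow> real^'p"
  assumes S: "open S" "p \<in> S" and f: "\<And>k. smooth_map S (\<lambda>x. f x $ k)"
    and nz: "det (fmat (\<lambda>i x. f x $ i) p) \<noteq> 0"
  obtains U where "open U" "p \<in> U" "U \<subseteq> S" "inj_on f U" "open (f ` U)" "smooth_map (f ` U) (inv_into U f)"
proof -
  have fd: "f differentiable at x" if "x \<in> S" for x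
    using smooth_diffable[OF f that] by (simp add: differentiable_vec_iff)
  define f' where "f' x = Blinfun (frechet_derivative f (at x))" for x
  have f': "blinfun_apply (f' x) = frechet_derivative f (at x)" if "x \<in> S" for x
    using fd[OF that] unfolding f'_def frechet_derivative_works
    by (intro bounded_linear_Blinfun_apply) (rule has_derivative_bounded_linear)
  have der: "(f has_derivative blinfun_apply (f' x)) (at x)" if "x \<in> S" for x
    using fd[OF that] f'[OF that] frechet_derivative_works by metis
  have cont: "continuous_on S f'"
  proof (rule continuous_on_blinfun_componentwise)
    fix b :: "real^'p" assume "b \<in> Basis"
    then obtain j where b: "b = axis j 1" by (auto simp: Basis_vec_def)
    have "continuous_on S (\<lambda>x. \<chi> k. pd j (\<lambda>x. f x $ k) x)"
      by (intro continuous_on_vec_lambda smooth_continuous_on smooth_pd f)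
    then show "continuous_on S (\<lambda>x. blinfun_apply (f' x) b)"
      by (rule continuous_on_eq) (simp add: vec_eq_iff f' b frechet_derivative_vec_nth fd)
  qed
  define A where "A = fmat (\<lambda>i x. f x $ i) p"
  have app: "blinfun_apply (f' p) v = A *v v" for v
  proof (simp add: vec_eq_iff, intro allI)
    fix i
    have "((\<lambda>x. f x $ i) has_derivative (\<lambda>v. frechet_derivative f (at p) v $ i)) (at p)"
      using fd[OF S(2)] unfolding frechet_derivative_works has_derivative_vec_iff by blast
    then have "frechet_derivative f (at p) v $ i = frechet_derivative (\<lambda>x. f x $ i) (at p) v"
      by (metis frechet_derivative_at)
    also have "\<dots> = (\<Sum>k\<in>UNIV. pd k (\<lambda>x. f x $ i) p * v $ k)"
      by (rule frechet_derivative_pd) (rule smooth_diffable[OF f S(2)])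
    finally show "blinfun_apply (f' p) v $ i = (A *v v) $ i"
      by (simp add: f'[OF S(2)] matrix_vector_mult_def A_def fmat_def)
  qed
  define invf where "invf = Blinfun (\<lambda>v. matrix_inv A *v v)"
  have invf: "invf o\<^sub>L f' p = id_blinfun"
    using nz by (intro blinfun_eqI)
      (simp add: invf_def bounded_linear_Blinfun_apply matrix_vector_mul_bounded_linear app
        matrix_vector_mul_assoc matrix_inv_mult A_def)
  obtain U V g g' where U: "open U" "U \<subseteq> S" "p \<in> U" and V: "open V" "f p \<in> V"
    and hom: "homeomorphism U V f g"
    and derg: "\<And>y. y \<in> V \<Longrightarrow> (g has_derivative g' y) (at y)"
    using inverse_function_theorem[OF S(1) der cont S(2) invf] by metis
  have V_eq: "f ` U = V" and gU: "g ` V = U" and fg: "\<And>y. y \<in> V \<Longrightarrow> f (g y) = y"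
    and gf: "\<And>x. x \<in> U \<Longrightarrow> g (f x) = x"
    using hom by (auto simp: homeomorphism_def)
  have inj: "inj_on f U" using gf by (metis inj_onI)
  have gd: "(\<lambda>y. g y $ k) differentiable at y" if "y \<in> V" for y k
    using derg[OF that] by (auto simp: has_derivative_vec_iff differentiable_def)
  have mul: "fmat (\<lambda>i x. f x $ i) (g y) ** (\<chi> k j. pd j (\<lambda>y. g y $ k) y) = mat 1" if y: "y \<in> V" for y
  proof (rule matrix_mult_eq_1I)
    fix i j
    have "(\<Sum>k\<in>UNIV. pd k (\<lambda>x. f x $ i) (g y) * pd j (\<lambda>y. g y $ k) y) = pd j (\<lambda>y. f (g y) $ i) y"
      by (rule pd_compose[symmetric, of "\<lambda>x. f x $ i" g], rule smooth_diffable[OF f], use y gU U(2) in blast, rule gd[OF y])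
    also have "\<dots> = pd j (\<lambda>y. y $ i) y"
      by (rule pd_cong[OF V(1) y]) (simp add: fg)
    finally show "(\<Sum>k\<in>UNIV. fmat (\<lambda>i x. f x $ i) (g y) $ i $ k * (\<chi> k j. pd j (\<lambda>y. g y $ k) y) $ k $ j) = (if i = j then 1 else 0)"
      by (simp add: pd_coord)
  qed
  have nzU: "det (fmat (\<lambda>i x. f x $ i) x) \<noteq> 0" if "x \<in> U" for x
    using matrix_inv_unique(2)[OF mul] gU that by blast
  have sm: "smooth_map U (\<lambda>x. matrix_inv (fmat (\<lambda>i x. f x $ i) x) $ k $ j)" for k j
    by (rule smooth_matrix_inv[OF U(1)])
      (use nzU in \<open>auto simp: fmat_def intro!: smooth_pd smooth_subset[OF f U(2)]\<close>)
  have eq: "matrix_inv (fmat (\<lambda>i x. f x $ i) (g y)) $ k $ j = pd j (\<lambda>y. g y $ k) y" if "y \<in> V" for y k j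
    by (simp add: matrix_inv_unique(1)[OF mul[OF that], symmetric])
  have "Ck n V (\<lambda>y. g y $ k)" for n k
  proof (induction n arbitrary: k)
    case (Suc n)
    have "Ck n V (\<lambda>y. matrix_inv (fmat (\<lambda>i x. f x $ i) (g y)) $ k $ j)" for j
      by (rule Ck_compose[OF V(1) _ sm Suc]) (simp add: gU)
    from Ck_cong[OF V(1) eq this] show ?case by (simp add: gd)
  qed simp
  then have "smooth_map V (\<lambda>y. g y $ k)" for k by (simp add: smooth_iff_Ck)
  moreover have "g y $ k = inv_into U f y $ k" if "y \<in> V" for y k
    using inv_into_f_eq[OF inj, of "g y" y] fg[OF that] gU that by auto
  ultimately have "smooth_map V (\<lambda>y. inv_into U f y $ k)" for k
    by (rule smooth_cong[OF _ V(1)])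
  then have "smooth_map (f ` U) (inv_into U f)"
    by (simp add: smooth_vec_iff[OF V(1)] V_eq)
  then show ?thesis using that[OF U(1,3,2) inj] V(1) V_eq by blast
qed

section \<open>Local diffeomorphisms and nonvanishing Jacobians\<close>

lemma local_diffeoI:
  fixes f :: "real^'p::finite \<Rightarrow> real^'p"
  assumes "open S" "0 \<in> S" "\<And>k. smooth_map S (\<lambda>x. f x $ k)" "f 0 = 0"
    and "det (fmat (\<lambda>i x. f x $ i) 0) \<noteq> 0"
  shows "local_diffeo f"
proof -
  obtain U where U: "open U" "0 \<in> U" "U \<subseteq> S" "inj_on f U" "open (f ` U)" "smooth_map (f ` U) (inv_into U f)"
    using smooth_inverse_function[OF assms(1-3,5)] by blast
  moreover have "smooth_map U f"
    using smooth_subset[OF _ U(3)] assms(3) smooth_vec_iff[OF U(1)] by blast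
  ultimately show ?thesis unfolding local_diffeo_def using assms(4) by blast
qed

lemma local_diffeoD:
  fixes f :: "real^'p::finite \<Rightarrow> real^'p"
  assumes "local_diffeo f"
  obtains U where "open U" "0 \<in> U" "\<And>k. smooth_map U (\<lambda>x. f x $ k)" "f 0 = 0"
    "\<And>x. x \<in> U \<Longrightarrow> det (fmat (\<lambda>i x. f x $ i) x) \<noteq> 0"
proof -
  obtain U where U: "f 0 = 0" "open U" "0 \<in> U" "inj_on f U" "open (f ` U)"
    and f: "smooth_map U f" and g: "smooth_map (f ` U) (inv_into U f)"
    using assms unfolding local_diffeo_def by blast
  define g' where "g' = inv_into U f"
  have f: "smooth_map U (\<lambda>x. f x $ k)" and g: "smooth_map (f ` U) (\<lambda>x. g' x $ k)" for k
    using f g U by (auto simp: smooth_vec_iff g'_def)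
  have "det (fmat (\<lambda>i x. f x $ i) x) \<noteq> 0" if x: "x \<in> U" for x
  proof -
    have "(\<chi> i k. pd k (\<lambda>x. g' x $ i) (f x)) ** fmat (\<lambda>i x. f x $ i) x = mat 1"
    proof (rule matrix_mult_eq_1I)
      fix i j
      have "(\<Sum>k\<in>UNIV. pd k (\<lambda>x. g' x $ i) (f x) * pd j (\<lambda>y. f y $ k) x) = pd j (\<lambda>y. g' (f y) $ i) x"
        by (rule pd_compose[symmetric, of "\<lambda>x. g' x $ i" f], rule smooth_diffable[OF g], use x in blast, rule smooth_diffable[OF f x])
      also have "\<dots> = pd j (\<lambda>y. y $ i) x"
        by (rule pd_cong[OF U(2) x]) (simp add: g'_def U)
      finally show "(\<Sum>k\<in>UNIV. (\<chi> i k. pd k (\<lambda>x. g' x $ i) (f x)) $ i $ k * fmat (\<lambda>i x. f x $ i) x $ k $ j) =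
          (if i = j then 1 else 0)"
        by (simp add: pd_coord)
    qed
    then have "det (\<chi> i k. pd k (\<lambda>x. g' x $ i) (f x)) * det (fmat (\<lambda>i x. f x $ i) x) = 1"
      by (metis det_I det_mul)
    then show ?thesis by auto
  qed
  then show ?thesis using that U f by blast
qed

section \<open>Linear differential operators and their formal adjoints\<close>

text \<open>Taylor monomials centred at \<open>a\<close>, normalised so that at \<open>a\<close>
  exactly the derivatives with multiset \<open>M\<close> are \<open>1\<close> and all others vanish.
  They serve as test functions that isolate one coefficient of an operator.\<close>

definition mono_at :: "real^'n::finite \<Rightarrow> 'n multiset \<Rightarrow> real^'n \<Rightarrow> real" where
  "mono_at a M t = (\<Prod>i\<in>UNIV. (t $ i - a $ i) ^ count M i / fact (count M i))"

lemma pd_power_div_fact: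
  "pd j (\<lambda>t. (t $ i - a $ i) ^ m / fact m) t =
    (if j = i \<and> 0 < m then (t $ i - a $ i) ^ (m - 1) / fact (m - 1) else 0)"
  "(\<lambda>t. (t $ i - a $ i) ^ m / fact m) differentiable at t"
proof -
  have "((\<lambda>t. (t $ i - a $ i) ^ m / fact m) has_derivative
      (\<lambda>v. of_nat m * (v $ i * (t $ i - a $ i) ^ (m - 1)) / fact m)) (at t)"
    by (auto intro!: derivative_eq_intros has_derivative_nth simp: mult_ac)
  from pd_has_derivative[OF this] show
    "pd j (\<lambda>t. (t $ i - a $ i) ^ m / fact m) t =
      (if j = i \<and> 0 < m then (t $ i - a $ i) ^ (m - 1) / fact (m - 1) else 0)"
    by (cases m) (auto simp: axis_def mult_divide_mult_cancel_left simp del: of_nat_Suc)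
  show "(\<lambda>t. (t $ i - a $ i) ^ m / fact m) differentiable at t"
    unfolding differentiable_def using \<open>(_ has_derivative _) _\<close> by blast
qed

lemma pd_mono_at: "pd j (mono_at a M) = (\<lambda>t. if j \<in># M then mono_at a (M - {#j#}) t else 0)"
proof
  fix t
  have "pd j (mono_at a M) t = (\<Sum>i\<in>UNIV. (if j = i \<and> 0 < count M i
      then (t $ i - a $ i) ^ (count M i - 1) / fact (count M i - 1) else 0) *
      (\<Prod>i'\<in>UNIV - {i}. (t $ i' - a $ i') ^ count M i' / fact (count M i')))"
    unfolding mono_at_def[abs_def] by (simp add: pd_prod pd_power_div_fact)
  also have "\<dots> = (if 0 < count M j then (t $ j - a $ j) ^ (count M j - 1) / fact (count M j - 1) else 0) *
      (\<Prod>i'\<in>UNIV - {j}. (t $ i' - a $ i') ^ count M i' / fact (count M i'))"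
    by (subst sum.remove[of UNIV j]) (auto intro!: sum.neutral)
  also have "\<dots> = (if j \<in># M then mono_at a (M - {#j#}) t else 0)"
    unfolding mono_at_def by (subst prod.remove[of UNIV j]) auto
  finally show "pd j (mono_at a M) t = (if j \<in># M then mono_at a (M - {#j#}) t else 0)" .
qed

lemma pderivs_zero: "pderivs J (\<lambda>t. 0) = (\<lambda>t. 0 :: real)"
  by (induction J) simp_all

lemma pderivs_mono_at:
  "pderivs J (mono_at a M) = (\<lambda>t. if mset J \<subseteq># M then mono_at a (M - mset J) t else 0)"
proof (induction J arbitrary: M rule: rev_induct)
  case Nil
  then show ?case by (simp add: fun_eq_iff)
next
  case (snoc j J)
  have "pderivs (J @ [j]) (mono_at a M) = pderivs J (\<lambda>t. if j \<in># M then mono_at a (M - {#j#}) t else 0)"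
    by (simp add: pderivs_append pd_mono_at)
  also have "\<dots> = (\<lambda>t. if mset (J @ [j]) \<subseteq># M then mono_at a (M - mset (J @ [j])) t else 0)"
  proof -
    have eq: "M - mset (J @ [j]) = M - {#j#} - mset J" by (simp add: multiset_eq_iff)
    show ?thesis unfolding eq using snoc.IH[of "M - {#j#}"]
      by (cases "j \<in># M") (simp_all add: pderivs_zero insert_subset_eq_iff)
  qed
  finally show ?case .
qed

lemma mono_at_self: "mono_at a N a = (if N = {#} then 1 else 0)"
proof (cases "N = {#}")
  case False
  then obtain i where "i \<in># N" by blast
  then have "count N i > 0" by simp
  then have "(a $ i - a $ i) ^ count N i / fact (count N i) = 0" by (simp add: power_0_left)
  then show ?thesis using False unfolding mono_at_def
    by (subst prod_zero) auto
qed (simp add: mono_at_def)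

lemma pderivs_mono_at_self: "pderivs J (mono_at a M) a = (if mset J = M then 1 else 0)"
  by (auto simp: pderivs_mono_at mono_at_self)
    (metis add.right_neutral subset_mset.add_diff_inverse)

lemma smooth_mono_at: "smooth_map S (mono_at a M)"
proof -
  have "mono_at a M differentiable at t" for M and t :: "real^'a"
    unfolding mono_at_def[abs_def] by (simp add: pd_prod pd_power_div_fact)
  then have "Ck n S (mono_at a M)" for n M
  proof (induction n arbitrary: M)
    case (Suc n)
    have "Ck n S (pd j (mono_at a M))" for j
      using Suc by (cases "j \<in># M") (simp_all add: pd_mono_at Ck_const)
    with Suc.prems show ?case by simp
  qed simp
  then show ?thesis by (simp add: smooth_iff_Ck)
qed

lemma pderivs_add:
  fixes f g :: "real^'p::finite \<Rightarrow> real"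
  assumes "open S" "smooth_map S f" "smooth_map S g"
  shows "x \<in> S \<Longrightarrow> pderivs J (\<lambda>x. f x + g x) x = pderivs J f x + pderivs J g x"
proof (induction J arbitrary: x)
  case (Cons j J)
  have "pd j (pderivs J (\<lambda>x. f x + g x)) x = pd j (\<lambda>x. pderivs J f x + pderivs J g x) x"
    by (rule pd_cong[OF assms(1) Cons.prems Cons.IH])
  also have "\<dots> = pd j (pderivs J f) x + pd j (pderivs J g) x"
    by (rule pd_add[OF smooth_diffable[OF smooth_pderivs[OF assms(2)] Cons.prems]
          smooth_diffable[OF smooth_pderivs[OF assms(3)] Cons.prems]])
  finally show ?case by simp
qed simp

lemma smooth_sum_list:
  fixes f :: "'b \<Rightarrow> real^'p::finite \<Rightarrow> real"
  assumes "open S" "\<And>c. c \<in> set cs \<Longrightarrow> smooth_map S (f c)"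
  shows "smooth_map S (\<lambda>x. \<Sum>c\<leftarrow>cs. f c x)"
  using assms(2) by (induction cs) (simp_all add: smooth_const smooth_add[OF assms(1)])

lemma pderivs_sum_list:
  fixes f :: "'b \<Rightarrow> real^'p::finite \<Rightarrow> real"
  assumes "open S" "x \<in> S"
  shows "(\<And>c. c \<in> set cs \<Longrightarrow> smooth_map S (f c)) \<Longrightarrow>
    pderivs J (\<lambda>x. \<Sum>c\<leftarrow>cs. f c x) x = (\<Sum>c\<leftarrow>cs. pderivs J (f c) x)"
proof (induction cs)
  case Nil
  then show ?case by (simp add: pderivs_zero)
next
  case (Cons c cs)
  have "smooth_map S (\<lambda>x. \<Sum>c\<leftarrow>cs. f c x)"
    using Cons.prems by (intro smooth_sum_list assms) simp
  then have "pderivs J (\<lambda>x. f c x + (\<Sum>c\<leftarrow>cs. f c x)) x = pderivs J (f c) x + pderivs J (\<lambda>x. \<Sum>c\<leftarrow>cs. f c x) x"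
    using Cons.prems by (intro pderivs_add[OF assms(1) _ _ assms(2)]) simp_all
  with Cons show ?case by simp
qed

lemma pd_sum_list:
  fixes f :: "'b \<Rightarrow> real^'p::finite \<Rightarrow> real"
  assumes "open S" "x \<in> S" "\<And>c. c \<in> set cs \<Longrightarrow> smooth_map S (f c)"
  shows "pd j (\<lambda>x. \<Sum>c\<leftarrow>cs. f c x) x = (\<Sum>c\<leftarrow>cs. pd j (f c) x)"
  using pderivs_sum_list[of S x cs f "[j]"] assms by simp

text \<open>A list of pairs \<open>(a, J)\<close> represents the operator \<open>\<phi> \<mapsto> \<Sum> a \<partial>\<^sub>J \<phi>\<close>, and \<open>dop_adj\<close> is the value
  at the constant function \<open>1\<close> of its formal adjoint, i.e. the Euler--Lagrange expression.\<close>

type_synonym 'n dop = "((real^'n \<Rightarrow> real) \<times> 'n list) list"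

definition dop_apply :: "'n::finite dop \<Rightarrow> (real^'n \<Rightarrow> real) \<Rightarrow> real^'n \<Rightarrow> real" where
  "dop_apply cs \<phi> t = (\<Sum>(a, J)\<leftarrow>cs. a t * pderivs J \<phi> t)"

definition dop_adj :: "'n::finite dop \<Rightarrow> real^'n \<Rightarrow> real" where
  "dop_adj cs t = (\<Sum>(a, J)\<leftarrow>cs. (-1) ^ length J * pderivs J a t)"

definition dop_smooth :: "(real^'n::finite) set \<Rightarrow> 'n dop \<Rightarrow> bool" where
  "dop_smooth U cs \<longleftrightarrow> (\<forall>c\<in>set cs. smooth_map U (fst c))"

lemma sum_list_group:
  assumes "finite A" "\<And>x. x \<in> set xs \<Longrightarrow> k x \<in> A"
  shows "(\<Sum>x\<leftarrow>xs. f x :: real) = (\<Sum>M\<in>A. \<Sum>x\<leftarrow>filter (\<lambda>x. k x = M) xs. f x)"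
  using assms(2)
proof (induction xs)
  case (Cons x xs)
  have "(\<Sum>M\<in>A. \<Sum>x\<leftarrow>filter (\<lambda>x. k x = M) (x # xs). f x) =
    (\<Sum>M\<in>A. (if k x = M then f x else 0) + (\<Sum>x\<leftarrow>filter (\<lambda>x. k x = M) xs. f x))"
    by (rule sum.cong) auto
  also have "\<dots> = f x + (\<Sum>M\<in>A. \<Sum>x\<leftarrow>filter (\<lambda>x. k x = M) xs. f x)"
    using Cons.prems assms(1) by (simp add: sum.distrib)
  finally show ?case using Cons by simp
qed simp

lemma mset_arrange [simp]: "mset (arrange M) = M"
  unfolding arrange_def by (rule someI_ex) (rule ex_mset)

lemma length_arrange [simp]: "length (arrange M) = size M"
  by (metis mset_arrange size_mset)

text \<open>A list may represent the zero operator without having zero entries, since multi-indices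
  can be repeated or permuted. Testing with the monomials centred at each point shows that the
  coefficients belonging to one multiset add up to zero on \<open>U\<close>. Partial derivatives
  commute, so the adjoint depends only on these sums.\<close>

lemma dop_adj_eq_0:
  assumes U: "open U" and cs: "dop_smooth U cs" and t: "t \<in> U"
    and 0: "\<And>\<phi> t. smooth_map UNIV \<phi> \<Longrightarrow> t \<in> U \<Longrightarrow> dop_apply cs \<phi> t = 0"
  shows "dop_adj cs t = 0"
proof -
  define A where "A = (\<lambda>c. mset (snd c)) ` set cs"
  let ?F = "\<lambda>M. filter (\<lambda>c. mset (snd c) = M) cs"
  have coeff: "(\<Sum>c\<leftarrow>?F M. fst c u) = 0" if u: "u \<in> U" for M u
  proof -
    have "dop_apply cs (mono_at u M) u = (\<Sum>c\<leftarrow>cs. fst c u * (if mset (snd c) = M then 1 else 0))"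
      by (simp add: dop_apply_def case_prod_unfold pderivs_mono_at_self)
    also have "\<dots> = (\<Sum>c\<leftarrow>?F M. fst c u)"
      by (induction cs) auto
    finally show ?thesis using 0[OF smooth_mono_at u] by simp
  qed
  have sm: "smooth_map U (fst c)" if "c \<in> set cs" for c
    using cs that by (simp add: dop_smooth_def)
  have "dop_adj cs t = (\<Sum>M\<in>A. \<Sum>c\<leftarrow>?F M. (-1) ^ length (snd c) * pderivs (snd c) (fst c) t)"
    unfolding dop_adj_def case_prod_unfold by (rule sum_list_group) (auto simp: A_def)
  also have "\<dots> = (\<Sum>M\<in>A. \<Sum>c\<leftarrow>?F M. (-1) ^ size M * pderivs (arrange M) (fst c) t)"
  proof (intro sum.cong refl arg_cong[of _ _ sum_list] map_cong)
    fix M c assume c: "c \<in> set (?F M)"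
    have "pderivs (snd c) (fst c) t = pderivs (arrange M) (fst c) t"
      using c by (intro pderivs_mset[OF sm U _ t]) auto
    then show "(-1) ^ length (snd c) * pderivs (snd c) (fst c) t = (-1) ^ size M * pderivs (arrange M) (fst c) t"
      using c by auto
  qed
  also have "\<dots> = (\<Sum>M\<in>A. (-1) ^ size M * pderivs (arrange M) (\<lambda>t. \<Sum>c\<leftarrow>?F M. fst c t) t)"
  proof (intro sum.cong refl)
    fix M
    have "pderivs (arrange M) (\<lambda>t. \<Sum>c\<leftarrow>?F M. fst c t) t = (\<Sum>c\<leftarrow>?F M. pderivs (arrange M) (fst c) t)"
      by (rule pderivs_sum_list[OF U t]) (use sm in auto)
    then show "(\<Sum>c\<leftarrow>?F M. (-1) ^ size M * pderivs (arrange M) (fst c) t) =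
      (-1) ^ size M * pderivs (arrange M) (\<lambda>t. \<Sum>c\<leftarrow>?F M. fst c t) t"
      by (simp add: sum_list_const_mult)
  qed
  also have "\<dots> = 0"
  proof (intro sum.neutral ballI)
    fix M
    have "pderivs (arrange M) (\<lambda>t. \<Sum>c\<leftarrow>?F M. fst c t) t = pderivs (arrange M) (\<lambda>t. 0) t"
      by (rule pderivs_cong[OF U coeff t])
    then show "(-1) ^ size M * pderivs (arrange M) (\<lambda>t. \<Sum>c\<leftarrow>?F M. fst c t) t = 0"
      by (simp add: pderivs_zero)
  qed
  finally show ?thesis .
qed

text \<open>\<open>Q\<close> acts on \<open>U\<close> as a differential operator with smooth
  coefficients, and \<open>e\<close> is its adjoint at \<open>1\<close>. Globally smooth
  \<open>\<phi>\<close> suffice as arguments because the separating test functions are polynomials;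
  no cutoff is involved.\<close>

definition has_adj :: "(real^'n::finite) set \<Rightarrow> ((real^'n \<Rightarrow> real) \<Rightarrow> real^'n \<Rightarrow> real) \<Rightarrow> (real^'n \<Rightarrow> real) \<Rightarrow> bool" where
  "has_adj U Q e \<longleftrightarrow> (\<exists>cs. dop_smooth U cs \<and>
    (\<forall>\<phi>. smooth_map UNIV \<phi> \<longrightarrow> (\<forall>t\<in>U. Q \<phi> t = dop_apply cs \<phi> t)) \<and> (\<forall>t\<in>U. e t = dop_adj cs t))"

lemma has_adj_cong:
  assumes "has_adj U Q e" "\<And>\<phi> t. smooth_map UNIV \<phi> \<Longrightarrow> t \<in> U \<Longrightarrow> Q \<phi> t = Q' \<phi> t"
    "\<And>t. t \<in> U \<Longrightarrow> e t = e' t"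
  shows "has_adj U Q' e'"
  using assms unfolding has_adj_def by (metis (no_types, lifting))

context
  fixes U :: "(real^'n::finite) set"
  assumes U: "open U"
begin

lemma smooth_dop_apply:
  assumes cs: "dop_smooth U cs" and \<phi>: "smooth_map UNIV \<phi>"
  shows "smooth_map U (dop_apply cs \<phi>)"
  unfolding dop_apply_def[abs_def] case_prod_unfold
proof (rule smooth_sum_list[OF U])
  fix c assume "c \<in> set cs"
  then show "smooth_map U (\<lambda>x. fst c x * pderivs (snd c) \<phi> x)"
    using cs smooth_subset[OF smooth_pderivs[OF \<phi>], of U]
    by (intro smooth_mult[OF U]) (auto simp: dop_smooth_def)
qed

lemma has_adj_smooth:
  assumes "has_adj U Q e" "smooth_map UNIV \<phi>"
  shows "smooth_map U (Q \<phi>)"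
proof -
  obtain cs where "dop_smooth U cs" and "\<And>t. t \<in> U \<Longrightarrow> Q \<phi> t = dop_apply cs \<phi> t"
    using assms unfolding has_adj_def by blast
  then show ?thesis
    using smooth_cong[OF smooth_dop_apply[of cs \<phi>] U] assms(2) by simp
qed

lemma has_adj_mult:
  assumes "smooth_map U p"
  shows "has_adj U (\<lambda>\<phi> t. p t * \<phi> t) p"
  unfolding has_adj_def using assms
  by (intro exI[of _ "[(p, [])]"]) (simp add: dop_apply_def dop_adj_def dop_smooth_def)

lemma has_adj_add:
  assumes "has_adj U Q e" "has_adj U Q' e'"
  shows "has_adj U (\<lambda>\<phi> t. Q \<phi> t + Q' \<phi> t) (\<lambda>t. e t + e' t)"
proof -
  obtain cs cs' where 1: "dop_smooth U cs" "\<forall>\<phi>. smooth_map UNIV \<phi> \<longrightarrow> (\<forall>t\<in>U. Q \<phi> t = dop_apply cs \<phi> t)"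
    "\<forall>t\<in>U. e t = dop_adj cs t"
    and 2: "dop_smooth U cs'" "\<forall>\<phi>. smooth_map UNIV \<phi> \<longrightarrow> (\<forall>t\<in>U. Q' \<phi> t = dop_apply cs' \<phi> t)"
    "\<forall>t\<in>U. e' t = dop_adj cs' t"
    using assms unfolding has_adj_def by blast
  show ?thesis unfolding has_adj_def
    using 1 2 by (intro exI[of _ "cs @ cs'"]) (auto simp: dop_apply_def dop_adj_def dop_smooth_def)
qed

lemma has_adj_uminus:
  assumes "has_adj U Q e"
  shows "has_adj U (\<lambda>\<phi> t. - Q \<phi> t) (\<lambda>t. - e t)"
proof -
  obtain cs where 1: "dop_smooth U cs" "\<forall>\<phi>. smooth_map UNIV \<phi> \<longrightarrow> (\<forall>t\<in>U. Q \<phi> t = dop_apply cs \<phi> t)"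
    "\<forall>t\<in>U. e t = dop_adj cs t"
    using assms unfolding has_adj_def by blast
  define ds where "ds = map (\<lambda>c. (\<lambda>t. - fst c t, snd c)) cs"
  have neg: "pderivs J (\<lambda>t. - a t) t = - pderivs J a t" if "smooth_map U a" "t \<in> U" for J t and a :: "real^'n \<Rightarrow> real"
  proof -
    have "pderivs J (\<lambda>t. a t + - a t) t = pderivs J a t + pderivs J (\<lambda>t. - a t) t"
      by (rule pderivs_add[OF U that(1) smooth_uminus[OF U that(1)] that(2)])
    then show ?thesis by (simp add: pderivs_zero)
  qed
  have "dop_smooth U ds"
    using 1(1) by (auto simp: ds_def dop_smooth_def smooth_uminus[OF U])
  moreover have "dop_apply ds \<phi> t = - dop_apply cs \<phi> t" for \<phi> t
    unfolding ds_def dop_apply_def by (induction cs) auto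
  moreover have "dop_adj ds t = - dop_adj cs t" if "t \<in> U" for t
    using 1(1) neg[OF _ that] unfolding ds_def dop_adj_def dop_smooth_def by (induction cs) auto
  ultimately show ?thesis using 1 unfolding has_adj_def by (intro exI[of _ ds]) simp
qed

text \<open>The difference of two representations of \<open>Q\<close> represents the zero operator.
  Thus \<open>e\<close> is determined by the values of \<open>Q\<close>, and equal variations in two
  charts have equal adjoints.\<close>

lemma has_adj_unique:
  assumes "has_adj U Q e" "has_adj U Q e'" "t \<in> U"
  shows "e t = e' t"
proof -
  have "has_adj U (\<lambda>\<phi> t. Q \<phi> t + - Q \<phi> t) (\<lambda>t. e t + - e' t)"
    by (intro has_adj_add has_adj_uminus assms)
  then obtain cs where cs: "dop_smooth U cs" "\<And>\<phi> t. smooth_map UNIV \<phi> \<Longrightarrow> t \<in> U \<Longrightarrow> dop_apply cs \<phi> t = 0"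
    "e t + - e' t = dop_adj cs t"
    unfolding has_adj_def using assms(3) by (auto simp: dest: sym)
  then show ?thesis using dop_adj_eq_0[OF U cs(1) assms(3) cs(2)] by simp
qed

lemma has_adj_zero: "has_adj U (\<lambda>\<phi> t. 0) (\<lambda>t. 0)"
  unfolding has_adj_def by (intro exI[of _ "[]"]) (simp add: dop_apply_def dop_adj_def dop_smooth_def)

lemma has_adj_sum:
  "(\<And>i. i \<in> I \<Longrightarrow> has_adj U (Q i) (e i)) \<Longrightarrow>
    has_adj U (\<lambda>\<phi> t. \<Sum>i\<in>I. Q i \<phi> t) (\<lambda>t. \<Sum>i\<in>I. e i t)"
  by (induction I rule: infinite_finite_induct) (simp_all add: has_adj_zero has_adj_add)

text \<open>The adjoint is left existential: the products formed in this way end up under a partial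
  derivative, where \<open>has_adj_pd\<close> returns \<open>0\<close> whatever it is.\<close>

lemma has_adj_mult_left:
  assumes "has_adj U Q e" "smooth_map U b"
  shows "\<exists>e'. has_adj U (\<lambda>\<phi> t. b t * Q \<phi> t) e'"
proof -
  obtain cs where 1: "dop_smooth U cs" "\<forall>\<phi>. smooth_map UNIV \<phi> \<longrightarrow> (\<forall>t\<in>U. Q \<phi> t = dop_apply cs \<phi> t)"
    using assms unfolding has_adj_def by blast
  define ds where "ds = map (\<lambda>c. (\<lambda>t. b t * fst c t, snd c)) cs"
  have "dop_smooth U ds"
    using 1(1) assms(2) by (auto simp: ds_def dop_smooth_def smooth_mult[OF U])
  moreover have "dop_apply ds \<phi> t = b t * dop_apply cs \<phi> t" for \<phi> t
    unfolding ds_def dop_apply_def by (induction cs) (auto simp: algebra_simps)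
  ultimately show ?thesis using 1 unfolding has_adj_def by (intro exI[of _ "dop_adj ds"] exI[of _ ds]) simp
qed

text \<open>Divergences are invisible. The product rule splits each term into one with
  \<open>k\<close> on the coefficient and one with \<open>k\<close> in the multi-index; their
  adjoint values have opposite signs and differ only in the order of differentiation.\<close>

lemma has_adj_pd:
  assumes "has_adj U Q e"
  shows "has_adj U (\<lambda>\<phi> t. pd k (Q \<phi>) t) (\<lambda>t. 0)"
proof -
  obtain cs where 1: "dop_smooth U cs" "\<And>\<phi> t. smooth_map UNIV \<phi> \<Longrightarrow> t \<in> U \<Longrightarrow> Q \<phi> t = dop_apply cs \<phi> t"
    using assms unfolding has_adj_def by blast
  have sm: "smooth_map U (fst c)" if "c \<in> set cs" for c
    using 1(1) that by (simp add: dop_smooth_def)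
  define ds where "ds = map (\<lambda>c. (pd k (fst c), snd c)) cs @ map (\<lambda>c. (fst c, k # snd c)) cs"
  have "dop_smooth U ds"
    using sm smooth_pd[OF sm] by (auto simp: ds_def dop_smooth_def)
  moreover have "pd k (Q \<phi>) t = dop_apply ds \<phi> t" if \<phi>: "smooth_map UNIV \<phi>" and t: "t \<in> U" for \<phi> t
  proof -
    have p: "smooth_map U (pderivs J \<phi>)" for J
      by (rule smooth_subset[OF smooth_pderivs[OF \<phi>]]) simp
    have "pd k (Q \<phi>) t = pd k (dop_apply cs \<phi>) t"
      by (rule pd_cong[OF U t 1(2)[OF \<phi>]])
    also have "\<dots> = (\<Sum>c\<leftarrow>cs. pd k (\<lambda>t. fst c t * pderivs (snd c) \<phi> t) t)"
      unfolding dop_apply_def[abs_def] case_prod_unfold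
      by (rule pd_sum_list[OF U t]) (rule smooth_mult[OF U sm p])
    also have "\<dots> = (\<Sum>c\<leftarrow>cs. pd k (fst c) t * pderivs (snd c) \<phi> t + fst c t * pderivs (k # snd c) \<phi> t)"
    proof (intro arg_cong[of _ _ sum_list] map_cong refl)
      fix c assume "c \<in> set cs"
      from pd_mult[OF smooth_diffable[OF sm[OF this] t] smooth_diffable[OF p t]]
      show "pd k (\<lambda>t. fst c t * pderivs (snd c) \<phi> t) t = pd k (fst c) t * pderivs (snd c) \<phi> t + fst c t * pderivs (k # snd c) \<phi> t"
        by simp
    qed
    also have "\<dots> = dop_apply ds \<phi> t"
      by (simp add: ds_def dop_apply_def sum_list_addf o_def)
    finally show ?thesis .
  qed
  moreover have "dop_adj ds t = 0" if t: "t \<in> U" for t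
  proof -
    have "dop_adj ds t = (\<Sum>c\<leftarrow>cs. (-1) ^ length (snd c) * (pderivs (snd c) (pd k (fst c)) t - pd k (pderivs (snd c) (fst c)) t))"
      by (simp add: ds_def dop_adj_def o_def flip: sum_list_addf) (simp add: algebra_simps)
    also have "\<dots> = (\<Sum>c\<leftarrow>cs. 0)"
      by (intro arg_cong[of _ _ sum_list] map_cong refl) (simp add: pderivs_pd_commute[OF sm U t])
    finally show ?thesis by (simp add: sum_list_0)
  qed
  ultimately show ?thesis unfolding has_adj_def by (intro exI[of _ ds]) simp
qed

end

context frame
begin

lemma has_adj_Bop:
  assumes "has_adj S Q e"
  shows "\<exists>e'. has_adj S (\<lambda>\<phi> t. Bop X i (Q \<phi>) t) e'"
proof -
  have "\<forall>j. \<exists>e'. has_adj S (\<lambda>\<phi> t. B j i t * pd j (Q \<phi>) t) e'"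
    by (intro allI has_adj_mult_left[OF open_S has_adj_pd[OF open_S assms] smooth_B])
  from choice[OF this] obtain e' where e': "\<forall>j. has_adj S (\<lambda>\<phi> t. B j i t * pd j (Q \<phi>) t) (e' j)"
    by (rule exE)
  have "has_adj S (\<lambda>\<phi> t. \<Sum>j\<in>UNIV. B j i t * pd j (Q \<phi>) t) (\<lambda>t. \<Sum>j\<in>UNIV. e' j t)"
    by (rule has_adj_sum[OF open_S e'[rule_format]])
  then show ?thesis unfolding Bop_def by (rule exI[where x = "\<lambda>t. \<Sum>j\<in>UNIV. e' j t"])
qed

lemma has_adj_Bops:
  assumes "smooth_map S p"
  shows "\<exists>e. has_adj S (\<lambda>\<phi>. foldr (Bop X) I (\<lambda>t. p t * \<phi> t)) e"
proof (induction I)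
  case Nil
  then show ?case using has_adj_mult[OF open_S assms] by auto
next
  case (Cons i I)
  then obtain e where "has_adj S (\<lambda>\<phi>. foldr (Bop X) I (\<lambda>t. p t * \<phi> t)) e" by blast
  from has_adj_Bop[OF this, of i] show ?case by simp
qed

text \<open>Integration by parts along the frame; the boundary terms are divergences by the Piola identity.\<close>

lemma has_adj_density_Bops:
  assumes J: "smooth_map S J"
    and dJ: "\<And>t k. t \<in> S \<Longrightarrow> pd k J t = J t * (\<Sum>l\<in>UNIV. \<Sum>m\<in>UNIV. B l m t * pd k (pd l (X m)) t)"
    and p: "smooth_map S p"
  shows "smooth_map S a \<Longrightarrow> has_adj S (\<lambda>\<phi> t. J t * a t * foldr (Bop X) I (\<lambda>t. p t * \<phi> t) t)
    (\<lambda>t. (-1) ^ length I * J t * p t * foldr (Bop X) (rev I) a t)"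
proof (induction I arbitrary: a)
  case Nil
  have "has_adj S (\<lambda>\<phi> t. (J t * a t * p t) * \<phi> t) (\<lambda>t. J t * a t * p t)"
    by (intro has_adj_mult open_S smooth_mult J p Nil)
  then show ?case by (simp add: mult_ac)
next
  case (Cons i I)
  define h where "h = (\<lambda>\<phi>. foldr (Bop X) I (\<lambda>t. p t * \<phi> t))"
  obtain e where h: "has_adj S h e" using has_adj_Bops[OF p] unfolding h_def by blast
  \<comment> \<open>The divergence of \<open>J a h\<close> along the frame field \<open>i\<close>
    is, by \<open>piola_mult\<close>, \<open>J\<close> times \<open>Bop X i\<close> of
    \<open>a * h\<close>. It accounts for moving one frame derivative from \<open>h\<close> to
    \<open>a\<close>.\<close>
  have 0: "has_adj S (\<lambda>\<phi> t. pd k (\<lambda>t. (J t * B k i t * a t) * h \<phi> t) t) (\<lambda>t. 0)" for k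
  proof -
    obtain e where "has_adj S (\<lambda>\<phi> t. (J t * B k i t * a t) * h \<phi> t) e"
      using has_adj_mult_left[OF open_S h smooth_mult[OF open_S smooth_mult[OF open_S J smooth_B[of k i]] Cons.prems]]
      by (rule exE)
    from has_adj_pd[OF open_S this] show ?thesis .
  qed
  have 1: "has_adj S (\<lambda>\<phi> t. \<Sum>k\<in>UNIV. pd k (\<lambda>t. (J t * B k i t * a t) * h \<phi> t) t) (\<lambda>t. \<Sum>k\<in>(UNIV::'p set). 0)"
    by (rule has_adj_sum[OF open_S 0])
  \<comment> \<open>The induction hypothesis is taken with \<open>Bop X i a\<close> in place of
    \<open>a\<close>. Indices leave the front of the list and reach \<open>a\<close> innermost
    first, hence \<open>rev I\<close> in the claim.\<close>
  have 2: "has_adj S (\<lambda>\<phi> t. - (J t * Bop X i a t * h \<phi> t))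
     (\<lambda>t. - ((-1) ^ length I * J t * p t * foldr (Bop X) (rev I) (Bop X i a) t))"
    unfolding h_def by (intro has_adj_uminus open_S Cons.IH smooth_Bop Cons.prems)
  show ?case
  proof (rule has_adj_cong[OF has_adj_add[OF open_S 1 2]])
    fix \<phi> :: "real^'p \<Rightarrow> real" and t assume \<phi>: "smooth_map UNIV \<phi>" and t: "t \<in> S"
    have hs: "smooth_map S (h \<phi>)" by (rule has_adj_smooth[OF open_S h \<phi>])
    have "(\<Sum>k\<in>UNIV. pd k (\<lambda>t. J t * B k i t * (a t * h \<phi> t)) t) = J t * Bop X i (\<lambda>t. a t * h \<phi> t) t"
      by (rule piola_mult[OF J dJ t smooth_mult[OF open_S Cons.prems hs]])
    also have "\<dots> = J t * (Bop X i a t * h \<phi> t + a t * Bop X i (h \<phi>) t)"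
      by (simp add: Bop_mult[OF Cons.prems hs t])
    finally show "(\<Sum>k\<in>UNIV. pd k (\<lambda>t. J t * B k i t * a t * h \<phi> t) t) + - (J t * Bop X i a t * h \<phi> t) =
        J t * a t * foldr (Bop X) (i # I) (\<lambda>t. p t * \<phi> t) t"
      by (simp add: h_def algebra_simps)
  qed simp
qed

end

section \<open>Smooth functions of finitely many labelled coordinates\<close>

text \<open>Relative openness in the copy of the coordinate space over \<open>K\<close>. It is
  phrased by boxes because coordinates off \<open>K\<close> are frozen at zero, whereas open sets of
  the full function space leave almost all coordinates free.\<close>

locale cdomain =
  fixes K :: "'k set" and U :: "('k \<Rightarrow> real) set"
  assumes finite_K: "finite K"
    and supp: "\<And>z k. z \<in> U \<Longrightarrow> k \<notin> K \<Longrightarrow> z k = 0"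
    and box: "\<And>z. z \<in> U \<Longrightarrow> \<exists>d>0. \<forall>z'. (\<forall>k. k \<notin> K \<longrightarrow> z' k = 0) \<and> (\<forall>k\<in>K. \<bar>z' k - z k\<bar> < d) \<longrightarrow> z' \<in> U"
begin

lemma eventually_upd:
  assumes "z \<in> U" "k \<in> K"
  shows "\<forall>\<^sub>F t in nhds (z k). z(k := t) \<in> U"
proof -
  obtain d where d: "d > 0"
    and dU: "\<And>z'. (\<forall>k. k \<notin> K \<longrightarrow> z' k = 0) \<Longrightarrow> (\<forall>k\<in>K. \<bar>z' k - z k\<bar> < d) \<Longrightarrow> z' \<in> U"
    using box[OF assms(1)] by auto
  have "z(k := t) \<in> U" if "dist t (z k) < d" for t
    using that d assms supp by (intro dU) (auto simp: dist_real_def)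
  then show ?thesis using d unfolding eventually_nhds_metric by blast
qed

lemma cpartial_cong:
  assumes "\<And>z. z \<in> U \<Longrightarrow> F z = G z" "z \<in> U" "k \<in> K"
  shows "cpartial k F z = cpartial k G z"
  unfolding cpartial_def
  by (intro deriv_cong_ev refl eventually_mono[OF eventually_upd[OF assms(2,3)]]) (rule assms(1))

text \<open>Translates continuity for the product topology into an estimate on boxes. A sequence
  violating the estimate would converge in every coordinate, being constantly zero off
  \<open>K\<close>, and convergence in the product topology is coordinatewise.\<close>

lemma continuous_on_eps:
  assumes "continuous_on U F" "z \<in> U" "(e::real) > 0"
  shows "\<exists>d>0. \<forall>z'\<in>U. (\<forall>k\<in>K. \<bar>z' k - z k\<bar> < d) \<longrightarrow> \<bar>F z' - F z\<bar> < e"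
proof (rule ccontr)
  assume "\<not> ?thesis"
  then have neg: "\<exists>z'\<in>U. (\<forall>k\<in>K. \<bar>z' k - z k\<bar> < d) \<and> \<not> \<bar>F z' - F z\<bar> < e" if "d > 0" for d
    using that by blast
  have "\<forall>n. \<exists>z'. z' \<in> U \<and> (\<forall>k\<in>K. \<bar>z' k - z k\<bar> < inverse (Suc n)) \<and> \<not> \<bar>F z' - F z\<bar> < e"
  proof
    fix n :: nat
    show "\<exists>z'. z' \<in> U \<and> (\<forall>k\<in>K. \<bar>z' k - z k\<bar> < inverse (Suc n)) \<and> \<not> \<bar>F z' - F z\<bar> < e"
      using neg[of "inverse (Suc n)"] by auto
  qed
  from choice[OF this] obtain u where u: "\<And>n. u n \<in> U"
    "\<And>n k. k \<in> K \<Longrightarrow> \<bar>u n k - z k\<bar> < inverse (Suc n)" "\<And>n. \<not> \<bar>F (u n) - F z\<bar> < e"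
    by auto
  have "(\<lambda>n. u n k) \<longlonglongrightarrow> z k" for k
  proof (cases "k \<in> K")
    case True
    have "(\<lambda>n. u n k - z k) \<longlonglongrightarrow> 0"
      by (rule Lim_null_comparison[OF _ LIMSEQ_inverse_real_of_nat])
        (use u(2)[OF True] in \<open>auto intro!: always_eventually less_imp_le\<close>)
    then show ?thesis by (simp add: LIM_zero_iff)
  next
    case False
    then show ?thesis using supp[OF u(1)] supp[OF assms(2)] by simp
  qed
  then have "limitin (product_topology (\<lambda>i. euclidean) UNIV) u z sequentially"
    unfolding limitin_componentwise by (simp add: extensional_def)
  then have "u \<longlonglongrightarrow> z" by (simp add: euclidean_product_topology)
  then have "(\<lambda>n. F (u n)) \<longlonglongrightarrow> F z"
    by (rule continuous_on_tendsto_compose[OF assms(1) _ assms(2)]) (simp add: u(1))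
  then have "\<forall>\<^sub>F n in sequentially. dist (F (u n)) (F z) < e"
    using assms(3) by (rule tendstoD)
  then obtain n where "dist (F (u n)) (F z) < e" by (auto simp: eventually_sequentially)
  then show False using u(3)[of n] by (simp add: dist_real_def)
qed

definition C1 :: "(('k \<Rightarrow> real) \<Rightarrow> real) \<Rightarrow> bool" where
  "C1 F \<longleftrightarrow> (\<forall>k\<in>K. continuous_on U (cpartial k F) \<and>
    (\<forall>x\<in>U. (\<lambda>t. F (x(k := t))) field_differentiable at (x k)))"

lemma cpartial_DERIV:
  assumes "C1 F" "x \<in> U" "k \<in> K"
  shows "((\<lambda>t. F (x(k := t))) has_real_derivative cpartial k F x) (at (x k))"
  unfolding cpartial_def DERIV_deriv_iff_field_differentiable using assms by (auto simp: C1_def)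

text \<open>Continuous partial derivatives imply total differentiability: one passes from
  \<open>z\<close> to \<open>w\<close> by changing one coordinate at a time and controls each change
  by the mean value inequality.\<close>

lemma C1_estimate:
  assumes F: "C1 F" and z: "z \<in> U" and e: "e > 0"
  shows "\<exists>d>0. \<forall>w. (\<forall>k. k \<notin> K \<longrightarrow> w k = 0) \<and> (\<forall>k\<in>K. \<bar>w k - z k\<bar> < d) \<longrightarrow> w \<in> U \<and>
    \<bar>F w - F z - (\<Sum>k\<in>K. cpartial k F z * (w k - z k))\<bar> \<le> e * (\<Sum>k\<in>K. \<bar>w k - z k\<bar>)"
proof -
  obtain d0 where d0: "d0 > 0"
    and d0U: "\<And>z'. (\<forall>k. k \<notin> K \<longrightarrow> z' k = 0) \<Longrightarrow> (\<forall>k\<in>K. \<bar>z' k - z k\<bar> < d0) \<Longrightarrow> z' \<in> U"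
    using box[OF z] by auto
  have "\<forall>k. \<exists>d. d > 0 \<and> (k \<in> K \<longrightarrow> (\<forall>z'\<in>U. (\<forall>k\<in>K. \<bar>z' k - z k\<bar> < d) \<longrightarrow> \<bar>cpartial k F z' - cpartial k F z\<bar> < e))"
  proof
    fix k
    show "\<exists>d. d > 0 \<and> (k \<in> K \<longrightarrow> (\<forall>z'\<in>U. (\<forall>k\<in>K. \<bar>z' k - z k\<bar> < d) \<longrightarrow> \<bar>cpartial k F z' - cpartial k F z\<bar> < e))"
      using continuous_on_eps[of "cpartial k F" z e] F z e by (cases "k \<in> K") (auto simp: C1_def intro: exI[of _ 1])
  qed
  from choice[OF this] obtain dk where dk: "\<And>k. dk k > 0"
    "\<And>k z'. k \<in> K \<Longrightarrow> z' \<in> U \<Longrightarrow> (\<forall>l\<in>K. \<bar>z' l - z l\<bar> < dk k) \<Longrightarrow> \<bar>cpartial k F z' - cpartial k F z\<bar> < e"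
    by auto
  define d where "d = Min (insert d0 (dk ` K))"
  have d: "d > 0" "d \<le> d0" "\<And>k. k \<in> K \<Longrightarrow> d \<le> dk k"
    using d0 dk(1) finite_K by (auto simp: d_def)
  \<comment> \<open>Induction over the set \<open>L\<close> of labels in which \<open>w\<close> is
    allowed to differ from \<open>z\<close>.\<close>
  have "(\<forall>k. k \<notin> K \<longrightarrow> w k = 0) \<Longrightarrow> (\<forall>k\<in>K. \<bar>w k - z k\<bar> < d) \<Longrightarrow> (\<forall>k\<in>K - L. w k = z k) \<Longrightarrow>
      \<bar>F w - F z - (\<Sum>k\<in>L. cpartial k F z * (w k - z k))\<bar> \<le> e * (\<Sum>k\<in>L. \<bar>w k - z k\<bar>)"
    if "finite L" "L \<subseteq> K" for L w
    using that
  proof (induction L arbitrary: w)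
    case empty
    have "w k = z k" for k using empty supp[OF z] by (cases "k \<in> K") auto
    then have "w = z" by (rule ext)
    then show ?case by simp
  next
    case (insert k L)
    have k: "k \<in> K" using insert.prems by auto
    define v where "v = w(k := z k)"
    have v: "\<bar>F v - F z - (\<Sum>l\<in>L. cpartial l F z * (v l - z l))\<bar> \<le> e * (\<Sum>l\<in>L. \<bar>v l - z l\<bar>)"
      by (rule insert.IH) (use insert.prems k d in \<open>auto simp: v_def\<close>)
    have vL: "v l = w l" if "l \<in> L" for l using that insert.hyps by (auto simp: v_def)
    \<comment> \<open>The mean value inequality for \<open>F\<close> minus its linear part in
      coordinate \<open>k\<close>: the derivative of the difference is at most \<open>e\<close> in
      the chosen box.\<close>
    have "norm ((F (w(k := w k)) - cpartial k F z * w k) - (F (w(k := z k)) - cpartial k F z * z k))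
       \<le> e * norm (w k - z k)"
    proof (rule field_differentiable_bound[where S = "ball (z k) d"])
      fix t assume t: "t \<in> ball (z k) d"
      have tw: "\<forall>l. l \<notin> K \<longrightarrow> (w(k := t)) l = 0" "\<forall>l\<in>K. \<bar>(w(k := t)) l - z l\<bar> < d"
        using insert.prems t k by (auto simp: dist_real_def)
      then have tU: "w(k := t) \<in> U" using d(2) by (intro d0U) force+
      have "((\<lambda>s. F ((w(k := t))(k := s))) has_real_derivative cpartial k F (w(k := t))) (at ((w(k := t)) k))"
        by (rule cpartial_DERIV[OF F tU k])
      then have D: "((\<lambda>s. F (w(k := s))) has_real_derivative cpartial k F (w(k := t))) (at t)" by simp
      have "((\<lambda>s. F (w(k := s)) - cpartial k F z * s) has_real_derivative
          cpartial k F (w(k := t)) - cpartial k F z) (at t)"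
        using DERIV_diff[OF D DERIV_cmult[OF DERIV_ident, of "cpartial k F z"]] by simp
      then show "((\<lambda>s. F (w(k := s)) - cpartial k F z * s) has_real_derivative
          cpartial k F (w(k := t)) - cpartial k F z) (at t within ball (z k) d)"
        by (rule has_field_derivative_at_within)
      have "\<bar>cpartial k F (w(k := t)) - cpartial k F z\<bar> < e"
        by (rule dk(2)[OF k tU]) (use tw(2) d(3)[OF k] in force)
      then show "norm (cpartial k F (w(k := t)) - cpartial k F z) \<le> e" by simp
    qed (use insert.prems k d in \<open>auto simp: dist_real_def\<close>)
    then have wv: "\<bar>F w - F v - cpartial k F z * (w k - z k)\<bar> \<le> e * \<bar>w k - z k\<bar>"
      by (simp add: v_def algebra_simps)
    have "F w - F z - (\<Sum>l\<in>insert k L. cpartial l F z * (w l - z l)) =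
      (F w - F v - cpartial k F z * (w k - z k)) + (F v - F z - (\<Sum>l\<in>L. cpartial l F z * (v l - z l)))"
      using insert.hyps vL by simp
    also have "\<bar>\<dots>\<bar> \<le> e * \<bar>w k - z k\<bar> + e * (\<Sum>l\<in>L. \<bar>v l - z l\<bar>)"
      using wv v by linarith
    also have "\<dots> = e * (\<Sum>l\<in>insert k L. \<bar>w l - z l\<bar>)"
      using insert.hyps vL by (simp add: distrib_left)
    finally show ?case .
  qed
  note est = this[OF finite_K subset_refl]
  have "w \<in> U" if "\<forall>k. k \<notin> K \<longrightarrow> w k = 0" "\<forall>k\<in>K. \<bar>w k - z k\<bar> < d" for w
    by (rule d0U) (use that d(2) in \<open>auto intro: less_le_trans\<close>)
  with est d(1) show ?thesis by (intro exI[of _ d]) simp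
qed

text \<open>\<open>F\<close> along \<open>z\<close> is split into the linear part \<open>l\<close>,
  whose derivative is the claimed one, and a remainder \<open>R\<close>, whose derivative at
  \<open>t\<close> is shown to vanish by \<open>C1_estimate\<close> and a Lipschitz bound on
  \<open>z\<close> at \<open>t\<close>.\<close>

lemma chain_rule:
  fixes z :: "real^'p::finite \<Rightarrow> 'k \<Rightarrow> real"
  assumes F: "C1 F" and S: "open S" "t \<in> S" and zU: "\<And>u. u \<in> S \<Longrightarrow> z u \<in> U"
    and zd: "\<And>k. k \<in> K \<Longrightarrow> (\<lambda>u. z u k) differentiable at t"
  shows "((\<lambda>u. F (z u)) has_derivative (\<lambda>v. \<Sum>k\<in>K. cpartial k F (z t) * frechet_derivative (\<lambda>u. z u k) (at t) v)) (at t)"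
proof -
  define D where "D k = frechet_derivative (\<lambda>u. z u k) (at t)" for k
  define l where "l u = (\<Sum>k\<in>K. cpartial k F (z t) * z u k)" for u
  define R where "R u = F (z u) - l u" for u
  have D: "((\<lambda>u. z u k) has_derivative D k) (at t)" if "k \<in> K" for k
    using zd[OF that] unfolding D_def frechet_derivative_works .
  have "(l has_derivative (\<lambda>v. \<Sum>k\<in>K. cpartial k F (z t) * D k v)) (at t)"
    unfolding l_def[abs_def] by (intro has_derivative_sum has_derivative_mult_right D)
  moreover have "(R has_derivative (\<lambda>v. 0)) (at t)"
    unfolding has_derivative_at_alt
  proof (intro conjI allI impI)
    fix e :: real assume e: "e > 0"
    have "\<exists>B. B > 0 \<and> (\<forall>k\<in>K. \<forall>v. \<bar>D k v\<bar> \<le> B * norm v)"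
    proof -
      have on: "\<bar>D k v\<bar> \<le> (\<Sum>k\<in>K. onorm (D k)) * norm v" if "k \<in> K" for k v
      proof -
        have bl: "bounded_linear (D k)" if "k \<in> K" for k using D[OF that] by (rule has_derivative_bounded_linear)
        have "\<bar>D k v\<bar> \<le> onorm (D k) * norm v" using onorm[OF bl[OF that], of v] by simp
        also have "\<dots> \<le> (\<Sum>k\<in>K. onorm (D k)) * norm v"
          using that bl onorm_pos_le finite_K by (intro mult_right_mono member_le_sum) auto
        finally show ?thesis .
      qed
      have "\<bar>D k v\<bar> \<le> (\<bar>\<Sum>k\<in>K. onorm (D k)\<bar> + 1) * norm v" if "k \<in> K" for k v
        by (rule order_trans[OF on[OF that] mult_right_mono]) auto
      then show ?thesis by (intro exI[of _ "\<bar>\<Sum>k\<in>K. onorm (D k)\<bar> + 1"]) auto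
    qed
    then obtain B where B: "B > 0" "\<And>k v. k \<in> K \<Longrightarrow> \<bar>D k v\<bar> \<le> B * norm v" by auto
    \<comment> \<open>Each coordinate of \<open>z\<close> moves by at most
      \<open>(B + 1) * norm (u - t)\<close>, and \<open>card K\<close> coordinates are summed. The
      extra \<open>1\<close> keeps the denominator positive for empty \<open>K\<close>.\<close>
    define e' where "e' = e / (real (card K) * (B + 1) + 1)"
    have pos: "real (card K) * (B + 1) + 1 > 0" using B by (intro add_nonneg_pos) auto
    have e': "e' > 0" unfolding e'_def using e pos by simp
    obtain d where d: "d > 0" and est: "\<And>w. (\<forall>k. k \<notin> K \<longrightarrow> w k = 0) \<Longrightarrow> (\<forall>k\<in>K. \<bar>w k - z t k\<bar> < d) \<Longrightarrow>
      \<bar>F w - F (z t) - (\<Sum>k\<in>K. cpartial k F (z t) * (w k - z t k))\<bar> \<le> e' * (\<Sum>k\<in>K. \<bar>w k - z t k\<bar>)"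
      using C1_estimate[OF F zU[OF S(2)] e'] by auto
    have "\<forall>\<^sub>F u in nhds t. \<forall>k\<in>K. \<bar>z u k - z t k\<bar> \<le> (B + 1) * norm (u - t)"
      unfolding eventually_ball_finite_distrib[OF finite_K]
    proof
      fix k assume k: "k \<in> K"
      obtain d' where d': "d' > 0" "\<And>u. norm (u - t) < d' \<Longrightarrow> norm (z u k - z t k - D k (u - t)) \<le> 1 * norm (u - t)"
        using D[OF k] zero_less_one unfolding has_derivative_at_alt by blast
      have "\<bar>z u k - z t k\<bar> \<le> (B + 1) * norm (u - t)" if "dist u t < d'" for u
        using d'(2)[of u] B(2)[OF k, of "u - t"] that by (simp add: dist_norm algebra_simps)
      then show "\<forall>\<^sub>F u in nhds t. \<bar>z u k - z t k\<bar> \<le> (B + 1) * norm (u - t)"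
        using d' unfolding eventually_nhds_metric by blast
    qed
    moreover have "\<forall>\<^sub>F u in nhds t. u \<in> S" using S by (rule eventually_nhds_in_open)
    moreover have "\<forall>\<^sub>F u in nhds t. norm (u - t) < d / (B + 1)"
      unfolding eventually_nhds_metric dist_norm using d B by (intro exI[of _ "d / (B + 1)"]) simp
    ultimately have "\<forall>\<^sub>F u in nhds t. norm (R u - R t - 0) \<le> e * norm (u - t)"
    proof eventually_elim
      case (elim u)
      have "(B + 1) * norm (u - t) < d" using elim(3) B by (simp add: pos_less_divide_eq mult.commute)
      then have small: "\<forall>k\<in>K. \<bar>z u k - z t k\<bar> < d" using elim(1) by force
      have "\<bar>R u - R t\<bar> = \<bar>F (z u) - F (z t) - (\<Sum>k\<in>K. cpartial k F (z t) * (z u k - z t k))\<bar>"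
        by (simp add: R_def l_def right_diff_distrib sum_subtractf algebra_simps)
      also have "\<dots> \<le> e' * (\<Sum>k\<in>K. \<bar>z u k - z t k\<bar>)"
        by (rule est) (use small supp zU elim in auto)
      also have "\<dots> \<le> e' * (\<Sum>k\<in>K. (B + 1) * norm (u - t))"
        using e' elim(1) by (intro mult_left_mono sum_mono) auto
      also have "\<dots> = e' * (real (card K) * (B + 1)) * norm (u - t)" by simp
      also have "\<dots> \<le> e * norm (u - t)"
      proof (rule mult_right_mono)
        have "e' * (real (card K) * (B + 1)) \<le> e' * (real (card K) * (B + 1) + 1)" using e' by simp
        also have "\<dots> = e" using pos by (simp add: e'_def)
        finally show "e' * (real (card K) * (B + 1)) \<le> e" .
      qed simp
      finally show ?case by simp
    qed
    then show "\<exists>d>0. \<forall>y. norm (y - t) < d \<longrightarrow> norm (R y - R t - 0) \<le> e * norm (y - t)"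
      unfolding eventually_nhds_metric dist_norm by blast
  qed simp
  ultimately have "((\<lambda>u. l u + R u) has_derivative (\<lambda>v. (\<Sum>k\<in>K. cpartial k F (z t) * D k v) + 0)) (at t)"
    by (rule has_derivative_add)
  then show ?thesis by (simp add: R_def D_def)
qed

lemma pd_chain:
  fixes z :: "real^'p::finite \<Rightarrow> 'k \<Rightarrow> real"
  assumes "C1 F" "open S" "t \<in> S" "\<And>u. u \<in> S \<Longrightarrow> z u \<in> U"
    and "\<And>k. k \<in> K \<Longrightarrow> (\<lambda>u. z u k) differentiable at t"
  shows "pd j (\<lambda>u. F (z u)) t = (\<Sum>k\<in>K. cpartial k F (z t) * pd j (\<lambda>u. z u k) t)"
    "(\<lambda>u. F (z u)) differentiable at t"
  using chain_rule[OF assms] pd_has_derivative[OF chain_rule[OF assms]]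
  by (simp add: pd_def, auto simp: differentiable_def)

section \<open>Closure properties of smooth functions of labelled coordinates\<close>

lemma csmooth_iff: "csmooth_on K U F \<longleftrightarrow> continuous_on U F \<and> (\<forall>k\<in>K. csmooth_on K U (cpartial k F) \<and>
    (\<forall>x\<in>U. (\<lambda>t. F (x(k := t))) field_differentiable at (x k)))" (is "?L \<longleftrightarrow> ?R")
proof
  assume L: ?L
  have "continuous_on U F \<and> (\<forall>k\<in>K. \<forall>x\<in>U. (\<lambda>t. F (x(k := t))) field_differentiable at (x k))"
    using L[unfolded csmooth_on_def, rule_format, of "[]"] by simp
  moreover have "csmooth_on K U (cpartial k F)" if "k \<in> K" for k
    unfolding csmooth_on_def
  proof (intro allI impI)
    fix ks assume "set ks \<subseteq> K"
    then show "continuous_on U (foldr cpartial ks (cpartial k F)) \<and>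
      (\<forall>l\<in>K. \<forall>x\<in>U. (\<lambda>t. foldr cpartial ks (cpartial k F) (x(l := t))) field_differentiable at (x l))"
      using L[unfolded csmooth_on_def, rule_format, of "ks @ [k]"] that by simp
  qed
  ultimately show ?R by simp
next
  assume R: ?R
  show ?L unfolding csmooth_on_def
  proof (intro allI impI)
    fix ks assume ks: "set ks \<subseteq> K"
    show "continuous_on U (foldr cpartial ks F) \<and>
      (\<forall>l\<in>K. \<forall>x\<in>U. (\<lambda>t. foldr cpartial ks F (x(l := t))) field_differentiable at (x l))"
    proof (cases ks rule: rev_cases)
      case (snoc ks' k)
      then show ?thesis using R ks by (auto simp: csmooth_on_def)
    qed (use R in auto)
  qed
qed

lemma csmooth_cpartial: "csmooth_on K U F \<Longrightarrow> k \<in> K \<Longrightarrow> csmooth_on K U (cpartial k F)"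
  using csmooth_iff by blast

lemma csmooth_C1: "csmooth_on K U F \<Longrightarrow> C1 F"
  unfolding C1_def using csmooth_iff by blast

text \<open>Graded version of \<open>csmooth_on\<close>, with the same purpose as \<open>Ck\<close>;
  continuity is carried along at every level because partial derivatives alone do not imply
  it.\<close>

fun Cc :: "nat \<Rightarrow> (('k \<Rightarrow> real) \<Rightarrow> real) \<Rightarrow> bool" where
  "Cc 0 F \<longleftrightarrow> continuous_on U F"
| "Cc (Suc n) F \<longleftrightarrow> continuous_on U F \<and> (\<forall>k\<in>K. Cc n (cpartial k F) \<and>
    (\<forall>x\<in>U. (\<lambda>t. F (x(k := t))) field_differentiable at (x k)))"

lemma Cc_SucD: "Cc (Suc n) F \<Longrightarrow> k \<in> K \<Longrightarrow> Cc n (cpartial k F)"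
  by simp

lemma Cc_iff: "csmooth_on K U F \<longleftrightarrow> (\<forall>n. Cc n F)"
proof
  assume "csmooth_on K U F"
  then have "Cc n F" for n
  proof (induction n arbitrary: F)
    case 0
    then show ?case by (subst (asm) csmooth_iff) simp
  next
    case (Suc n)
    from Suc.prems show ?case by (subst (asm) csmooth_iff) (simp add: Suc.IH)
  qed
  then show "\<forall>n. Cc n F" ..
next
  assume all: "\<forall>n. Cc n F"
  have *: "set ks \<subseteq> K \<Longrightarrow> Cc (Suc n) (foldr cpartial ks F)" for ks n
  proof (induction ks arbitrary: n)
    case Nil
    then show ?case using all[rule_format, of "Suc n"] by simp
  next
    case (Cons k ks)
    have "Cc (Suc (Suc n)) (foldr cpartial ks F)"
      by (rule Cons.IH) (use Cons.prems in simp)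
    from Cc_SucD[OF this, of k] Cons.prems show ?case by (simp del: Cc.simps)
  qed
  show "csmooth_on K U F"
    unfolding csmooth_on_def
  proof (intro allI impI)
    fix ks assume "set ks \<subseteq> K"
    from *[OF this, of 0] show "continuous_on U (foldr cpartial ks F) \<and>
      (\<forall>l\<in>K. \<forall>x\<in>U. (\<lambda>t. foldr cpartial ks F (x(l := t))) field_differentiable at (x l))"
      by simp
  qed
qed

lemma Cc_Suc: "Cc (Suc n) F \<Longrightarrow> Cc n F"
  by (induction n arbitrary: F) auto

lemma field_diff_cong:
  assumes "\<And>z. z \<in> U \<Longrightarrow> F z = G z" "x \<in> U" "k \<in> K"
    "(\<lambda>t. F (x(k := t))) field_differentiable at (x k)"
  shows "(\<lambda>t. G (x(k := t))) field_differentiable at (x k)"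
proof -
  have ev: "\<forall>\<^sub>F t in nhds (x k). F (x(k := t)) = G (x(k := t))"
    by (rule eventually_mono[OF eventually_upd[OF assms(2,3)]]) (rule assms(1))
  show ?thesis using assms(4) unfolding field_differentiable_def
    using DERIV_cong_ev[OF refl ev refl] by blast
qed

lemma Cc_cong: "(\<And>z. z \<in> U \<Longrightarrow> F z = G z) \<Longrightarrow> Cc n F \<Longrightarrow> Cc n G"
proof (induction n arbitrary: F G)
  case 0
  then show ?case using continuous_on_eq[of U F G] by simp
next
  case (Suc n)
  have "Cc n (cpartial k G)" if k: "k \<in> K" for k
  proof (rule Suc.IH)
    show "cpartial k F z = cpartial k G z" if "z \<in> U" for z
      by (rule cpartial_cong[OF Suc.prems(1) that k])
    show "Cc n (cpartial k F)" using Suc.prems k by simp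
  qed
  moreover have "continuous_on U G" using Suc.prems continuous_on_eq[of U F G] by simp
  moreover have "(\<lambda>t. G (x(k := t))) field_differentiable at (x k)" if "x \<in> U" "k \<in> K" for x k
  proof (rule field_diff_cong[OF Suc.prems(1) that])
    show "(\<lambda>t. F (x(k := t))) field_differentiable at (x k)"
      using Suc.prems(2) that unfolding Cc.simps by blast
  qed
  ultimately show ?case by simp
qed

lemma csmooth_cong: "csmooth_on K U F \<Longrightarrow> (\<And>z. z \<in> U \<Longrightarrow> F z = G z) \<Longrightarrow> csmooth_on K U G"
  unfolding Cc_iff using Cc_cong[of F G] by simp

lemma cpartial_add:
  assumes "(\<lambda>t. F (x(k := t))) field_differentiable at (x k)" "(\<lambda>t. G (x(k := t))) field_differentiable at (x k)"
  shows "cpartial k (\<lambda>z. F z + G z) x = cpartial k F x + cpartial k G x"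
  using assms unfolding cpartial_def by (rule deriv_add)

lemma cpartial_mult:
  assumes "(\<lambda>t. F (x(k := t))) field_differentiable at (x k)" "(\<lambda>t. G (x(k := t))) field_differentiable at (x k)"
  shows "cpartial k (\<lambda>z. F z * G z) x = F x * cpartial k G x + cpartial k F x * G x"
  unfolding cpartial_def using deriv_mult[OF assms] by simp

lemma Cc_const: "Cc n (\<lambda>z. c)"
  by (induction n arbitrary: c) (auto simp: cpartial_def[abs_def])

lemma Cc_coord: "Cc n (\<lambda>z. z k)"
proof (cases n)
  have c: "continuous_on U (\<lambda>z. z k)"
    by (rule continuous_on_product_then_coordinatewise) (rule continuous_on_id)
  case 0
  then show ?thesis using c by simp
next
  case (Suc m)
  have c: "continuous_on U (\<lambda>z. z k)"
    by (rule continuous_on_product_then_coordinatewise) (rule continuous_on_id)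
  have eq: "cpartial l (\<lambda>z. z k) = (\<lambda>z. if l = k then 1 else 0)" for l
    by (auto simp: cpartial_def fun_eq_iff)
  have "(\<lambda>t. (x(l := t)) k) field_differentiable at (x l)" for l and x :: "'k \<Rightarrow> real"
    by (cases "l = k") (simp_all add: field_differentiable_ident)
  then show ?thesis using c Suc by (simp only: Cc.simps eq Cc_const) blast
qed

lemma Cc_add: "Cc n F \<Longrightarrow> Cc n G \<Longrightarrow> Cc n (\<lambda>z. F z + G z)"
proof (induction n arbitrary: F G)
  case 0
  then show ?case by (simp add: continuous_on_add)
next
  case (Suc n)
  have "Cc n (cpartial k (\<lambda>z. F z + G z))" if k: "k \<in> K" for k
  proof (rule Cc_cong)
    show "cpartial k F z + cpartial k G z = cpartial k (\<lambda>z. F z + G z) z" if "z \<in> U" for z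
      using Suc.prems k that by (intro cpartial_add[symmetric]) auto
    show "Cc n (\<lambda>z. cpartial k F z + cpartial k G z)"
      using Suc k by simp
  qed
  with Suc.prems show ?case by (auto intro: continuous_on_add field_differentiable_add)
qed

lemma Cc_mult: "Cc n F \<Longrightarrow> Cc n G \<Longrightarrow> Cc n (\<lambda>z. F z * G z)"
proof (induction n arbitrary: F G)
  case 0
  then show ?case by (simp add: continuous_on_mult)
next
  case (Suc n)
  have "Cc n (cpartial k (\<lambda>z. F z * G z))" if k: "k \<in> K" for k
  proof (rule Cc_cong)
    show "F z * cpartial k G z + cpartial k F z * G z = cpartial k (\<lambda>z. F z * G z) z" if "z \<in> U" for z
      using Suc.prems k that by (intro cpartial_mult[symmetric]) auto
    show "Cc n (\<lambda>z. F z * cpartial k G z + cpartial k F z * G z)"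
      using Suc k Cc_Suc[OF Suc.prems(1)] Cc_Suc[OF Suc.prems(2)] by (intro Cc_add Suc.IH) auto
  qed
  with Suc.prems show ?case by (auto intro: continuous_on_mult field_differentiable_mult)
qed

lemma csmooth_const: "csmooth_on K U (\<lambda>z. c)" by (simp add: Cc_iff Cc_const)

lemma csmooth_coord: "csmooth_on K U (\<lambda>z. z k)" by (simp add: Cc_iff Cc_coord)

lemma csmooth_add: "csmooth_on K U F \<Longrightarrow> csmooth_on K U G \<Longrightarrow> csmooth_on K U (\<lambda>z. F z + G z)"
  by (simp add: Cc_iff Cc_add)

lemma csmooth_mult: "csmooth_on K U F \<Longrightarrow> csmooth_on K U G \<Longrightarrow> csmooth_on K U (\<lambda>z. F z * G z)"
  by (simp add: Cc_iff Cc_mult)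

lemma csmooth_sum: "(\<And>i. i \<in> I \<Longrightarrow> csmooth_on K U (F i)) \<Longrightarrow> csmooth_on K U (\<lambda>z. \<Sum>i\<in>I. F i z)"
  by (induction I rule: infinite_finite_induct) (simp_all add: csmooth_const csmooth_add)

lemma smooth_csmooth_compose:
  fixes z :: "real^'p::finite \<Rightarrow> 'k \<Rightarrow> real"
  assumes F: "csmooth_on K U F" and S: "open S" and zU: "\<And>u. u \<in> S \<Longrightarrow> z u \<in> U"
    and zs: "\<And>k. k \<in> K \<Longrightarrow> smooth_map S (\<lambda>u. z u k)"
  shows "smooth_map S (\<lambda>u. F (z u))"
proof -
  have "csmooth_on K U F \<Longrightarrow> Ck n S (\<lambda>u. F (z u))" for n F
  proof (induction n arbitrary: F)
    case (Suc n)
    have C: "Ck n S (\<lambda>u. \<Sum>k\<in>A. cpartial k F (z u) * pd j (\<lambda>u. z u k) u)" if "finite A" "A \<subseteq> K" for j A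
      using that
    proof (induction A)
      case (insert k A)
      then have k: "k \<in> K" by simp
      have "Ck n S (\<lambda>u. cpartial k F (z u))"
        by (rule Suc.IH[OF csmooth_cpartial[OF Suc.prems k]])
      moreover have "Ck n S (pd j (\<lambda>u. z u k))" using smooth_pd[OF zs[OF k]] smooth_iff_Ck by blast
      ultimately show ?case using insert by (auto intro!: Ck_add[OF S] Ck_mult[OF S])
    qed (simp add: Ck_const)
    have ch: "pd j (\<lambda>u. F (z u)) u = (\<Sum>k\<in>K. cpartial k F (z u) * pd j (\<lambda>u. z u k) u)"
      "(\<lambda>u. F (z u)) differentiable at u" if "u \<in> S" for u j
      using pd_chain[OF csmooth_C1[OF Suc.prems] S that zU smooth_diffable[OF zs that]] by auto
    from Ck_cong[OF S ch(1)[symmetric] C[OF finite_K subset_refl]] ch(2) show ?case by simp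
  qed simp
  with F show ?thesis by (simp add: smooth_iff_Ck)
qed

end

section \<open>The coordinate expression of the total derivative\<close>

lemma finite_msets_size_le: "finite {M :: 'n::finite multiset. size M \<le> s}"
proof (rule finite_subset)
  show "{M :: 'n multiset. size M \<le> s} \<subseteq> mset ` {xs. set xs \<subseteq> UNIV \<and> length xs \<le> s}"
  proof
    fix M :: "'n multiset" assume "M \<in> {M. size M \<le> s}"
    then show "M \<in> mset ` {xs. set xs \<subseteq> UNIV \<and> length xs \<le> s}"
      by (intro image_eqI[of _ _ "arrange M"]) auto
  qed
  show "finite (mset ` {xs :: 'n list. set xs \<subseteq> UNIV \<and> length xs \<le> s})"
    by (intro finite_imageI finite_lists_length_le) simp
qed

lemma finite_lists_le: "finite {J :: 'n::finite list. length J \<le> m}"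
  using finite_lists_length_le[of "UNIV :: 'n set" m] by simp

text \<open>One over the number of rearrangements of \<open>J\<close>. This is the factor in
  \<open>Delta\<close>; it makes a sum over sequences count every multiset exactly once, as in
  \<open>sum_jweight\<close>.\<close>

definition jweight :: "'n::finite list \<Rightarrow> real" where
  "jweight J = (\<Prod>l\<in>UNIV. fact (count_list J l)) / fact (length J)"

lemma sum_jweight:
  fixes f :: "'n::finite multiset \<Rightarrow> real"
  shows "(\<Sum>J | length J \<le> m. jweight J * f (mset J)) = (\<Sum>M | size M \<le> m. f M)"
proof -
  have "(\<Sum>J | length J \<le> m. jweight J * f (mset J)) =
    (\<Sum>M | size M \<le> m. \<Sum>J | J \<in> {J. length J \<le> m} \<and> mset J = M. jweight J * f (mset J))"
    by (rule sum.group[symmetric]) (auto simp: finite_lists_le finite_msets_size_le)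
  also have "\<dots> = (\<Sum>M | size M \<le> m. f M)"
  proof (rule sum.cong[OF refl])
    fix M :: "'n multiset" assume M: "M \<in> {M. size M \<le> m}"
    have set: "{J. J \<in> {J. length J \<le> m} \<and> mset J = M} = permutations_of_multiset M"
      using M by (auto simp: permutations_of_multiset_def)
    have prod: "(\<Prod>l\<in>UNIV. fact (count M l) :: real) = (\<Prod>l\<in>set_mset M. fact (count M l))"
      by (rule prod.mono_neutral_right) (auto simp: not_in_iff)
    have w: "jweight J = (\<Prod>l\<in>set_mset M. fact (count M l)) / fact (size M)" if "J \<in> permutations_of_multiset M" for J
      using that prod by (auto simp: jweight_def permutations_of_multiset_def count_mset)
    have nz: "(\<Prod>l\<in>set_mset M. fact (count M l) :: real) \<noteq> 0" by simp
    have dvd: "(\<Prod>l\<in>set_mset M. fact (count M l) :: nat) dvd fact (size M)"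
      by (rule card_permutations_of_multiset)
    have "real (card (permutations_of_multiset M)) = fact (size M) / (\<Prod>l\<in>set_mset M. fact (count M l))"
      unfolding card_permutations_of_multiset(1) by (subst real_of_nat_div[OF dvd]) simp
    then have "real (card (permutations_of_multiset M)) * ((\<Prod>l\<in>set_mset M. fact (count M l)) / fact (size M)) = 1"
      using nz by simp
    moreover have "(\<Sum>J | J \<in> {J. length J \<le> m} \<and> mset J = M. jweight J * f (mset J)) =
      (\<Sum>J\<in>permutations_of_multiset M. (\<Prod>l\<in>set_mset M. fact (count M l)) / fact (size M) * f M)"
      unfolding set by (rule sum.cong) (auto simp: w dest: permutations_of_multisetD)
    ultimately show "(\<Sum>J | J \<in> {J. length J \<le> m} \<and> mset J = M. jweight J * f (mset J)) = f M"
      by (simp only: sum_constant mult.assoc[symmetric])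
  qed
  finally show ?thesis .
qed

lemma sum_P_labels:
  fixes c :: "('x, 'n::finite, 'N::finite) split_chart"
  shows "(\<Sum>k\<in>P_labels s c. f k) =
    (\<Sum>i\<in>UNIV. f (Inl i)) + (\<Sum>\<sigma>\<in>dep c. \<Sum>M | size M \<le> s. f (Inr (\<sigma>, M)))"
proof -
  have eq: "{(\<sigma>, M). \<sigma> \<in> dep c \<and> size M \<le> s} = dep c \<times> {M :: 'n multiset. size M \<le> s}" by auto
  show ?thesis unfolding P_labels_def eq
    by (subst sum.union_disjoint)
      (auto simp: sum.reindex sum.cartesian_product finite_msets_size_le)
qed

lemma finite_P_labels: "finite (P_labels s c)"
proof -
  have "{(\<sigma>, M). \<sigma> \<in> dep c \<and> size M \<le> s} = dep c \<times> {M :: 'b multiset. size M \<le> s}" by auto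
  then show ?thesis unfolding P_labels_def by (simp add: finite_msets_size_le)
qed

lemma Inl_P_labels [simp]: "Inl i \<in> P_labels s c" by (simp add: P_labels_def)

lemma Inr_P_labels [simp]: "Inr (\<sigma>, M) \<in> P_labels s c \<longleftrightarrow> \<sigma> \<in> dep c \<and> size M \<le> s"
  by (auto simp: P_labels_def)

lemma P_labels_cases:
  assumes "k \<in> P_labels s c"
  obtains i where "k = Inl i" | \<sigma> M where "k = Inr (\<sigma>, M)" "\<sigma> \<in> dep c" "size M \<le> s"
  using assms by (auto simp: P_labels_def)

lemma P_labels_mono: "d \<le> s \<Longrightarrow> P_labels d c \<subseteq> P_labels s c"
  by (auto simp: P_labels_def)

definition basept :: "('x, 'n::finite, 'N::finite) split_chart \<Rightarrow> ('n + 'N \<times> 'n multiset \<Rightarrow> real) \<Rightarrow> real^'N" where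
  "basept c z = (\<chi> A. if A \<in> range (ind c) then z (Inl (inv (ind c) A)) else z (Inr (A, {#})))"

text \<open>The coordinate image of the orbits of regular velocities (see
  \<open>P_coords_image\<close>): only the base point is constrained, the derivative coordinates are
  arbitrary.\<close>

definition P_domain :: "nat \<Rightarrow> ('x, 'n::finite, 'N::finite) split_chart \<Rightarrow> ('n + 'N \<times> 'n multiset \<Rightarrow> real) set" where
  "P_domain s c = {z. (\<forall>k. k \<notin> P_labels s c \<longrightarrow> z k = 0) \<and> basept c z \<in> cmap c ` cdom c}"

definition Xof :: "('x, 'n::finite, 'N::finite) split_chart \<Rightarrow> (real^'p::finite \<Rightarrow> real^'N) \<Rightarrow> 'n \<Rightarrow> real^'p \<Rightarrow> real" where
  "Xof c g i t = g t $ ind c i"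

text \<open>The coordinates on \<open>P\<^sup>s\<^sub>nX\<close> of the jet at \<open>t\<close> of the map with coordinate expression \<open>g\<close>.\<close>

definition pcoord :: "nat \<Rightarrow> ('x, 'n::finite, 'N::finite) split_chart \<Rightarrow> (real^'n \<Rightarrow> real^'N) \<Rightarrow> real^'n \<Rightarrow>
    'n + 'N \<times> 'n multiset \<Rightarrow> real" where
  "pcoord s c g t k = (if k \<in> P_labels s c then (case k of Inl i \<Rightarrow> Xof c g i t
     | Inr (\<sigma>, M) \<Rightarrow> foldr (Bop (Xof c g)) (arrange M) (\<lambda>t. g t $ \<sigma>) t) else 0)"

text \<open>\<open>Dtot\<close> in coordinates. The derivative with respect to the coordinates of
  top order \<open>s\<close> is missing, since it would be multiplied by coordinates of order
  \<open>s + 1\<close>; hence the bound \<open>d < s\<close> in \<open>Dloc_pcoord\<close>.\<close>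

definition Dloc :: "nat \<Rightarrow> ('x, 'n::finite, 'N::finite) split_chart \<Rightarrow> 'n \<Rightarrow>
    (('n + 'N \<times> 'n multiset \<Rightarrow> real) \<Rightarrow> real) \<Rightarrow> ('n + 'N \<times> 'n multiset \<Rightarrow> real) \<Rightarrow> real" where
  "Dloc s c i G z = cpartial (Inl i) G z + (\<Sum>\<sigma>\<in>dep c. \<Sum>J | length J \<le> s - 1.
     z (Inr (\<sigma>, mset (i # J))) * (jweight J * cpartial (Inr (\<sigma>, mset J)) G z))"

lemma arrange_empty [simp]: "arrange {#} = []"
  by (metis length_0_conv length_arrange size_empty)

lemma pcoord_Inl [simp]: "pcoord s c g t (Inl i) = Xof c g i t"
  by (simp add: pcoord_def)

lemma pcoord_Inr: "\<sigma> \<in> dep c \<Longrightarrow> size M \<le> s \<Longrightarrow>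
    pcoord s c g t (Inr (\<sigma>, M)) = foldr (Bop (Xof c g)) (arrange M) (\<lambda>t. g t $ \<sigma>) t"
  by (simp add: pcoord_def)

locale jet_domain =
  fixes c :: "('x, 'n::finite, 'N::finite) split_chart" and s :: nat
  assumes inj_ind: "inj (ind c)" and open_V: "open (cmap c ` cdom c)"
begin

lemma basept_ind: "basept c z $ ind c i = z (Inl i)"
  by (simp add: basept_def inj_ind)

lemma basept_dep: "\<sigma> \<in> dep c \<Longrightarrow> basept c z $ \<sigma> = z (Inr (\<sigma>, {#}))"
  by (simp add: basept_def dep_def)

lemma basept_pcoord: "basept c (pcoord s c g t) = g t"
proof -
  have "basept c (pcoord s c g t) $ A = g t $ A" for A
  proof (cases "A \<in> range (ind c)")
    case True
    then obtain i where "A = ind c i" by auto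
    then show ?thesis by (simp add: basept_ind Xof_def)
  next
    case False
    then have "A \<in> dep c" by (simp add: dep_def)
    then show ?thesis by (simp add: basept_dep pcoord_Inr)
  qed
  then show ?thesis by (simp add: vec_eq_iff)
qed

lemma pcoord_in: "g t \<in> cmap c ` cdom c \<Longrightarrow> pcoord s c g t \<in> P_domain s c"
  by (simp add: P_domain_def basept_pcoord pcoord_def)

sublocale cdomain "P_labels s c" "P_domain s c"
proof
  fix z assume z: "z \<in> P_domain s c"
  then have "basept c z \<in> cmap c ` cdom c" by (simp add: P_domain_def)
  with open_V obtain e where e: "e > 0" "ball (basept c z) e \<subseteq> cmap c ` cdom c"
    by (rule openE)
  \<comment> \<open>The distance of base points is bounded by the sum of \<open>CARD('N)\<close>
    component differences of size at most \<open>d\<close>; the extra \<open>1\<close> makes the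
    total strictly less than \<open>e\<close>.\<close>
  define d where "d = e / (real CARD('N) + 1)"
  have d: "d > 0" using e by (simp add: d_def add_nonneg_pos)
  have "z' \<in> P_domain s c" if z': "\<forall>k. k \<notin> P_labels s c \<longrightarrow> z' k = 0" "\<forall>k\<in>P_labels s c. \<bar>z' k - z k\<bar> < d" for z'
  proof -
    have comp: "\<bar>(basept c z' - basept c z) $ A\<bar> \<le> d" for A
      using z'(2) by (cases "A \<in> range (ind c)") (auto simp: basept_ind basept_def dep_def less_imp_le inj_ind)
    have "norm (basept c z' - basept c z) \<le> (\<Sum>A\<in>UNIV. \<bar>(basept c z' - basept c z) $ A\<bar>)"
      by (rule norm_le_l1_cart)
    also have "\<dots> \<le> (\<Sum>A\<in>(UNIV :: 'N set). d)" by (rule sum_mono) (rule comp)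
    also have "\<dots> < e"
      using e by (simp add: d_def field_simps)
    finally have "basept c z' \<in> ball (basept c z) e" by (simp add: dist_norm norm_minus_commute)
    with e z'(1) show ?thesis by (auto simp: P_domain_def)
  qed
  with d show "\<exists>d>0. \<forall>z'. (\<forall>k. k \<notin> P_labels s c \<longrightarrow> z' k = 0) \<and> (\<forall>k\<in>P_labels s c. \<bar>z' k - z k\<bar> < d) \<longrightarrow> z' \<in> P_domain s c"
    by (intro exI[of _ d]) simp
qed (auto simp: finite_P_labels P_domain_def)

text \<open>The order filtration. Each \<open>Dloc\<close> raises the order by one, so for
  \<open>F\<close> of order \<open>r\<close> all terms of \<open>EL_loc\<close> have order at most
  \<open>2 * r\<close>, and every derivative is applied to a function of order below
  \<open>s\<close>.\<close>

definition order_le :: "nat \<Rightarrow> (('n + 'N \<times> 'n multiset \<Rightarrow> real) \<Rightarrow> real) \<Rightarrow> bool" where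
  "order_le d G \<longleftrightarrow> (\<forall>z\<in>P_domain s c. \<forall>z'\<in>P_domain s c. (\<forall>k\<in>P_labels d c. z k = z' k) \<longrightarrow> G z = G z')"

lemma order_leD:
  "order_le d G \<Longrightarrow> z \<in> P_domain s c \<Longrightarrow> z' \<in> P_domain s c \<Longrightarrow>
    (\<And>k. k \<in> P_labels d c \<Longrightarrow> z k = z' k) \<Longrightarrow> G z = G z'"
  unfolding order_le_def by blast

lemma order_le_cpartial_0:
  assumes G: "order_le d G" and k: "k \<in> P_labels s c" "k \<notin> P_labels d c" and z: "z \<in> P_domain s c"
  shows "cpartial k G z = 0"
proof -
  have "\<forall>\<^sub>F t in nhds (z k). G (z(k := t)) = G z"
  proof (rule eventually_mono[OF eventually_upd[OF z k(1)]])
    fix t assume "z(k := t) \<in> P_domain s c"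
    then show "G (z(k := t)) = G z" by (rule order_leD[OF G _ z]) (use k(2) in auto)
  qed
  then have "deriv (\<lambda>t. G (z(k := t))) (z k) = deriv (\<lambda>t. G z) (z k)"
    by (rule deriv_cong_ev) simp
  then show ?thesis by (simp add: cpartial_def)
qed

lemma order_le_cpartial:
  assumes G: "order_le d G" and k: "k \<in> P_labels s c"
  shows "order_le d (cpartial k G)"
  unfolding order_le_def
proof (intro ballI impI)
  fix z z' assume z: "z \<in> P_domain s c" "z' \<in> P_domain s c" and eq: "\<forall>k\<in>P_labels d c. z k = z' k"
  show "cpartial k G z = cpartial k G z'"
  proof (cases "k \<in> P_labels d c")
    case True
    then have zk: "z k = z' k" using eq by simp
    have "\<forall>\<^sub>F t in nhds (z k). z(k := t) \<in> P_domain s c \<and> z'(k := t) \<in> P_domain s c"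
      using eventually_conj[OF eventually_upd[OF z(1) k] eventually_upd[OF z(2) k, folded zk]] .
    then have "\<forall>\<^sub>F t in nhds (z k). G (z(k := t)) = G (z'(k := t))"
    proof (rule eventually_mono)
      fix t assume "z(k := t) \<in> P_domain s c \<and> z'(k := t) \<in> P_domain s c"
      then show "G (z(k := t)) = G (z'(k := t))" using eq by (intro order_leD[OF G]) auto
    qed
    then show ?thesis unfolding cpartial_def by (rule deriv_cong_ev) (rule zk)
  next
    case False
    then show ?thesis using order_le_cpartial_0[OF G k] z by simp
  qed
qed

lemma order_le_Dloc:
  assumes G: "order_le d G" and d: "d < s"
  shows "order_le (Suc d) (Dloc s c i G)"
  unfolding order_le_def
proof (intro ballI impI)
  fix z z' assume z: "z \<in> P_domain s c" "z' \<in> P_domain s c" and eq: "\<forall>k\<in>P_labels (Suc d) c. z k = z' k"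
  have eq': "\<forall>k\<in>P_labels d c. z k = z' k" using eq P_labels_mono[of d "Suc d" c] by auto
  have cp: "cpartial k G z = cpartial k G z'" if "k \<in> P_labels s c" for k
    by (rule order_leD[OF order_le_cpartial[OF G that] z]) (use eq' in simp)
  have "z (Inr (\<sigma>, mset (i # J))) * (jweight J * cpartial (Inr (\<sigma>, mset J)) G z) =
      z' (Inr (\<sigma>, mset (i # J))) * (jweight J * cpartial (Inr (\<sigma>, mset J)) G z')"
    if "\<sigma> \<in> dep c" "length J \<le> s - 1" for \<sigma> J
  proof (cases "length J \<le> d")
    case True
    then have "z (Inr (\<sigma>, mset (i # J))) = z' (Inr (\<sigma>, mset (i # J)))" using eq that by auto
    moreover have "cpartial (Inr (\<sigma>, mset J)) G z = cpartial (Inr (\<sigma>, mset J)) G z'"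
      by (rule cp) (use that in simp)
    ultimately show ?thesis by simp
  next
    case False
    then show ?thesis using order_le_cpartial_0[OF G, of "Inr (\<sigma>, mset J)"] that z by simp
  qed
  then show "Dloc s c i G z = Dloc s c i G z'"
    unfolding Dloc_def by (intro arg_cong2[of _ _ _ _ "(+)"] cp sum.cong refl) auto
qed

lemma csmooth_Dloc:
  assumes "csmooth_on (P_labels s c) (P_domain s c) G"
  shows "csmooth_on (P_labels s c) (P_domain s c) (Dloc s c i G)"
  unfolding Dloc_def[abs_def]
  by (intro csmooth_add csmooth_sum csmooth_mult csmooth_const csmooth_coord csmooth_cpartial[OF assms]) auto

lemma Dlocs_regular:
  assumes "csmooth_on (P_labels s c) (P_domain s c) G" "order_le d G"
  shows "d + length J \<le> s \<Longrightarrow> csmooth_on (P_labels s c) (P_domain s c) (foldr (Dloc s c) J G) \<and>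
    order_le (d + length J) (foldr (Dloc s c) J G)"
proof (induction J)
  case (Cons i J)
  then show ?case using csmooth_Dloc order_le_Dloc[of "d + length J"] by simp
qed (use assms in simp)

end

text \<open>The coordinate expression of a map into \<open>X\<close> all of whose jets over
  \<open>S\<close> are regular in the chart. The jets at varying \<open>t\<close> give a map
  \<open>pcoord s c g\<close> into the coordinate domain, along which operators become ordinary
  differentiation in \<open>t\<close>.\<close>

locale jet_curve = jet_domain c s + frame "Xof c g" S
  for c :: "('x, 'n::finite, 'N::finite) split_chart" and s :: nat
    and g :: "real^'n \<Rightarrow> real^'N" and S :: "(real^'n) set" +
  assumes smooth_g: "\<And>A. smooth_map S (\<lambda>t. g t $ A)" and g_in: "\<And>t. t \<in> S \<Longrightarrow> g t \<in> cmap c ` cdom c"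
begin

lemma smooth_pcoord: "smooth_map S (\<lambda>t. pcoord s c g t k)"
proof (cases "k \<in> P_labels s c")
  case True
  then show ?thesis
  proof (cases rule: P_labels_cases)
    case (1 i)
    then show ?thesis using smooth_g[of "ind c i"] by (simp add: Xof_def)
  next
    case (2 \<sigma> M)
    then show ?thesis using smooth_Bops[OF smooth_g, of "arrange M" \<sigma>] by (simp add: pcoord_Inr)
  qed
qed (simp add: pcoord_def smooth_const)

lemma pcoord_in_domain: "t \<in> S \<Longrightarrow> pcoord s c g t \<in> P_domain s c"
  by (rule pcoord_in[OF g_in])

lemma smooth_on_curve:
  "csmooth_on (P_labels s c) (P_domain s c) G \<Longrightarrow> smooth_map S (\<lambda>t. G (pcoord s c g t))"
  by (rule smooth_csmooth_compose[OF _ open_S pcoord_in_domain smooth_pcoord])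

lemma Bop_on_curve:
  assumes G: "csmooth_on (P_labels s c) (P_domain s c) G" and t: "t \<in> S"
  shows "Bop (Xof c g) i (\<lambda>t. G (pcoord s c g t)) t =
    (\<Sum>k\<in>P_labels s c. cpartial k G (pcoord s c g t) * Bop (Xof c g) i (\<lambda>t. pcoord s c g t k) t)"
proof -
  have "pd j (\<lambda>t. G (pcoord s c g t)) t =
    (\<Sum>k\<in>P_labels s c. cpartial k G (pcoord s c g t) * pd j (\<lambda>t. pcoord s c g t k) t)" for j
    by (rule pd_chain(1)[OF csmooth_C1[OF G] open_S t pcoord_in_domain smooth_diffable[OF smooth_pcoord t]])
  then show ?thesis unfolding Bop_def
    by (simp add: sum_distrib_left mult_ac) (rule sum.swap)
qed

lemma Bop_pcoord:
  assumes t: "t \<in> S"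
  shows "Bop (Xof c g) i (\<lambda>t. pcoord s c g t (Inl j)) t = (if i = j then 1 else 0)"
    and "\<sigma> \<in> dep c \<Longrightarrow> size M < s \<Longrightarrow>
      Bop (Xof c g) i (\<lambda>t. pcoord s c g t (Inr (\<sigma>, M))) t = pcoord s c g t (Inr (\<sigma>, add_mset i M))"
proof -
  show "Bop (Xof c g) i (\<lambda>t. pcoord s c g t (Inl j)) t = (if i = j then 1 else 0)"
    using Bop_X[OF t] by simp
  assume "\<sigma> \<in> dep c" "size M < s"
  then show "Bop (Xof c g) i (\<lambda>t. pcoord s c g t (Inr (\<sigma>, M))) t = pcoord s c g t (Inr (\<sigma>, add_mset i M))"
    using Bops_mset[OF smooth_g _ t, of "i # arrange M" "arrange (add_mset i M)" \<sigma>]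
    by (simp add: pcoord_Inr)
qed

text \<open>The chain rule along the curve. The frame derivative of a coordinate with multiset
  \<open>M\<close> is the coordinate with \<open>i\<close> added, and the terms with
  \<open>size M = s\<close>, which \<open>Dloc\<close> lacks, vanish because \<open>G\<close> has
  order below \<open>s\<close>.\<close>

lemma Dloc_pcoord:
  assumes G: "csmooth_on (P_labels s c) (P_domain s c) G" "order_le d G" "d < s" and t: "t \<in> S"
  shows "Dloc s c i G (pcoord s c g t) = Bop (Xof c g) i (\<lambda>t. G (pcoord s c g t)) t"
proof -
  let ?z = "pcoord s c g t"
  have "(\<Sum>M | size M \<le> s. cpartial (Inr (\<sigma>, M)) G ?z * Bop (Xof c g) i (\<lambda>t. pcoord s c g t (Inr (\<sigma>, M))) t) =
    (\<Sum>J | length J \<le> s - 1. ?z (Inr (\<sigma>, mset (i # J))) * (jweight J * cpartial (Inr (\<sigma>, mset J)) G ?z))"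
    if \<sigma>: "\<sigma> \<in> dep c" for \<sigma>
  proof -
    have "(\<Sum>M | size M \<le> s. cpartial (Inr (\<sigma>, M)) G ?z * Bop (Xof c g) i (\<lambda>t. pcoord s c g t (Inr (\<sigma>, M))) t) =
      (\<Sum>M | size M \<le> s - 1. cpartial (Inr (\<sigma>, M)) G ?z * ?z (Inr (\<sigma>, add_mset i M)))"
    proof (rule sum.mono_neutral_cong_right)
      show "\<forall>M\<in>{M. size M \<le> s} - {M. size M \<le> s - 1}.
        cpartial (Inr (\<sigma>, M)) G ?z * Bop (Xof c g) i (\<lambda>t. pcoord s c g t (Inr (\<sigma>, M))) t = 0"
        using order_le_cpartial_0[OF G(2) _ _ pcoord_in_domain[OF t]] \<sigma> G(3) by auto
    next
      fix M assume "M \<in> {M :: 'n multiset. size M \<le> s - 1}"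
      then show "cpartial (Inr (\<sigma>, M)) G ?z * Bop (Xof c g) i (\<lambda>t. pcoord s c g t (Inr (\<sigma>, M))) t =
        cpartial (Inr (\<sigma>, M)) G ?z * ?z (Inr (\<sigma>, add_mset i M))"
        using Bop_pcoord(2)[OF t \<sigma>, of M i] G(3) by simp
    qed (auto simp: finite_msets_size_le)
    also have "\<dots> = (\<Sum>J | length J \<le> s - 1. jweight J * (cpartial (Inr (\<sigma>, mset J)) G ?z * ?z (Inr (\<sigma>, add_mset i (mset J)))))"
      by (rule sum_jweight[symmetric])
    finally show ?thesis by (simp add: mult_ac)
  qed
  moreover have "(\<Sum>j\<in>UNIV. cpartial (Inl j) G ?z * Bop (Xof c g) i (\<lambda>t. pcoord s c g t (Inl j)) t) = cpartial (Inl i) G ?z"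
    by (simp add: Bop_X[OF t] if_distrib cong: if_cong)
  ultimately show ?thesis
    unfolding Bop_on_curve[OF G(1) t] sum_P_labels Dloc_def by simp
qed

lemma Dlocs_pcoord:
  assumes G: "csmooth_on (P_labels s c) (P_domain s c) G" "order_le d G"
  shows "d + length J \<le> s \<Longrightarrow> t \<in> S \<Longrightarrow>
    foldr (Dloc s c) J G (pcoord s c g t) = foldr (Bop (Xof c g)) J (\<lambda>t. G (pcoord s c g t)) t"
proof (induction J arbitrary: t)
  case (Cons i J)
  have "Dloc s c i (foldr (Dloc s c) J G) (pcoord s c g t) =
    Bop (Xof c g) i (\<lambda>t. foldr (Dloc s c) J G (pcoord s c g t)) t"
    using Dlocs_regular[OF G, of J] Cons.prems by (intro Dloc_pcoord[of _ "d + length J"]) auto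
  also have "\<dots> = Bop (Xof c g) i (foldr (Bop (Xof c g)) J (\<lambda>t. G (pcoord s c g t))) t"
    by (rule Bop_cong[OF open_S Cons.prems(2) refl Cons.IH]) (use Cons.prems in auto)
  finally show ?case by simp
qed simp

end

definition EL_loc :: "nat \<Rightarrow> nat \<Rightarrow> ('x, 'n::finite, 'N::finite) split_chart \<Rightarrow> 'N \<Rightarrow>
    (('n + 'N \<times> 'n multiset \<Rightarrow> real) \<Rightarrow> real) \<Rightarrow> ('n + 'N \<times> 'n multiset \<Rightarrow> real) \<Rightarrow> real" where
  "EL_loc r s c \<sigma> F z = (\<Sum>J | length J \<le> r. (-1) ^ length J *
     foldr (Dloc s c) J (\<lambda>z. jweight J * cpartial (Inr (\<sigma>, mset J)) F z) z)"

context jet_curve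
begin

lemma Bop_cmult: "f differentiable at t \<Longrightarrow> Bop X i (\<lambda>t. a * f t) t = a * Bop X i f t"
  by (simp add: Bop_def pd_cmult sum_distrib_left mult_ac)

lemma order_le_mult:
  assumes "order_le d F"
  shows "order_le d (\<lambda>z. a * F z)"
  unfolding order_le_def
proof (intro ballI impI)
  fix z z' assume "z \<in> P_domain s c" "z' \<in> P_domain s c" "\<forall>k\<in>P_labels d c. z k = z' k"
  then have "F z = F z'" by (intro order_leD[OF assms]) auto
  then show "a * F z = a * F z'" by simp
qed

lemma Bops_cmult:
  assumes "smooth_map S h"
  shows "t \<in> S \<Longrightarrow> foldr (Bop (Xof c g)) J (\<lambda>t. a * h t) t = a * foldr (Bop (Xof c g)) J h t"
proof (induction J arbitrary: t)
  case (Cons i J)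
  have "Bop (Xof c g) i (foldr (Bop (Xof c g)) J (\<lambda>t. a * h t)) t = Bop (Xof c g) i (\<lambda>t. a * foldr (Bop (Xof c g)) J h t) t"
    by (rule Bop_cong[OF open_S Cons.prems refl Cons.IH])
  also have "\<dots> = a * Bop (Xof c g) i (foldr (Bop (Xof c g)) J h) t"
    by (rule Bop_cmult[OF smooth_diffable[OF smooth_Bops[OF assms] Cons.prems]])
  finally show ?case by simp
qed simp

text \<open>The right side is shaped to match the output of \<open>has_adj_density_Bops\<close>: one
  term per multiset and a reversed list of derivatives. Rearrangements of \<open>J\<close>
  contribute equally because frame derivatives commute, and the weights turn them into one
  term.\<close>

lemma EL_loc_pcoord:
  assumes F: "csmooth_on (P_labels s c) (P_domain s c) F" "order_le r F" and s: "2 * r \<le> s"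
    and \<sigma>: "\<sigma> \<in> dep c" and t: "t \<in> S"
  shows "EL_loc r s c \<sigma> F (pcoord s c g t) =
    (\<Sum>M | size M \<le> r. (-1) ^ size M * foldr (Bop (Xof c g)) (rev (arrange M)) (\<lambda>t. cpartial (Inr (\<sigma>, M)) F (pcoord s c g t)) t)"
proof -
  let ?f = "\<lambda>M. (-1) ^ size M * foldr (Bop (Xof c g)) (rev (arrange M)) (\<lambda>t. cpartial (Inr (\<sigma>, M)) F (pcoord s c g t)) t"
  have "(-1) ^ length J * foldr (Dloc s c) J (\<lambda>z. jweight J * cpartial (Inr (\<sigma>, mset J)) F z) (pcoord s c g t) =
      jweight J * ?f (mset J)" if J: "length J \<le> r" for J
  proof -
    have lab: "Inr (\<sigma>, mset J) \<in> P_labels s c" using J s \<sigma> by simp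
    note cs = csmooth_cpartial[OF F(1) lab]
    note sm = smooth_on_curve[OF cs]
    have "foldr (Dloc s c) J (\<lambda>z. jweight J * cpartial (Inr (\<sigma>, mset J)) F z) (pcoord s c g t) =
       foldr (Bop (Xof c g)) J (\<lambda>t. jweight J * cpartial (Inr (\<sigma>, mset J)) F (pcoord s c g t)) t"
      by (rule Dlocs_pcoord[of _ r])
        (use J s t in \<open>auto intro!: csmooth_mult csmooth_const cs order_le_mult order_le_cpartial F(2) lab\<close>)
    also have "\<dots> = jweight J * foldr (Bop (Xof c g)) J (\<lambda>t. cpartial (Inr (\<sigma>, mset J)) F (pcoord s c g t)) t"
      by (rule Bops_cmult[OF sm t])
    also have "foldr (Bop (Xof c g)) J (\<lambda>t. cpartial (Inr (\<sigma>, mset J)) F (pcoord s c g t)) t =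
       foldr (Bop (Xof c g)) (rev (arrange (mset J))) (\<lambda>t. cpartial (Inr (\<sigma>, mset J)) F (pcoord s c g t)) t"
      by (rule Bops_mset[OF sm _ t]) simp
    finally show ?thesis by simp
  qed
  then have "EL_loc r s c \<sigma> F (pcoord s c g t) = (\<Sum>J | length J \<le> r. jweight J * ?f (mset J))"
    unfolding EL_loc_def by (intro sum.cong) auto
  also have "\<dots> = (\<Sum>M | size M \<le> r. ?f M)" by (rule sum_jweight)
  finally show ?thesis .
qed

end

section \<open>The first variation\<close>

text \<open>A one-parameter family of curves is a map of \<open>(\<epsilon>, t)\<close>; the parameter \<open>\<epsilon>\<close> has the label \<open>None\<close>.\<close>

definition opt :: "real \<Rightarrow> real^'n::finite \<Rightarrow> real^('n option)" where
  "opt e t = (\<chi> a. case a of None \<Rightarrow> e | Some i \<Rightarrow> t $ i)"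

lemma opt_nth [simp]: "opt e t $ None = e" "opt e t $ Some i = t $ i"
  by (simp_all add: opt_def)

lemma opt_cases: obtains e t where "p = opt e t"
proof -
  have "p = opt (p $ None) (\<chi> i. p $ Some i)"
    by (auto simp: vec_eq_iff opt_def split: option.split)
  then show ?thesis by (rule that)
qed

lemma sum_UNIV_option: "(\<Sum>a\<in>UNIV. f a) = f None + (\<Sum>i\<in>UNIV. f (Some i))"
  for f :: "'n::finite option \<Rightarrow> real"
  unfolding UNIV_option_conv by (subst sum.insert) (auto simp: sum.reindex)

lemma smooth_opt: "smooth_map S (\<lambda>t. opt e t $ a)"
  by (cases a) (simp_all add: smooth_const smooth_coord)

lemma open_slice:
  assumes "open R"
  shows "open {t. opt e t \<in> R}"
proof -
  have "continuous_on UNIV (opt e :: real^'a \<Rightarrow> _)"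
    unfolding opt_def
  proof (rule continuous_on_vec_lambda)
    fix a :: "'a option"
    show "continuous_on UNIV (\<lambda>t :: real^'a. case a of None \<Rightarrow> e | Some i \<Rightarrow> t $ i)"
      by (cases a) (auto intro!: continuous_intros)
  qed
  then show ?thesis using open_vimage[OF assms] by (simp add: vimage_def)
qed

lemma pd_slice:
  assumes "h differentiable at (opt e t)"
  shows "pd j (\<lambda>t. h (opt e t)) t = pd (Some j) h (opt e t)"
proof -
  have "pd j (\<lambda>t. h (opt e t)) t = (\<Sum>k\<in>UNIV. pd k h (opt e t) * pd j (\<lambda>t. opt e t $ k) t)"
    by (rule pd_compose[OF assms smooth_diffable[OF smooth_opt[of UNIV e] UNIV_I]])
  also have "\<dots> = pd (Some j) h (opt e t)"
    by (simp add: sum_UNIV_option pd_coord if_distrib cong: if_cong)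
  finally show ?thesis .
qed

text \<open>\<open>R\<close> is an arbitrary open set, not a product: staying in the chart and
  staying regular are open conditions, and the range of admissible \<open>\<epsilon>\<close> may
  depend on \<open>t\<close>.\<close>

locale jet_family = jet_domain c s for c :: "('x, 'n::finite, 'N::finite) split_chart" and s :: nat +
  fixes G :: "real^('n option) \<Rightarrow> real^'N" and R :: "(real^('n option)) set"
  assumes open_R: "open R" and smooth_G: "\<And>A. smooth_map R (\<lambda>p. G p $ A)"
    and G_in: "\<And>p. p \<in> R \<Longrightarrow> G p \<in> cmap c ` cdom c"
    and slice_det: "\<And>e t. opt e t \<in> R \<Longrightarrow> det (fmat (Xof c (\<lambda>t. G (opt e t))) t) \<noteq> 0"
begin

text \<open>Since \<open>\<epsilon>\<close> itself is a member of the extended frame, the \<open>\<epsilon>\<close>-derivative at fixed \<open>x\<^sup>i\<close>, which is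
  \<open>Bop Xe None\<close>, commutes with the total derivatives.\<close>

definition Xe :: "'n option \<Rightarrow> real^('n option) \<Rightarrow> real" where
  "Xe a p = (case a of None \<Rightarrow> p $ None | Some i \<Rightarrow> G p $ ind c i)"

lemma Xe_simps [simp]: "Xe None = (\<lambda>p. p $ None)" "Xe (Some i) = (\<lambda>p. G p $ ind c i)"
  by (simp_all add: Xe_def fun_eq_iff)

lemma smooth_slice:
  assumes "smooth_map R h"
  shows "smooth_map {t. opt e t \<in> R} (\<lambda>t. h (opt e t) :: real)"
proof (rule smooth_compose)
  show "open {t. opt e t \<in> R}" by (rule open_slice[OF open_R])
  show "smooth_map {t. opt e t \<in> R} (\<lambda>t. opt e t $ k)" for k by (rule smooth_opt)
  show "smooth_map R h" by (rule assms)
qed auto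

definition Am :: "real^('n option) \<Rightarrow> real^'n^'n" where
  "Am p = (\<chi> i j. pd (Some j) (\<lambda>p. G p $ ind c i) p)"

lemma Am_slice:
  assumes "opt e t \<in> R"
  shows "Am (opt e t) = fmat (Xof c (\<lambda>t. G (opt e t))) t"
  using pd_slice[OF smooth_diffable[OF smooth_G assms]]
  by (simp add: Am_def vec_eq_iff Xof_def[abs_def])

lemma Am_det: "p \<in> R \<Longrightarrow> det (Am p) \<noteq> 0"
  by (cases p rule: opt_cases) (simp add: Am_slice slice_det)

text \<open>The inverse of the block triangular Jacobian of \<open>Xe\<close>. Its rows are
  \<open>(1, 0)\<close> and \<open>(b, A)\<close> with \<open>b\<close> the
  \<open>\<epsilon>\<close>-derivative of the independent components, so the inverse has rows
  \<open>(1, 0)\<close> and \<open>(- A^-1 b, A^-1)\<close>.\<close>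

definition Minv :: "real^('n option) \<Rightarrow> real^('n option)^('n option)" where
  "Minv p = (\<chi> a b. case a of
     None \<Rightarrow> (if b = None then 1 else 0)
   | Some l \<Rightarrow> (case b of None \<Rightarrow> - (\<Sum>m\<in>UNIV. matrix_inv (Am p) $ l $ m * pd None (\<lambda>p. G p $ ind c m) p)
       | Some m \<Rightarrow> matrix_inv (Am p) $ l $ m))"

lemma fmat_Minv:
  assumes p: "p \<in> R"
  shows "fmat Xe p ** Minv p = mat 1"
proof (rule matrix_mult_eq_1I)
  fix a b
  note inv = matrix_inv_sum(2)[OF Am_det[OF p]]
  show "(\<Sum>k\<in>UNIV. fmat Xe p $ a $ k * Minv p $ k $ b) = (if a = b then 1 else 0)"
  proof (cases a)
    case None
    then show ?thesis by (auto simp: sum_UNIV_option pd_coord Minv_def)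
  next
    case (Some i)
    have A: "pd (Some k) (\<lambda>p. G p $ ind c i) p = Am p $ i $ k" for k by (simp add: Am_def)
    show ?thesis
    proof (cases b)
      case None
      have "(\<Sum>k\<in>UNIV. Am p $ i $ k * (\<Sum>m\<in>UNIV. matrix_inv (Am p) $ k $ m * pd None (\<lambda>p. G p $ ind c m) p)) =
        (\<Sum>m\<in>UNIV. (\<Sum>k\<in>UNIV. Am p $ i $ k * matrix_inv (Am p) $ k $ m) * pd None (\<lambda>p. G p $ ind c m) p)"
        by (simp add: sum_distrib_left sum_distrib_right mult_ac) (rule sum.swap)
      also have "\<dots> = pd None (\<lambda>p. G p $ ind c i) p"
        by (simp add: inv if_distrib[of "\<lambda>x. x * _"] cong: if_cong)
      finally show ?thesis using None Some by (simp add: sum_UNIV_option Minv_def A sum_negf)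
    next
      case (Some m)
      with \<open>a = Some i\<close> show ?thesis by (simp add: sum_UNIV_option Minv_def A inv)
    qed
  qed
qed

sublocale ext: frame Xe R
proof
  show "smooth_map R (Xe a)" for a by (cases a) (simp_all add: smooth_coord smooth_G)
  show "det (fmat Xe p) \<noteq> 0" if "p \<in> R" for p by (rule matrix_inv_unique(2)[OF fmat_Minv[OF that]])
qed (rule open_R)

lemma inv_Xe: "p \<in> R \<Longrightarrow> matrix_inv (fmat Xe p) = Minv p"
  by (rule matrix_inv_unique(1)[OF fmat_Minv, symmetric])

definition Jh :: "real^('n option) \<Rightarrow> real" where "Jh p = det (Am p)"

lemma smooth_Jh: "smooth_map R Jh"
  unfolding Jh_def[abs_def] by (rule smooth_det[OF open_R]) (simp add: Am_def smooth_pd smooth_G)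

text \<open>The density condition of \<open>piola\<close> for the extended frame. The entries with
  label \<open>None\<close> contribute nothing: the second derivatives of the coordinate
  \<open>\<epsilon>\<close> vanish, and the first row of the inverse is \<open>(1, 0)\<close>. So
  \<open>Jh\<close>, the determinant of the slice alone, is an admissible density.\<close>

lemma pd_Jh:
  assumes p: "p \<in> R"
  shows "pd k Jh p = Jh p * (\<Sum>l\<in>UNIV. \<Sum>m\<in>UNIV. matrix_inv (fmat Xe p) $ l $ m * pd k (pd l (Xe m)) p)"
proof -
  have "pd k Jh p = Jh p * (\<Sum>l\<in>UNIV. \<Sum>m\<in>UNIV. matrix_inv (Am p) $ l $ m * pd k (\<lambda>p. Am p $ m $ l) p)"
    unfolding Jh_def[abs_def]
    by (rule pd_det[where M = Am, OF _ Am_det[OF p]]) (simp add: Am_def smooth_diffable[OF smooth_pd[OF smooth_G] p])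
  moreover have "(\<lambda>p. Am p $ m $ l) = pd (Some l) (Xe (Some m))" for l m
    by (simp add: Am_def)
  ultimately show ?thesis
    by (simp add: inv_Xe[OF p] Minv_def sum_UNIV_option pd_coord)
qed

text \<open>The fields with label \<open>Some i\<close> are tangent to the slices, because
  \<open>\<epsilon>\<close> has no derivative in the \<open>t\<close> directions.\<close>

lemma Bop_slice:
  assumes h: "smooth_map R h" and p: "opt e t \<in> R"
  shows "Bop Xe (Some i) h (opt e t) = Bop (Xof c (\<lambda>t. G (opt e t))) i (\<lambda>t. h (opt e t)) t"
proof (rule Bop_unique[OF slice_det[OF p], symmetric])
  fix j
  have "pd (Some j) h (opt e t) = (\<Sum>a\<in>UNIV. pd (Some j) (Xe a) (opt e t) * Bop Xe a h (opt e t))"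
    by (rule pd_eq_Bop[OF ext.det_nz[OF p]])
  also have "\<dots> = (\<Sum>i\<in>UNIV. pd j (\<lambda>t. G (opt e t) $ ind c i) t * Bop Xe (Some i) h (opt e t))"
    by (simp add: sum_UNIV_option pd_coord pd_slice[OF smooth_diffable[OF smooth_G p]])
  finally show "(\<Sum>i\<in>UNIV. pd j (Xof c (\<lambda>t. G (opt e t)) i) t * Bop Xe (Some i) h (opt e t)) = pd j (\<lambda>t. h (opt e t)) t"
    by (simp add: Xof_def[abs_def] pd_slice[OF smooth_diffable[OF h p]])
qed

lemma Bops_slice:
  assumes h: "smooth_map R h"
  shows "opt e t \<in> R \<Longrightarrow> foldr (Bop Xe) (map Some I) h (opt e t) =
    foldr (Bop (Xof c (\<lambda>t. G (opt e t)))) I (\<lambda>t. h (opt e t)) t"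
proof (induction I arbitrary: t)
  case (Cons i I)
  have "Bop Xe (Some i) (foldr (Bop Xe) (map Some I) h) (opt e t) =
    Bop (Xof c (\<lambda>t. G (opt e t))) i (\<lambda>t. foldr (Bop Xe) (map Some I) h (opt e t)) t"
    by (rule Bop_slice[OF ext.smooth_Bops[OF h] Cons.prems])
  also have "\<dots> = Bop (Xof c (\<lambda>t. G (opt e t))) i (foldr (Bop (Xof c (\<lambda>t. G (opt e t)))) I (\<lambda>t. h (opt e t))) t"
    by (rule Bop_cong[OF open_slice[OF open_R, of e] _ refl]) (use Cons in auto)
  finally show ?case by simp
qed simp

text \<open>The coordinates of the jet at \<open>(\<epsilon>, t)\<close>, written with the extended
  frame rather than slice by slice, so that joint smoothness and commutation with
  \<open>Bop Xe None\<close> are immediate; \<open>zh_slice\<close> recovers the coordinates of each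
  slice.\<close>

definition zh :: "real^('n option) \<Rightarrow> 'n + 'N \<times> 'n multiset \<Rightarrow> real" where
  "zh p k = (if k \<in> P_labels s c then (case k of Inl i \<Rightarrow> G p $ ind c i
     | Inr (\<sigma>, M) \<Rightarrow> foldr (Bop Xe) (map Some (arrange M)) (\<lambda>p. G p $ \<sigma>) p) else 0)"

lemma zh_slice:
  assumes "opt e t \<in> R"
  shows "zh (opt e t) = pcoord s c (\<lambda>t. G (opt e t)) t"
proof
  fix k
  show "zh (opt e t) k = pcoord s c (\<lambda>t. G (opt e t)) t k"
    by (cases k) (auto simp: zh_def pcoord_def Xof_def Bops_slice[OF smooth_G assms])
qed

lemma zh_in: "p \<in> R \<Longrightarrow> zh p \<in> P_domain s c"
  by (cases p rule: opt_cases) (simp add: zh_slice pcoord_in G_in)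

lemma smooth_zh: "smooth_map R (\<lambda>p. zh p k)"
proof (cases "k \<in> P_labels s c")
  case True
  then show ?thesis
    by (cases rule: P_labels_cases) (simp_all add: zh_def smooth_G ext.smooth_Bops[OF smooth_G])
qed (simp add: zh_def smooth_const)

text \<open>\<open>Bop Xe None\<close> annihilates the independent coordinates and commutes with
  total derivatives, so it differentiates \<open>F\<close> only through the dependent coordinates.
  By the Piola identity its product with \<open>Jh\<close> is a full divergence in
  \<open>(\<epsilon>, t)\<close>, whose \<open>\<epsilon>\<close> component is
  \<open>Jh * F\<close>. Solving for this component leaves a divergence in \<open>t\<close>.\<close>

lemma first_variation:
  assumes F: "csmooth_on (P_labels s c) (P_domain s c) F" and p: "opt e t \<in> R"
  shows "pd None (\<lambda>p. Jh p * F (zh p)) (opt e t) =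
    Jh (opt e t) * (\<Sum>\<sigma>\<in>dep c. \<Sum>M | size M \<le> s. cpartial (Inr (\<sigma>, M)) F (zh (opt e t)) *
      foldr (Bop (Xof c (\<lambda>t. G (opt e t)))) (arrange M) (\<lambda>t. Bop Xe None (\<lambda>p. G p $ \<sigma>) (opt e t)) t)
    - (\<Sum>k\<in>UNIV. pd k (\<lambda>t. Jh (opt e t) * Minv (opt e t) $ Some k $ None * F (zh (opt e t))) t)"
proof -
  let ?p = "opt e t"
  let ?rhs = "\<Sum>\<sigma>\<in>dep c. \<Sum>M | size M \<le> s. cpartial (Inr (\<sigma>, M)) F (zh ?p) *
      foldr (Bop (Xof c (\<lambda>t. G (opt e t)))) (arrange M) (\<lambda>t. Bop Xe None (\<lambda>p. G p $ \<sigma>) (opt e t)) t"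
  have Fs: "smooth_map R (\<lambda>p. F (zh p))"
    by (rule smooth_csmooth_compose[OF F open_R zh_in smooth_zh])
  have "pd j (\<lambda>p. F (zh p)) ?p = (\<Sum>k\<in>P_labels s c. cpartial k F (zh ?p) * pd j (\<lambda>p. zh p k) ?p)" for j
    by (rule pd_chain(1)[OF csmooth_C1[OF F] open_R p zh_in smooth_diffable[OF smooth_zh p]])
  then have "Bop Xe None (\<lambda>p. F (zh p)) ?p = (\<Sum>k\<in>P_labels s c. cpartial k F (zh ?p) * Bop Xe None (\<lambda>p. zh p k) ?p)"
    unfolding Bop_def by (simp add: sum_distrib_left mult_ac) (rule sum.swap)
  also have "\<dots> = (\<Sum>\<sigma>\<in>dep c. \<Sum>M | size M \<le> s. cpartial (Inr (\<sigma>, M)) F (zh ?p) * Bop Xe None (\<lambda>p. zh p (Inr (\<sigma>, M))) ?p)"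
  proof -
    have "Bop Xe None (\<lambda>p. zh p (Inl i)) ?p = 0" for i
      using ext.Bop_X[OF p, of None "Some i"] by (simp add: zh_def)
    then show ?thesis unfolding sum_P_labels by simp
  qed
  also have "\<dots> = ?rhs"
  proof (intro sum.cong refl)
    fix \<sigma> M assume "\<sigma> \<in> dep c" "M \<in> {M :: 'n multiset. size M \<le> s}"
    then have "Bop Xe None (\<lambda>p. zh p (Inr (\<sigma>, M))) ?p =
        Bop Xe None (foldr (Bop Xe) (map Some (arrange M)) (\<lambda>p. G p $ \<sigma>)) ?p"
      by (simp add: zh_def)
    also have "\<dots> = foldr (Bop Xe) (map Some (arrange M)) (Bop Xe None (\<lambda>p. G p $ \<sigma>)) ?p"
      by (rule ext.Bops_Bop_commute[OF smooth_G p, symmetric])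
    also have "\<dots> = foldr (Bop (Xof c (\<lambda>t. G (opt e t)))) (arrange M) (\<lambda>t. Bop Xe None (\<lambda>p. G p $ \<sigma>) (opt e t)) t"
      by (rule Bops_slice[OF ext.smooth_Bop[OF smooth_G] p])
    finally show "cpartial (Inr (\<sigma>, M)) F (zh ?p) * Bop Xe None (\<lambda>p. zh p (Inr (\<sigma>, M))) ?p =
      cpartial (Inr (\<sigma>, M)) F (zh ?p) *
      foldr (Bop (Xof c (\<lambda>t. G (opt e t)))) (arrange M) (\<lambda>t. Bop Xe None (\<lambda>p. G p $ \<sigma>) (opt e t)) t"
      by simp
  qed
  finally have 1: "Jh ?p * Bop Xe None (\<lambda>p. F (zh p)) ?p = Jh ?p * ?rhs" by simp
  have 2: "(\<Sum>k\<in>UNIV. pd k (\<lambda>p. Jh p * ext.B k None p * F (zh p)) ?p) = Jh ?p * Bop Xe None (\<lambda>p. F (zh p)) ?p"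
    by (rule ext.piola_mult[OF smooth_Jh pd_Jh p Fs])
  have 3: "pd None (\<lambda>p. Jh p * ext.B None None p * F (zh p)) ?p = pd None (\<lambda>p. Jh p * F (zh p)) ?p"
    by (rule pd_cong[OF open_R p]) (simp add: inv_Xe Minv_def)
  have 4: "pd (Some k) (\<lambda>p. Jh p * ext.B (Some k) None p * F (zh p)) ?p =
      pd k (\<lambda>t. Jh (opt e t) * Minv (opt e t) $ Some k $ None * F (zh (opt e t))) t" for k
  proof -
    have "smooth_map R (\<lambda>p. Jh p * ext.B (Some k) None p * F (zh p))"
      by (rule smooth_mult[OF open_R smooth_mult[OF open_R smooth_Jh ext.smooth_B] Fs])
    then have "pd (Some k) (\<lambda>p. Jh p * ext.B (Some k) None p * F (zh p)) ?p =
      pd k (\<lambda>t. Jh (opt e t) * ext.B (Some k) None (opt e t) * F (zh (opt e t))) t"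
      by (rule pd_slice[OF smooth_diffable[OF _ p], symmetric])
    also have "\<dots> = pd k (\<lambda>t. Jh (opt e t) * Minv (opt e t) $ Some k $ None * F (zh (opt e t))) t"
      by (rule pd_cong[OF open_slice[OF open_R, of e]]) (use p inv_Xe in auto)
    finally show ?thesis .
  qed
  show ?thesis using 1 2 unfolding sum_UNIV_option 3 4 by linarith
qed

end

section \<open>The variation operator along a curve\<close>

context jet_curve
begin

definition Jd :: "real^'n \<Rightarrow> real" where "Jd t = det (fmat (Xof c g) t)"

lemma smooth_Jd: "smooth_map S Jd"
  unfolding Jd_def[abs_def] by (rule smooth_det[OF open_S]) (simp add: smooth_pd smooth_X)

lemma pd_Jd: "t \<in> S \<Longrightarrow> pd k Jd t = Jd t * (\<Sum>l\<in>UNIV. \<Sum>m\<in>UNIV. B l m t * pd k (pd l (Xof c g m)) t)"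
  unfolding Jd_def[abs_def]
  by (subst pd_det) (simp_all add: smooth_diffable[OF smooth_pd[OF smooth_X]] det_nz)

text \<open>\<open>vert \<xi>\<close> is the variation \<open>\<xi>\<close> at fixed \<open>x\<^sup>i\<close> instead of fixed parameter \<open>t\<close>.\<close>

definition vert :: "('N \<Rightarrow> real^'n \<Rightarrow> real) \<Rightarrow> 'N \<Rightarrow> real^'n \<Rightarrow> real" where
  "vert \<xi> \<sigma> t = \<xi> \<sigma> t - (\<Sum>m\<in>UNIV. \<xi> (ind c m) t * Bop (Xof c g) m (\<lambda>t. g t $ \<sigma>) t)"

text \<open>The horizontal part of \<open>\<xi>\<close>, written as a vector field in the
  parameters, times the Lagrangian density. It comes from the entries of \<open>Minv\<close> in the
  column \<open>None\<close>, whose minus sign cancels the one in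
  \<open>first_variation\<close>.\<close>

definition flux :: "(('n + 'N \<times> 'n multiset \<Rightarrow> real) \<Rightarrow> real) \<Rightarrow> ('N \<Rightarrow> real^'n \<Rightarrow> real) \<Rightarrow> 'n \<Rightarrow> real^'n \<Rightarrow> real" where
  "flux F \<xi> k t = Jd t * (\<Sum>m\<in>UNIV. B k m t * \<xi> (ind c m) t) * F (pcoord s c g t)"

text \<open>The right side of \<open>first_variation\<close> at \<open>\<epsilon> = 0\<close> for
  any family with initial velocity \<open>\<xi> * \<phi>\<close>. It refers to the curve only and is
  a linear differential operator in \<open>\<phi>\<close>.\<close>

definition variation :: "(('n + 'N \<times> 'n multiset \<Rightarrow> real) \<Rightarrow> real) \<Rightarrow> ('N \<Rightarrow> real^'n \<Rightarrow> real) \<Rightarrow>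
    (real^'n \<Rightarrow> real) \<Rightarrow> real^'n \<Rightarrow> real" where
  "variation F \<xi> \<phi> t =
    (\<Sum>\<sigma>\<in>dep c. \<Sum>M | size M \<le> s. Jd t * cpartial (Inr (\<sigma>, M)) F (pcoord s c g t) *
      foldr (Bop (Xof c g)) (arrange M) (\<lambda>t. vert \<xi> \<sigma> t * \<phi> t) t)
    + (\<Sum>k\<in>UNIV. pd k (\<lambda>t. flux F \<xi> k t * \<phi> t) t)"

lemma smooth_vert: "(\<And>A. smooth_map S (\<xi> A)) \<Longrightarrow> smooth_map S (vert \<xi> \<sigma>)"
  unfolding vert_def[abs_def]
  by (intro smooth_diff smooth_sum smooth_mult open_S smooth_Bop smooth_g)

lemma smooth_flux:
  assumes F: "csmooth_on (P_labels s c) (P_domain s c) F" and \<xi>: "\<And>A. smooth_map S (\<xi> A)"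
  shows "smooth_map S (flux F \<xi> k)"
  unfolding flux_def[abs_def]
  by (intro smooth_mult[OF open_S] smooth_sum[OF open_S] smooth_Jd smooth_B \<xi> smooth_on_curve[OF F])

text \<open>The flux term is a divergence and contributes \<open>0\<close>. Integration by parts
  turns the remaining terms into the Euler--Lagrange expressions, after the terms of order above
  \<open>r\<close> are dropped.\<close>

lemma has_adj_variation:
  assumes F: "csmooth_on (P_labels s c) (P_domain s c) F" "order_le r F" and s: "2 * r \<le> s"
    and \<xi>: "\<And>A. smooth_map S (\<xi> A)"
  shows "has_adj S (variation F \<xi>) (\<lambda>t. Jd t * (\<Sum>\<sigma>\<in>dep c. vert \<xi> \<sigma> t * EL_loc r s c \<sigma> F (pcoord s c g t)))"
proof -
  have Fc: "smooth_map S (\<lambda>t. cpartial (Inr (\<sigma>, M)) F (pcoord s c g t))" if "\<sigma> \<in> dep c" "size M \<le> s" for \<sigma> M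
    by (rule smooth_on_curve[OF csmooth_cpartial[OF F(1)]]) (use that in simp)
  have 0: "has_adj S (\<lambda>\<phi> t. Jd t * cpartial (Inr (\<sigma>, M)) F (pcoord s c g t) *
      foldr (Bop (Xof c g)) (arrange M) (\<lambda>t. vert \<xi> \<sigma> t * \<phi> t) t)
     (\<lambda>t. (-1) ^ length (arrange M) * Jd t * vert \<xi> \<sigma> t *
       foldr (Bop (Xof c g)) (rev (arrange M)) (\<lambda>t. cpartial (Inr (\<sigma>, M)) F (pcoord s c g t)) t)"
    if "\<sigma> \<in> dep c" "size M \<le> s" for \<sigma> M
    by (rule has_adj_density_Bops[OF smooth_Jd pd_Jd smooth_vert[OF \<xi>] Fc[OF that]])
  have 1: "has_adj S (\<lambda>\<phi> t. \<Sum>\<sigma>\<in>dep c. \<Sum>M | size M \<le> s. Jd t * cpartial (Inr (\<sigma>, M)) F (pcoord s c g t) *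
      foldr (Bop (Xof c g)) (arrange M) (\<lambda>t. vert \<xi> \<sigma> t * \<phi> t) t)
     (\<lambda>t. \<Sum>\<sigma>\<in>dep c. \<Sum>M | size M \<le> s. (-1) ^ length (arrange M) * Jd t * vert \<xi> \<sigma> t *
       foldr (Bop (Xof c g)) (rev (arrange M)) (\<lambda>t. cpartial (Inr (\<sigma>, M)) F (pcoord s c g t)) t)"
    by (rule has_adj_sum[OF open_S], rule has_adj_sum[OF open_S], rule 0) auto
  have "has_adj S (\<lambda>\<phi> t. flux F \<xi> k t * \<phi> t) (flux F \<xi> k)" for k
    by (rule has_adj_mult[OF open_S smooth_flux[OF F(1) \<xi>]])
  from has_adj_pd[OF open_S this]
  have 2: "has_adj S (\<lambda>\<phi> t. \<Sum>k\<in>UNIV. pd k (\<lambda>t. flux F \<xi> k t * \<phi> t) t) (\<lambda>t. \<Sum>k\<in>(UNIV :: 'n set). 0)"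
    by (rule has_adj_sum[OF open_S])
  show ?thesis
  proof (rule has_adj_cong[OF has_adj_add[OF open_S 1 2]])
    fix t assume t: "t \<in> S"
    have "(\<Sum>M | size M \<le> s. (-1) ^ length (arrange M) * Jd t * vert \<xi> \<sigma> t *
       foldr (Bop (Xof c g)) (rev (arrange M)) (\<lambda>t. cpartial (Inr (\<sigma>, M)) F (pcoord s c g t)) t) =
       Jd t * (vert \<xi> \<sigma> t * EL_loc r s c \<sigma> F (pcoord s c g t))" if \<sigma>: "\<sigma> \<in> dep c" for \<sigma>
    proof -
      have "(\<Sum>M | size M \<le> s. (-1) ^ length (arrange M) * Jd t * vert \<xi> \<sigma> t *
         foldr (Bop (Xof c g)) (rev (arrange M)) (\<lambda>t. cpartial (Inr (\<sigma>, M)) F (pcoord s c g t)) t) =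
        (\<Sum>M | size M \<le> r. Jd t * vert \<xi> \<sigma> t * ((-1) ^ size M *
         foldr (Bop (Xof c g)) (rev (arrange M)) (\<lambda>t. cpartial (Inr (\<sigma>, M)) F (pcoord s c g t)) t))"
      proof (rule sum.mono_neutral_cong_right)
        show "\<forall>M\<in>{M. size M \<le> s} - {M. size M \<le> r}. (-1) ^ length (arrange M) * Jd t * vert \<xi> \<sigma> t *
         foldr (Bop (Xof c g)) (rev (arrange M)) (\<lambda>t. cpartial (Inr (\<sigma>, M)) F (pcoord s c g t)) t = 0"
        proof
          fix M :: "'n multiset" assume M: "M \<in> {M. size M \<le> s} - {M. size M \<le> r}"
          \<comment> \<open>Zero is written as a product so that \<open>Bops_cmult\<close> can
            extract a factor \<open>0\<close> from the iterated derivative.\<close>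
          have 0: "cpartial (Inr (\<sigma>, M)) F (pcoord s c g u) = 0 * 0" if "u \<in> S" for u
            using order_le_cpartial_0[OF F(2) _ _ pcoord_in_domain[OF that], of "Inr (\<sigma>, M)"] M \<sigma> by simp
          have "foldr (Bop (Xof c g)) (rev (arrange M)) (\<lambda>t. cpartial (Inr (\<sigma>, M)) F (pcoord s c g t)) t =
            foldr (Bop (Xof c g)) (rev (arrange M)) (\<lambda>t. 0 * 0) t"
            by (rule Bops_cong[OF open_S refl 0 t])
          also have "\<dots> = 0 * foldr (Bop (Xof c g)) (rev (arrange M)) (\<lambda>t. 0) t"
            by (rule Bops_cmult[OF smooth_const t])
          finally show "(-1) ^ length (arrange M) * Jd t * vert \<xi> \<sigma> t *
            foldr (Bop (Xof c g)) (rev (arrange M)) (\<lambda>t. cpartial (Inr (\<sigma>, M)) F (pcoord s c g t)) t = 0"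
            by simp
        qed
      qed (use s in \<open>auto simp: finite_msets_size_le\<close>)
      then show ?thesis unfolding EL_loc_pcoord[OF F s \<sigma> t] by (simp add: sum_distrib_left mult_ac)
    qed
    then show "(\<Sum>\<sigma>\<in>dep c. \<Sum>M | size M \<le> s. (-1) ^ length (arrange M) * Jd t * vert \<xi> \<sigma> t *
       foldr (Bop (Xof c g)) (rev (arrange M)) (\<lambda>t. cpartial (Inr (\<sigma>, M)) F (pcoord s c g t)) t) + (\<Sum>k\<in>(UNIV :: 'n set). 0) =
       Jd t * (\<Sum>\<sigma>\<in>dep c. vert \<xi> \<sigma> t * EL_loc r s c \<sigma> F (pcoord s c g t))"
      by (simp add: sum_distrib_left)
  qed (simp add: variation_def)
qed

text \<open>Only the initial curve and the initial velocity of the family enter, so families built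
  in different charts can be compared through their \<open>\<epsilon>\<close>-derivatives
  alone.\<close>

lemma variation_family:
  assumes fam: "jet_family c G R" and F: "csmooth_on (P_labels s c) (P_domain s c) F"
    and \<xi>: "\<And>A. smooth_map S (\<xi> A)" and \<phi>: "smooth_map UNIV \<phi>"
    and G0: "\<And>t. G (opt 0 t) = g t" and SR: "\<And>t. t \<in> S \<Longrightarrow> opt 0 t \<in> R"
    and dG: "\<And>t A. t \<in> S \<Longrightarrow> pd None (\<lambda>p. G p $ A) (opt 0 t) = \<xi> A t * \<phi> t"
    and t: "t \<in> S"
  shows "pd None (\<lambda>p. jet_family.Jh c G p * F (jet_family.zh c s G p)) (opt 0 t) = variation F \<xi> \<phi> t"
proof -
  interpret fam: jet_family c s G R by (rule fam)
  have g: "(\<lambda>t. G (opt 0 t)) = g" by (rule ext) (rule G0)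
  have z: "fam.zh (opt 0 u) = pcoord s c g u" if "u \<in> S" for u
    using fam.zh_slice[OF SR[OF that]] g by simp
  have A: "fam.Am (opt 0 u) = fmat (Xof c g) u" if "u \<in> S" for u
    using fam.Am_slice[OF SR[OF that]] g by simp
  have J: "fam.Jh (opt 0 u) = Jd u" if "u \<in> S" for u
    using A[OF that] by (simp add: fam.Jh_def Jd_def)
  have M: "fam.Minv (opt 0 u) $ Some k $ None = - ((\<Sum>m\<in>UNIV. B k m u * \<xi> (ind c m) u) * \<phi> u)" if "u \<in> S" for u k
    by (simp add: fam.Minv_def A[OF that] dG[OF that] sum_distrib_right sum_distrib_left mult_ac)
  have V: "Bop fam.Xe None (\<lambda>p. G p $ \<sigma>) (opt 0 u) = vert \<xi> \<sigma> u * \<phi> u" if u: "u \<in> S" for u \<sigma>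
  proof -
    \<comment> \<open>In the extended frame the derivative at fixed \<open>t\<close> is the
      derivative at fixed \<open>x^i\<close> plus transport along the total derivatives with the
      velocities of the independent components. Subtracting the transport gives
      \<open>vert\<close>.\<close>
    have "pd None (\<lambda>p. G p $ \<sigma>) (opt 0 u) =
      (\<Sum>a\<in>UNIV. pd None (fam.Xe a) (opt 0 u) * Bop fam.Xe a (\<lambda>p. G p $ \<sigma>) (opt 0 u))"
      by (rule pd_eq_Bop[OF fam.ext.det_nz[OF SR[OF u]]])
    also have "\<dots> = Bop fam.Xe None (\<lambda>p. G p $ \<sigma>) (opt 0 u) +
      (\<Sum>m\<in>UNIV. \<xi> (ind c m) u * \<phi> u * Bop (Xof c g) m (\<lambda>t. g t $ \<sigma>) u)"
      by (simp add: sum_UNIV_option pd_coord dG[OF u] fam.Bop_slice[OF fam.smooth_G SR[OF u]] g G0)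
    finally show ?thesis
      by (simp add: dG[OF u] vert_def right_diff_distrib sum_distrib_left mult_ac)
  qed
  have D: "pd k (\<lambda>t. fam.Jh (opt 0 t) * fam.Minv (opt 0 t) $ Some k $ None * F (fam.zh (opt 0 t))) t =
    - pd k (\<lambda>t. flux F \<xi> k t * \<phi> t) t" for k
  proof -
    have "pd k (\<lambda>t. fam.Jh (opt 0 t) * fam.Minv (opt 0 t) $ Some k $ None * F (fam.zh (opt 0 t))) t =
      pd k (\<lambda>t. -1 * (flux F \<xi> k t * \<phi> t)) t"
      by (rule pd_cong[OF open_S t]) (simp add: J z M flux_def mult_ac)
    also have "\<dots> = -1 * pd k (\<lambda>t. flux F \<xi> k t * \<phi> t) t"
      by (rule pd_cmult[OF differentiable_mult[OF smooth_diffable[OF smooth_flux[OF F \<xi>] t] smooth_diffable[OF \<phi> UNIV_I]]])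
    finally show ?thesis by simp
  qed
  have Bs: "foldr (Bop (Xof c g)) (arrange M) (\<lambda>t. Bop fam.Xe None (\<lambda>p. G p $ \<sigma>) (opt 0 t)) t =
      foldr (Bop (Xof c g)) (arrange M) (\<lambda>t. vert \<xi> \<sigma> t * \<phi> t) t" for M \<sigma>
    by (rule Bops_cong[OF open_S refl V t])
  show ?thesis
    unfolding fam.first_variation[OF F SR[OF t]] g J[OF t] z[OF t] D Bs variation_def sum_negf
    by (simp add: sum_distrib_left mult_ac)
qed

end

section \<open>Reparametrisation and jets of curves\<close>

lemma pd_vec_compose:
  assumes "smooth_map T f" "\<And>k. smooth_map S (\<lambda>x. \<alpha> x $ k)" "t \<in> S" "\<alpha> t \<in> T"
  shows "pd j (\<lambda>x. f (\<alpha> x)) t = (\<Sum>k\<in>UNIV. pd k f (\<alpha> t) * pd j (\<lambda>x. \<alpha> x $ k) t)"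
  by (rule pd_compose[OF smooth_diffable[OF assms(1,4)] smooth_diffable[OF assms(2,3)]])

lemma det_fmat_compose:
  fixes \<alpha> :: "real^'p::finite \<Rightarrow> real^'p"
  assumes "\<And>i. smooth_map T (X i)" "\<And>k. smooth_map S (\<lambda>x. \<alpha> x $ k)" "t \<in> S" "\<alpha> t \<in> T"
  shows "det (fmat (\<lambda>i t. X i (\<alpha> t)) t) = det (fmat X (\<alpha> t)) * det (fmat (\<lambda>k x. \<alpha> x $ k) t)"
proof -
  have "fmat (\<lambda>i t. X i (\<alpha> t)) t = fmat X (\<alpha> t) ** fmat (\<lambda>k x. \<alpha> x $ k) t"
    by (simp add: vec_eq_iff matrix_matrix_mult_def pd_vec_compose[OF assms])
  then show ?thesis by (simp add: det_mul)
qed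

context frame
begin

lemma frame_compose:
  assumes S': "open S'" and \<alpha>: "\<And>k. smooth_map S' (\<lambda>x. \<alpha> x $ k)" and im: "\<And>t. t \<in> S' \<Longrightarrow> \<alpha> t \<in> S"
    and nz: "\<And>t. t \<in> S' \<Longrightarrow> det (fmat (\<lambda>k x. \<alpha> x $ k) t) \<noteq> 0"
  shows "frame (\<lambda>i t. X i (\<alpha> t)) S'"
proof
  show "smooth_map S' (\<lambda>t. X i (\<alpha> t))" for i
    by (rule smooth_compose[OF S' \<alpha> smooth_X]) (use im in auto)
  show "det (fmat (\<lambda>i t. X i (\<alpha> t)) t) \<noteq> 0" if "t \<in> S'" for t
    using det_fmat_compose[OF smooth_X \<alpha> that im[OF that]] det_nz[OF im[OF that]] nz[OF that] by simp
qed (rule S')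

text \<open>By the chain rule the old frame derivatives, evaluated at \<open>\<alpha> t\<close>,
  solve the equations that characterise the new ones. The invariance of the \<open>y\<close>
  coordinates under reparametrisation rests on this.\<close>

lemma Bops_compose:
  assumes S': "open S'" and \<alpha>: "\<And>k. smooth_map S' (\<lambda>x. \<alpha> x $ k)" and im: "\<And>t. t \<in> S' \<Longrightarrow> \<alpha> t \<in> S"
    and nz: "\<And>t. t \<in> S' \<Longrightarrow> det (fmat (\<lambda>k x. \<alpha> x $ k) t) \<noteq> 0"
    and h: "smooth_map S h"
  shows "t \<in> S' \<Longrightarrow> foldr (Bop (\<lambda>i t. X i (\<alpha> t))) I (\<lambda>t. h (\<alpha> t)) t = foldr (Bop X) I h (\<alpha> t)"
proof (induction I arbitrary: t)
  case (Cons i I)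
  interpret c: frame "\<lambda>i t. X i (\<alpha> t)" S' by (rule frame_compose[OF S' \<alpha> im nz])
  let ?h = "foldr (Bop X) I h"
  have "Bop (\<lambda>i t. X i (\<alpha> t)) i (foldr (Bop (\<lambda>i t. X i (\<alpha> t))) I (\<lambda>t. h (\<alpha> t))) t =
    Bop (\<lambda>i t. X i (\<alpha> t)) i (\<lambda>t. ?h (\<alpha> t)) t"
    by (rule Bop_cong[OF S' Cons.prems refl Cons.IH])
  also have "\<dots> = Bop X i ?h (\<alpha> t)"
  proof (rule Bop_unique[OF c.det_nz[OF Cons.prems]])
    fix j
    have "(\<Sum>i\<in>UNIV. pd j (\<lambda>t. X i (\<alpha> t)) t * Bop X i ?h (\<alpha> t)) =
      (\<Sum>k\<in>UNIV. (\<Sum>i\<in>UNIV. pd k (X i) (\<alpha> t) * Bop X i ?h (\<alpha> t)) * pd j (\<lambda>x. \<alpha> x $ k) t)"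
      by (simp add: pd_vec_compose[OF smooth_X \<alpha> Cons.prems im[OF Cons.prems]] sum_distrib_right sum_distrib_left mult_ac)
        (rule sum.swap)
    also have "\<dots> = pd j (\<lambda>t. ?h (\<alpha> t)) t"
      by (simp add: pd_eq_Bop[OF det_nz[OF im[OF Cons.prems]], of _ ?h, symmetric]
          pd_vec_compose[OF smooth_Bops[OF h] \<alpha> Cons.prems im[OF Cons.prems]])
    finally show "(\<Sum>i\<in>UNIV. pd j (\<lambda>t. X i (\<alpha> t)) t * Bop X i ?h (\<alpha> t)) = pd j (\<lambda>t. ?h (\<alpha> t)) t" .
  qed
  finally show ?case by simp
qed simp

text \<open>Ordinary derivatives are combinations of frame derivatives with smooth coefficients
  depending on \<open>X\<close> only, so a jet can be recovered from iterated frame derivatives.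
  This is what makes the orbit coordinates separate orbits.\<close>

lemma eqr_from_Bops:
  assumes p: "p \<in> S"
  shows "smooth_map S h \<Longrightarrow> smooth_map S h' \<Longrightarrow>
    (\<And>I. length I \<le> r \<Longrightarrow> foldr (Bop X) I h p = foldr (Bop X) I h' p) \<Longrightarrow> eqr r p h h'"
proof (induction r arbitrary: h h')
  case 0
  from 0(3)[of "[]"] show ?case by simp
next
  case (Suc r)
  have 1: "eqr r p (Bop X i h) (Bop X i h')" for i
  proof (rule Suc.IH[OF smooth_Bop[OF Suc.prems(1)] smooth_Bop[OF Suc.prems(2)]])
    fix I :: "'p list" assume "length I \<le> r"
    then show "foldr (Bop X) I (Bop X i h) p = foldr (Bop X) I (Bop X i h') p"
      using Suc.prems(3)[of "I @ [i]"] by simp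
  qed
  have 2: "eqr r p (\<lambda>t. \<Sum>i\<in>UNIV. pd j (X i) t * Bop X i h t) (\<lambda>t. \<Sum>i\<in>UNIV. pd j (X i) t * Bop X i h' t)" for j
    by (intro eqr_sum[OF open_S p] eqr_mult[OF open_S p] smooth_mult[OF open_S] 1 smooth_pd smooth_X smooth_Bop Suc.prems eqr_refl)
  have 3: "eqr r p (pd j k) (\<lambda>t. \<Sum>i\<in>UNIV. pd j (X i) t * Bop X i k t)" for j k
    by (rule eqr_local[OF open_S p pd_eq_Bop[OF det_nz]])
  have "eqr r p (pd j h) (pd j h')" for j
    by (rule eqr_trans[OF 3 eqr_trans[OF 2 eqr_sym[OF 3]]])
  then show ?case using Suc.prems(3)[of "[]"] by (simp add: eqr_Suc)
qed

end

text \<open>Every frame derivative costs one order of agreement, both through the differentiated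
  function and through the first derivatives of the frame functions, whence
  \<open>r - length I\<close>.\<close>

lemma Bops_eqr:
  assumes X: "frame X S" and X': "frame X' S" and p: "p \<in> S"
  shows "smooth_map S h \<Longrightarrow> smooth_map S h' \<Longrightarrow> (\<And>i. eqr r p (X i) (X' i)) \<Longrightarrow> eqr r p h h' \<Longrightarrow>
    length I \<le> r \<Longrightarrow> eqr (r - length I) p (foldr (Bop X) I h) (foldr (Bop X') I h')"
proof (induction I)
  case Nil
  then show ?case by simp
next
  case (Cons i I)
  interpret X: frame X S by (rule X)
  interpret X': frame X' S by (rule X')
  define m where "m = r - length (i # I)"
  have m: "r - length I = Suc m" "Suc m \<le> r" using Cons.prems(5) by (auto simp: m_def)
  let ?k = "foldr (Bop X) I h" and ?k' = "foldr (Bop X') I h'"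
  have k: "smooth_map S ?k" "smooth_map S ?k'" by (rule X.smooth_Bops X'.smooth_Bops, fact)+
  have kk: "eqr (Suc m) p ?k ?k'" using Cons by (simp add: m(1))
  have A: "eqr m p (pd j (X i)) (pd j (X' i))" for i j
    by (rule eqr_pd[OF eqr_mono[OF Cons.prems(3) m(2)]])
  \<comment> \<open>With \<open>P Z\<close> the product of \<open>X.B\<close>, the Jacobian of
    \<open>Z\<close> and \<open>X'.B\<close>, the choice \<open>Z = X'\<close> collapses to
    \<open>X.B\<close> and \<open>Z = X\<close> to \<open>X'.B\<close>. Agreement of the Jacobians
    thus passes to their inverses.\<close>
  have B: "eqr m p (X.B j i) (X'.B j i)" for j i
  proof -
    let ?P = "\<lambda>Z t. \<Sum>a\<in>UNIV. \<Sum>b\<in>UNIV. X.B j a t * pd b (Z a) t * X'.B b i t"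
    have 1: "eqr m p (?P X') (?P X)"
      by (intro eqr_sum[OF X.open_S p] eqr_mult[OF X.open_S p] smooth_sum[OF X.open_S] smooth_mult[OF X.open_S]
          X.smooth_B X'.smooth_B smooth_pd X.smooth_X X'.smooth_X A[THEN eqr_sym] eqr_refl)
    have 2: "X.B j i t = ?P X' t" if t: "t \<in> S" for t
    proof -
      have *: "(\<Sum>b\<in>UNIV. pd b (X' a) t * X'.B b i t) = (if a = i then 1 else 0)" for a
        using matrix_inv_sum(2)[OF X'.det_nz[OF t], of a i] by simp
      have "(\<Sum>a\<in>UNIV. X.B j a t * (\<Sum>b\<in>UNIV. pd b (X' a) t * X'.B b i t)) = X.B j i t"
        by (simp add: * if_distrib cong: if_cong)
      then show ?thesis by (simp add: sum_distrib_left mult_ac)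
    qed
    have 3: "X'.B j i t = ?P X t" if t: "t \<in> S" for t
    proof -
      have *: "(\<Sum>a\<in>UNIV. X.B j a t * pd b (X a) t) = (if j = b then 1 else 0)" for b
        using matrix_inv_sum(1)[OF X.det_nz[OF t], of j b] by simp
      have "(\<Sum>b\<in>UNIV. (\<Sum>a\<in>UNIV. X.B j a t * pd b (X a) t) * X'.B b i t) = X'.B j i t"
        by (simp add: * if_distrib[of "\<lambda>x. x * _"] cong: if_cong)
      then show ?thesis by (subst sum.swap) (simp add: sum_distrib_right)
    qed
    show ?thesis
      by (rule eqr_trans[OF eqr_local[OF X.open_S p 2] eqr_trans[OF 1 eqr_sym[OF eqr_local[OF X.open_S p 3]]]])
  qed
  have "eqr m p (\<lambda>t. \<Sum>j\<in>UNIV. X.B j i t * pd j ?k t) (\<lambda>t. \<Sum>j\<in>UNIV. X'.B j i t * pd j ?k' t)"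
    by (intro eqr_sum[OF X.open_S p] eqr_mult[OF X.open_S p] smooth_mult[OF X.open_S]
          X.smooth_B X'.smooth_B smooth_pd k B eqr_pd[OF kk])
  then show ?case unfolding m_def[symmetric] by (simp add: Bop_def[abs_def])
qed

section \<open>Jets in charts\<close>

locale manifold =
  fixes \<A> :: "('x::topological_space, 'N::finite) chart set"
  assumes smooth_structure: "smooth_structure \<A>"
begin

lemma chart_props:
  assumes "(V, \<psi>) \<in> \<A>"
  shows "open V" "open (\<psi> ` V)" "homeomorphism V (\<psi> ` V) \<psi> (inv_into V \<psi>)" "inj_on \<psi> V"
    "continuous_on (\<psi> ` V) (inv_into V \<psi>)"
proof -
  have c: "is_chart (V, \<psi>)" using smooth_structure assms unfolding smooth_structure_def by blast
  then show "open V" "open (\<psi> ` V)" and h: "homeomorphism V (\<psi> ` V) \<psi> (inv_into V \<psi>)"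
    by (simp_all add: is_chart_def)
  then show "continuous_on (\<psi> ` V) (inv_into V \<psi>)" by (simp add: homeomorphism_def)
  have "inv_into V \<psi> (\<psi> x) = x" if "x \<in> V" for x using h that by (simp add: homeomorphism_def)
  then show "inj_on \<psi> V" by (rule inj_on_inverseI)
qed

lemma transition:
  assumes "(V, \<psi>) \<in> \<A>" "(V', \<psi>') \<in> \<A>"
  shows "open (\<psi> ` (V \<inter> V'))" "smooth_map (\<psi> ` (V \<inter> V')) (\<lambda>x. \<psi>' (inv_into V \<psi> x) $ k)"
proof -
  have "openin (top_of_set V) (V \<inter> V')"
    using chart_props(1)[OF assms(2)] by (simp add: openin_open_Int)
  then have "openin (top_of_set (\<psi> ` V)) (\<psi> ` (V \<inter> V'))"
    by (rule homeomorphism_imp_open_map[OF chart_props(3)[OF assms(1)]])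
  then show op: "open (\<psi> ` (V \<inter> V'))"
    using chart_props(2)[OF assms(1)] openin_open_trans by blast
  have "smooth_transition (V, \<psi>) (V', \<psi>')"
    using smooth_structure assms unfolding smooth_structure_def by blast
  then have "smooth_map (\<psi> ` (V \<inter> V')) (\<psi>' \<circ> inv_into V \<psi>)" by (simp add: smooth_transition_def)
  then show "smooth_map (\<psi> ` (V \<inter> V')) (\<lambda>x. \<psi>' (inv_into V \<psi> x) $ k)"
    by (simp add: smooth_vec_iff[OF op])
qed

lemma inv_chart: "(V, \<psi>) \<in> \<A> \<Longrightarrow> x \<in> V \<Longrightarrow> inv_into V \<psi> (\<psi> x) = x"
  using chart_props(4) by (rule inv_into_f_f)

lemma smooth_germD:
  assumes "smooth_germ \<A> \<gamma>" "(V, \<psi>) \<in> \<A>" "\<gamma> 0 \<in> V"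
  obtains S where "open S" "0 \<in> S" "\<And>t. t \<in> S \<Longrightarrow> \<gamma> t \<in> V" "\<And>k. smooth_map S (\<lambda>t. \<psi> (\<gamma> t) $ k)"
proof -
  obtain U where U: "open U" "0 \<in> U" "continuous_on U \<gamma>"
    and sm: "smooth_map {t\<in>U. \<gamma> t \<in> V} (\<psi> \<circ> \<gamma>)"
    using assms(1,2) unfolding smooth_germ_def by blast
  have op: "open {t\<in>U. \<gamma> t \<in> V}"
    using continuous_open_preimage[OF U(3,1) chart_props(1)[OF assms(2)]] by (simp add: Int_def vimage_def)
  show ?thesis
  proof (rule that[OF op])
    show "smooth_map {t\<in>U. \<gamma> t \<in> V} (\<lambda>t. \<psi> (\<gamma> t) $ k)" for k
      using sm by (simp add: smooth_vec_iff[OF op])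
  qed (use U assms in auto)
qed

lemma smooth_germI:
  assumes c: "(V, \<psi>) \<in> \<A>" and S: "open S" "0 \<in> S" and h: "\<And>k. smooth_map S (\<lambda>t. h t $ k)"
    and hV: "\<And>t. t \<in> S \<Longrightarrow> h t \<in> \<psi> ` V" and \<gamma>: "\<And>t. t \<in> S \<Longrightarrow> \<gamma> t = inv_into V \<psi> (h t)"
  shows "smooth_germ \<A> \<gamma>"
proof -
  have "continuous_on S h" using h by (simp add: smooth_continuous_on smooth_vec_iff[OF S(1)])
  then have "continuous_on S (\<lambda>t. inv_into V \<psi> (h t))"
    by (rule continuous_on_compose2[OF chart_props(5)[OF c]]) (use hV in auto)
  then have cont: "continuous_on S \<gamma>" by (rule continuous_on_eq) (simp add: \<gamma>)
  have "smooth_map {t\<in>S. \<gamma> t \<in> V'} (\<psi>' \<circ> \<gamma>)" if c': "(V', \<psi>') \<in> \<A>" for V' \<psi>'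
  proof -
    have op: "open {t\<in>S. \<gamma> t \<in> V'}"
      using continuous_open_preimage[OF cont S(1) chart_props(1)[OF c']] by (simp add: Int_def vimage_def)
    have im: "h t \<in> \<psi> ` (V \<inter> V')" if "t \<in> S" "\<gamma> t \<in> V'" for t
      using hV[OF that(1)] \<gamma>[OF that(1)] that(2) by (auto simp: inv_chart[OF c])
    have "smooth_map {t\<in>S. \<gamma> t \<in> V'} (\<lambda>t. \<psi>' (inv_into V \<psi> (h t)) $ k)" for k
    proof (rule smooth_compose[where g = h, OF op])
      show "smooth_map {t\<in>S. \<gamma> t \<in> V'} (\<lambda>t. h t $ k)" for k by (rule smooth_subset[OF h]) auto
      show "smooth_map (\<psi> ` (V \<inter> V')) (\<lambda>x. \<psi>' (inv_into V \<psi> x) $ k)" by (rule transition(2)[OF c c'])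
    qed (use im in auto)
    then have "smooth_map {t\<in>S. \<gamma> t \<in> V'} (\<lambda>t. (\<psi>' \<circ> \<gamma>) t $ k)" for k
      by (rule smooth_cong[OF _ op]) (simp add: \<gamma>)
    then show ?thesis by (simp add: smooth_vec_iff[OF op])
  qed
  then show ?thesis unfolding smooth_germ_def using S cont by blast
qed

definition same_jet :: "nat \<Rightarrow> (real^'n::finite \<Rightarrow> 'x) \<Rightarrow> (real^'n \<Rightarrow> 'x) \<Rightarrow> bool" where
  "same_jet r \<gamma> \<gamma>' \<longleftrightarrow> smooth_germ \<A> \<gamma> \<and> smooth_germ \<A> \<gamma>' \<and> \<gamma>' 0 = \<gamma> 0 \<and>
    (\<forall>(V, \<psi>)\<in>\<A>. \<gamma> 0 \<in> V \<longrightarrow> (\<forall>k. eqr r 0 (\<lambda>t. \<psi> (\<gamma>' t) $ k) (\<lambda>t. \<psi> (\<gamma> t) $ k)))"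

lemma same_jetD: "same_jet r \<gamma> \<gamma>' \<Longrightarrow> (V, \<psi>) \<in> \<A> \<Longrightarrow> \<gamma> 0 \<in> V \<Longrightarrow>
    eqr r 0 (\<lambda>t. \<psi> (\<gamma>' t) $ k) (\<lambda>t. \<psi> (\<gamma> t) $ k)"
  unfolding same_jet_def by blast

text \<open>Agreement in one chart suffices: both curves are read in another chart through the same
  transition map, and \<open>eqr\<close> is preserved by composition.\<close>

lemma same_jetI:
  assumes sm: "smooth_germ \<A> \<gamma>" "smooth_germ \<A> \<gamma>'" "\<gamma>' 0 = \<gamma> 0" and c: "(V, \<psi>) \<in> \<A>" "\<gamma> 0 \<in> V"
    and eq: "\<And>k. eqr r 0 (\<lambda>t. \<psi> (\<gamma>' t) $ k) (\<lambda>t. \<psi> (\<gamma> t) $ k)"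
  shows "same_jet r \<gamma> \<gamma>'"
proof -
  have "eqr r 0 (\<lambda>t. \<psi>' (\<gamma>' t) $ k) (\<lambda>t. \<psi>' (\<gamma> t) $ k)" if c': "(V', \<psi>') \<in> \<A>" "\<gamma> 0 \<in> V'" for V' \<psi>' k
  proof -
    have c2: "\<gamma>' 0 \<in> V" "\<gamma>' 0 \<in> V'" using c(2) c'(2) sm(3) by simp_all
    obtain S1 where S1: "open S1" "0 \<in> S1" "\<And>t. t \<in> S1 \<Longrightarrow> \<gamma> t \<in> V" "\<And>k. smooth_map S1 (\<lambda>t. \<psi> (\<gamma> t) $ k)"
      by (rule smooth_germD[OF sm(1) c]) blast
    obtain S2 where S2: "open S2" "0 \<in> S2" "\<And>t. t \<in> S2 \<Longrightarrow> \<gamma> t \<in> V'" "\<And>k. smooth_map S2 (\<lambda>t. \<psi>' (\<gamma> t) $ k)"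
      by (rule smooth_germD[OF sm(1) c']) blast
    obtain S3 where S3: "open S3" "0 \<in> S3" "\<And>t. t \<in> S3 \<Longrightarrow> \<gamma>' t \<in> V" "\<And>k. smooth_map S3 (\<lambda>t. \<psi> (\<gamma>' t) $ k)"
      by (rule smooth_germD[OF sm(2) c(1) c2(1)]) blast
    obtain S4 where S4: "open S4" "0 \<in> S4" "\<And>t. t \<in> S4 \<Longrightarrow> \<gamma>' t \<in> V'" "\<And>k. smooth_map S4 (\<lambda>t. \<psi>' (\<gamma>' t) $ k)"
      by (rule smooth_germD[OF sm(2) c'(1) c2(2)]) blast
    define S where "S = S1 \<inter> S2 \<inter> S3 \<inter> S4"
    have S: "open S" "0 \<in> S" using S1 S2 S3 S4 by (auto simp: S_def)
    have sm1: "smooth_map S (\<lambda>t. \<psi> (\<gamma> t) $ k)" for k by (rule smooth_subset[OF S1(4)]) (auto simp: S_def)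
    have sm2: "smooth_map S (\<lambda>t. \<psi> (\<gamma>' t) $ k)" for k by (rule smooth_subset[OF S3(4)]) (auto simp: S_def)
    have "eqr r 0 (\<lambda>t. \<psi>' (inv_into V \<psi> (\<psi> (\<gamma>' t))) $ k) (\<lambda>t. \<psi>' (inv_into V \<psi> (\<psi> (\<gamma> t))) $ k)"
      by (rule eqr_compose[OF S sm2 sm1 _ _ transition(1)[OF c(1) c'(1)] transition(2)[OF c(1) c'(1)]
            transition(2)[OF c(1) c'(1)] eqr_refl eq])
        (use S1(3) S2(3) S3(3) S4(3) in \<open>auto simp: S_def\<close>)
    then show ?thesis
      by (rule eqr_cong[OF S, THEN iffD1, rotated 2])
        (use S1(3) S3(3) in \<open>auto simp: S_def inv_chart[OF c(1)]\<close>)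
  qed
  then show ?thesis using sm unfolding same_jet_def by blast
qed

lemma same_jet_refl: "smooth_germ \<A> \<gamma> \<Longrightarrow> same_jet r \<gamma> \<gamma>"
  unfolding same_jet_def by auto

lemma same_jet_mono: "same_jet r \<gamma> \<gamma>' \<Longrightarrow> k \<le> r \<Longrightarrow> same_jet k \<gamma> \<gamma>'"
  unfolding same_jet_def using eqr_mono by blast

lemma same_jet_sym: "same_jet r \<gamma> \<gamma>' \<Longrightarrow> same_jet r \<gamma>' \<gamma>"
  unfolding same_jet_def using eqr_sym by fastforce

lemma same_jet_trans: "same_jet r \<gamma> \<gamma>' \<Longrightarrow> same_jet r \<gamma>' \<gamma>'' \<Longrightarrow> same_jet r \<gamma> \<gamma>''"
  unfolding same_jet_def using eqr_trans by fastforce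

lemma jet_iff: "smooth_germ \<A> \<gamma> \<Longrightarrow> \<gamma>' \<in> jet \<A> r \<gamma> \<longleftrightarrow> same_jet r \<gamma> \<gamma>'"
proof -
  assume sm: "smooth_germ \<A> \<gamma>"
  have key: "(\<forall>J. length J \<le> r \<longrightarrow> pderivs J (\<psi> \<circ> \<gamma>') 0 = pderivs J (\<psi> \<circ> \<gamma>) 0) \<longleftrightarrow>
      (\<forall>k. eqr r 0 (\<lambda>t. \<psi> (\<gamma>' t) $ k) (\<lambda>t. \<psi> (\<gamma> t) $ k))"
    if sm': "smooth_germ \<A> \<gamma>'" and eq: "\<gamma>' 0 = \<gamma> 0" and c: "(V, \<psi>) \<in> \<A>" "\<gamma> 0 \<in> V" for V \<psi>
  proof -
    obtain S1 where S1: "open S1" "0 \<in> S1" "\<And>k. smooth_map S1 (\<lambda>t. \<psi> (\<gamma> t) $ k)"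
      by (rule smooth_germD[OF sm c]) blast
    have "\<gamma>' 0 \<in> V" using c eq by simp
    then obtain S3 where S3: "open S3" "0 \<in> S3" "\<And>k. smooth_map S3 (\<lambda>t. \<psi> (\<gamma>' t) $ k)"
      by (rule smooth_germD[OF sm' c(1)]) blast
    have "pderivs J (\<lambda>t. \<psi> (\<gamma> t)) 0 $ k = pderivs J (\<lambda>t. \<psi> (\<gamma> t) $ k) 0"
      "pderivs J (\<lambda>t. \<psi> (\<gamma>' t)) 0 $ k = pderivs J (\<lambda>t. \<psi> (\<gamma>' t) $ k) 0" for J k
      using pderivs_vec_nth[OF S1(1,3,2)] pderivs_vec_nth[OF S3(1,3,2)] by simp_all
    then show ?thesis unfolding eqr_def vec_eq_iff o_def by auto
  qed
  have key2: "(\<forall>(V, \<psi>)\<in>\<A>. \<gamma> 0 \<in> V \<longrightarrow> (\<forall>J. length J \<le> r \<longrightarrow> pderivs J (\<psi> \<circ> \<gamma>') 0 = pderivs J (\<psi> \<circ> \<gamma>) 0)) \<longleftrightarrow>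
      (\<forall>(V, \<psi>)\<in>\<A>. \<gamma> 0 \<in> V \<longrightarrow> (\<forall>k. eqr r 0 (\<lambda>t. \<psi> (\<gamma>' t) $ k) (\<lambda>t. \<psi> (\<gamma> t) $ k)))"
    if "smooth_germ \<A> \<gamma>'" "\<gamma>' 0 = \<gamma> 0"
  proof (rule ball_cong[OF refl])
    fix ch assume ch: "ch \<in> \<A>"
    obtain V \<psi> where Pair: "ch = (V, \<psi>)" by (cases ch)
    show "(case ch of (V, \<psi>) \<Rightarrow> \<gamma> 0 \<in> V \<longrightarrow> (\<forall>J. length J \<le> r \<longrightarrow> pderivs J (\<psi> \<circ> \<gamma>') 0 = pderivs J (\<psi> \<circ> \<gamma>) 0)) \<longleftrightarrow>
        (case ch of (V, \<psi>) \<Rightarrow> \<gamma> 0 \<in> V \<longrightarrow> (\<forall>k. eqr r 0 (\<lambda>t. \<psi> (\<gamma>' t) $ k) (\<lambda>t. \<psi> (\<gamma> t) $ k)))"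
      unfolding Pair prod.case using key[OF that, of V \<psi>] ch[unfolded Pair] by blast
  qed
  show ?thesis
  proof (cases "smooth_germ \<A> \<gamma>' \<and> \<gamma>' 0 = \<gamma> 0")
    case True
    then show ?thesis unfolding jet_def same_jet_def mem_Collect_eq key2[OF True[THEN conjunct1] True[THEN conjunct2]]
      using sm by simp
  next
    case False
    then show ?thesis unfolding jet_def same_jet_def mem_Collect_eq by blast
  qed
qed

lemma jet_eqI: "same_jet r \<gamma> \<gamma>' \<Longrightarrow> jet \<A> r \<gamma> = jet \<A> r \<gamma>'"
proof -
  assume s: "same_jet r \<gamma> \<gamma>'"
  then have sm: "smooth_germ \<A> \<gamma>" "smooth_germ \<A> \<gamma>'" by (auto simp: same_jet_def)
  show ?thesis
    by (rule set_eqI, unfold jet_iff[OF sm(1)] jet_iff[OF sm(2)])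
      (rule iffI, erule same_jet_trans[OF same_jet_sym[OF s]], erule same_jet_trans[OF s])
qed

lemma rep_jet:
  assumes "smooth_germ \<A> \<gamma>"
  shows "same_jet r \<gamma> (rep (jet \<A> r \<gamma>))"
proof -
  have "\<gamma> \<in> jet \<A> r \<gamma>" using assms by (simp add: jet_iff same_jet_refl)
  then have "rep (jet \<A> r \<gamma>) \<in> jet \<A> r \<gamma>" unfolding rep_def by (rule someI[of "\<lambda>x. x \<in> jet \<A> r \<gamma>"])
  then show ?thesis using assms by (simp add: jet_iff)
qed

end

section \<open>Coordinates of velocities and of their orbits\<close>

definition loc :: "('x, 'n::finite, 'N::finite) split_chart \<Rightarrow> (real^'n \<Rightarrow> 'x) \<Rightarrow> real^'n \<Rightarrow> real^'N" where
  "loc c \<gamma> t = cmap c (\<gamma> t)"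

abbreviation Dcoord :: "('x, 'n::finite, 'N::finite) split_chart \<Rightarrow> (real^'n \<Rightarrow> real^'N) \<Rightarrow> 'n list \<Rightarrow> 'N \<Rightarrow> real^'n \<Rightarrow> real" where
  "Dcoord c g I \<sigma> \<equiv> foldr (Bop (Xof c g)) I (\<lambda>t. g t $ \<sigma>)"

lemma jet_curveI:
  assumes "jet_domain c" "open S" "\<And>A. smooth_map S (\<lambda>t. g t $ A)" "\<And>t. t \<in> S \<Longrightarrow> g t \<in> cmap c ` cdom c"
    "\<And>t. t \<in> S \<Longrightarrow> det (fmat (Xof c g) t) \<noteq> 0"
  shows "jet_curve c g S"
proof -
  interpret jet_domain c by (rule assms(1))
  show ?thesis
  proof unfold_locales
    show "smooth_map S (Xof c g i)" for i using assms(3) by (simp add: Xof_def[abs_def])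
  qed (rule assms; assumption?)+
qed

lemma jet_curve_subset:
  assumes "jet_curve c g S" "open T" "T \<subseteq> S"
  shows "jet_curve c g T"
proof -
  interpret jet_curve c 0 g S by (rule assms(1))
  show ?thesis
    by (rule jet_curveI[OF jet_domain_axioms assms(2)])
      (use assms(3) det_nz g_in smooth_subset[OF smooth_g] in auto)
qed

lemma Xof_smooth: "(\<And>A. smooth_map S (\<lambda>t. g t $ A)) \<Longrightarrow> smooth_map S (Xof c g i)"
  by (simp add: Xof_def[abs_def])

lemma open_det_nonzero:
  fixes M :: "real^'p::finite \<Rightarrow> real^'q::finite^'q"
  assumes "open S" "\<And>i j. smooth_map S (\<lambda>t. M t $ i $ j)"
  shows "open {t\<in>S. det (M t) \<noteq> 0}"
proof -
  have "continuous_on S (\<lambda>t. det (M t))" by (rule smooth_continuous_on[OF smooth_det[OF assms]])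
  from continuous_open_preimage[OF this assms(1), of "- {0}"] show ?thesis
    by (simp add: Int_def vimage_def open_Compl)
qed

lemma local_diffeo_id: "local_diffeo (\<lambda>x :: real^'n::finite. x)"
proof (rule local_diffeoI[of UNIV])
  have "fmat (\<lambda>i (x :: real^'n). x $ i) 0 = mat 1"
    by (auto simp: vec_eq_iff pd_coord mat_def)
  then show "det (fmat (\<lambda>i (x :: real^'n). x $ i) 0) \<noteq> 0" by simp
qed (simp_all add: smooth_coord)

lemma smooth_translate: "smooth_map S (\<lambda>t. (a + t) $ k)"
proof -
  have 1: "pd j (\<lambda>t. (a + t) $ k) = pd j (\<lambda>t. t $ k)" for j
  proof
    fix t
    have "pd j (\<lambda>t. a $ k + t $ k) t = pd j (\<lambda>t. a $ k) t + pd j (\<lambda>t. t $ k) t"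
      by (rule pd_add) (simp_all add: smooth_diffable[OF smooth_coord UNIV_I])
    then show "pd j (\<lambda>t. (a + t) $ k) t = pd j (\<lambda>t. t $ k) t" by simp
  qed
  have "smooth_map UNIV (\<lambda>t. a $ k + t $ k)" by (rule smooth_add[OF open_UNIV smooth_const smooth_coord])
  then have "smooth_map S (\<lambda>t. a $ k + t $ k)" by (rule smooth_subset) simp
  then show ?thesis by simp
qed

lemma pd_translate: "pd j (\<lambda>t. a $ k + t $ k) t = (if j = k then 1 else 0)"
proof -
  have "pd j (\<lambda>t. a $ k + t $ k) t = pd j (\<lambda>t. a $ k) t + pd j (\<lambda>t. t $ k) t"
    by (rule pd_add) (simp_all add: smooth_diffable[OF smooth_coord UNIV_I])
  then show ?thesis by (simp add: pd_coord)
qed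

lemma fmat_translate: "fmat (\<lambda>k t. (a + t) $ k) t = mat 1"
  by (auto simp: vec_eq_iff pd_translate mat_def)

lemma open_translate: "open S \<Longrightarrow> open {t. a + t \<in> S}" for a :: "real^'n::finite"
  using open_vimage[of S "\<lambda>t. a + t"] by (simp add: vimage_def continuous_intros)

context jet_curve
begin

lemma Dcoord_translate:
  assumes "a + t \<in> S"
  shows "Dcoord c (\<lambda>t. g (a + t)) I \<sigma> t = Dcoord c g I \<sigma> (a + t)"
proof -
  have X: "Xof c (\<lambda>t. g (a + t)) = (\<lambda>i t. Xof c g i (a + t))" by (simp add: Xof_def fun_eq_iff)
  show ?thesis unfolding X
  proof (rule Bops_compose[where S' = "{t. a + t \<in> S}" and h = "\<lambda>t. g t $ \<sigma>", OF open_translate[OF open_S] smooth_translate _ _ smooth_g])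
    show "det (fmat (\<lambda>k x. (a + x) $ k) t) \<noteq> 0" for t by (simp only: fmat_translate det_I)
  qed (use assms in auto)
qed

lemma fmat_translate_curve:
  assumes "a + t \<in> S"
  shows "fmat (Xof c (\<lambda>t. g (a + t))) t = fmat (Xof c g) (a + t)"
proof -
  have "pd j (\<lambda>t. g (a + t) $ ind c i) t = pd j (\<lambda>t. g t $ ind c i) (a + t)" for i j
    using pd_vec_compose[where \<alpha> = "\<lambda>t. a + t" and S = UNIV, OF smooth_g smooth_translate UNIV_I assms, of j "ind c i"]
    by (simp add: pd_translate if_distrib cong: if_cong)
  then show ?thesis by (simp add: vec_eq_iff Xof_def[abs_def])
qed

end

section \<open>Regular germs, reparametrisation and the coordinates of orbits\<close>

context manifold
begin

text \<open>The property of a germ that places its jet in \<open>W\<close>, for every order at least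
  \<open>1\<close> (see \<open>W_iff\<close>). Being independent of the order, it lets one curve
  represent points of orbit spaces of different orders.\<close>

definition good :: "('x, 'n::finite, 'N) split_chart \<Rightarrow> (real^'n \<Rightarrow> 'x) \<Rightarrow> bool" where
  "good c \<gamma> \<longleftrightarrow> smooth_germ \<A> \<gamma> \<and> \<gamma> 0 \<in> cdom c \<and> det (fmat (Xof c (loc c \<gamma>)) 0) \<noteq> 0"

lemma sc_chart: "is_split_chart \<A> c \<Longrightarrow> (cdom c, cmap c) \<in> \<A>"
  by (simp add: is_split_chart_def)

lemma jet_domain_sc: "is_split_chart \<A> c \<Longrightarrow> jet_domain c"
  using chart_props(2) by (simp add: is_split_chart_def jet_domain_def)

lemma good_nbhd:
  assumes c: "is_split_chart \<A> c" and \<gamma>: "good c \<gamma>"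
  obtains S where "open S" "0 \<in> S" "jet_curve c (loc c \<gamma>) S" "\<And>t. t \<in> S \<Longrightarrow> \<gamma> t \<in> cdom c"
proof -
  obtain S where S: "open S" "0 \<in> S" "\<And>t. t \<in> S \<Longrightarrow> \<gamma> t \<in> cdom c" "\<And>k. smooth_map S (\<lambda>t. cmap c (\<gamma> t) $ k)"
    using smooth_germD[OF _ sc_chart[OF c], of \<gamma>] \<gamma> unfolding good_def by blast
  have sm: "smooth_map S (\<lambda>t. loc c \<gamma> t $ k)" for k using S(4) by (simp add: loc_def)
  have op: "open {t\<in>S. det (fmat (Xof c (loc c \<gamma>)) t) \<noteq> 0}"
    by (rule open_det_nonzero[OF S(1)]) (simp add: smooth_pd Xof_smooth sm)
  show ?thesis
  proof (rule that[OF op])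
    show "jet_curve c (loc c \<gamma>) {t\<in>S. det (fmat (Xof c (loc c \<gamma>)) t) \<noteq> 0}"
    proof (rule jet_curveI[OF jet_domain_sc[OF c] op smooth_subset[OF sm]])
      show "loc c \<gamma> t \<in> cmap c ` cdom c" if "t \<in> {t\<in>S. det (fmat (Xof c (loc c \<gamma>)) t) \<noteq> 0}" for t
        using S(3) that by (simp add: loc_def)
    qed auto
  qed (use S \<gamma> in \<open>auto simp: good_def\<close>)
qed

lemma good_same_jet:
  assumes c: "is_split_chart \<A> c" and \<gamma>: "good c \<gamma>" and s: "same_jet r \<gamma> \<gamma>'" and r: "1 \<le> r"
  shows "good c \<gamma>'"
proof -
  have eq: "eqr 1 0 (\<lambda>t. loc c \<gamma>' t $ k) (\<lambda>t. loc c \<gamma> t $ k)" for k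
    using same_jetD[OF same_jet_mono[OF s r] sc_chart[OF c]] \<gamma> by (simp add: good_def loc_def)
  have "pd j (\<lambda>t. loc c \<gamma>' t $ k) 0 = pd j (\<lambda>t. loc c \<gamma> t $ k) 0" for j k
    using eq[of k] unfolding One_nat_def eqr_Suc by simp
  then have "fmat (Xof c (loc c \<gamma>')) 0 = fmat (Xof c (loc c \<gamma>)) 0"
    by (simp add: vec_eq_iff Xof_def[abs_def])
  then show ?thesis using \<gamma> s by (simp add: good_def same_jet_def)
qed

lemma Dcoord_same_jet:
  assumes c: "is_split_chart \<A> c" and \<gamma>: "good c \<gamma>" and s: "same_jet r \<gamma> \<gamma>'" and I: "length I \<le> r"
  shows "Dcoord c (loc c \<gamma>') I \<sigma> 0 = Dcoord c (loc c \<gamma>) I \<sigma> 0"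
proof (cases "1 \<le> r")
  \<comment> \<open>For \<open>r = 0\<close> the Jacobian of \<open>\<gamma>'\<close> is not
    controlled, so it may fail to be \<open>good\<close>; only the value at \<open>0\<close> is then
    compared.\<close>
  case False
  then have "I = []" using I by (cases I) auto
  then show ?thesis using s by (simp add: same_jet_def loc_def)
next
  case True
  obtain S where S: "open S" "0 \<in> S" "jet_curve c (loc c \<gamma>) S" by (rule good_nbhd[OF c \<gamma>]) blast
  obtain S' where S': "open S'" "0 \<in> S'" "jet_curve c (loc c \<gamma>') S'"
    by (rule good_nbhd[OF c good_same_jet[OF c \<gamma> s True]]) blast
  have T: "open (S \<inter> S')" using S S' by auto
  interpret a: jet_curve c 0 "loc c \<gamma>" "S \<inter> S'" by (rule jet_curve_subset[OF S(3) T]) simp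
  interpret b: jet_curve c 0 "loc c \<gamma>'" "S \<inter> S'" by (rule jet_curve_subset[OF S'(3) T]) simp
  have eq: "eqr r 0 (\<lambda>t. loc c \<gamma>' t $ k) (\<lambda>t. loc c \<gamma> t $ k)" for k
    using same_jetD[OF s sc_chart[OF c]] \<gamma> by (simp add: good_def loc_def)
  have eqX: "eqr r 0 (Xof c (loc c \<gamma>') i) (Xof c (loc c \<gamma>) i)" for i
    using eq[of "ind c i"] by (simp add: Xof_def[abs_def])
  have z: "0 \<in> S \<inter> S'" using S S' by simp
  show ?thesis
    by (rule eqr_point[OF Bops_eqr[OF b.frame_axioms a.frame_axioms z b.smooth_g a.smooth_g eqX eq I]])
qed

lemma germ_compose:
  assumes ch: "(V, \<psi>) \<in> \<A>" "\<gamma> 0 \<in> V" and \<gamma>: "smooth_germ \<A> \<gamma>" and \<alpha>: "local_diffeo \<alpha>"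
  shows "smooth_germ \<A> (\<lambda>t. \<gamma> (\<alpha> t))"
proof -
  obtain S where S: "open S" "0 \<in> S" "\<And>t. t \<in> S \<Longrightarrow> \<gamma> t \<in> V" "\<And>k. smooth_map S (\<lambda>t. \<psi> (\<gamma> t) $ k)"
    by (rule smooth_germD[OF \<gamma> ch]) blast
  obtain U where U: "open U" "0 \<in> U" "\<And>k. smooth_map U (\<lambda>x. \<alpha> x $ k)" "\<alpha> 0 = 0"
    by (rule local_diffeoD[OF \<alpha>]) blast
  have "continuous_on U \<alpha>" using U by (simp add: smooth_continuous_on smooth_vec_iff)
  then have op: "open {t\<in>U. \<alpha> t \<in> S}"
    using continuous_open_preimage[OF _ U(1) S(1)] by (simp add: Int_def vimage_def)
  show ?thesis
  proof (rule smooth_germI[where h = "\<lambda>t. \<psi> (\<gamma> (\<alpha> t))", OF ch(1) op])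
    show "smooth_map {t\<in>U. \<alpha> t \<in> S} (\<lambda>t. \<psi> (\<gamma> (\<alpha> t)) $ k)" for k
    proof (rule smooth_compose[where g = \<alpha> and f = "\<lambda>t. \<psi> (\<gamma> t) $ k", OF op _ S(4)])
      show "smooth_map {t\<in>U. \<alpha> t \<in> S} (\<lambda>t. \<alpha> t $ k)" for k by (rule smooth_subset[OF U(3)]) auto
    qed auto
    show "0 \<in> {t\<in>U. \<alpha> t \<in> S}" using S(2) U(2,4) by simp
    fix t assume "t \<in> {t\<in>U. \<alpha> t \<in> S}"
    then have "\<gamma> (\<alpha> t) \<in> V" by (simp add: S(3))
    then show "\<psi> (\<gamma> (\<alpha> t)) \<in> \<psi> ` V" "\<gamma> (\<alpha> t) = inv_into V \<psi> (\<psi> (\<gamma> (\<alpha> t)))"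
      by (simp_all add: inv_chart[OF ch(1)])
  qed
qed

lemma good_compose:
  assumes c: "is_split_chart \<A> c" and \<gamma>: "good c \<gamma>" and \<alpha>: "local_diffeo \<alpha>"
  shows "good c (\<lambda>t. \<gamma> (\<alpha> t))" and "Dcoord c (loc c (\<lambda>t. \<gamma> (\<alpha> t))) I \<sigma> 0 = Dcoord c (loc c \<gamma>) I \<sigma> 0"
proof -
  obtain S where S: "open S" "0 \<in> S" "jet_curve c (loc c \<gamma>) S" by (rule good_nbhd[OF c \<gamma>]) blast
  interpret jet_curve c 0 "loc c \<gamma>" S by (rule S(3))
  obtain U where U: "open U" "0 \<in> U" "\<And>k. smooth_map U (\<lambda>x. \<alpha> x $ k)" "\<alpha> 0 = 0"
    "\<And>x. x \<in> U \<Longrightarrow> det (fmat (\<lambda>i x. \<alpha> x $ i) x) \<noteq> 0"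
    by (rule local_diffeoD[OF \<alpha>]) blast
  have "continuous_on U \<alpha>" using U by (simp add: smooth_continuous_on smooth_vec_iff)
  then have op: "open {t\<in>U. \<alpha> t \<in> S}"
    using continuous_open_preimage[OF _ U(1) S(1)] by (simp add: Int_def vimage_def)
  have \<alpha>s: "smooth_map {t\<in>U. \<alpha> t \<in> S} (\<lambda>t. \<alpha> t $ k)" for k by (rule smooth_subset[OF U(3)]) auto
  have X: "Xof c (loc c (\<lambda>t. \<gamma> (\<alpha> t))) = (\<lambda>i t. Xof c (loc c \<gamma>) i (\<alpha> t))"
    by (simp add: Xof_def loc_def fun_eq_iff)
  have h: "(\<lambda>t. loc c (\<lambda>t. \<gamma> (\<alpha> t)) t $ \<sigma>) = (\<lambda>t. loc c \<gamma> (\<alpha> t) $ \<sigma>)" by (simp add: loc_def)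
  have z: "0 \<in> {t\<in>U. \<alpha> t \<in> S}" using U S by simp
  have im: "\<alpha> t \<in> S" "det (fmat (\<lambda>k x. \<alpha> x $ k) t) \<noteq> 0" if "t \<in> {t\<in>U. \<alpha> t \<in> S}" for t
    using that U(5) by auto
  have "det (fmat (Xof c (loc c (\<lambda>t. \<gamma> (\<alpha> t)))) 0) \<noteq> 0"
    unfolding X by (rule frame.det_nz[OF frame_compose[OF op \<alpha>s im] z])
  then show "good c (\<lambda>t. \<gamma> (\<alpha> t))"
    using germ_compose[OF sc_chart[OF c] _ _ \<alpha>, of \<gamma>] \<gamma> U(4) by (simp add: good_def)
  show "Dcoord c (loc c (\<lambda>t. \<gamma> (\<alpha> t))) I \<sigma> 0 = Dcoord c (loc c \<gamma>) I \<sigma> 0"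
    unfolding X h using Bops_compose[OF op \<alpha>s im smooth_g z, of I \<sigma>] unfolding U(4) .
qed

text \<open>The action is defined by composing chosen representatives of both jets. This shows that
  the choices do not matter, as used in \<open>jet_act_jet\<close>.\<close>

lemma same_jet_compose:
  assumes ch: "(V, \<psi>) \<in> \<A>" "\<gamma> 0 \<in> V" and s: "same_jet r \<gamma> \<gamma>'" and \<alpha>: "local_diffeo \<alpha>" and \<beta>: "local_diffeo \<beta>"
    and eq: "\<And>k. eqr r 0 (\<lambda>t. \<beta> t $ k) (\<lambda>t. \<alpha> t $ k)"
  shows "same_jet r (\<lambda>t. \<gamma> (\<alpha> t)) (\<lambda>t. \<gamma>' (\<beta> t))"
proof -
  have sm: "smooth_germ \<A> \<gamma>" "smooth_germ \<A> \<gamma>'" "\<gamma>' 0 = \<gamma> 0" using s by (auto simp: same_jet_def)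
  have ch': "\<gamma>' 0 \<in> V" using ch sm by simp
  obtain S where S: "open S" "0 \<in> S" "\<And>t. t \<in> S \<Longrightarrow> \<gamma> t \<in> V" "\<And>k. smooth_map S (\<lambda>t. \<psi> (\<gamma> t) $ k)"
    by (rule smooth_germD[OF sm(1) ch]) blast
  obtain S' where S': "open S'" "0 \<in> S'" "\<And>t. t \<in> S' \<Longrightarrow> \<gamma>' t \<in> V" "\<And>k. smooth_map S' (\<lambda>t. \<psi> (\<gamma>' t) $ k)"
    by (rule smooth_germD[OF sm(2) ch(1) ch']) blast
  obtain U where U: "open U" "0 \<in> U" "\<And>k. smooth_map U (\<lambda>x. \<alpha> x $ k)" "\<alpha> 0 = 0"
    by (rule local_diffeoD[OF \<alpha>]) blast
  obtain U' where U': "open U'" "0 \<in> U'" "\<And>k. smooth_map U' (\<lambda>x. \<beta> x $ k)" "\<beta> 0 = 0"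
    by (rule local_diffeoD[OF \<beta>]) blast
  define T where "T = S \<inter> S'"
  have T: "open T" using S S' by (auto simp: T_def)
  have cont: "continuous_on U \<alpha>" "continuous_on U' \<beta>" using U U' by (simp_all add: smooth_continuous_on smooth_vec_iff)
  define Z where "Z = {t\<in>U. \<alpha> t \<in> T} \<inter> {t\<in>U'. \<beta> t \<in> T}"
  have "open {t\<in>U. \<alpha> t \<in> T}" "open {t\<in>U'. \<beta> t \<in> T}"
    using continuous_open_preimage[OF cont(1) U(1) T] continuous_open_preimage[OF cont(2) U'(1) T]
    by (simp_all add: Int_def vimage_def)
  then have Z: "open Z" "0 \<in> Z"
    using U(2,4) U'(2,4) S(2) S'(2) by (auto simp: Z_def T_def)
  have sT: "smooth_map T (\<lambda>t. \<psi> (\<gamma> t) $ k)" "smooth_map T (\<lambda>t. \<psi> (\<gamma>' t) $ k)" for k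
    by (rule smooth_subset[OF S(4)], simp add: T_def) (rule smooth_subset[OF S'(4)], simp add: T_def)
  have sZ: "smooth_map Z (\<lambda>t. \<alpha> t $ k)" "smooth_map Z (\<lambda>t. \<beta> t $ k)" for k
    by (rule smooth_subset[OF U(3)], auto simp: Z_def) (rule smooth_subset[OF U'(3)], auto simp: Z_def)
  have im: "\<alpha> ` Z \<subseteq> T" "\<beta> ` Z \<subseteq> T" by (auto simp: Z_def)
  have "eqr r 0 (\<lambda>t. \<psi> (\<gamma>' (\<beta> t)) $ k) (\<lambda>t. \<psi> (\<gamma> (\<alpha> t)) $ k)" for k
    by (rule eqr_compose[where f = "\<lambda>t. \<psi> (\<gamma>' t) $ k" and f' = "\<lambda>t. \<psi> (\<gamma> t) $ k", OF Z sZ(2) sZ(1) im(2,1) T sT(2,1) _ eq])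
      (use same_jetD[OF s ch] U'(4) in simp)
  then show ?thesis
    by (intro same_jetI[OF germ_compose[OF ch sm(1) \<alpha>] germ_compose[OF ch(1) ch' sm(2) \<beta>] _ ch(1)])
      (use U(4) U'(4) sm(3) ch(2) in auto)
qed

lemma jet_act_jet:
  fixes \<alpha> :: "real^'n::finite \<Rightarrow> real^'n"
  assumes ch: "(V, \<psi>) \<in> \<A>" "\<gamma> 0 \<in> V" and \<gamma>: "smooth_germ \<A> \<gamma>" and \<alpha>: "local_diffeo \<alpha>"
  shows "jet_act \<A> r (jet \<A> r \<gamma>) (diffeo_jet r \<alpha>) = jet \<A> r (\<lambda>t. \<gamma> (\<alpha> t))"
proof -
  define \<beta> where "\<beta> = rep (diffeo_jet r \<alpha>)"
  have "\<alpha> \<in> diffeo_jet r \<alpha>" using \<alpha> by (simp add: diffeo_jet_def)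
  then have "\<beta> \<in> diffeo_jet r \<alpha>" unfolding \<beta>_def rep_def by (rule someI[of "\<lambda>x. x \<in> diffeo_jet r \<alpha>"])
  then have \<beta>: "local_diffeo \<beta>" "\<And>J. length J \<le> r \<Longrightarrow> pderivs J \<beta> 0 = pderivs J \<alpha> 0"
    by (auto simp: diffeo_jet_def)
  obtain U where U: "open U" "0 \<in> U" "\<And>k. smooth_map U (\<lambda>x. \<alpha> x $ k)"
    by (rule local_diffeoD[OF \<alpha>]) blast
  obtain U' where U': "open U'" "0 \<in> U'" "\<And>k. smooth_map U' (\<lambda>x. \<beta> x $ k)"
    by (rule local_diffeoD[OF \<beta>(1)]) blast
  have "eqr r 0 (\<lambda>t. \<beta> t $ k) (\<lambda>t. \<alpha> t $ k)" for k
    unfolding eqr_def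
  proof (intro allI impI)
    fix J :: "'n list" assume "length J \<le> r"
    then show "pderivs J (\<lambda>t. \<beta> t $ k) 0 = pderivs J (\<lambda>t. \<alpha> t $ k) 0"
      using \<beta>(2)[of J] pderivs_vec_nth[OF U(1,3,2), of J k] pderivs_vec_nth[OF U'(1,3,2), of J k] by simp
  qed
  from jet_eqI[OF same_jet_compose[OF ch rep_jet[OF \<gamma>, of r] \<alpha> \<beta>(1) this]]
  show ?thesis unfolding jet_act_def \<beta>_def[symmetric] by (simp add: o_def)
qed

lemma rho_jet:
  assumes ch: "(V, \<psi>) \<in> \<A>" "\<gamma> 0 \<in> V" and \<gamma>: "smooth_germ \<A> \<gamma>"
  shows "rho \<A> r (jet \<A> r \<gamma>) = {jet \<A> r (\<lambda>t. \<gamma> (\<alpha> t)) | \<alpha>. local_diffeo \<alpha>}"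
proof -
  have "rho \<A> r (jet \<A> r \<gamma>) = (\<lambda>\<alpha>. jet_act \<A> r (jet \<A> r \<gamma>) (diffeo_jet r \<alpha>)) ` {\<alpha>. local_diffeo \<alpha>}"
    by (simp add: rho_def diff_group_def image_image)
  also have "\<dots> = (\<lambda>\<alpha>. jet \<A> r (\<lambda>t. \<gamma> (\<alpha> t))) ` {\<alpha>. local_diffeo \<alpha>}"
    by (rule image_cong[OF refl]) (simp add: jet_act_jet[OF ch \<gamma>])
  finally show ?thesis by auto
qed

text \<open>All that is known about the chosen element of an orbit is that it is the jet of some
  reparametrisation. Functions on orbits are therefore computed by proving invariance under an
  arbitrary \<open>\<alpha>\<close>.\<close>

lemma rep_rho:
  assumes ch: "(V, \<psi>) \<in> \<A>" "\<gamma> 0 \<in> V" and \<gamma>: "smooth_germ \<A> \<gamma>"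
  obtains \<alpha> where "local_diffeo \<alpha>" "rep (rho \<A> r (jet \<A> r \<gamma>)) = jet \<A> r (\<lambda>t. \<gamma> (\<alpha> t))"
proof -
  have "jet \<A> r (\<lambda>t. \<gamma> t) \<in> rho \<A> r (jet \<A> r \<gamma>)"
    unfolding rho_jet[OF assms] by (intro CollectI exI[of _ "\<lambda>x. x"] conjI refl local_diffeo_id)
  then have "rep (rho \<A> r (jet \<A> r \<gamma>)) \<in> rho \<A> r (jet \<A> r \<gamma>)"
    unfolding rep_def by (rule someI[of "\<lambda>x. x \<in> rho \<A> r (jet \<A> r \<gamma>)"])
  then show ?thesis unfolding rho_jet[OF assms] using that unfolding rho_jet[OF assms] by blast
qed

lemma xcoord_jet:
  assumes c: "(cdom c, cmap c) \<in> \<A>" "\<gamma> 0 \<in> cdom c" and \<gamma>: "smooth_germ \<A> \<gamma>" and J: "length J \<le> r"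
  shows "xcoord (cmap c) A J (jet \<A> r \<gamma>) = pderivs J (\<lambda>t. loc c \<gamma> t $ A) 0"
  using same_jetD[OF rep_jet[OF \<gamma>] c] J by (simp add: xcoord_def eqr_def loc_def)

lemma xcoord_Nil_jet:
  assumes "smooth_germ \<A> \<gamma>"
  shows "xcoord \<psi> A [] (jet \<A> r \<gamma>) = \<psi> (\<gamma> 0) $ A"
  using rep_jet[OF assms, of r] by (simp add: xcoord_def same_jet_def)

lemma xmat_jet:
  assumes c: "is_split_chart \<A> c" and \<gamma>: "smooth_germ \<A> \<gamma>" "\<gamma> 0 \<in> cdom c" and r: "1 \<le> r"
  shows "xmat c (jet \<A> r \<gamma>) = fmat (Xof c (loc c \<gamma>)) 0"
  using xcoord_jet[OF sc_chart[OF c] \<gamma>(2,1)] r by (simp add: xmat_def vec_eq_iff Xof_def[abs_def])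

text \<open>\<open>good\<close> concerns a single minor in one chart, while an immersion needs an
  injective differential in all charts. A vector in the kernel for another chart is sent to zero by
  the invertible minor, through the transition map.\<close>

lemma immersion_good:
  assumes c: "is_split_chart \<A> c" and \<gamma>: "good c \<gamma>"
  shows "immersion_germ \<A> \<gamma>"
proof -
  have sm: "smooth_germ \<A> \<gamma>" "\<gamma> 0 \<in> cdom c" using \<gamma> by (auto simp: good_def)
  have "inj (frechet_derivative (\<psi> \<circ> \<gamma>) (at 0))" if ch: "(V, \<psi>) \<in> \<A>" "\<gamma> 0 \<in> V" for V \<psi>
  proof -
    obtain S where S: "open S" "0 \<in> S" "\<And>t. t \<in> S \<Longrightarrow> \<gamma> t \<in> V" "\<And>k. smooth_map S (\<lambda>t. \<psi> (\<gamma> t) $ k)"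
      by (rule smooth_germD[OF sm(1) ch]) blast
    obtain S' where S': "open S'" "0 \<in> S'" "\<And>t. t \<in> S' \<Longrightarrow> \<gamma> t \<in> cdom c" "\<And>k. smooth_map S' (\<lambda>t. cmap c (\<gamma> t) $ k)"
      by (rule smooth_germD[OF sm(1) sc_chart[OF c] sm(2)]) blast
    have d: "(\<psi> \<circ> \<gamma>) differentiable at 0"
      unfolding differentiable_vec_iff o_def using smooth_diffable[OF S(4,2)] by blast
    note tr = transition(2)[OF ch(1) sc_chart[OF c]]
    have mem: "\<psi> (\<gamma> 0) \<in> \<psi> ` (V \<inter> cdom c)" using ch sm by auto
    have pdX: "pd j (Xof c (loc c \<gamma>) i) 0 =
      (\<Sum>k\<in>UNIV. pd k (\<lambda>x. cmap c (inv_into V \<psi> x) $ ind c i) (\<psi> (\<gamma> 0)) * pd j (\<lambda>t. \<psi> (\<gamma> t) $ k) 0)" for i j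
    proof -
      have "pd j (Xof c (loc c \<gamma>) i) 0 = pd j (\<lambda>t. cmap c (inv_into V \<psi> (\<psi> (\<gamma> t))) $ ind c i) 0"
        by (rule pd_cong[OF S(1,2)]) (simp add: Xof_def loc_def inv_chart[OF ch(1)] S(3))
      also have "\<dots> = (\<Sum>k\<in>UNIV. pd k (\<lambda>x. cmap c (inv_into V \<psi> x) $ ind c i) (\<psi> (\<gamma> 0)) * pd j (\<lambda>t. \<psi> (\<gamma> t) $ k) 0)"
        by (rule pd_vec_compose[where \<alpha> = "\<lambda>t. \<psi> (\<gamma> t)", OF tr S(4,2) mem])
      finally show ?thesis .
    qed
    have lin: "linear (frechet_derivative (\<psi> \<circ> \<gamma>) (at 0))" by (rule linear_frechet_derivative[OF d])
    have ker: "v = 0" if v: "frechet_derivative (\<psi> \<circ> \<gamma>) (at 0) v = 0" for v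
    proof -
      have comp: "(\<Sum>j\<in>UNIV. pd j (\<lambda>t. \<psi> (\<gamma> t) $ k) 0 * v $ j) = 0" for k
      proof -
        have "((\<lambda>t. \<psi> (\<gamma> t) $ k) has_derivative (\<lambda>w. frechet_derivative (\<psi> \<circ> \<gamma>) (at 0) w $ k)) (at 0)"
          using d unfolding frechet_derivative_works has_derivative_vec_iff by (simp add: o_def)
        from frechet_derivative_at[OF this]
        have "frechet_derivative (\<lambda>t. \<psi> (\<gamma> t) $ k) (at 0) v = frechet_derivative (\<psi> \<circ> \<gamma>) (at 0) v $ k"
          by (simp add: fun_eq_iff)
        then show ?thesis using frechet_derivative_pd[OF smooth_diffable[OF S(4,2)], of k v] v by simp
      qed
      have "(fmat (Xof c (loc c \<gamma>)) 0 *v v) $ i = 0" for i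
      proof -
        have "(fmat (Xof c (loc c \<gamma>)) 0 *v v) $ i =
          (\<Sum>k\<in>UNIV. pd k (\<lambda>x. cmap c (inv_into V \<psi> x) $ ind c i) (\<psi> (\<gamma> 0)) * (\<Sum>j\<in>UNIV. pd j (\<lambda>t. \<psi> (\<gamma> t) $ k) 0 * v $ j))"
          by (simp add: matrix_vector_mult_def pdX sum_distrib_left sum_distrib_right mult_ac) (rule sum.swap)
        then show ?thesis by (simp add: comp)
      qed
      then have "fmat (Xof c (loc c \<gamma>)) 0 *v v = 0" by (simp add: vec_eq_iff)
      then have "matrix_inv (fmat (Xof c (loc c \<gamma>)) 0) *v (fmat (Xof c (loc c \<gamma>)) 0 *v v) = 0" by simp
      then show "v = 0" using \<gamma> by (simp add: matrix_vector_mul_assoc matrix_inv_mult good_def)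
    qed
    show ?thesis using linear_injective_0[OF lin] ker by blast
  qed
  then show ?thesis using sm by (auto simp: immersion_germ_def)
qed

lemma W_iff:
  assumes c: "is_split_chart \<A> c" and \<gamma>: "smooth_germ \<A> \<gamma>" and r: "1 \<le> r"
  shows "jet \<A> r \<gamma> \<in> W \<A> r c \<longleftrightarrow> good c \<gamma>"
proof -
  have rep0: "rep (jet \<A> r \<gamma>) 0 = \<gamma> 0" using rep_jet[OF \<gamma>, of r] by (simp add: same_jet_def)
  have imm: "jet \<A> r \<gamma> \<in> ImmT \<A> r" if "good c \<gamma>"
    using immersion_good[OF c that] by (auto simp: ImmT_def)
  show ?thesis
    using imm xmat_jet[OF c \<gamma> _ r] by (auto simp: W_def ImmT_over_def rep0 good_def \<gamma>)
qed

lemma W_E: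
  assumes c: "is_split_chart \<A> c" and u: "u \<in> W \<A> r c" and r: "1 \<le> r"
  obtains \<gamma> where "u = jet \<A> r \<gamma>" "good c \<gamma>"
proof -
  obtain \<gamma> where \<gamma>: "u = jet \<A> r \<gamma>" "immersion_germ \<A> \<gamma>"
    using u by (auto simp: W_def ImmT_over_def ImmT_def)
  then have sm: "smooth_germ \<A> \<gamma>" by (simp add: immersion_germ_def)
  show ?thesis using that[OF \<gamma>(1)] u W_iff[OF c sm r] \<gamma>(1) by simp
qed

lemma good_translate:
  assumes c: "is_split_chart \<A> c" and S: "jet_curve c (loc c \<gamma>) S" "\<And>t. t \<in> S \<Longrightarrow> \<gamma> t \<in> cdom c" and a: "a \<in> S"
  shows "good c (\<lambda>t. \<gamma> (a + t))"
proof -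
  interpret jet_curve c 0 "loc c \<gamma>" S by (rule S(1))
  have loc: "loc c (\<lambda>t. \<gamma> (a + t)) = (\<lambda>t. loc c \<gamma> (a + t))" by (simp add: loc_def fun_eq_iff)
  have op: "open {t. a + t \<in> S}" by (rule open_translate[OF open_S])
  have "smooth_germ \<A> (\<lambda>t. \<gamma> (a + t))"
  proof (rule smooth_germI[where h = "\<lambda>t. loc c \<gamma> (a + t)", OF sc_chart[OF c] op])
    show "smooth_map {t. a + t \<in> S} (\<lambda>t. loc c \<gamma> (a + t) $ k)" for k
      by (rule smooth_compose[where g = "\<lambda>t. a + t" and f = "\<lambda>t. loc c \<gamma> t $ k", OF op smooth_translate smooth_g]) auto
    show "0 \<in> {t. a + t \<in> S}" using a by simp
    fix t assume "t \<in> {t. a + t \<in> S}"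
    then have "\<gamma> (a + t) \<in> cdom c" by (simp add: S(2))
    then show "loc c \<gamma> (a + t) \<in> cmap c ` cdom c" "\<gamma> (a + t) = inv_into (cdom c) (cmap c) (loc c \<gamma> (a + t))"
      by (simp_all add: inv_chart[OF sc_chart[OF c]] loc_def)
  qed
  moreover have "det (fmat (Xof c (loc c (\<lambda>t. \<gamma> (a + t)))) 0) \<noteq> 0"
    unfolding loc using fmat_translate_curve[of a 0] det_nz[OF a] a by simp
  ultimately show ?thesis using S(2)[OF a] by (simp add: good_def)
qed

text \<open>The induction ranges over all germs and orders, because the formal derivative evaluates
  \<open>ycoord\<close> on jets of translated curves; these remain \<open>good\<close> for small
  translations.\<close>

lemma ycoord_jet:
  assumes c: "is_split_chart \<A> c"
  shows "good c \<gamma> \<Longrightarrow> length I \<le> k \<Longrightarrow> ycoord \<A> c \<sigma> I (jet \<A> k \<gamma>) = Dcoord c (loc c \<gamma>) I \<sigma> 0"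
proof (induction I arbitrary: \<gamma> k)
  case Nil
  then show ?case by (simp add: xcoord_Nil_jet good_def loc_def)
next
  case (Cons i I)
  then have k: "1 \<le> k" by simp
  \<comment> \<open>\<open>xmat\<close> and \<open>formal_deriv\<close> see only the chosen
    representative of the jet. The computation is done on it and transferred back to
    \<open>\<gamma>\<close> at the end.\<close>
  define \<gamma>' where "\<gamma>' = rep (jet \<A> k \<gamma>)"
  have sm: "smooth_germ \<A> \<gamma>" "\<gamma> 0 \<in> cdom c" using Cons.prems by (auto simp: good_def)
  have sj: "same_jet k \<gamma> \<gamma>'" unfolding \<gamma>'_def by (rule rep_jet[OF sm(1)])
  have g': "good c \<gamma>'" by (rule good_same_jet[OF c Cons.prems(1) sj k])
  obtain S where S: "open S" "0 \<in> S" "jet_curve c (loc c \<gamma>') S" "\<And>t. t \<in> S \<Longrightarrow> \<gamma>' t \<in> cdom c"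
    by (rule good_nbhd[OF c g']) blast
  interpret jet_curve c 0 "loc c \<gamma>'" S by (rule S(3))
  let ?h = "Dcoord c (loc c \<gamma>') I \<sigma>"
  have fd: "formal_deriv \<A> (length I) j (ycoord \<A> c \<sigma> I) (jet \<A> k \<gamma>) = pd j ?h 0" for j
  proof -
    have "\<forall>\<^sub>F e in nhds 0. e *\<^sub>R axis j 1 \<in> S"
    proof -
      have "continuous_on UNIV (\<lambda>e. e *\<^sub>R axis j (1 :: real))" by (intro continuous_intros)
      from open_vimage[OF S(1) this] have "open {e :: real. e *\<^sub>R axis j 1 \<in> S}" by (simp add: vimage_def)
      from eventually_nhds_in_open[OF this, of 0] show ?thesis using S(2) by simp
    qed
    then have ev: "\<forall>\<^sub>F e in nhds 0. ycoord \<A> c \<sigma> I (jet \<A> (length I) (\<lambda>t. \<gamma>' (e *\<^sub>R axis j 1 + t))) = ?h (0 + e *\<^sub>R axis j 1)"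
    proof (rule eventually_mono)
      fix e :: real assume e: "e *\<^sub>R axis j 1 \<in> S"
      have "ycoord \<A> c \<sigma> I (jet \<A> (length I) (\<lambda>t. \<gamma>' (e *\<^sub>R axis j 1 + t))) =
        Dcoord c (loc c (\<lambda>t. \<gamma>' (e *\<^sub>R axis j 1 + t))) I \<sigma> 0"
        by (rule Cons.IH[OF good_translate[OF c S(3,4) e]]) simp_all
      also have "loc c (\<lambda>t. \<gamma>' (e *\<^sub>R axis j 1 + t)) = (\<lambda>t. loc c \<gamma>' (e *\<^sub>R axis j 1 + t))"
        by (simp add: loc_def fun_eq_iff)
      also have "Dcoord c (\<lambda>t. loc c \<gamma>' (e *\<^sub>R axis j 1 + t)) I \<sigma> 0 = ?h (0 + e *\<^sub>R axis j 1)"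
        using Dcoord_translate[of "e *\<^sub>R axis j 1" 0 I \<sigma>] e by simp
      finally show "ycoord \<A> c \<sigma> I (jet \<A> (length I) (\<lambda>t. \<gamma>' (e *\<^sub>R axis j 1 + t))) = ?h (0 + e *\<^sub>R axis j 1)" .
    qed
    have "?h differentiable at (0 + 0 *\<^sub>R axis j 1)"
      using smooth_diffable[OF smooth_Bops[OF smooth_g] S(2)] by simp
    from has_real_derivative_line[OF this]
    have "deriv (\<lambda>e. ?h (0 + e *\<^sub>R axis j 1)) 0 = pd j ?h 0" by (simp add: DERIV_imp_deriv)
    then show ?thesis unfolding formal_deriv_def \<gamma>'_def[symmetric] using deriv_cong_ev[OF ev refl] by simp
  qed
  have "xmat c (jet \<A> k \<gamma>) = fmat (Xof c (loc c \<gamma>')) 0"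
    using xmat_jet[OF c _ _ k, of \<gamma>'] jet_eqI[OF sj] g' by (simp add: good_def)
  then have "ycoord \<A> c \<sigma> (i # I) (jet \<A> k \<gamma>) = Dcoord c (loc c \<gamma>') (i # I) \<sigma> 0"
    by (simp add: fd Bop_def[of _ _ ?h])
  also have "\<dots> = Dcoord c (loc c \<gamma>) (i # I) \<sigma> 0"
    by (rule Dcoord_same_jet[OF c Cons.prems(1) sj Cons.prems(2)])
  finally show ?case .
qed

lemma Py_rho:
  assumes c: "is_split_chart \<A> c" and \<gamma>: "good c \<gamma>" and I: "length I \<le> s"
  shows "Py \<A> c \<sigma> I (rho \<A> s (jet \<A> s \<gamma>)) = Dcoord c (loc c \<gamma>) I \<sigma> 0"
proof -
  have "\<gamma> 0 \<in> cdom c" "smooth_germ \<A> \<gamma>" using \<gamma> by (auto simp: good_def)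
  from rep_rho[OF sc_chart[OF c] this] obtain \<alpha> where
    \<alpha>: "local_diffeo \<alpha>" "rep (rho \<A> s (jet \<A> s \<gamma>)) = jet \<A> s (\<lambda>t. \<gamma> (\<alpha> t))" .
  show ?thesis unfolding Py_def \<alpha>(2)
    using ycoord_jet[OF c good_compose(1)[OF c \<gamma> \<alpha>(1)] I] good_compose(2)[OF c \<gamma> \<alpha>(1)] by simp
qed

lemma base_rho:
  assumes ch: "(V, \<psi>) \<in> \<A>" "\<gamma> 0 \<in> V" and \<gamma>: "smooth_germ \<A> \<gamma>"
  shows "Px c' i (rho \<A> s (jet \<A> s \<gamma>)) = cmap c' (\<gamma> 0) $ ind c' i"
    and "Py \<A> c' \<sigma> [] (rho \<A> s (jet \<A> s \<gamma>)) = cmap c' (\<gamma> 0) $ \<sigma>"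
proof -
  from rep_rho[OF assms] obtain \<alpha> where
    \<alpha>: "local_diffeo \<alpha>" "rep (rho \<A> s (jet \<A> s \<gamma>)) = jet \<A> s (\<lambda>t. \<gamma> (\<alpha> t))" .
  have "\<alpha> 0 = 0" using \<alpha>(1) by (simp add: local_diffeo_def)
  then show "Px c' i (rho \<A> s (jet \<A> s \<gamma>)) = cmap c' (\<gamma> 0) $ ind c' i"
    "Py \<A> c' \<sigma> [] (rho \<A> s (jet \<A> s \<gamma>)) = cmap c' (\<gamma> 0) $ \<sigma>"
    using xcoord_Nil_jet[OF germ_compose[OF ch \<gamma> \<alpha>(1)]] by (simp_all add: Px_def Py_def \<alpha>(2))
qed

lemma P_coords_rho:
  assumes c: "is_split_chart \<A> c" and \<gamma>: "good c \<gamma>"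
  shows "P_coords \<A> s c (rho \<A> s (jet \<A> s \<gamma>)) = pcoord s c (loc c \<gamma>) 0"
proof
  fix k
  have sm: "\<gamma> 0 \<in> cdom c" "smooth_germ \<A> \<gamma>" using \<gamma> by (auto simp: good_def)
  show "P_coords \<A> s c (rho \<A> s (jet \<A> s \<gamma>)) k = pcoord s c (loc c \<gamma>) 0 k"
  proof (cases "k \<in> P_labels s c")
    case True
    then show ?thesis
    proof (cases rule: P_labels_cases)
      case (1 i)
      then show ?thesis using base_rho(1)[OF sc_chart[OF c] sm] by (simp add: P_coords_def Xof_def loc_def)
    next
      case (2 \<sigma> M)
      then show ?thesis by (simp add: P_coords_def pcoord_Inr Py_rho[OF c \<gamma>])
    qed
  qed (simp add: P_coords_def pcoord_def)
qed

end

section \<open>Functions on the space of orbits in coordinates\<close>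

definition trunc :: "nat \<Rightarrow> ('x, 'n::finite, 'N::finite) split_chart \<Rightarrow> ('n + 'N \<times> 'n multiset \<Rightarrow> real) \<Rightarrow>
    'n + 'N \<times> 'n multiset \<Rightarrow> real" where
  "trunc r c z k = (if k \<in> P_labels r c then z k else 0)"

lemma trunc_pcoord: "r \<le> s \<Longrightarrow> trunc r c (pcoord s c g t) = pcoord r c g t"
  using P_labels_mono[of r s c] by (auto simp: fun_eq_iff trunc_def pcoord_def)

lemma (in jet_domain) basept_trunc: "basept c (trunc r c z) = basept c z"
proof -
  have "basept c (trunc r c z) $ A = basept c z $ A" for A
  proof (cases "A \<in> range (ind c)")
    case True
    then show ?thesis by (auto simp: basept_ind trunc_def)
  next
    case False
    then have "A \<in> dep c" by (simp add: dep_def)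
    then show ?thesis by (simp add: basept_dep trunc_def)
  qed
  then show ?thesis by (simp add: vec_eq_iff)
qed

lemma (in jet_domain) trunc_in: "z \<in> P_domain s c \<Longrightarrow> trunc r c z \<in> P_domain r c"
  by (simp add: P_domain_def basept_trunc trunc_def)

text \<open>Changing one coordinate either passes through \<open>trunc\<close> or is erased by it.
  So each partial derivative is either zero or a partial derivative of \<open>F\<close> composed
  with \<open>trunc\<close>, and the induction closes.\<close>

lemma csmooth_trunc:
  fixes c :: "('x, 'n::finite, 'N::finite) split_chart"
  assumes c: "jet_domain c" and rs: "r \<le> s" and F: "csmooth_on (P_labels r c) (P_domain r c) F"
  shows "csmooth_on (P_labels s c) (P_domain s c) (\<lambda>z. F (trunc r c z))"
proof -
  interpret r: jet_domain c r by (rule c)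
  interpret s: jet_domain c s by (rule c)
  have upd: "trunc r c (z(k := t)) = (if k \<in> P_labels r c then (trunc r c z)(k := t) else trunc r c z)" for z k t
    by (auto simp: trunc_def fun_eq_iff)
  have cp: "cpartial k (\<lambda>z. F (trunc r c z)) =
      (if k \<in> P_labels r c then (\<lambda>z. cpartial k F (trunc r c z)) else (\<lambda>z. 0))" for k F
    by (auto simp: cpartial_def upd fun_eq_iff) (simp add: trunc_def)
  have "r.Cc n F \<Longrightarrow> s.Cc n (\<lambda>z. F (trunc r c z))" for n F
  proof (induction n arbitrary: F)
    have cont: "continuous_on (P_domain s c) (\<lambda>z. F (trunc r c z))" if "continuous_on (P_domain r c) F" for F
    proof (rule continuous_on_compose2[OF that])
      show "continuous_on (P_domain s c) (trunc r c)"
      proof (rule continuous_on_coordinatewise_then_product)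
        fix k
        have "continuous_on (P_domain s c) (\<lambda>z. z k)"
          by (rule continuous_on_product_then_coordinatewise) (rule continuous_on_id)
        then show "continuous_on (P_domain s c) (\<lambda>z. trunc r c z k)"
          by (cases "k \<in> P_labels r c") (simp_all add: trunc_def)
      qed
    qed (use s.trunc_in in auto)
    {
      case 0
      then show ?case using cont by simp
    next
      case (Suc n)
      have "s.Cc n (cpartial k (\<lambda>z. F (trunc r c z)))" for k
        using Suc.IH[of "cpartial k F"] Suc.prems s.Cc_const unfolding cp by simp
      moreover have "(\<lambda>t. F (trunc r c (z(k := t)))) field_differentiable at (z k)" if z: "z \<in> P_domain s c" for z k
      proof (cases "k \<in> P_labels r c")
        case True
        then have "(\<lambda>t. F ((trunc r c z)(k := t))) field_differentiable at ((trunc r c z) k)"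
          using Suc.prems s.trunc_in[OF z, of r] unfolding r.Cc.simps by blast
        then show ?thesis using True by (simp add: upd) (simp add: trunc_def)
      next
        case False
        then show ?thesis by (simp add: upd)
      qed
      ultimately show ?case using cont[of F] Suc.prems by simp
    }
  qed
  then show ?thesis using F by (simp add: r.Cc_iff s.Cc_iff)
qed

lemma (in jet_curve) Dcoord_pcoord:
  assumes "\<sigma> \<in> dep c" "length I \<le> s" "t \<in> S"
  shows "Dcoord c g I \<sigma> t = pcoord s c g t (Inr (\<sigma>, mset I))"
  using Bops_mset[OF smooth_g _ assms(3), of I "arrange (mset I)" \<sigma>] assms by (simp add: pcoord_Inr)

lemma (in jet_curve) pcoord_translate:
  assumes "a \<in> S"
  shows "pcoord s c (\<lambda>t. g (a + t)) 0 = pcoord s c g a"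
proof
  fix k
  show "pcoord s c (\<lambda>t. g (a + t)) 0 k = pcoord s c g a k"
    using Dcoord_translate[of a 0] assms by (cases k) (auto simp: pcoord_def Xof_def)
qed

lemma pcoord_cong:
  assumes "open S" "t \<in> S" "\<And>u. u \<in> S \<Longrightarrow> g u = g' u"
  shows "pcoord s c g t = pcoord s c g' t"
proof
  fix k
  have "Dcoord c g I \<sigma> t = Dcoord c g' I \<sigma> t" for I \<sigma>
    by (rule Bops_cong[OF assms(1) _ _ assms(2)]) (simp_all add: Xof_def assms(3))
  then show "pcoord s c g t k = pcoord s c g' t k"
    using assms(2,3) by (cases k) (auto simp: pcoord_def Xof_def)
qed

lemma fmat_cong:
  assumes "open S" "t \<in> S" "\<And>u. u \<in> S \<Longrightarrow> g u = g' u"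
  shows "fmat (Xof c g) t = fmat (Xof c g') t"
proof -
  have "pd j (Xof c g i) t = pd j (Xof c g' i) t" for i j
    by (rule pd_cong[OF assms(1,2)]) (simp add: Xof_def assms(3))
  then show ?thesis by (simp add: vec_eq_iff)
qed

lemma jet_curve_cong:
  assumes "jet_curve c g S" "\<And>u. u \<in> S \<Longrightarrow> g u = g' u"
  shows "jet_curve c g' S"
proof -
  interpret jet_curve c 0 g S by (rule assms(1))
  show ?thesis
  proof (rule jet_curveI[OF jet_domain_axioms open_S])
    show "smooth_map S (\<lambda>t. g' t $ A)" for A
      by (rule smooth_cong[OF smooth_g open_S]) (simp add: assms(2))
    show "g' t \<in> cmap c ` cdom c" if "t \<in> S" for t using g_in[OF that] assms(2)[OF that] by simp
    show "det (fmat (Xof c g') t) \<noteq> 0" if "t \<in> S" for t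
      using det_nz[OF that] fmat_cong[of S t g g' c, OF open_S that assms(2)] by simp
  qed
qed

lemma pderivs_sum_cmult:
  fixes f :: "'i \<Rightarrow> real^'p::finite \<Rightarrow> real"
  assumes "\<And>i. i \<in> I \<Longrightarrow> smooth_map UNIV (f i)"
  shows "pderivs J (\<lambda>t. \<Sum>i\<in>I. a i * f i t) = (\<lambda>t. \<Sum>i\<in>I. a i * pderivs J (f i) t)"
proof (induction J)
  case (Cons j J)
  have d: "pderivs J (f i) differentiable at t" if "i \<in> I" for i t
    by (rule smooth_diffable[OF smooth_pderivs[OF assms[OF that]] UNIV_I])
  have "pd j (\<lambda>t. \<Sum>i\<in>I. a i * pderivs J (f i) t) t = (\<Sum>i\<in>I. a i * pd j (pderivs J (f i)) t)" for t
    by (subst pd_sum) (simp_all add: d pd_cmult)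
  then show ?case by (simp add: Cons fun_eq_iff)
qed simp

section \<open>Orbits are classified by their coordinates\<close>

context manifold
begin

text \<open>Reparametrising \<open>\<gamma>1\<close> by the inverse of its independent components
  after those of \<open>\<gamma>2\<close> makes the independent components agree identically. Both
  curves then have the same frame, equal coordinates mean equal frame derivatives of the dependent
  components, and \<open>eqr_from_Bops\<close> gives equal jets.\<close>

lemma same_coords:
  fixes c :: "('x, 'n::finite, 'N) split_chart"
  assumes c: "is_split_chart \<A> c" and g1: "good c \<gamma>1" and g2: "good c \<gamma>2"
    and eq: "pcoord s c (loc c \<gamma>1) 0 = pcoord s c (loc c \<gamma>2) 0"
  obtains \<alpha> where "local_diffeo \<alpha>" "same_jet s \<gamma>2 (\<lambda>t. \<gamma>1 (\<alpha> t))"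
proof -
  obtain S1 where S1: "open S1" "0 \<in> S1" "jet_curve c (loc c \<gamma>1) S1" by (rule good_nbhd[OF c g1]) blast
  obtain S2 where S2: "open S2" "0 \<in> S2" "jet_curve c (loc c \<gamma>2) S2" by (rule good_nbhd[OF c g2]) blast
  interpret a: jet_curve c s "loc c \<gamma>1" S1 by (rule S1(3))
  interpret b: jet_curve c s "loc c \<gamma>2" S2 by (rule S2(3))
  define x1 x2 :: "real^'n \<Rightarrow> real^'n" where "x1 t = (\<chi> i. Xof c (loc c \<gamma>1) i t)" and "x2 t = (\<chi> i. Xof c (loc c \<gamma>2) i t)" for t
  have fm: "fmat (\<lambda>i x. x1 x $ i) = fmat (Xof c (loc c \<gamma>1))" by (simp add: x1_def)
  have x1s: "smooth_map S1 (\<lambda>t. x1 t $ k)" for k using a.smooth_X by (simp add: x1_def)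
  have x2s: "smooth_map S2 (\<lambda>t. x2 t $ k)" for k using b.smooth_X by (simp add: x2_def)
  obtain U where U: "open U" "0 \<in> U" "U \<subseteq> S1" "inj_on x1 U" "open (x1 ` U)" "smooth_map (x1 ` U) (inv_into U x1)"
    by (rule smooth_inverse_function[OF S1(1,2) x1s]) (use a.det_nz[OF S1(2)] in \<open>simp_all add: fm\<close>)
  have bs: "smooth_map (x1 ` U) (\<lambda>x. inv_into U x1 x $ k)" for k
    using U(6) by (simp add: smooth_vec_iff[OF U(5)])
  define S where "S = {t\<in>S2. x2 t \<in> x1 ` U}"
  have "continuous_on S2 x2" using x2s by (simp add: smooth_continuous_on smooth_vec_iff[OF S2(1)])
  then have S: "open S"
    using continuous_open_preimage[OF _ S2(1) U(5)] by (simp add: S_def Int_def vimage_def)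
  have "Xof c (loc c \<gamma>1) i 0 = Xof c (loc c \<gamma>2) i 0" for i
    using fun_cong[OF eq, of "Inl i"] by simp
  then have x0: "x1 0 = x2 0" by (simp add: x1_def x2_def)
  have zS: "0 \<in> S" using S2(2) U(2) x0 by (simp add: S_def flip: x0)
  define \<alpha> where "\<alpha> t = inv_into U x1 (x2 t)" for t
  have \<alpha>s: "smooth_map S (\<lambda>t. \<alpha> t $ k)" for k
    unfolding \<alpha>_def
  proof (rule smooth_compose[where g = x2 and f = "\<lambda>x. inv_into U x1 x $ k", OF S _ bs])
    show "smooth_map S (\<lambda>x. x2 x $ k)" for k by (rule smooth_subset[OF x2s]) (auto simp: S_def)
  qed (auto simp: S_def)
  have \<alpha>0: "\<alpha> 0 = 0" using x0 U(2,4) by (simp add: \<alpha>_def flip: x0)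
  have x1\<alpha>: "x1 (\<alpha> t) = x2 t" if "t \<in> S" for t
    using that by (simp add: \<alpha>_def S_def f_inv_into_f)
  have X: "Xof c (loc c \<gamma>1) i (\<alpha> t) = Xof c (loc c \<gamma>2) i t" if "t \<in> S" for i t
    using arg_cong[OF x1\<alpha>[OF that], of "\<lambda>v. v $ i"] by (simp add: x1_def x2_def)
  have "pd j (\<lambda>t. Xof c (loc c \<gamma>1) i (\<alpha> t)) 0 = pd j (Xof c (loc c \<gamma>2) i) 0" for i j
    by (rule pd_cong[OF S zS X])
  then have "fmat (\<lambda>i t. Xof c (loc c \<gamma>1) i (\<alpha> t)) 0 = fmat (Xof c (loc c \<gamma>2)) 0"
    by (simp add: vec_eq_iff)
  moreover have "det (fmat (\<lambda>i t. Xof c (loc c \<gamma>1) i (\<alpha> t)) 0) =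
      det (fmat (Xof c (loc c \<gamma>1)) (\<alpha> 0)) * det (fmat (\<lambda>k x. \<alpha> x $ k) 0)"
    by (rule det_fmat_compose[OF a.smooth_X \<alpha>s zS]) (simp add: \<alpha>0 S1(2))
  ultimately have "det (fmat (\<lambda>k x. \<alpha> x $ k) 0) \<noteq> 0"
    using b.det_nz[OF S2(2)] by auto
  then have \<alpha>: "local_diffeo \<alpha>" using local_diffeoI[OF S zS \<alpha>s \<alpha>0] by simp
  define \<gamma>' where "\<gamma>' t = \<gamma>1 (\<alpha> t)" for t
  have g': "good c \<gamma>'" and D': "Dcoord c (loc c \<gamma>') I \<sigma> 0 = Dcoord c (loc c \<gamma>1) I \<sigma> 0" for I \<sigma>
    unfolding \<gamma>'_def by (rule good_compose[OF c g1 \<alpha>])+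
  obtain S3 where S3: "open S3" "0 \<in> S3" "jet_curve c (loc c \<gamma>') S3" by (rule good_nbhd[OF c g']) blast
  define Z where "Z = S \<inter> S2 \<inter> S3"
  have Z: "open Z" "0 \<in> Z" "Z \<subseteq> S2" "Z \<subseteq> S3" "Z \<subseteq> S" using S zS S2 S3 by (auto simp: Z_def)
  interpret bz: jet_curve c s "loc c \<gamma>2" Z by (rule jet_curve_subset[OF S2(3) Z(1,3)])
  interpret az: jet_curve c s "loc c \<gamma>'" Z by (rule jet_curve_subset[OF S3(3) Z(1,4)])
  have X': "Xof c (loc c \<gamma>') i t = Xof c (loc c \<gamma>2) i t" if "t \<in> Z" for i t
    using X[of t i] that Z(5) by (auto simp: Xof_def loc_def \<gamma>'_def)
  have "eqr s 0 (\<lambda>t. loc c \<gamma>' t $ A) (\<lambda>t. loc c \<gamma>2 t $ A)" for A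
  proof (cases "A \<in> range (ind c)")
    case True
    then obtain i where A: "A = ind c i" by auto
    show ?thesis by (rule eqr_local[OF Z(1,2)]) (use X'[of _ i] in \<open>simp add: A Xof_def\<close>)
  next
    case False
    then have A: "A \<in> dep c" by (simp add: dep_def)
    show ?thesis
    proof (rule bz.eqr_from_Bops[OF Z(2) az.smooth_g bz.smooth_g])
      fix I :: "'n list" assume I: "length I \<le> s"
      have "foldr (Bop (Xof c (loc c \<gamma>2))) I (\<lambda>t. loc c \<gamma>' t $ A) 0 = Dcoord c (loc c \<gamma>') I A 0"
        by (rule Bops_cong[OF Z(1) _ refl Z(2)]) (simp add: X')
      also have "\<dots> = Dcoord c (loc c \<gamma>2) I A 0"
        using D' a.Dcoord_pcoord[OF A I S1(2)] b.Dcoord_pcoord[OF A I S2(2)] eq by simp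
      finally show "foldr (Bop (Xof c (loc c \<gamma>2))) I (\<lambda>t. loc c \<gamma>' t $ A) 0 = Dcoord c (loc c \<gamma>2) I A 0" .
    qed
  qed
  moreover have "\<gamma>' 0 = \<gamma>2 0"
  proof -
    have "loc c \<gamma>1 0 = loc c \<gamma>2 0"
      using a.basept_pcoord[of "loc c \<gamma>1" 0] a.basept_pcoord[of "loc c \<gamma>2" 0] eq by simp
    moreover have "\<gamma>1 0 \<in> cdom c" "\<gamma>2 0 \<in> cdom c" using g1 g2 by (auto simp: good_def)
    ultimately have "\<gamma>1 0 = \<gamma>2 0"
      using chart_props(4)[OF sc_chart[OF c]] by (auto simp: loc_def inj_on_def)
    then show ?thesis by (simp add: \<gamma>'_def \<alpha>0)
  qed
  ultimately have "same_jet s \<gamma>2 \<gamma>'"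
    using g2 g' by (intro same_jetI[OF _ _ _ sc_chart[OF c]]) (auto simp: good_def loc_def)
  then show ?thesis using that[OF \<alpha>] unfolding \<gamma>'_def by blast
qed

lemma pcoord_compose:
  assumes c: "is_split_chart \<A> c" and \<gamma>: "good c \<gamma>" and \<alpha>: "local_diffeo \<alpha>"
  shows "pcoord s c (loc c (\<lambda>t. \<gamma> (\<alpha> t))) 0 = pcoord s c (loc c \<gamma>) 0"
proof
  fix k
  have "\<alpha> 0 = 0" using \<alpha> by (simp add: local_diffeo_def)
  then show "pcoord s c (loc c (\<lambda>t. \<gamma> (\<alpha> t))) 0 k = pcoord s c (loc c \<gamma>) 0 k"
    using good_compose(2)[OF c \<gamma> \<alpha>] by (cases k) (auto simp: pcoord_def Xof_def loc_def)
qed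

lemma rho_subset:
  assumes c: "is_split_chart \<A> c" and g1: "good c \<gamma>1" and g2: "good c \<gamma>2"
    and eq: "pcoord s c (loc c \<gamma>1) 0 = pcoord s c (loc c \<gamma>2) 0"
  shows "rho \<A> s (jet \<A> s \<gamma>2) \<subseteq> rho \<A> s (jet \<A> s \<gamma>1)"
proof
  have ch: "\<gamma>1 0 \<in> cdom c" "smooth_germ \<A> \<gamma>1" "\<gamma>2 0 \<in> cdom c" "smooth_germ \<A> \<gamma>2"
    using g1 g2 by (auto simp: good_def)
  fix w assume "w \<in> rho \<A> s (jet \<A> s \<gamma>2)"
  then obtain \<beta> where \<beta>: "local_diffeo \<beta>" "w = jet \<A> s (\<lambda>t. \<gamma>2 (\<beta> t))"
    unfolding rho_jet[OF sc_chart[OF c] ch(3,4)] by blast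
  have "pcoord s c (loc c \<gamma>1) 0 = pcoord s c (loc c (\<lambda>t. \<gamma>2 (\<beta> t))) 0"
    by (simp add: eq pcoord_compose[OF c g2 \<beta>(1)])
  from same_coords[OF c g1 good_compose(1)[OF c g2 \<beta>(1)] this]
  obtain \<alpha> where "local_diffeo \<alpha>" "same_jet s (\<lambda>t. \<gamma>2 (\<beta> t)) (\<lambda>t. \<gamma>1 (\<alpha> t))" .
  then show "w \<in> rho \<A> s (jet \<A> s \<gamma>1)"
    unfolding rho_jet[OF sc_chart[OF c] ch(1,2)] \<beta>(2) using jet_eqI by blast
qed

lemma rho_eq:
  assumes c: "is_split_chart \<A> c" and g1: "good c \<gamma>1" and g2: "good c \<gamma>2"
    and eq: "pcoord s c (loc c \<gamma>1) 0 = pcoord s c (loc c \<gamma>2) 0"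
  shows "rho \<A> s (jet \<A> s \<gamma>1) = rho \<A> s (jet \<A> s \<gamma>2)"
  using rho_subset[OF c g1 g2 eq] rho_subset[OF c g2 g1 eq[symmetric]] by blast

text \<open>The independent components are taken as translations, so that the frame consists of the
  ordinary partial derivatives. Taylor polynomials as dependent components then realise any
  prescribed coordinates.\<close>

lemma coords_surj:
  fixes c :: "('x, 'n::finite, 'N) split_chart"
  assumes c: "is_split_chart \<A> c" and z: "z \<in> P_domain s c"
  obtains \<gamma> where "good c \<gamma>" "pcoord s c (loc c \<gamma>) 0 = z"
proof -
  interpret jet_domain c s by (rule jet_domain_sc[OF c])
  define h :: "real^'n \<Rightarrow> real^'N" where "h t = (\<chi> A. if A \<in> range (ind c)
    then z (Inl (inv (ind c) A)) + t $ inv (ind c) A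
    else \<Sum>M | size M \<le> s. z (Inr (A, M)) * mono_at 0 M t)" for t
  have h_ind: "h t $ ind c i = z (Inl i) + t $ i" for t i by (simp add: h_def inj_ind)
  have h_dep: "(\<lambda>t. h t $ A) = (\<lambda>t. \<Sum>M | size M \<le> s. z (Inr (A, M)) * mono_at 0 M t)" if "A \<in> dep c" for A
    using that by (simp add: h_def dep_def fun_eq_iff)
  have sm: "smooth_map UNIV (\<lambda>t. h t $ A)" for A
  proof (cases "A \<in> range (ind c)")
    case True
    then obtain i where A: "A = ind c i" by auto
    show ?thesis unfolding A h_ind by (rule smooth_add[OF open_UNIV smooth_const smooth_coord])
  next
    case False
    then have A: "A \<in> dep c" by (simp add: dep_def)
    show ?thesis unfolding h_dep[OF A]
      by (intro smooth_sum[OF open_UNIV] smooth_mult[OF open_UNIV] smooth_const smooth_mono_at)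
  qed
  have der: "pderivs I (\<lambda>t. h t $ A) 0 = z (Inr (A, mset I))" if A: "A \<in> dep c" and I: "length I \<le> s" for A I
  proof -
    have "pderivs I (\<lambda>t. h t $ A) 0 = (\<Sum>M | size M \<le> s. z (Inr (A, M)) * pderivs I (mono_at 0 M) 0)"
      unfolding h_dep[OF A] by (subst pderivs_sum_cmult) (simp_all add: smooth_mono_at)
    also have "\<dots> = z (Inr (A, mset I))"
      using I by (simp add: pderivs_mono_at_self if_distrib finite_msets_size_le cong: if_cong)
    finally show ?thesis .
  qed
  have h0: "h 0 = basept c z"
  proof -
    have "h 0 $ A = basept c z $ A" for A
    proof (cases "A \<in> range (ind c)")
      case True
      then show ?thesis by (auto simp: basept_ind h_ind)
    next
      case False
      then have A: "A \<in> dep c" by (simp add: dep_def)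
      from der[OF A, of "[]"] show ?thesis by (simp add: basept_dep[OF A])
    qed
    then show ?thesis by (simp add: vec_eq_iff)
  qed
  define S where "S = {t. h t \<in> cmap c ` cdom c}"
  have "continuous_on UNIV h" using sm by (simp add: smooth_continuous_on smooth_vec_iff)
  from open_vimage[OF open_V this] have S: "open S" by (simp add: S_def vimage_def)
  have S0: "0 \<in> S" using z by (simp add: S_def h0 P_domain_def)
  define \<gamma> where "\<gamma> t = inv_into (cdom c) (cmap c) (h t)" for t
  have loc: "loc c \<gamma> t = h t" if "t \<in> S" for t
    using that by (simp add: loc_def \<gamma>_def S_def f_inv_into_f)
  have germ: "smooth_germ \<A> \<gamma>"
    by (rule smooth_germI[where h = h, OF sc_chart[OF c] S S0 smooth_subset[OF sm]]) (auto simp: S_def \<gamma>_def)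
  have X: "Xof c h i = (\<lambda>t. z (Inl i) + t $ i)" for i by (simp add: Xof_def h_ind fun_eq_iff)
  have pdX: "pd j (Xof c h i) t = (if j = i then 1 else 0)" for i j t
  proof -
    have "pd j (\<lambda>t. z (Inl i) + t $ i) t = pd j (\<lambda>t. z (Inl i)) t + pd j (\<lambda>t. t $ i) t"
      by (rule pd_add) (simp_all add: smooth_diffable[OF smooth_coord UNIV_I])
    then show ?thesis unfolding X by (simp add: pd_coord)
  qed
  have fm: "fmat (Xof c h) t = mat 1" for t by (auto simp: vec_eq_iff pdX mat_def)
  have Bop: "Bop (Xof c h) i k t = pd i k t" for i k t
    by (rule Bop_unique) (simp_all add: fm pdX if_distrib[of "\<lambda>x. x * _"] cong: if_cong)
  have Bops: "foldr (Bop (Xof c h)) I k = pderivs I k" for I k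
  proof (induction I)
    case (Cons i I)
    then show ?case by (simp add: Bop fun_eq_iff[of "Bop _ _ _"])
  qed simp
  have "det (fmat (Xof c (loc c \<gamma>)) 0) \<noteq> 0"
    using fmat_cong[of S 0 "loc c \<gamma>" h c, OF S S0 loc] fm by simp
  then have good: "good c \<gamma>"
    using germ S0 by (simp add: good_def \<gamma>_def S_def inv_into_into)
  have "pcoord s c h 0 = z"
  proof
    fix k
    show "pcoord s c h 0 k = z k"
    proof (cases "k \<in> P_labels s c")
      case True
      then show ?thesis
        by (cases rule: P_labels_cases) (simp_all add: pcoord_Inr Bops der X)
    qed (use z in \<open>simp add: pcoord_def P_domain_def\<close>)
  qed
  then have "pcoord s c (loc c \<gamma>) 0 = z" using pcoord_cong[of S 0 "loc c \<gamma>" h s c, OF S S0 loc] by simp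
  with good show ?thesis by (rule that)
qed

section \<open>Local expressions of functions and operators on orbits\<close>

lemma rho_W:
  assumes c: "is_split_chart \<A> c" and s: "1 \<le> s"
  shows "rho \<A> s ` W \<A> s c = {rho \<A> s (jet \<A> s \<gamma>) | \<gamma>. good c \<gamma>}"
proof
  show "rho \<A> s ` W \<A> s c \<subseteq> {rho \<A> s (jet \<A> s \<gamma>) | \<gamma>. good c \<gamma>}"
  proof
    fix q assume "q \<in> rho \<A> s ` W \<A> s c"
    then obtain u where u: "u \<in> W \<A> s c" "q = rho \<A> s u" by blast
    from W_E[OF c u(1) s] obtain \<gamma> where "u = jet \<A> s \<gamma>" "good c \<gamma>" .
    with u(2) show "q \<in> {rho \<A> s (jet \<A> s \<gamma>) | \<gamma>. good c \<gamma>}" by blast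
  qed
  show "{rho \<A> s (jet \<A> s \<gamma>) | \<gamma>. good c \<gamma>} \<subseteq> rho \<A> s ` W \<A> s c"
    using W_iff[OF c _ s] by (auto simp: good_def)
qed

lemma P_coords_image:
  assumes c: "is_split_chart \<A> c" and s: "1 \<le> s"
  shows "P_coords \<A> s c ` rho \<A> s ` W \<A> s c = P_domain s c"
proof
  interpret jet_domain c s by (rule jet_domain_sc[OF c])
  show "P_coords \<A> s c ` rho \<A> s ` W \<A> s c \<subseteq> P_domain s c"
    unfolding rho_W[OF c s] by (auto simp: P_coords_rho[OF c] good_def loc_def intro!: pcoord_in)
  show "P_domain s c \<subseteq> P_coords \<A> s c ` rho \<A> s ` W \<A> s c"
  proof
    fix z assume "z \<in> P_domain s c"
    from coords_surj[OF c this] obtain \<gamma> where "good c \<gamma>" "pcoord s c (loc c \<gamma>) 0 = z" .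
    then show "z \<in> P_coords \<A> s c ` rho \<A> s ` W \<A> s c"
      unfolding rho_W[OF c s] image_iff using P_coords_rho[OF c, of \<gamma> s]
      by (intro bexI[of _ "rho \<A> s (jet \<A> s \<gamma>)"] CollectI exI[of _ \<gamma>] conjI refl) simp_all
  qed
qed

text \<open>\<open>P_local\<close> contains an inverse of the coordinate map; injectivity, which
  comes from \<open>rho_eq\<close>, makes it meaningful. Afterwards functions on orbits are
  evaluated through curves only.\<close>

lemma P_local_pcoord:
  assumes c: "is_split_chart \<A> c" and s: "1 \<le> s" and \<gamma>: "good c \<gamma>"
  shows "P_local \<A> s c F (pcoord s c (loc c \<gamma>) 0) = F (rho \<A> s (jet \<A> s \<gamma>))"
proof -
  have "inj_on (P_coords \<A> s c) (rho \<A> s ` W \<A> s c)"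
  proof (rule inj_onI)
    fix q q' assume q: "q \<in> rho \<A> s ` W \<A> s c" "q' \<in> rho \<A> s ` W \<A> s c"
      and eq: "P_coords \<A> s c q = P_coords \<A> s c q'"
    obtain \<gamma>1 where 1: "q = rho \<A> s (jet \<A> s \<gamma>1)" "good c \<gamma>1" using q(1) unfolding rho_W[OF c s] by blast
    obtain \<gamma>2 where 2: "q' = rho \<A> s (jet \<A> s \<gamma>2)" "good c \<gamma>2" using q(2) unfolding rho_W[OF c s] by blast
    show "q = q'"
      unfolding 1(1) 2(1) using eq unfolding 1(1) 2(1) P_coords_rho[OF c 1(2)] P_coords_rho[OF c 2(2)]
      by (rule rho_eq[OF c 1(2) 2(2)])
  qed
  moreover have "rho \<A> s (jet \<A> s \<gamma>) \<in> rho \<A> s ` W \<A> s c" unfolding rho_W[OF c s] using \<gamma> by blast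
  ultimately have "inv_into (rho \<A> s ` W \<A> s c) (P_coords \<A> s c) (P_coords \<A> s c (rho \<A> s (jet \<A> s \<gamma>))) = rho \<A> s (jet \<A> s \<gamma>)"
    by (rule inv_into_f_f)
  then show ?thesis by (simp add: P_local_def P_coords_rho[OF c \<gamma>])
qed

lemma P_proj_rho:
  assumes c: "is_split_chart \<A> c" and r: "1 \<le> r" "r \<le> s" and \<gamma>: "good c \<gamma>"
  shows "P_proj \<A> r (rho \<A> s (jet \<A> s \<gamma>)) = rho \<A> r (jet \<A> r \<gamma>)"
proof -
  have "\<gamma> 0 \<in> cdom c" "smooth_germ \<A> \<gamma>" using \<gamma> by (auto simp: good_def)
  from rep_rho[OF sc_chart[OF c] this] obtain \<alpha> where
    \<alpha>: "local_diffeo \<alpha>" "rep (rho \<A> s (jet \<A> s \<gamma>)) = jet \<A> s (\<lambda>t. \<gamma> (\<alpha> t))" .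
  note g\<alpha> = good_compose(1)[OF c \<gamma> \<alpha>(1)]
  have "same_jet s (\<lambda>t. \<gamma> (\<alpha> t)) (rep (jet \<A> s (\<lambda>t. \<gamma> (\<alpha> t))))"
    by (rule rep_jet) (use g\<alpha> in \<open>simp add: good_def\<close>)
  from jet_eqI[OF same_jet_mono[OF this r(2)]]
  have "P_proj \<A> r (rho \<A> s (jet \<A> s \<gamma>)) = rho \<A> r (jet \<A> r (\<lambda>t. \<gamma> (\<alpha> t)))"
    by (simp add: P_proj_def \<alpha>(2))
  also have "\<dots> = rho \<A> r (jet \<A> r \<gamma>)"
    by (rule rho_eq[OF c g\<alpha> \<gamma> pcoord_compose[OF c \<gamma> \<alpha>(1)]])
  finally show ?thesis .
qed

definition Lhat :: "nat \<Rightarrow> nat \<Rightarrow> ('x, 'n::finite, 'N) split_chart \<Rightarrow> (('n, 'x) jet set \<Rightarrow> real) \<Rightarrow>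
    ('n + 'N \<times> 'n multiset \<Rightarrow> real) \<Rightarrow> real" where
  "Lhat r s c L = P_local \<A> s c (L \<circ> P_proj \<A> r)"

lemma Lhat_pcoord:
  assumes c: "is_split_chart \<A> c" and r: "1 \<le> r" "r \<le> s" and \<gamma>: "good c \<gamma>"
  shows "Lhat r s c L (pcoord s c (loc c \<gamma>) 0) = L (rho \<A> r (jet \<A> r \<gamma>))"
proof -
  have "1 \<le> s" using r by simp
  from P_local_pcoord[OF c this \<gamma>] show ?thesis
    by (simp add: Lhat_def P_proj_rho[OF c r \<gamma>])
qed

lemma Lhat_trunc:
  assumes c: "is_split_chart \<A> c" and r: "1 \<le> r" "r \<le> s" and z: "z \<in> P_domain s c"
  shows "Lhat r s c L z = P_local \<A> r c L (trunc r c z)"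
proof -
  from coords_surj[OF c z] obtain \<gamma> where \<gamma>: "good c \<gamma>" "pcoord s c (loc c \<gamma>) 0 = z" .
  show ?thesis
    using Lhat_pcoord[OF c r \<gamma>(1), of L] P_local_pcoord[OF c r(1) \<gamma>(1), of L]
    by (simp add: trunc_pcoord[OF r(2)] flip: \<gamma>(2))
qed

text \<open>The Lagrangian pulled back to order \<open>s\<close> is its local expression of order
  \<open>r\<close> composed with the projection of coordinates, so it is smooth and blind to
  coordinates of higher order.\<close>

lemma Lhat_regular:
  assumes c: "is_split_chart \<A> c" and r: "1 \<le> r" "r \<le> s" and L: "associated_lagrangian \<A> r c \<L> L"
  shows "csmooth_on (P_labels s c) (P_domain s c) (Lhat r s c L)" "jet_domain.order_le c s r (Lhat r s c L)"
proof -
  interpret jet_domain c s by (rule jet_domain_sc[OF c])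
  have "csmooth_on (P_labels r c) (P_domain r c) (P_local \<A> r c L)"
    using L unfolding associated_lagrangian_def P_coords_image[OF c r(1)] by blast
  from csmooth_trunc[OF jet_domain_axioms r(2) this]
  show "csmooth_on (P_labels s c) (P_domain s c) (Lhat r s c L)"
    by (rule csmooth_cong) (simp add: Lhat_trunc[OF c r])
  show "order_le r (Lhat r s c L)"
    unfolding order_le_def
  proof (intro ballI impI)
    fix z z' assume z: "z \<in> P_domain s c" "z' \<in> P_domain s c" and eq: "\<forall>k\<in>P_labels r c. z k = z' k"
    then have "trunc r c z = trunc r c z'" by (auto simp: trunc_def fun_eq_iff)
    then show "Lhat r s c L z = Lhat r s c L z'" using z by (simp add: Lhat_trunc[OF c r])
  qed
qed

lemma P_local_Delta:
  assumes c: "is_split_chart \<A> c" and s: "1 \<le> s" and z: "z \<in> P_domain s c"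
  shows "P_local \<A> s c (Delta \<A> s c \<sigma> J F) z = jweight J * cpartial (Inr (\<sigma>, mset J)) (P_local \<A> s c F) z"
proof -
  from coords_surj[OF c z] obtain \<gamma> where \<gamma>: "good c \<gamma>" "pcoord s c (loc c \<gamma>) 0 = z" .
  show ?thesis
    using P_local_pcoord[OF c s \<gamma>(1), of "Delta \<A> s c \<sigma> J F"]
    by (simp add: Delta_def P_partial_def jweight_def P_coords_rho[OF c \<gamma>(1)] \<gamma>(2))
qed

lemma P_local_Dtot:
  assumes c: "is_split_chart \<A> c" and s: "1 \<le> s" and z: "z \<in> P_domain s c"
  shows "P_local \<A> s c (Dtot \<A> s c i F) z = Dloc s c i (P_local \<A> s c F) z"
proof -
  from coords_surj[OF c z] obtain \<gamma> where \<gamma>: "good c \<gamma>" "pcoord s c (loc c \<gamma>) 0 = z" .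
  obtain S where S: "0 \<in> S" "jet_curve c (loc c \<gamma>) S" by (rule good_nbhd[OF c \<gamma>(1)]) blast
  interpret jet_curve c s "loc c \<gamma>" S by (rule S(2))
  have "Py \<A> c \<sigma> (i # J) (rho \<A> s (jet \<A> s \<gamma>)) = z (Inr (\<sigma>, mset (i # J)))"
    if "\<sigma> \<in> dep c" "length J \<le> s - 1" for \<sigma> J
  proof -
    have l: "length (i # J) \<le> s" using that(2) s by simp
    show ?thesis
      unfolding Py_rho[OF c \<gamma>(1) l] \<gamma>(2)[symmetric] by (rule Dcoord_pcoord[OF that(1) l S(1)])
  qed
  then show ?thesis
    using P_local_pcoord[OF c s \<gamma>(1), of "Dtot \<A> s c i F"]
    by (simp add: Dtot_def Dloc_def Delta_def P_partial_def P_coords_rho[OF c \<gamma>(1)] \<gamma>(2) jweight_def)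
qed

lemma Dloc_cong:
  assumes c: "is_split_chart \<A> c" and s: "1 \<le> s" and z: "z \<in> P_domain s c"
    and eq: "\<And>z. z \<in> P_domain s c \<Longrightarrow> F z = G z"
  shows "Dloc s c i F z = Dloc s c i G z"
proof -
  interpret jet_domain c s by (rule jet_domain_sc[OF c])
  show ?thesis unfolding Dloc_def
    using s by (intro arg_cong2[of _ _ _ _ "(+)"] arg_cong2[of _ _ _ _ "(*)"] sum.cong refl cpartial_cong[OF eq z]) auto
qed

text \<open>Agreement on \<open>P_domain\<close> is enough at every stage, because the domain is
  open in the coordinate space and the derivatives see only values inside it.\<close>

lemma P_local_Dtots:
  assumes c: "is_split_chart \<A> c" and s: "1 \<le> s"
    and eq: "\<And>z. z \<in> P_domain s c \<Longrightarrow> P_local \<A> s c F z = G z"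
  shows "z \<in> P_domain s c \<Longrightarrow> P_local \<A> s c (foldr (Dtot \<A> s c) J F) z = foldr (Dloc s c) J G z"
proof (induction J arbitrary: z)
  case (Cons i J)
  have "P_local \<A> s c (Dtot \<A> s c i (foldr (Dtot \<A> s c) J F)) z =
    Dloc s c i (P_local \<A> s c (foldr (Dtot \<A> s c) J F)) z"
    by (rule P_local_Dtot[OF c s Cons.prems])
  also have "\<dots> = Dloc s c i (foldr (Dloc s c) J G) z"
    by (rule Dloc_cong[OF c s Cons.prems Cons.IH])
  finally show ?case by simp
qed (simp add: eq)

lemma EL_rho:
  assumes c: "is_split_chart \<A> c" and s: "1 \<le> s" and \<gamma>: "good c \<gamma>"
  shows "Euler_Lagrange \<A> r s c \<sigma> L (rho \<A> s (jet \<A> s \<gamma>)) = EL_loc r s c \<sigma> (Lhat r s c L) (pcoord s c (loc c \<gamma>) 0)"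
proof -
  interpret jet_domain c s by (rule jet_domain_sc[OF c])
  have dom: "pcoord s c (loc c \<gamma>) 0 \<in> P_domain s c"
    by (rule pcoord_in) (use \<gamma> in \<open>simp add: good_def loc_def\<close>)
  have "foldr (Dtot \<A> s c) J (Delta \<A> s c \<sigma> J (L \<circ> P_proj \<A> r)) (rho \<A> s (jet \<A> s \<gamma>)) =
    foldr (Dloc s c) J (\<lambda>z. jweight J * cpartial (Inr (\<sigma>, mset J)) (Lhat r s c L) z) (pcoord s c (loc c \<gamma>) 0)" for J
    unfolding P_local_pcoord[OF c s \<gamma>, symmetric] Lhat_def
    by (rule P_local_Dtots[OF c s P_local_Delta[OF c s] dom])
  then show ?thesis by (simp add: Euler_Lagrange_def EL_loc_def)
qed

text \<open>Velocities are jets at \<open>0\<close>, so the jet at \<open>t\<close> is that of the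
  translated curve. This expresses the chart-free function \<open>\<L>\<close> along a curve by the
  data of one chart.\<close>

lemma lagrangian_on_curve:
  assumes c: "is_split_chart \<A> c" and r: "1 \<le> r" "r \<le> s" and L: "associated_lagrangian \<A> r c \<L> L"
    and S: "jet_curve c g S" and \<gamma>: "\<And>t. t \<in> S \<Longrightarrow> \<gamma> t \<in> cdom c" "\<And>t. t \<in> S \<Longrightarrow> cmap c (\<gamma> t) = g t" and t: "t \<in> S"
  shows "\<L> (jet \<A> r (\<lambda>u. \<gamma> (t + u))) = det (fmat (Xof c g) t) * Lhat r s c L (pcoord s c g t)"
proof -
  interpret jet_curve c s g S by (rule S)
  have J: "jet_curve c (loc c \<gamma>) S" by (rule jet_curve_cong[OF S]) (simp add: loc_def \<gamma>(2))
  interpret l: jet_curve c s "loc c \<gamma>" S by (rule J)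
  have good: "good c (\<lambda>u. \<gamma> (t + u))" by (rule good_translate[OF c J \<gamma>(1) t])
  have loc: "loc c (\<lambda>u. \<gamma> (t + u)) = (\<lambda>u. loc c \<gamma> (t + u))" by (simp add: loc_def fun_eq_iff)
  have lg: "loc c \<gamma> u = g u" if "u \<in> S" for u by (simp add: loc_def \<gamma>(2)[OF that])
  have "jet \<A> r (\<lambda>u. \<gamma> (t + u)) \<in> W \<A> r c" using W_iff[OF c _ r(1)] good by (simp add: good_def)
  then have "\<L> (jet \<A> r (\<lambda>u. \<gamma> (t + u))) = det (xmat c (jet \<A> r (\<lambda>u. \<gamma> (t + u)))) * L (rho \<A> r (jet \<A> r (\<lambda>u. \<gamma> (t + u))))"
    using L unfolding associated_lagrangian_def by blast
  also have "xmat c (jet \<A> r (\<lambda>u. \<gamma> (t + u))) = fmat (Xof c (loc c (\<lambda>u. \<gamma> (t + u)))) 0"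
    by (rule xmat_jet[OF c _ _ r(1)]) (use good in \<open>auto simp: good_def\<close>)
  also have "\<dots> = fmat (Xof c g) t"
    unfolding loc using l.fmat_translate_curve[of t 0] fmat_cong[of S t "loc c \<gamma>" g c, OF open_S t lg] t by simp
  also have "L (rho \<A> r (jet \<A> r (\<lambda>u. \<gamma> (t + u)))) = Lhat r s c L (pcoord s c (loc c (\<lambda>u. \<gamma> (t + u))) 0)"
    by (rule Lhat_pcoord[OF c r good, symmetric])
  also have "pcoord s c (loc c (\<lambda>u. \<gamma> (t + u))) 0 = pcoord s c g t"
    unfolding loc using l.pcoord_translate[OF t] pcoord_cong[of S t "loc c \<gamma>" g s c, OF open_S t lg] by simp
  finally show ?thesis .
qed

end

section \<open>Change of charts\<close>

lemma (in jet_domain) sum_split: "(\<Sum>A\<in>UNIV. f A) = (\<Sum>i\<in>UNIV. f (ind c i)) + (\<Sum>\<sigma>\<in>dep c. f \<sigma> :: real)"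
proof -
  have "(\<Sum>A\<in>UNIV. f A) = (\<Sum>A\<in>range (ind c). f A) + (\<Sum>A\<in>dep c. f A)"
    unfolding dep_def by (subst sum.union_disjoint[symmetric]) (auto intro: sum.cong)
  then show ?thesis by (simp add: sum.reindex[OF inj_ind])
qed

lemma (in jet_domain) cpartial_basept:
  assumes f: "smooth_map Q f" "basept c z \<in> Q"
  shows "cpartial (Inl i) (\<lambda>z. f (basept c z)) z = pd (ind c i) f (basept c z)"
    and "\<sigma> \<in> dep c \<Longrightarrow> cpartial (Inr (\<sigma>, {#})) (\<lambda>z. f (basept c z)) z = pd \<sigma> f (basept c z)"
    and "M \<noteq> {#} \<Longrightarrow> cpartial (Inr (\<sigma>, M)) (\<lambda>z. f (basept c z)) z = 0"
proof -
  have line: "deriv (\<lambda>t. f (basept c z - z k *\<^sub>R axis A 1 + t *\<^sub>R axis A 1)) (z k) = pd A f (basept c z)" for k A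
    using has_real_derivative_line[of f "basept c z - z k *\<^sub>R axis A 1" "z k" A] smooth_diffable[OF f]
    by (simp add: DERIV_imp_deriv)
  have "basept c (z(Inl i := t)) = basept c z - z (Inl i) *\<^sub>R axis (ind c i) 1 + t *\<^sub>R axis (ind c i) 1" for t
    using inj_ind by (auto simp: vec_eq_iff basept_def axis_def inj_eq)
  then show "cpartial (Inl i) (\<lambda>z. f (basept c z)) z = pd (ind c i) f (basept c z)"
    using line[of "Inl i" "ind c i"] by (simp add: cpartial_def)
  show "cpartial (Inr (\<sigma>, {#})) (\<lambda>z. f (basept c z)) z = pd \<sigma> f (basept c z)" if "\<sigma> \<in> dep c"
  proof -
    have "basept c (z(Inr (\<sigma>, {#}) := t)) = basept c z - z (Inr (\<sigma>, {#})) *\<^sub>R axis \<sigma> 1 + t *\<^sub>R axis \<sigma> 1" for t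
      using that by (auto simp: vec_eq_iff basept_def axis_def dep_def)
    then show ?thesis using line[of "Inr (\<sigma>, {#})" \<sigma>] by (simp add: cpartial_def)
  qed
  show "cpartial (Inr (\<sigma>, M)) (\<lambda>z. f (basept c z)) z = 0" if "M \<noteq> {#}"
  proof -
    have "basept c (z(Inr (\<sigma>, M) := t)) = basept c z" for t
      using that by (auto simp: vec_eq_iff basept_def)
    then show ?thesis by (simp add: cpartial_def)
  qed
qed

lemma jweight_Nil [simp]: "jweight [] = 1"
  by (simp add: jweight_def)

lemma (in jet_curve) Dloc_basept:
  assumes s: "1 \<le> s" and t: "t \<in> S" and f: "smooth_map Q f" "g t \<in> Q"
  shows "Dloc s c i (\<lambda>z. f (basept c z)) (pcoord s c g t) = Bop (Xof c g) i (\<lambda>t. f (g t)) t"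
proof -
  let ?z = "pcoord s c g t"
  note bz = basept_pcoord[of g t]
  have fz: "basept c ?z \<in> Q" using f(2) by (simp add: bz)
  have "(\<Sum>J | length J \<le> s - 1. ?z (Inr (\<sigma>, mset (i # J))) * (jweight J * cpartial (Inr (\<sigma>, mset J)) (\<lambda>z. f (basept c z)) ?z)) =
     pd \<sigma> f (g t) * Bop (Xof c g) i (\<lambda>t. g t $ \<sigma>) t" if \<sigma>: "\<sigma> \<in> dep c" for \<sigma>
  proof -
    have "(\<Sum>J | length J \<le> s - 1. ?z (Inr (\<sigma>, mset (i # J))) * (jweight J * cpartial (Inr (\<sigma>, mset J)) (\<lambda>z. f (basept c z)) ?z)) =
      (\<Sum>J\<in>{[]}. ?z (Inr (\<sigma>, mset (i # J))) * (jweight J * cpartial (Inr (\<sigma>, mset J)) (\<lambda>z. f (basept c z)) ?z))"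
      by (rule sum.mono_neutral_right) (auto simp: finite_lists_le cpartial_basept(3)[OF f(1) fz])
    also have "\<dots> = ?z (Inr (\<sigma>, {#i#})) * pd \<sigma> f (g t)"
      by (simp add: cpartial_basept(2)[OF f(1) fz \<sigma>] bz)
    also have "?z (Inr (\<sigma>, {#i#})) = Bop (Xof c g) i (\<lambda>t. g t $ \<sigma>) t"
      using Dcoord_pcoord[OF \<sigma> _ t, of "[i]"] s by simp
    finally show ?thesis by simp
  qed
  then have "Dloc s c i (\<lambda>z. f (basept c z)) ?z = pd (ind c i) f (g t) + (\<Sum>\<sigma>\<in>dep c. pd \<sigma> f (g t) * Bop (Xof c g) i (\<lambda>t. g t $ \<sigma>) t)"
    unfolding Dloc_def by (simp add: cpartial_basept(1)[OF f(1) fz] bz)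
  moreover have "Bop (Xof c g) i (\<lambda>t. f (g t)) t = (\<Sum>A\<in>UNIV. pd A f (g t) * Bop (Xof c g) i (\<lambda>t. g t $ A) t)"
    by (rule Bop_compose[OF t smooth_diffable[OF f] smooth_g])
  moreover have "(\<Sum>m\<in>UNIV. pd (ind c m) f (g t) * Bop (Xof c g) i (\<lambda>t. g t $ ind c m) t) = pd (ind c i) f (g t)"
  proof -
    have *: "Bop (Xof c g) i (\<lambda>t. g t $ ind c m) t = (if i = m then 1 else 0)" for m
      using Bop_X[OF t, of i m] by (simp add: Xof_def[abs_def])
    show ?thesis by (simp add: * if_distrib cong: if_cong)
  qed
  ultimately show ?thesis unfolding sum_split by simp
qed

definition chart_change :: "('x, 'n::finite, 'N::finite) split_chart \<Rightarrow> ('x, 'n, 'N) split_chart \<Rightarrow> real^'N \<Rightarrow> real^'N" where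
  "chart_change c c' x = cmap c' (inv_into (cdom c) (cmap c) x)"

definition overlap :: "('x, 'n::finite, 'N::finite) split_chart \<Rightarrow> ('x, 'n, 'N) split_chart \<Rightarrow> (real^'N) set" where
  "overlap c c' = cmap c ` (cdom c \<inter> cdom c')"

section \<open>The transformation coefficients along a curve and the comparison of
  variations\<close>

context manifold
begin

lemma smooth_chart_change:
  assumes "is_split_chart \<A> c" "is_split_chart \<A> c'"
  shows "open (overlap c c')" "smooth_map (overlap c c') (\<lambda>x. chart_change c c' x $ k)"
  using transition[OF sc_chart[OF assms(1)] sc_chart[OF assms(2)]] by (simp_all add: overlap_def chart_change_def)

lemma chart_change_loc: "is_split_chart \<A> c \<Longrightarrow> \<gamma> t \<in> cdom c \<Longrightarrow> chart_change c c' (loc c \<gamma> t) = loc c' \<gamma> t"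
  by (simp add: chart_change_def loc_def inv_chart[OF sc_chart])

lemma P_local_base:
  assumes c: "is_split_chart \<A> c" and s: "1 \<le> s" and z: "z \<in> P_domain s c"
  shows "P_local \<A> s c (Px c' j) z = chart_change c c' (basept c z) $ ind c' j"
    and "P_local \<A> s c (Py \<A> c' \<nu> []) z = chart_change c c' (basept c z) $ \<nu>"
proof -
  from coords_surj[OF c z] obtain \<gamma> where \<gamma>: "good c \<gamma>" "pcoord s c (loc c \<gamma>) 0 = z" .
  interpret jet_domain c s by (rule jet_domain_sc[OF c])
  have g: "\<gamma> 0 \<in> cdom c" "smooth_germ \<A> \<gamma>" using \<gamma>(1) by (auto simp: good_def)
  have "basept c z = loc c \<gamma> 0" using basept_pcoord[of "loc c \<gamma>" 0] \<gamma>(2) by simp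
  then have "chart_change c c' (basept c z) = cmap c' (\<gamma> 0)" using chart_change_loc[of c \<gamma> 0 c', OF c g(1)] by (simp add: loc_def)
  then show "P_local \<A> s c (Px c' j) z = chart_change c c' (basept c z) $ ind c' j"
    "P_local \<A> s c (Py \<A> c' \<nu> []) z = chart_change c c' (basept c z) $ \<nu>"
    using P_local_pcoord[OF c s \<gamma>(1), of "Px c' j"] P_local_pcoord[OF c s \<gamma>(1), of "Py \<A> c' \<nu> []"]
      base_rho[OF sc_chart[OF c] g] by (simp_all add: \<gamma>(2))
qed

lemma jac_rho:
  assumes c: "is_split_chart \<A> c" and c': "is_split_chart \<A> c'" and s: "1 \<le> s"
    and \<gamma>: "good c \<gamma>" "\<gamma> 0 \<in> cdom c'"
  shows "jac \<A> s c c' (rho \<A> s (jet \<A> s \<gamma>)) = det (\<chi> i j. Bop (Xof c (loc c \<gamma>)) i (\<lambda>t. chart_change c c' (loc c \<gamma> t) $ ind c' j) 0)"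
proof -
  obtain S where S: "0 \<in> S" "jet_curve c (loc c \<gamma>) S" by (rule good_nbhd[OF c \<gamma>(1)]) blast
  interpret jet_curve c s "loc c \<gamma>" S by (rule S(2))
  have ov: "loc c \<gamma> 0 \<in> overlap c c'" using \<gamma> by (simp add: overlap_def loc_def good_def)
  have "Dtot \<A> s c i (Px c' j) (rho \<A> s (jet \<A> s \<gamma>)) = Bop (Xof c (loc c \<gamma>)) i (\<lambda>t. chart_change c c' (loc c \<gamma> t) $ ind c' j) 0" for i j
  proof -
    note dom = pcoord_in_domain[OF S(1)]
    have "Dtot \<A> s c i (Px c' j) (rho \<A> s (jet \<A> s \<gamma>)) = Dloc s c i (P_local \<A> s c (Px c' j)) (pcoord s c (loc c \<gamma>) 0)"
      unfolding P_local_pcoord[OF c s \<gamma>(1), symmetric] by (rule P_local_Dtot[OF c s dom])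
    also have "\<dots> = Dloc s c i (\<lambda>z. chart_change c c' (basept c z) $ ind c' j) (pcoord s c (loc c \<gamma>) 0)"
      by (rule Dloc_cong[OF c s dom]) (rule P_local_base(1)[OF c s])
    also have "\<dots> = Bop (Xof c (loc c \<gamma>)) i (\<lambda>t. chart_change c c' (loc c \<gamma> t) $ ind c' j) 0"
      by (rule Dloc_basept[OF s S(1) smooth_chart_change(2)[OF c c'] ov])
    finally show ?thesis .
  qed
  then show ?thesis by (simp add: jac_def)
qed

lemma Pcoef_rho:
  assumes c: "is_split_chart \<A> c" and c': "is_split_chart \<A> c'" and s: "1 \<le> s"
    and \<gamma>: "good c \<gamma>" "good c' \<gamma>" and \<sigma>: "\<sigma> \<in> dep c"
  shows "Pcoef \<A> s c c' \<nu> \<sigma> (rho \<A> s (jet \<A> s \<gamma>)) = pd \<sigma> (\<lambda>x. chart_change c c' x $ \<nu>) (loc c \<gamma> 0) -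
    (\<Sum>i\<in>UNIV. pd \<sigma> (\<lambda>x. chart_change c c' x $ ind c' i) (loc c \<gamma> 0) * Bop (Xof c' (loc c' \<gamma>)) i (\<lambda>t. loc c' \<gamma> t $ \<nu>) 0)"
proof -
  interpret jet_domain c s by (rule jet_domain_sc[OF c])
  have ov: "loc c \<gamma> 0 \<in> overlap c c'" using \<gamma> by (simp add: overlap_def loc_def good_def)
  have dom: "pcoord s c (loc c \<gamma>) 0 \<in> P_domain s c"
    by (rule pcoord_in) (use \<gamma> in \<open>simp add: good_def loc_def\<close>)
  have lab: "Inr (\<sigma>, {#}) \<in> P_labels s c" using \<sigma> by simp
  have bz: "basept c (pcoord s c (loc c \<gamma>) 0) = loc c \<gamma> 0" by (rule basept_pcoord)
  have D: "Delta \<A> s c \<sigma> [] F (rho \<A> s (jet \<A> s \<gamma>)) = pd \<sigma> (\<lambda>x. chart_change c c' x $ A) (loc c \<gamma> 0)"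
    if "\<And>z. z \<in> P_domain s c \<Longrightarrow> P_local \<A> s c F z = chart_change c c' (basept c z) $ A" for F A
  proof -
    have "Delta \<A> s c \<sigma> [] F (rho \<A> s (jet \<A> s \<gamma>)) = cpartial (Inr (\<sigma>, {#})) (P_local \<A> s c F) (pcoord s c (loc c \<gamma>) 0)"
      unfolding P_local_pcoord[OF c s \<gamma>(1), symmetric] using P_local_Delta[OF c s dom, of \<sigma> "[]" F] by simp
    also have "\<dots> = cpartial (Inr (\<sigma>, {#})) (\<lambda>z. chart_change c c' (basept c z) $ A) (pcoord s c (loc c \<gamma>) 0)"
      by (rule cpartial_cong[OF that dom lab])
    also have "\<dots> = pd \<sigma> (\<lambda>x. chart_change c c' x $ A) (loc c \<gamma> 0)"
      using cpartial_basept(2)[OF smooth_chart_change(2)[OF c c'] _ \<sigma>, of "pcoord s c (loc c \<gamma>) 0"] ov unfolding bz by simp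
    finally show ?thesis .
  qed
  have P: "Py \<A> c' \<nu> [i] (rho \<A> s (jet \<A> s \<gamma>)) = Bop (Xof c' (loc c' \<gamma>)) i (\<lambda>t. loc c' \<gamma> t $ \<nu>) 0" for i
    using Py_rho[OF c' \<gamma>(2), of "[i]" s \<nu>] s by simp
  have "Delta \<A> s c \<sigma> [] (Px c' i) (rho \<A> s (jet \<A> s \<gamma>)) = pd \<sigma> (\<lambda>x. chart_change c c' x $ ind c' i) (loc c \<gamma> 0)" for i
    by (rule D) (rule P_local_base(1)[OF c s])
  moreover have "Delta \<A> s c \<sigma> [] (Py \<A> c' \<nu> []) (rho \<A> s (jet \<A> s \<gamma>)) = pd \<sigma> (\<lambda>x. chart_change c c' x $ \<nu>) (loc c \<gamma> 0)"
    by (rule D) (rule P_local_base(2)[OF c s])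
  ultimately show ?thesis
    unfolding Pcoef_def P by (simp add: mult.commute)
qed

text \<open>Both sides are the \<open>\<epsilon>\<close>-derivative of \<open>\<L>\<close> on the jets of the variation \<open>g + \<epsilon> \<phi> e\<^sub>\<sigma>\<close>.\<close>

lemma variation_transform:
  fixes c c' :: "('x, 'n::finite, 'N) split_chart"
  assumes c: "is_split_chart \<A> c" and c': "is_split_chart \<A> c'" and r: "1 \<le> r" "r \<le> s"
    and L: "associated_lagrangian \<A> r c \<L> L" and L': "associated_lagrangian \<A> r c' \<L> L'"
    and g: "jet_curve c g S" and g': "jet_curve c' (\<lambda>t. chart_change c c' (g t)) S"
    and ov: "\<And>t. t \<in> S \<Longrightarrow> g t \<in> overlap c c'" and \<phi>: "smooth_map UNIV \<phi>" and t: "t \<in> S"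
  shows "jet_curve.variation c s g (Lhat r s c L) (\<lambda>A t. if A = \<sigma> then 1 else 0) \<phi> t =
    jet_curve.variation c' s (\<lambda>t. chart_change c c' (g t)) (Lhat r s c' L') (\<lambda>A t. pd \<sigma> (\<lambda>x. chart_change c c' x $ A) (g t)) \<phi> t"
proof -
  interpret a: jet_curve c s g S by (rule g)
  interpret b: jet_curve c' s "\<lambda>t. chart_change c c' (g t)" S by (rule g')
  note Q = smooth_chart_change[OF c c']
  define tp :: "real^('n option) \<Rightarrow> real^'n" where "tp p = (\<chi> i. p $ Some i)" for p
  define G where "G p = g (tp p) + (p $ None * \<phi> (tp p)) *\<^sub>R axis \<sigma> 1" for p
  define G' where "G' p = chart_change c c' (G p)" for p
  have tp: "tp (opt e t) = t" for e t by (simp add: tp_def vec_eq_iff)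
  have G0: "G (opt 0 t) = g t" for t by (simp add: G_def tp)
  have tps: "smooth_map R (\<lambda>p. tp p $ k)" for R k by (simp add: tp_def smooth_coord)
  define R1 where "R1 = {p. tp p \<in> S}"
  have "continuous_on UNIV tp" by (simp add: smooth_continuous_on smooth_vec_iff tps)
  from open_vimage[OF a.open_S this] have R1: "open R1" by (simp add: R1_def vimage_def)
  have gs: "smooth_map R1 (\<lambda>p. g (tp p) $ A)" for A
    by (rule smooth_compose[where g = tp and f = "\<lambda>t. g t $ A", OF R1 tps a.smooth_g]) (auto simp: R1_def)
  have \<phi>s: "smooth_map R1 (\<lambda>p. \<phi> (tp p))"
    by (rule smooth_compose[where g = tp and f = \<phi>, OF R1 tps \<phi>]) auto
  have Gs1: "smooth_map R1 (\<lambda>p. G p $ A)" for A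
  proof -
    have "smooth_map R1 (\<lambda>p. g (tp p) $ A + p $ None * \<phi> (tp p) * axis \<sigma> 1 $ A)"
      by (intro smooth_add[OF R1] smooth_mult[OF R1] gs \<phi>s smooth_coord smooth_const)
    then show ?thesis by (simp add: G_def)
  qed
  \<comment> \<open>For \<open>\<epsilon> \<noteq> 0\<close> the varied curve may leave the overlap
    or lose regularity in either chart. The region is cut down in two stages, since the Jacobian in
    the second chart is smooth only where the values lie in the overlap; the points with
    \<open>\<epsilon> = 0\<close> over \<open>S\<close> survive both.\<close>
  define R0 where "R0 = {p\<in>R1. G p \<in> overlap c c'}"
  have "continuous_on R1 G" using Gs1 by (simp add: smooth_continuous_on smooth_vec_iff[OF R1])
  from continuous_open_preimage[OF this R1 Q(1)] have R0: "open R0"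
    by (simp add: R0_def Int_def vimage_def)
  have Gs0: "smooth_map R0 (\<lambda>p. G p $ A)" for A by (rule smooth_subset[OF Gs1]) (auto simp: R0_def)
  have Gs0': "smooth_map R0 (\<lambda>p. G' p $ A)" for A
    unfolding G'_def by (rule smooth_compose[where g = G and f = "\<lambda>x. chart_change c c' x $ A", OF R0 Gs0 Q(2)]) (auto simp: R0_def)
  define M where "M = (\<lambda>p. \<chi> i j. pd (Some j) (\<lambda>p. G p $ ind c i) p)"
  define M' where "M' = (\<lambda>p. \<chi> i j. pd (Some j) (\<lambda>p. G' p $ ind c' i) p)"
  have M: "M (opt e t) = fmat (Xof c (\<lambda>t. G (opt e t))) t" and M': "M' (opt e t) = fmat (Xof c' (\<lambda>t. G' (opt e t))) t"
    if "opt e t \<in> R0" for e t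
    using pd_slice[OF smooth_diffable[OF Gs0 that]] pd_slice[OF smooth_diffable[OF Gs0' that]]
    by (simp_all add: M_def M'_def vec_eq_iff Xof_def[abs_def])
  define R where "R = {p\<in>R0. det (M p) \<noteq> 0} \<inter> {p\<in>R0. det (M' p) \<noteq> 0}"
  have "open {p\<in>R0. det (M p) \<noteq> 0}" "open {p\<in>R0. det (M' p) \<noteq> 0}"
    by (rule open_det_nonzero[OF R0]; simp add: M_def M'_def smooth_pd Gs0 Gs0')+
  then have R: "open R" by (simp add: R_def open_Int)
  have RR0: "R \<subseteq> R0" by (auto simp: R_def)
  have ovl: "x \<in> cmap c ` cdom c" "chart_change c c' x \<in> cmap c' ` cdom c'" "inv_into (cdom c) (cmap c) x \<in> cdom c"
    "inv_into (cdom c) (cmap c) x \<in> cdom c'" "cmap c (inv_into (cdom c) (cmap c) x) = x" if "x \<in> overlap c c'" for x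
    using that by (auto simp: overlap_def chart_change_def inv_chart[OF sc_chart[OF c]])
  have Gin: "G p \<in> overlap c c'" if "p \<in> R" for p using that by (auto simp: R_def R0_def)
  interpret fa: jet_family c s G R
  proof unfold_locales
    show "smooth_map R (\<lambda>p. G p $ A)" for A by (rule smooth_subset[OF Gs0 RR0])
    show "G p \<in> cmap c ` cdom c" if "p \<in> R" for p by (rule ovl(1)[OF Gin[OF that]])
    show "det (fmat (Xof c (\<lambda>t. G (opt e t))) t) \<noteq> 0" if "opt e t \<in> R" for e t
      using that M[of e t] by (auto simp: R_def)
  qed (rule R)
  interpret fb: jet_family c' s G' R
  proof unfold_locales
    show "smooth_map R (\<lambda>p. G' p $ A)" for A by (rule smooth_subset[OF Gs0' RR0])
    show "G' p \<in> cmap c' ` cdom c'" if "p \<in> R" for p unfolding G'_def by (rule ovl(2)[OF Gin[OF that]])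
    show "det (fmat (Xof c' (\<lambda>t. G' (opt e t))) t) \<noteq> 0" if "opt e t \<in> R" for e t
      using that M'[of e t] by (auto simp: R_def)
  qed (rule R)
  have SR: "opt 0 t \<in> R" if t: "t \<in> S" for t
  proof -
    have "opt 0 t \<in> R0" using t ov[OF t] by (simp add: R0_def R1_def tp G0)
    then show ?thesis
      using M[of 0 t] M'[of 0 t] a.det_nz[OF t] b.det_nz[OF t] by (simp add: R_def G0 G'_def)
  qed
  have same: "fa.Jh p * Lhat r s c L (fa.zh p) = fb.Jh p * Lhat r s c' L' (fb.zh p)" if p: "p \<in> R" for p
  proof -
    obtain e t where pe: "p = opt e t" by (rule opt_cases)
    \<comment> \<open>The slice as a curve in \<open>X\<close>. Reading it in both charts links the
      two Lagrangians through the value of \<open>\<L>\<close> on one and the same jet.\<close>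
    define \<delta> where "\<delta> u = inv_into (cdom c) (cmap c) (G (opt e u))" for u
    let ?S = "{u. opt e u \<in> R}"
    have op: "open ?S" by (rule open_slice[OF R])
    have J: "jet_curve c (\<lambda>u. G (opt e u)) ?S"
      by (rule jet_curveI[OF a.jet_domain_axioms op fa.smooth_slice[OF fa.smooth_G]]) (use fa.G_in fa.slice_det in auto)
    have J': "jet_curve c' (\<lambda>u. G' (opt e u)) ?S"
      by (rule jet_curveI[OF b.jet_domain_axioms op fb.smooth_slice[OF fb.smooth_G]]) (use fb.G_in fb.slice_det in auto)
    have tS: "t \<in> ?S" using p pe by simp
    have "\<L> (jet \<A> r (\<lambda>u. \<delta> (t + u))) = det (fmat (Xof c (\<lambda>u. G (opt e u))) t) * Lhat r s c L (pcoord s c (\<lambda>u. G (opt e u)) t)"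
      by (rule lagrangian_on_curve[OF c r L J _ _ tS]) (use ovl(3,5)[OF Gin] in \<open>auto simp: \<delta>_def\<close>)
    moreover have "\<L> (jet \<A> r (\<lambda>u. \<delta> (t + u))) = det (fmat (Xof c' (\<lambda>u. G' (opt e u))) t) * Lhat r s c' L' (pcoord s c' (\<lambda>u. G' (opt e u)) t)"
      by (rule lagrangian_on_curve[OF c' r L' J' _ _ tS]) (use ovl(4)[OF Gin] in \<open>auto simp: \<delta>_def G'_def chart_change_def\<close>)
    ultimately show ?thesis
      using p by (simp add: pe fa.Jh_def fb.Jh_def fa.Am_slice fb.Am_slice fa.zh_slice fb.zh_slice)
  qed
  have dG: "pd None (\<lambda>p. G p $ A) (opt 0 u) = (if A = \<sigma> then 1 else 0) * \<phi> u" if u: "u \<in> S" for u A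
  proof -
    have mem: "opt 0 u \<in> R1" "tp (opt 0 u) \<in> S" using u by (simp_all add: R1_def tp)
    have tp0: "pd None (\<lambda>p. tp p $ k) (opt 0 u) = 0" for k by (simp add: tp_def pd_coord)
    have 1: "pd None (\<lambda>p. g (tp p) $ A) (opt 0 u) = 0"
      using pd_vec_compose[where \<alpha> = tp and f = "\<lambda>t. g t $ A", OF a.smooth_g tps mem] by (simp add: tp0)
    have 2: "pd None (\<lambda>p. \<phi> (tp p)) (opt 0 u) = 0"
      using pd_vec_compose[where \<alpha> = tp and f = \<phi>, OF \<phi> tps mem(1) UNIV_I] by (simp add: tp0)
    have 3: "pd None (\<lambda>p. p $ None * \<phi> (tp p)) (opt 0 u) = \<phi> u"
      using pd_mult[OF smooth_diffable[OF smooth_coord mem(1), of None] smooth_diffable[OF \<phi>s mem(1)], of None]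
      by (simp add: pd_coord 2 tp)
    have 4: "smooth_map R1 (\<lambda>p. p $ None * \<phi> (tp p))" by (rule smooth_mult[OF R1 smooth_coord \<phi>s])
    have "pd None (\<lambda>p. g (tp p) $ A + axis \<sigma> 1 $ A * (p $ None * \<phi> (tp p))) (opt 0 u) =
      pd None (\<lambda>p. g (tp p) $ A) (opt 0 u) + pd None (\<lambda>p. axis \<sigma> 1 $ A * (p $ None * \<phi> (tp p))) (opt 0 u)"
      by (rule pd_add[OF smooth_diffable[OF gs mem(1)] smooth_diffable[OF smooth_mult[OF R1 smooth_const 4] mem(1)]])
    also have "\<dots> = axis \<sigma> 1 $ A * \<phi> u"
      using pd_cmult[OF smooth_diffable[OF 4 mem(1)], of None "axis \<sigma> 1 $ A"] by (simp add: 1 3)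
    finally show ?thesis by (simp add: G_def axis_def mult_ac)
  qed
  have dG': "pd None (\<lambda>p. G' p $ A) (opt 0 u) = pd \<sigma> (\<lambda>x. chart_change c c' x $ A) (g u) * \<phi> u" if u: "u \<in> S" for u A
  proof -
    have mem: "opt 0 u \<in> R0" "G (opt 0 u) \<in> overlap c c'" using SR[OF u] RR0 by (auto simp: R0_def)
    have "pd None (\<lambda>p. chart_change c c' (G p) $ A) (opt 0 u) =
      (\<Sum>B\<in>UNIV. pd B (\<lambda>x. chart_change c c' x $ A) (G (opt 0 u)) * pd None (\<lambda>p. G p $ B) (opt 0 u))"
      by (rule pd_vec_compose[where \<alpha> = G and f = "\<lambda>x. chart_change c c' x $ A", OF Q(2) Gs0 mem])
    also have "\<dots> = pd \<sigma> (\<lambda>x. chart_change c c' x $ A) (g u) * \<phi> u"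
      by (simp add: dG[OF u] G0 if_distrib[of "\<lambda>x. x * _"] if_distrib[of "\<lambda>x. _ * x"] cong: if_cong)
    finally show ?thesis by (simp add: G'_def)
  qed
  have \<xi>': "smooth_map S (\<lambda>t. pd \<sigma> (\<lambda>x. chart_change c c' x $ A) (g t))" for A
    by (rule smooth_compose[where g = g, OF a.open_S a.smooth_g smooth_pd[OF Q(2)]]) (use ov in auto)
  have \<xi>: "smooth_map S (\<lambda>t. if A = \<sigma> then 1 else 0 :: real)" for A by (rule smooth_const)
  have "a.variation (Lhat r s c L) (\<lambda>A t. if A = \<sigma> then 1 else 0) \<phi> t =
    pd None (\<lambda>p. fa.Jh p * Lhat r s c L (fa.zh p)) (opt 0 t)"
    by (rule a.variation_family[OF fa.jet_family_axioms Lhat_regular(1)[OF c r L] \<xi> \<phi> G0 SR dG t, symmetric])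
  also have "\<dots> = pd None (\<lambda>p. fb.Jh p * Lhat r s c' L' (fb.zh p)) (opt 0 t)"
    by (rule pd_cong[OF R SR[OF t] same])
  also have "\<dots> = b.variation (Lhat r s c' L') (\<lambda>A t. pd \<sigma> (\<lambda>x. chart_change c c' x $ A) (g t)) \<phi> t"
    by (rule b.variation_family[OF fb.jet_family_axioms Lhat_regular(1)[OF c' r L'] \<xi>' \<phi> _ SR dG' t]) (simp_all add: G'_def G0)
  finally show ?thesis .
qed

text \<open>A variation along a dependent label is vertical in the first chart, so only the
  expression with label \<open>\<sigma>\<close> remains there. In the second chart its velocity is
  the \<open>\<sigma>\<close>-derivative of the chart change, whose vertical part is
  \<open>Pcoef\<close>. The quotient of the two densities is \<open>jac\<close>.\<close>

lemma euler_transform: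
  fixes c c' :: "('x, 'n::finite, 'N) split_chart"
  assumes c: "is_split_chart \<A> c" and c': "is_split_chart \<A> c'" and r: "1 \<le> r" "2 * r \<le> s"
    and L: "associated_lagrangian \<A> r c \<L> L" and L': "associated_lagrangian \<A> r c' \<L> L'"
    and \<sigma>: "\<sigma> \<in> dep c" and \<gamma>: "good c \<gamma>" "good c' \<gamma>"
  shows "Euler_Lagrange \<A> r s c \<sigma> L (rho \<A> s (jet \<A> s \<gamma>)) =
    jac \<A> s c c' (rho \<A> s (jet \<A> s \<gamma>)) * (\<Sum>\<nu>\<in>dep c'. Pcoef \<A> s c c' \<nu> \<sigma> (rho \<A> s (jet \<A> s \<gamma>)) *
      Euler_Lagrange \<A> r s c' \<nu> L' (rho \<A> s (jet \<A> s \<gamma>)))"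
proof -
  have s: "1 \<le> s" "r \<le> s" using r by auto
  define g where "g = loc c \<gamma>"
  define h where "h t = chart_change c c' (g t)" for t
  obtain S1 where S1: "open S1" "0 \<in> S1" "jet_curve c g S1" "\<And>t. t \<in> S1 \<Longrightarrow> \<gamma> t \<in> cdom c"
    unfolding g_def by (rule good_nbhd[OF c \<gamma>(1)]) blast
  obtain S2 where S2: "open S2" "0 \<in> S2" "jet_curve c' (loc c' \<gamma>) S2" "\<And>t. t \<in> S2 \<Longrightarrow> \<gamma> t \<in> cdom c'"
    by (rule good_nbhd[OF c' \<gamma>(2)]) blast
  define S where "S = S1 \<inter> S2"
  have S: "open S" "0 \<in> S" using S1 S2 by (auto simp: S_def)
  have hl: "h t = loc c' \<gamma> t" if "t \<in> S" for t
    using chart_change_loc[of c \<gamma> t c', OF c S1(4)] that by (simp add: h_def g_def S_def)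
  have Ja: "jet_curve c g S" by (rule jet_curve_subset[OF S1(3) S(1)]) (simp add: S_def)
  have Jb: "jet_curve c' h S"
    by (rule jet_curve_cong[OF jet_curve_subset[OF S2(3) S(1)]]) (simp_all add: S_def hl)
  interpret a: jet_curve c s g S by (rule Ja)
  interpret b: jet_curve c' s h S by (rule Jb)
  have ov: "g t \<in> overlap c c'" if "t \<in> S" for t
    using that S1(4) S2(4) by (auto simp: g_def loc_def overlap_def S_def)
  define \<xi> :: "'N \<Rightarrow> real^'n \<Rightarrow> real" where "\<xi> = (\<lambda>A t. if A = \<sigma> then 1 else 0)"
  define \<xi>' where "\<xi>' = (\<lambda>A t. pd \<sigma> (\<lambda>x. chart_change c c' x $ A) (g t))"
  have \<xi>s: "smooth_map S (\<xi> A)" for A unfolding \<xi>_def by (rule smooth_const)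
  have \<xi>s': "smooth_map S (\<xi>' A)" for A
    unfolding \<xi>'_def
    by (rule smooth_compose[where g = g, OF a.open_S a.smooth_g smooth_pd[OF smooth_chart_change(2)[OF c c']]]) (use ov in auto)
  note ra = Lhat_regular[OF c r(1) s(2) L]
  note rb = Lhat_regular[OF c' r(1) s(2) L']
  let ?E = "\<lambda>\<tau>. EL_loc r s c \<tau> (Lhat r s c L) (pcoord s c g 0)"
  let ?E' = "\<lambda>\<nu>. EL_loc r s c' \<nu> (Lhat r s c' L') (pcoord s c' h 0)"
  \<comment> \<open>Both sides are adjoint values at \<open>0\<close> of one operator in
    \<open>\<phi>\<close>, since the variations in the two charts coincide by
    \<open>variation_transform\<close>.\<close>
  have "a.Jd 0 * (\<Sum>\<tau>\<in>dep c. a.vert \<xi> \<tau> 0 * ?E \<tau>) = b.Jd 0 * (\<Sum>\<nu>\<in>dep c'. b.vert \<xi>' \<nu> 0 * ?E' \<nu>)"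
  proof (rule has_adj_unique[OF S(1) a.has_adj_variation[OF ra r(2) \<xi>s] _ S(2)])
    show "has_adj S (a.variation (Lhat r s c L) \<xi>) (\<lambda>t. b.Jd t * (\<Sum>\<nu>\<in>dep c'. b.vert \<xi>' \<nu> t * EL_loc r s c' \<nu> (Lhat r s c' L') (pcoord s c' h t)))"
    proof (rule has_adj_cong[OF b.has_adj_variation[OF rb r(2) \<xi>s']])
      fix \<phi> :: "real^'n \<Rightarrow> real" and t assume "smooth_map UNIV \<phi>" "t \<in> S"
      then show "b.variation (Lhat r s c' L') \<xi>' \<phi> t = a.variation (Lhat r s c L) \<xi> \<phi> t"
        using variation_transform[OF c c' r(1) s(2) L L' Ja Jb[unfolded h_def] ov, of \<phi> t \<sigma>]
        unfolding \<xi>_def \<xi>'_def h_def by simp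
    qed simp
  qed
  moreover have "a.vert \<xi> \<tau> 0 = (if \<tau> = \<sigma> then 1 else 0)" for \<tau>
  proof -
    have "ind c m \<noteq> \<sigma>" for m using \<sigma> by (auto simp: dep_def)
    then show ?thesis by (simp add: a.vert_def \<xi>_def)
  qed
  then have "(\<Sum>\<tau>\<in>dep c. a.vert \<xi> \<tau> 0 * ?E \<tau>) = ?E \<sigma>"
    using \<sigma> by (simp add: if_distrib[of "\<lambda>x. x * _"] cong: if_cong)
  moreover have "?E \<sigma> = Euler_Lagrange \<A> r s c \<sigma> L (rho \<A> s (jet \<A> s \<gamma>))"
    by (simp add: EL_rho[OF c s(1) \<gamma>(1)] g_def)
  moreover have "?E' \<nu> = Euler_Lagrange \<A> r s c' \<nu> L' (rho \<A> s (jet \<A> s \<gamma>))" for \<nu>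
    using pcoord_cong[of S 0 h "loc c' \<gamma>" s c', OF S hl] by (simp add: EL_rho[OF c' s(1) \<gamma>(2)])
  moreover have "b.vert \<xi>' \<nu> 0 = Pcoef \<A> s c c' \<nu> \<sigma> (rho \<A> s (jet \<A> s \<gamma>))" for \<nu>
  proof -
    have "Bop (Xof c' h) i (\<lambda>t. h t $ \<nu>) 0 = Bop (Xof c' (loc c' \<gamma>)) i (\<lambda>t. loc c' \<gamma> t $ \<nu>) 0" for i
      by (rule Bop_cong[OF S]) (simp_all add: hl Xof_def)
    then show ?thesis
      by (simp add: b.vert_def \<xi>'_def Pcoef_rho[OF c c' s(1) \<gamma> \<sigma>] g_def)
  qed
  ultimately have eq: "a.Jd 0 * Euler_Lagrange \<A> r s c \<sigma> L (rho \<A> s (jet \<A> s \<gamma>)) =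
    b.Jd 0 * (\<Sum>\<nu>\<in>dep c'. Pcoef \<A> s c c' \<nu> \<sigma> (rho \<A> s (jet \<A> s \<gamma>)) * Euler_Lagrange \<A> r s c' \<nu> L' (rho \<A> s (jet \<A> s \<gamma>)))"
    by simp
  have "b.Jd 0 = jac \<A> s c c' (rho \<A> s (jet \<A> s \<gamma>)) * a.Jd 0"
  proof -
    \<comment> \<open>The chain rule in the frame of \<open>g\<close>. The transpose below appears
      because \<open>N\<close> has the direction of differentiation as its row index, whereas
      \<open>fmat\<close> has the component there.\<close>
    define N where "N = (\<chi> i j. Bop (Xof c g) i (\<lambda>t. chart_change c c' (g t) $ ind c' j) 0)"
    have "fmat (Xof c' h) 0 = transpose N ** fmat (Xof c g) 0"
    proof (simp add: vec_eq_iff matrix_matrix_mult_def transpose_def, intro allI)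
      fix j k
      show "pd k (Xof c' h j) 0 = (\<Sum>i\<in>UNIV. N $ i $ j * pd k (Xof c g i) 0)"
        using pd_eq_Bop[OF a.det_nz[OF S(2)], of k "Xof c' h j"]
        by (simp add: N_def Xof_def[abs_def] h_def mult.commute)
    qed
    moreover have "jac \<A> s c c' (rho \<A> s (jet \<A> s \<gamma>)) = det N"
      unfolding N_def g_def by (rule jac_rho[OF c c' s(1) \<gamma>(1)]) (use \<gamma>(2) in \<open>simp add: good_def\<close>)
    ultimately show ?thesis by (simp add: a.Jd_def b.Jd_def det_mul det_transpose)
  qed
  moreover have "a.Jd 0 \<noteq> 0" using a.det_nz[OF S(2)] by (simp add: a.Jd_def)
  ultimately show ?thesis using eq by simp
qed

end

theorem proposition3p12:
  fixes \<A> :: "('x::{t2_space, second_countable_topology}, 'N::finite) chart set"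
    and \<L> :: "('n::finite, 'x) jet \<Rightarrow> real"
    and c c' :: "('x, 'n, 'N) split_chart"
    and L L' :: "('n, 'x) jet set \<Rightarrow> real"
    and r s :: nat
  assumes "smooth_structure \<A>"
    and "r \<ge> 1"
    and "homogeneous_lagrangian \<A> r \<L>"
    and "is_split_chart \<A> c" and "is_split_chart \<A> c'"
    and "cdom c \<inter> cdom c' \<noteq> {}"
    and "associated_lagrangian \<A> r c \<L> L"
    and "associated_lagrangian \<A> r c' \<L> L'"
    and "s \<ge> 2 * r"
    and "\<sigma> \<in> dep c"
    and "q \<in> rho \<A> s ` (W \<A> s c \<inter> W \<A> s c')"
  shows "Euler_Lagrange \<A> r s c \<sigma> L q =
    jac \<A> s c c' q * (\<Sum>\<nu>\<in>dep c'. Pcoef \<A> s c c' \<nu> \<sigma> q * Euler_Lagrange \<A> r s c' \<nu> L' q)"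
proof -
  interpret manifold \<A> by standard (rule assms(1))
  have s: "1 \<le> s" using assms(2,9) by simp
  obtain u where u: "u \<in> W \<A> s c" "u \<in> W \<A> s c'" "q = rho \<A> s u" using assms(11) by blast
  from W_E[OF assms(4) u(1) s] obtain \<gamma> where \<gamma>: "u = jet \<A> s \<gamma>" "good c \<gamma>" .
  have "good c' \<gamma>"
    using W_iff[OF assms(5) _ s, of \<gamma>] u(2) \<gamma> by (simp add: good_def)
  from euler_transform[OF assms(4,5,2,9,7,8,10) \<gamma>(2) this] show ?thesis
    unfolding u(3) \<gamma>(1) .
qed

end
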